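(* Let $D \in \mathbb{N}$ be a non-square discriminant and let $d_1,d_2 \in \mathbb{N}$ with $d_1 \mid d_2$ and $\tfrac{d_2}{d_1}$ relatively prime to the conductor of $D$. Then $X_{D,(d_1,d_2)}$ is non-empty if and only if $(d_1,d_2)$ satisfies the prime factor condition in $\mathcal{O}_D$. In this case $X_{D,(d_1,d_2)}$ consists of $2^s$ irreducible components $X_{\mathfrak a}$, where $s$ is the number of splitting prime divisors of $\tfrac{d_2}{d_1}$. For each component $X_{\mathfrak a}$ defined by the ideal $\mathfrak a$, there is an isomorphism $$\Phi:\ \mathrm{PSL}_2(\mathcal{O}_D\oplus\tfrac{1}{\sqrt D}\mathfrak a)\backslash\mathbb{H}^2\ \cong\ X_{\mathfrak a},\qquad [z]\mapsto[(A_z,H_z,\rho_z)]$$ between the corresponding Hilbert modular surface and $X_{\mathfrak a}$.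
   Context: A discriminant is an integer $D\equiv 0,1\bmod 4$. For $D>0$ non-square put $K=\mathbb{Q}(\sqrt D)$, $\mathcal{O}_D=\langle1,\frac{D+\sqrt D}{2}\rangle_{\mathbb{Z}}$; $x\mapsto x^\sigma$ is the Galois conjugation and $\mathrm{tr}(x)=x+x^\sigma$. The conductor of $D$ is the $f\in\mathbb{N}$ with $D=f^2\Delta_K$, $\Delta_K$ the discriminant of the maximal order of $K$. Prime factor condition: for $d_1\mid d_2$ with $\frac{d_2}{d_1}=\prod p_i^{k_i}$ (prime factorization) relatively prime to the conductor, $(d_1,d_2)$ satisfies the prime factor condition in $\mathcal{O}_D$ if no $p_i$ is inert in $K$ and $k_i=1$ whenever $p_i$ is ramified in $K$. A polarization on a complex torus $V/\Lambda$ is a positive definite Hermitian form $H$ on $V$ with $E_H:=\mathrm{Im}\,H$ integral on $\Lambda$; conversely $H(v,w)=E_H(iv,w)+iE_H(v,w)$; its type is that of $E_H|_{\Lambda\times\Lambda}$. Real multiplication by $\mathcal{O}_D$ on a polarized Abelian surface $(A,H)$ is an injective ring homomorphism $\rho:\mathcal{O}_D\hookrightarrow\mathrm{End}(A)$ with image in the endomorphisms self-adjoint with respect to $H$, which is proper (does not extend to an injective ring homomorphism of a strictly larger order of $K$). $X_{D,(d_1,d_2)}$ is the moduli space of isomorphism classes $[(A,H,\rho)]$ of polarized Abelian surfaces of type $(d_1,d_2)$ with real multiplication $\rho$ by $\mathcal{O}_D$; isomorphisms are isomorphisms of polarized Abelian varieties commuting with the $\mathcal{O}_D$-actions. The trace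 pairing on $K^2$ is $\langle(x,y),(\tilde x,\tilde y)\rangle=\mathrm{tr}(\tilde xy-x\tilde y)$. For an ideal $\mathfrak a\subseteq\mathcal{O}_D$ such that the trace pairing on $\mathcal{O}_D\oplus\frac1{\sqrt D}\mathfrak a$ has type $(d_1,d_2)$ (these are the ideals $\mathfrak a=d_1\mathfrak a'$ with $\mathfrak a'$ a primitive ideal of norm $\frac{d_2}{d_1}$, where primitive means $\frac1m\mathfrak a'\subset\mathcal{O}_D$, $m\in\mathbb{Z}$, implies $m=\pm1$), $X_{\mathfrak a}\subseteq X_{D,(d_1,d_2)}$ is the locus of classes $[(V/\Lambda,H,\rho)]$ with $(\Lambda,E_H)\cong(\mathcal{O}_D\oplus\frac1{\sqrt D}\mathfrak a,\langle\cdot,\cdot\rangle)$ as $\mathcal{O}_D$-modules with symplectic form. The components $X_{\mathfrak a}$ are indexed by these ideals. For $z=(z_1,z_2)\in\mathbb{H}^2$ let $\phi_z:\mathcal{O}_D\oplus\frac1{\sqrt D}\mathfrak a\hookrightarrow\mathbb{C}^2$, $(x,y)\mapsto(x+yz_1,x^\sigma+y^\sigma z_2)$, $\Lambda_z$ its image, $A_z=\mathbb{C}^2/\Lambda_z$, $H_z$ the polarization whose imaginary part is the $\mathbb{R}$-bilinear extension of the trace pairing transported by $\phi_z$, and $\rho_z(k)(c_1,c_2)=(kc_1,k^\sigma c_2)$ for $k\in\mathcal{O}_D$. $\mathrm{SL}_2(\mathcal{O}_D\oplus\frac1{\sqrt D}\mathfrak a)$ is the group of matrices $\begin{pmatrix}a&b\\c&d\end{pmatrix}\in\mathrm{SL}_2(K)$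 with $a,d\in\mathcal{O}_D$, $b\in(\frac1{\sqrt D}\mathfrak a)^{-1}$, $c\in\frac1{\sqrt D}\mathfrak a$; it acts on $\mathbb{H}^2$ by $M.(z_1,z_2)=(Mz_1,M^\sigma z_2)$ (Möbius transformations), and $\mathrm{PSL}_2$ is its quotient by $\{\pm I_2\}$. *)

theory Defs
  imports "HOL-Complex_Analysis.Complex_Analysis" "HOL-Algebra.Ideal_Product"
    "HOL-Algebra.Subrings"
begin

section \<open>Real quadratic fields and their orders\<close>

definition discriminant :: "nat \<Rightarrow> bool" where
  "discriminant D \<longleftrightarrow> D mod 4 = 0 \<or> D mod 4 = 1"

text \<open>The field \<open>K\<close> is realised inside the reals, with the positive square root of \<open>D\<close>;
  the inclusion is the first real embedding, and \<open>quad_conj D\<close> the second one.\<close>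

definition quad_field :: "nat \<Rightarrow> real set" where
  "quad_field D = {x. \<exists>a\<in>\<rat>. \<exists>b\<in>\<rat>. x = a + b * sqrt (real D)}"

definition quad_conj :: "nat \<Rightarrow> real \<Rightarrow> real" where
  "quad_conj D x =
    (THE y. \<exists>a\<in>\<rat>. \<exists>b\<in>\<rat>. x = a + b * sqrt (real D) \<and> y = a - b * sqrt (real D))"

definition quad_trace :: "nat \<Rightarrow> real \<Rightarrow> real" where
  "quad_trace D x = x + quad_conj D x"

definition quad_order :: "nat \<Rightarrow> real set" where
  "quad_order D = {x. \<exists>m n :: int. x = of_int m + of_int n * ((real D + sqrt (real D)) / 2)}"

definition real_ring :: "real set \<Rightarrow> real ring" where
  "real_ring R = \<lparr>carrier = R, mult = (*), one = 1, zero = 0, add = (+)\<rparr>"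

definition zbasis :: "('i::finite \<Rightarrow> 'a::real_vector) \<Rightarrow> 'a set \<Rightarrow> bool" where
  "zbasis b L \<longleftrightarrow> bij_betw (\<lambda>k :: 'i \<Rightarrow> int. \<Sum>i\<in>UNIV. of_int (k i) *\<^sub>R b i) UNIV L"

definition is_order :: "nat \<Rightarrow> real set \<Rightarrow> bool" where
  "is_order D R \<longleftrightarrow>
    subring R (real_ring (quad_field D)) \<and> (\<exists>b :: 2 \<Rightarrow> real. zbasis b R)"

definition max_order :: "nat \<Rightarrow> real set" where
  "max_order D = (GREATEST R. is_order D R)"

definition order_disc :: "nat \<Rightarrow> real set \<Rightarrow> int \<Rightarrow> bool" where
  "order_disc D R \<Delta> \<longleftrightarrow> (\<exists>b :: 2 \<Rightarrow> real. zbasis b R \<and>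
    of_int \<Delta> = (b 1 * quad_conj D (b 2) - b 2 * quad_conj D (b 1))\<^sup>2)"

definition conductor :: "nat \<Rightarrow> nat" where
  "conductor D =
    (THE f. 0 < f \<and> (\<exists>\<Delta>. order_disc D (max_order D) \<Delta> \<and> int D = int f ^ 2 * \<Delta>))"

definition inert :: "nat \<Rightarrow> nat \<Rightarrow> bool" where
  "inert D p \<longleftrightarrow> (let R = real_ring (max_order D) in
    primeideal (cgenideal R (real p)) R)"

definition ramified :: "nat \<Rightarrow> nat \<Rightarrow> bool" where
  "ramified D p \<longleftrightarrow> (let R = real_ring (max_order D) in
    \<exists>P. primeideal P R \<and> cgenideal R (real p) = ideal_prod R P P)"

definition splitting :: "nat \<Rightarrow> nat \<Rightarrow> bool" where
  "splitting D p \<longleftrightarrow> (let R = real_ring (max_order D) in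
    \<exists>P Q. primeideal P R \<and> primeideal Q R \<and> P \<noteq> Q \<and>
      cgenideal R (real p) = ideal_prod R P Q)"

definition prime_factor_condition :: "nat \<Rightarrow> nat \<Rightarrow> nat \<Rightarrow> bool" where
  "prime_factor_condition D d1 d2 \<longleftrightarrow> (\<forall>p\<in>prime_factors (d2 div d1).
    \<not> inert D p \<and> (ramified D p \<longrightarrow> multiplicity p (d2 div d1) = 1))"


section \<open>Polarized Abelian surfaces with real multiplication\<close>

text \<open>An alternating form \<open>E\<close> on a free group \<open>L\<close> of rank four has type \<open>(d1, d2)\<close> if it has
  a symplectic basis with these elementary divisors.\<close>

definition form_type ::
    "'a::real_vector set \<Rightarrow> ('a \<Rightarrow> 'a \<Rightarrow> real) \<Rightarrow> nat \<Rightarrow> nat \<Rightarrow> bool" where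
  "form_type L E d1 d2 \<longleftrightarrow> 0 < d1 \<and> 0 < d2 \<and> d1 dvd d2 \<and>
    (\<exists>u v :: 2 \<Rightarrow> 'a. zbasis (case_sum u v) L \<and>
      (\<forall>i j. E (u i) (u j) = 0 \<and> E (v i) (v j) = 0 \<and>
        E (u i) (v j) = (if i \<noteq> j then 0 else if i = 1 then real d1 else real d2) \<and>
        E (v j) (u i) = - E (u i) (v j)))"

definition is_lattice :: "(complex ^ 2) set \<Rightarrow> bool" where
  "is_lattice L \<longleftrightarrow> (\<exists>b :: 4 \<Rightarrow> complex ^ 2. inj b \<and> independent (range b) \<and> zbasis b L)"

definition polarization :: "(complex ^ 2) set \<Rightarrow> (complex ^ 2 \<Rightarrow> complex ^ 2 \<Rightarrow> complex) \<Rightarrow> bool" where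
  "polarization L H \<longleftrightarrow>
    (\<forall>u v w. H (u + v) w = H u w + H v w) \<and>
    (\<forall>c v w. H (c *s v) w = c * H v w) \<and>
    (\<forall>v w. H w v = cnj (H v w)) \<and>
    (\<forall>v. v \<noteq> 0 \<longrightarrow> 0 < Re (H v v)) \<and>
    (\<forall>v\<in>L. \<forall>w\<in>L. Im (H v w) \<in> \<int>)"

text \<open>Endomorphisms of the torus \<open>\<complex>\<^sup>2 / L\<close> are given by their analytic representation.\<close>

definition torus_End :: "(complex ^ 2) set \<Rightarrow> (complex ^ 2 ^ 2) ring" where
  "torus_End L = \<lparr>carrier = {M. \<forall>v\<in>L. M *v v \<in> L},
     mult = (**), one = mat 1, zero = 0, add = (+)\<rparr>"

definition self_adjoint ::
    "(complex ^ 2 \<Rightarrow> complex ^ 2 \<Rightarrow> complex) \<Rightarrow> complex ^ 2 ^ 2 \<Rightarrow> bool" where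
  "self_adjoint H M \<longleftrightarrow> (\<forall>v w. H (M *v v) w = H v (M *v w))"

definition real_multiplication :: "nat \<Rightarrow> (complex ^ 2) set \<Rightarrow>
    (complex ^ 2 \<Rightarrow> complex ^ 2 \<Rightarrow> complex) \<Rightarrow> (real \<Rightarrow> complex ^ 2 ^ 2) \<Rightarrow> bool" where
  "real_multiplication D L H \<rho> \<longleftrightarrow>
    \<rho> \<in> ring_hom (real_ring (quad_order D)) (torus_End L) \<and>
    inj_on \<rho> (quad_order D) \<and>
    (\<forall>k\<in>quad_order D. self_adjoint H (\<rho> k)) \<and>
    \<not> (\<exists>R \<rho>'. is_order D R \<and> quad_order D \<subset> R \<and>
        \<rho>' \<in> ring_hom (real_ring R) (torus_End L) \<and> inj_on \<rho>' R \<and>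
        (\<forall>k\<in>quad_order D. \<rho>' k = \<rho> k))"

text \<open>A triple \<open>(L, H, \<rho>)\<close> stands for the torus \<open>\<complex>\<^sup>2 / L\<close> with polarization \<open>H\<close> and real
  multiplication \<open>\<rho>\<close>; only the values of \<open>\<rho>\<close> on \<open>quad_order D\<close> matter.\<close>

type_synonym rm_triple =
  "(complex ^ 2) set \<times> (complex ^ 2 \<Rightarrow> complex ^ 2 \<Rightarrow> complex) \<times> (real \<Rightarrow> complex ^ 2 ^ 2)"

definition rm_surfaces :: "nat \<Rightarrow> nat \<Rightarrow> nat \<Rightarrow> rm_triple set" where
  "rm_surfaces D d1 d2 = {(L, H, \<rho>). is_lattice L \<and> polarization L H \<and>
    form_type L (\<lambda>v w. Im (H v w)) d1 d2 \<and> real_multiplication D L H \<rho>}"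

definition rm_iso :: "nat \<Rightarrow> nat \<Rightarrow> nat \<Rightarrow> (rm_triple \<times> rm_triple) set" where
  "rm_iso D d1 d2 = {((L, H, \<rho>), (L', H', \<rho>')).
    (L, H, \<rho>) \<in> rm_surfaces D d1 d2 \<and> (L', H', \<rho>') \<in> rm_surfaces D d1 d2 \<and>
    (\<exists>F :: complex ^ 2 ^ 2. invertible F \<and> (\<lambda>v. F *v v) ` L = L' \<and>
      (\<forall>v w. H' (F *v v) (F *v w) = H v w) \<and>
      (\<forall>k\<in>quad_order D. F ** \<rho> k = \<rho>' k ** F))}"

definition moduli_set :: "nat \<Rightarrow> nat \<Rightarrow> nat \<Rightarrow> rm_triple set set" where
  "moduli_set D d1 d2 = rm_surfaces D d1 d2 // rm_iso D d1 d2"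

definition rm_class :: "nat \<Rightarrow> nat \<Rightarrow> nat \<Rightarrow> rm_triple \<Rightarrow> rm_triple set" where
  "rm_class D d1 d2 T = rm_iso D d1 d2 `` {T}"


section \<open>The loci attached to ideals\<close>

definition twisted_ideal :: "nat \<Rightarrow> real set \<Rightarrow> real set" where
  "twisted_ideal D \<aa> = (\<lambda>\<alpha>. \<alpha> / sqrt (real D)) ` \<aa>"

definition ideal_module :: "nat \<Rightarrow> real set \<Rightarrow> (real \<times> real) set" where
  "ideal_module D \<aa> = quad_order D \<times> twisted_ideal D \<aa>"

definition trace_pairing :: "nat \<Rightarrow> real \<times> real \<Rightarrow> real \<times> real \<Rightarrow> real" where
  "trace_pairing D = (\<lambda>(x, y) (x', y'). quad_trace D (x' * y - x * y'))"

definition type_ideals :: "nat \<Rightarrow> nat \<Rightarrow> nat \<Rightarrow> real set set" where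
  "type_ideals D d1 d2 = {\<aa>. ideal \<aa> (real_ring (quad_order D)) \<and>
    form_type (ideal_module D \<aa>) (trace_pairing D) d1 d2}"

definition symplectic_module_iso ::
    "nat \<Rightarrow> real set \<Rightarrow> rm_triple \<Rightarrow> (real \<times> real \<Rightarrow> complex ^ 2) \<Rightarrow> bool" where
  "symplectic_module_iso D \<aa> = (\<lambda>(L, H, \<rho>) \<psi>.
    bij_betw \<psi> (ideal_module D \<aa>) L \<and>
    (\<forall>p\<in>ideal_module D \<aa>. \<forall>q\<in>ideal_module D \<aa>.
      \<psi> (p + q) = \<psi> p + \<psi> q \<and> Im (H (\<psi> p) (\<psi> q)) = trace_pairing D p q) \<and>
    (\<forall>k\<in>quad_order D. \<forall>(x, y)\<in>ideal_module D \<aa>. \<psi> (k * x, k * y) = \<rho> k *v \<psi> (x, y)))"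

definition ideal_locus :: "nat \<Rightarrow> nat \<Rightarrow> nat \<Rightarrow> real set \<Rightarrow> rm_triple set set" where
  "ideal_locus D d1 d2 \<aa> =
    {c \<in> moduli_set D d1 d2. \<exists>T\<in>c. \<exists>\<psi>. symplectic_module_iso D \<aa> T \<psi>}"


section \<open>The surfaces over the product of two upper half planes\<close>

definition upper2 :: "(complex \<times> complex) set" where
  "upper2 = {(z1, z2). 0 < Im z1 \<and> 0 < Im z2}"

definition period_map :: "nat \<Rightarrow> complex \<times> complex \<Rightarrow> real \<times> real \<Rightarrow> complex ^ 2" where
  "period_map D = (\<lambda>(z1, z2) (x, y). vector
    [of_real x + of_real y * z1, of_real (quad_conj D x) + of_real (quad_conj D y) * z2])"

definition period_lattice :: "nat \<Rightarrow> real set \<Rightarrow> complex \<times> complex \<Rightarrow> (complex ^ 2) set" where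
  "period_lattice D \<aa> z = period_map D z ` ideal_module D \<aa>"

text \<open>A Hermitian form is determined by the values of its imaginary part on a lattice.\<close>

definition period_polarization ::
    "nat \<Rightarrow> real set \<Rightarrow> complex \<times> complex \<Rightarrow> complex ^ 2 \<Rightarrow> complex ^ 2 \<Rightarrow> complex" where
  "period_polarization D \<aa> z = (THE H. polarization (period_lattice D \<aa> z) H \<and>
    (\<forall>p\<in>ideal_module D \<aa>. \<forall>q\<in>ideal_module D \<aa>.
      Im (H (period_map D z p) (period_map D z q)) = trace_pairing D p q))"

definition period_rm :: "nat \<Rightarrow> real \<Rightarrow> complex ^ 2 ^ 2" where
  "period_rm D k =
    vector [vector [of_real k, 0], vector [0, of_real (quad_conj D k)]]"

definition period_surface :: "nat \<Rightarrow> real set \<Rightarrow> complex \<times> complex \<Rightarrow> rm_triple" where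
  "period_surface D \<aa> z = (period_lattice D \<aa> z, period_polarization D \<aa> z, period_rm D)"

definition ideal_inverse :: "nat \<Rightarrow> real set \<Rightarrow> real set" where
  "ideal_inverse D I = {x \<in> quad_field D. \<forall>y\<in>I. x * y \<in> quad_order D}"

definition SL2_module :: "nat \<Rightarrow> real set \<Rightarrow> (real ^ 2 ^ 2) set" where
  "SL2_module D \<aa> = {M. det M = 1 \<and> (\<forall>i j. M $ i $ j \<in> quad_field D) \<and>
    M $ 1 $ 1 \<in> quad_order D \<and> M $ 1 $ 2 \<in> ideal_inverse D (twisted_ideal D \<aa>) \<and>
    M $ 2 $ 1 \<in> twisted_ideal D \<aa> \<and> M $ 2 $ 2 \<in> quad_order D}"

definition PSL2_module :: "nat \<Rightarrow> real set \<Rightarrow> (real ^ 2 ^ 2) set set" where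
  "PSL2_module D \<aa> = SL2_module D \<aa> //
    {(M, N). M \<in> SL2_module D \<aa> \<and> N \<in> SL2_module D \<aa> \<and> (N = M \<or> N = - M)}"

definition moebius :: "real ^ 2 ^ 2 \<Rightarrow> complex \<Rightarrow> complex" where
  "moebius M z = (of_real (M $ 1 $ 1) * z + of_real (M $ 1 $ 2)) /
                 (of_real (M $ 2 $ 1) * z + of_real (M $ 2 $ 2))"

definition mat_conj :: "nat \<Rightarrow> real ^ 2 ^ 2 \<Rightarrow> real ^ 2 ^ 2" where
  "mat_conj D M = (\<chi> i j. quad_conj D (M $ i $ j))"

definition hilbert_action :: "nat \<Rightarrow> real ^ 2 ^ 2 \<Rightarrow> complex \<times> complex \<Rightarrow> complex \<times> complex" where
  "hilbert_action D M = (\<lambda>(z1, z2). (moebius M z1, moebius (mat_conj D M) z2))"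

definition hilbert_rel ::
    "nat \<Rightarrow> real set \<Rightarrow> ((complex \<times> complex) \<times> (complex \<times> complex)) set" where
  "hilbert_rel D \<aa> = {(z, w). z \<in> upper2 \<and>
    (\<exists>P\<in>PSL2_module D \<aa>. \<exists>M\<in>P. w = hilbert_action D M z)}"


section \<open>Reduced complex spaces as spaces with a sheaf of functions\<close>

text \<open>\<open>cs_hol X U\<close> are the functions that are holomorphic on the open set \<open>U\<close>; only the values
  of such a function on \<open>U\<close> are meaningful.\<close>

record 'a cspace =
  cs_top :: "'a topology"
  cs_hol :: "'a set \<Rightarrow> ('a \<Rightarrow> complex) set"

definition cs_iso :: "'a cspace \<Rightarrow> 'b cspace \<Rightarrow> ('a \<Rightarrow> 'b) \<Rightarrow> bool" where
  "cs_iso X Y \<phi> \<longleftrightarrow> homeomorphic_map (cs_top X) (cs_top Y) \<phi> \<and>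
    (\<forall>U f. openin (cs_top Y) U \<longrightarrow>
      (f \<in> cs_hol Y U \<longleftrightarrow> f \<circ> \<phi> \<in> cs_hol X {x \<in> topspace (cs_top X). \<phi> x \<in> U}))"

text \<open>The reduced structure on a subset: functions that locally extend to the ambient space.\<close>

definition cs_sub :: "'a cspace \<Rightarrow> 'a set \<Rightarrow> 'a cspace" where
  "cs_sub X Z = \<lparr>cs_top = subtopology (cs_top X) Z,
     cs_hol = (\<lambda>U. {f. \<forall>x\<in>U. \<exists>V g. openin (cs_top X) V \<and> x \<in> V \<and> g \<in> cs_hol X V \<and>
       (\<forall>y\<in>U \<inter> V. f y = g y)})\<rparr>"

definition analytic_subset :: "'a cspace \<Rightarrow> 'a set \<Rightarrow> bool" where
  "analytic_subset X Z \<longleftrightarrow> Z \<subseteq> topspace (cs_top X) \<and>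
    (\<forall>x\<in>topspace (cs_top X). \<exists>U F. openin (cs_top X) U \<and> x \<in> U \<and>
      finite F \<and> F \<subseteq> cs_hol X U \<and> Z \<inter> U = {y \<in> U. \<forall>f\<in>F. f y = 0})"

definition irreducible_subset :: "'a cspace \<Rightarrow> 'a set \<Rightarrow> bool" where
  "irreducible_subset X Z \<longleftrightarrow> analytic_subset X Z \<and> Z \<noteq> {} \<and>
    (\<forall>Z1 Z2. analytic_subset X Z1 \<and> analytic_subset X Z2 \<and> Z = Z1 \<union> Z2 \<longrightarrow> Z = Z1 \<or> Z = Z2)"

definition irreducible_components :: "'a cspace \<Rightarrow> 'a set set" where
  "irreducible_components X = {Z. irreducible_subset X Z \<and>
    (\<forall>Z'. irreducible_subset X Z' \<and> Z \<subseteq> Z' \<longrightarrow> Z' = Z)}"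


section \<open>The Hilbert modular surface as a complex space\<close>

definition holomorphic2 :: "(complex \<times> complex) set \<Rightarrow> (complex \<times> complex \<Rightarrow> complex) \<Rightarrow> bool" where
  "holomorphic2 U f \<longleftrightarrow> continuous_on U f \<and>
    (\<forall>z1 z2. (\<lambda>w. f (w, z2)) holomorphic_on {w. (w, z2) \<in> U} \<and>
             (\<lambda>w. f (z1, w)) holomorphic_on {w. (z1, w) \<in> U})"

text \<open>The quotient topology, with the invariant holomorphic functions as structure sheaf. A set
  of orbits \<open>U\<close> has preimage \<open>{z \<in> upper2. hilbert_rel D \<aa> `` {z} \<in> U}\<close> in \<open>upper2\<close>.\<close>

definition hilbert_open :: "nat \<Rightarrow> real set \<Rightarrow> (complex \<times> complex) set set \<Rightarrow> bool" where
  "hilbert_open D \<aa> U \<longleftrightarrow> U \<subseteq> upper2 // hilbert_rel D \<aa> \<and>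
    open {z \<in> upper2. hilbert_rel D \<aa> `` {z} \<in> U}"

definition hilbert_modular_surface :: "nat \<Rightarrow> real set \<Rightarrow> (complex \<times> complex) set cspace" where
  "hilbert_modular_surface D \<aa> = \<lparr>cs_top = topology (hilbert_open D \<aa>),
     cs_hol = (\<lambda>U. {f. holomorphic2 {z \<in> upper2. hilbert_rel D \<aa> `` {z} \<in> U}
       (\<lambda>z. f (hilbert_rel D \<aa> `` {z}))})\<rparr>"

lemma istopology_hilbert_open: "istopology (hilbert_open D \<aa>)"
  unfolding istopology_def
proof (intro conjI allI impI)
  fix S T assume "hilbert_open D \<aa> S" "hilbert_open D \<aa> T"
  moreover have "{z \<in> upper2. hilbert_rel D \<aa> `` {z} \<in> S \<inter> T} =
      {z \<in> upper2. hilbert_rel D \<aa> `` {z} \<in> S} \<inter> {z \<in> upper2. hilbert_rel D \<aa> `` {z} \<in> T}"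
    by blast
  ultimately show "hilbert_open D \<aa> (S \<inter> T)"
    unfolding hilbert_open_def by (simp add: open_Int le_infI1)
next
  fix \<K> assume K: "\<forall>K\<in>\<K>. hilbert_open D \<aa> K"
  have "{z \<in> upper2. hilbert_rel D \<aa> `` {z} \<in> \<Union>\<K>} =
      (\<Union>K\<in>\<K>. {z \<in> upper2. hilbert_rel D \<aa> `` {z} \<in> K})"
    by auto
  moreover have "open (\<Union>K\<in>\<K>. {z \<in> upper2. hilbert_rel D \<aa> `` {z} \<in> K})"
    using K by (auto simp: hilbert_open_def intro!: open_UN)
  ultimately show "hilbert_open D \<aa> (\<Union>\<K>)"
    using K by (simp add: hilbert_open_def Sup_least)
qed


section \<open>The moduli space as a complex space\<close>

text \<open>The moduli space carries the finest structure for which the classifying maps of all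
  holomorphic families are holomorphic (coarse moduli space). Since this is a local condition on
  the base, it suffices to consider bases \<open>B\<close> that are open in some \<open>\<complex>\<^sup>n\<close> and families
  of lattices with a global holomorphic frame \<open>b\<close>; with respect to such a frame the symplectic
  form and the action of the order are locally constant. Here \<open>\<complex>\<^sup>n\<close>, with \<open>n\<close> varying, is
  realised inside \<open>nat \<Rightarrow> complex\<close> with the product topology.\<close>

definition Cn :: "nat \<Rightarrow> (nat \<Rightarrow> complex) set" where
  "Cn n = {t. \<forall>i\<ge>n. t i = 0}"

definition holomorphic_Cn ::
    "nat \<Rightarrow> (nat \<Rightarrow> complex) set \<Rightarrow> ((nat \<Rightarrow> complex) \<Rightarrow> complex) \<Rightarrow> bool" where
  "holomorphic_Cn n B f \<longleftrightarrow> continuous_on B f \<and>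
    (\<forall>t\<in>B. \<forall>i<n. (\<lambda>w. f (t(i := w))) holomorphic_on {w. t(i := w) \<in> B})"

definition rm_family :: "nat \<Rightarrow> nat \<Rightarrow> nat \<Rightarrow> nat \<Rightarrow> (nat \<Rightarrow> complex) set \<Rightarrow>
    ((nat \<Rightarrow> complex) \<Rightarrow> (complex ^ 2) set) \<Rightarrow>
    ((nat \<Rightarrow> complex) \<Rightarrow> complex ^ 2 \<Rightarrow> complex ^ 2 \<Rightarrow> complex) \<Rightarrow>
    ((nat \<Rightarrow> complex) \<Rightarrow> real \<Rightarrow> complex ^ 2 ^ 2) \<Rightarrow> bool" where
  "rm_family D d1 d2 n B L H \<rho> \<longleftrightarrow> openin (top_of_set (Cn n)) B \<and>
    (\<forall>t\<in>B. (L t, H t, \<rho> t) \<in> rm_surfaces D d1 d2) \<and>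
    (\<exists>b :: 4 \<Rightarrow> (nat \<Rightarrow> complex) \<Rightarrow> complex ^ 2.
      (\<forall>i j. holomorphic_Cn n B (\<lambda>t. b i t $ j)) \<and>
      (\<forall>t\<in>B. zbasis (\<lambda>i. b i t) (L t)) \<and>
      (\<forall>i j. \<exists>e. \<forall>t\<in>B. Im (H t (b i t) (b j t)) = e) \<and>
      (\<forall>k\<in>quad_order D. \<forall>j. \<exists>m :: 4 \<Rightarrow> int. \<forall>t\<in>B.
        \<rho> t k *v b j t = (\<Sum>i\<in>UNIV. of_int (m i) *\<^sub>R b i t)))"

definition moduli_open :: "nat \<Rightarrow> nat \<Rightarrow> nat \<Rightarrow> rm_triple set set \<Rightarrow> bool" where
  "moduli_open D d1 d2 U \<longleftrightarrow> U \<subseteq> moduli_set D d1 d2 \<and>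
    (\<forall>n B L H \<rho>. rm_family D d1 d2 n B L H \<rho> \<longrightarrow>
      openin (top_of_set (Cn n)) {t \<in> B. rm_class D d1 d2 (L t, H t, \<rho> t) \<in> U})"

definition moduli_space :: "nat \<Rightarrow> nat \<Rightarrow> nat \<Rightarrow> rm_triple set cspace" where
  "moduli_space D d1 d2 = \<lparr>cs_top = topology (moduli_open D d1 d2),
     cs_hol = (\<lambda>U. {f. \<forall>n B L H \<rho>. rm_family D d1 d2 n B L H \<rho> \<longrightarrow>
       holomorphic_Cn n {t \<in> B. rm_class D d1 d2 (L t, H t, \<rho> t) \<in> U}
         (\<lambda>t. f (rm_class D d1 d2 (L t, H t, \<rho> t)))})\<rparr>"

lemma istopology_moduli_open: "istopology (moduli_open D d1 d2)"
  unfolding istopology_def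
proof (intro conjI allI impI)
  fix S T assume ST: "moduli_open D d1 d2 S" "moduli_open D d1 d2 T"
  show "moduli_open D d1 d2 (S \<inter> T)"
    unfolding moduli_open_def
  proof (intro conjI allI impI)
    show "S \<inter> T \<subseteq> moduli_set D d1 d2"
      using ST unfolding moduli_open_def by blast
    fix n B L H \<rho> assume fam: "rm_family D d1 d2 n B L H \<rho>"
    have "{t \<in> B. rm_class D d1 d2 (L t, H t, \<rho> t) \<in> S \<inter> T} =
        {t \<in> B. rm_class D d1 d2 (L t, H t, \<rho> t) \<in> S} \<inter>
        {t \<in> B. rm_class D d1 d2 (L t, H t, \<rho> t) \<in> T}"
      by blast
    then show "openin (top_of_set (Cn n)) {t \<in> B. rm_class D d1 d2 (L t, H t, \<rho> t) \<in> S \<inter> T}"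
      using ST fam by (simp add: moduli_open_def openin_Int)
  qed
next
  fix \<K> assume K: "\<forall>K\<in>\<K>. moduli_open D d1 d2 K"
  show "moduli_open D d1 d2 (\<Union>\<K>)"
    unfolding moduli_open_def
  proof (intro conjI allI impI)
    show "\<Union>\<K> \<subseteq> moduli_set D d1 d2"
      using K unfolding moduli_open_def by blast
    fix n B L H \<rho> assume fam: "rm_family D d1 d2 n B L H \<rho>"
    have "openin (top_of_set (Cn n))
        (\<Union>K\<in>\<K>. {t \<in> B. rm_class D d1 d2 (L t, H t, \<rho> t) \<in> K})"
      using K fam by (intro openin_Union) (auto simp: moduli_open_def)
    moreover have "(\<Union>K\<in>\<K>. {t \<in> B. rm_class D d1 d2 (L t, H t, \<rho> t) \<in> K}) =
        {t \<in> B. rm_class D d1 d2 (L t, H t, \<rho> t) \<in> \<Union>\<K>}"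
      by auto
    ultimately show
      "openin (top_of_set (Cn n)) {t \<in> B. rm_class D d1 d2 (L t, H t, \<rho> t) \<in> \<Union>\<K>}"
      by simp
  qed
qed

lemma topspace_moduli_space: "topspace (cs_top (moduli_space D d1 d2)) = moduli_set D d1 d2"
proof -
  have cls: "rm_class D d1 d2 T \<in> moduli_set D d1 d2" if "T \<in> rm_surfaces D d1 d2" for T
    using that unfolding rm_class_def moduli_set_def by (rule quotientI)
  have "moduli_open D d1 d2 (moduli_set D d1 d2)"
    unfolding moduli_open_def
  proof (intro conjI allI impI subset_refl)
    fix n B L H \<rho> assume fam: "rm_family D d1 d2 n B L H \<rho>"
    then have "{t \<in> B. rm_class D d1 d2 (L t, H t, \<rho> t) \<in> moduli_set D d1 d2} = B"
      using cls unfolding rm_family_def by blast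
    with fam show "openin (top_of_set (Cn n))
        {t \<in> B. rm_class D d1 d2 (L t, H t, \<rho> t) \<in> moduli_set D d1 d2}"
      unfolding rm_family_def by simp
  qed
  moreover have "openin (topology (moduli_open D d1 d2)) = moduli_open D d1 d2"
    by (rule topology_inverse'[OF istopology_moduli_open])
  ultimately show ?thesis
    unfolding moduli_space_def topspace_def by (auto simp: moduli_open_def)
qed

end

theory Submission
  imports Defs "HOL-Number_Theory.Cong"
begin

text \<open>Let \<open>n = d2 / d1\<close> and \<open>\<omega> = (D + \<surd>D) / 2\<close>. An ideal of the required type is \<open>d1\<close> times a primitive
  ideal \<open>\<langle>n, \<omega> - r\<rangle>\<close>, where \<open>r\<close> is a root modulo \<open>n\<close> of the minimal polynomial of \<open>\<omega>\<close>. Away from the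
  conductor there are two such roots modulo every power of a split prime, none modulo an inert prime,
  one modulo a ramified prime and none modulo its square; this gives the prime factor condition and the
  number \<open>2\<^sup>s\<close>.

  The lattice of a surface with real multiplication is a symplectic \<open>\<O>\<^sub>D\<close>-module of type \<open>(d1, d2)\<close>.
  Properness of the multiplication yields a vector \<open>e\<close> whose \<open>K\<close>-multiples in the lattice are exactly
  \<open>\<O>\<^sub>D e\<close>, and pairing with \<open>e\<close> maps the lattice onto an ideal with kernel \<open>\<O>\<^sub>D e\<close>. Up to an
  integral factor the norm of this ideal is prime to the conductor, so the ideal is invertible, the
  sequence splits, and the module is some \<open>\<O>\<^sub>D \<oplus> \<aa> / \<surd>D\<close>. The two eigenlines of \<open>\<rho> \<omega>\<close> are
  orthogonal for the polarization; projecting the generators \<open>(1, 0)\<close> and \<open>(0, 1)\<close> to them and taking quotients gives the period \<open>z\<close>, and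
  two periods give isomorphic surfaces precisely when an element of \<open>SL\<^sub>2\<close> relates them.

  In a family the frame transports the module isomorphism, so the period is a holomorphic function of
  the parameter and each locus is open and closed. A locus is irreducible because \<open>\<H>\<^sup>2\<close> is, by the
  identity theorem. The family of all period surfaces over \<open>\<H>\<^sup>2\<close> is itself admissible, which makes
  the bijection from the Hilbert modular surface an isomorphism of complex spaces.\<close>

section \<open>Arithmetic of the quadratic field\<close>

text \<open>The order need not be maximal, so ideals can fail to be invertible and modules can fail
  to split; both defects sit at primes dividing the conductor. The proof therefore works with
  explicit integers: an ideal is g<a, omega - r> with \<open>omega_poly D r\<close> = a h, and
  gcd(a, D - 2r, h) = 1 makes it invertible, Bezout coefficients giving the elements of the inverse.
  The vector e is found prime by prime. If v and omega v were dependent in L/pL for every v, then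
  omega would act on L/pL as a scalar c and (omega - c)/p would act on L, against properness.
  Chinese remaindering reaches only finitely many primes, hence two passes: first a vector good at
  the primes of the conductor, then a second vector v corrected by an element of the K-line of the
  first. Outside the index of the lattice spanned by the two O_D-orbits every such correction is
  good; at the finitely many other primes some correction is. The bases of families may be
  disconnected. Lying in a locus is nevertheless a property of a whole family, because the frame has
  the same form values and the same matrices of the action on all of B.\<close>

definition omega :: "nat \<Rightarrow> real" where
  "omega D = (real D + sqrt (real D)) / 2"

definition omega' :: "nat \<Rightarrow> real" where
  "omega' D = (real D - sqrt (real D)) / 2"

text \<open>The norm \<open>omega D * omega' D\<close>. The division is exact because D(D - 1) is
  divisible by 4 for a discriminant D.\<close>

definition omega_norm :: "nat \<Rightarrow> int" where
  "omega_norm D = (int D * (int D - 1)) div 4"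

lemma quad_order_eq: "quad_order D = {x. \<exists>m n :: int. x = of_int m + of_int n * omega D}"
  by (simp add: quad_order_def omega_def)

lemma quad_orderI [intro]: "of_int m + of_int n * omega D \<in> quad_order D"
  by (auto simp: quad_order_eq)

lemma quad_orderE:
  assumes "x \<in> quad_order D"
  obtains m n :: int where "x = of_int m + of_int n * omega D"
  using assms by (auto simp: quad_order_eq)

lemma omega_add_omega': "omega D + omega' D = real D"
  and omega_diff_omega': "omega D - omega' D = sqrt (real D)"
  by (simp_all add: omega_def omega'_def field_simps)

lemma omega'_eq: "omega' D = real D - omega D"
  using omega_add_omega'[of D] by simp

lemma real_ring_simps [simp]:
  "carrier (real_ring R) = R" "mult (real_ring R) = (*)" "one (real_ring R) = 1"
  "zero (real_ring R) = 0" "add (real_ring R) = (+)"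
  by (simp_all add: real_ring_def)

locale quad_disc =
  fixes D :: nat
  assumes D_pos: "0 < D" and D_disc: "discriminant D" and D_nonsquare: "\<nexists>k. D = k ^ 2"
begin

lemma sqrt_pos: "sqrt (real D) > 0"
  using D_pos by simp

lemma sqrt_irrational: "sqrt (real D) \<notin> \<rat>"
proof
  assume "sqrt (real D) \<in> \<rat>"
  then obtain m n :: nat where mn: "n \<noteq> 0" "\<bar>sqrt (real D)\<bar> = real m / real n" "coprime m n"
    by (rule Rats_abs_nat_div_natE)
  have "sqrt (real D) * real n = real m"
    using mn by (simp add: field_simps)
  then have "(sqrt (real D) * real n)\<^sup>2 = (real m)\<^sup>2"
    by simp
  then have "real (D * n\<^sup>2) = real (m\<^sup>2)"
    by (simp add: power_mult_distrib)
  then have e: "D * n\<^sup>2 = m\<^sup>2"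
    by (simp only: of_nat_eq_iff)
  then have "n\<^sup>2 dvd m\<^sup>2"
    by (metis dvd_triv_right)
  then have "n dvd m"
    by simp
  then have "n = 1"
    using mn(3) by (metis coprime_common_divisor_nat dvd_refl)
  with e D_nonsquare show False
    by auto
qed

lemma rat_indep:
  assumes "a \<in> \<rat>" "b \<in> \<rat>" "a + b * omega D = 0"
  shows "a = 0" "b = 0"
proof -
  show "b = 0"
  proof (rule ccontr)
    assume b: "b \<noteq> 0"
    have "sqrt (real D) = (- 2 * a) / b - real D"
      using assms(3) b by (simp add: omega_def field_simps)
    then show False
      using sqrt_irrational assms by simp
  qed
  then show "a = 0"
    using assms(3) by simp
qed

lemma rat_unique:
  assumes "a \<in> \<rat>" "b \<in> \<rat>" "c \<in> \<rat>" "d \<in> \<rat>" "a + b * omega D = c + d * omega D"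
  shows "a = c \<and> b = d"
  using rat_indep[of "a - c" "b - d"] assms by (simp add: algebra_simps)

lemma int_unique:
  assumes "of_int a + of_int b * omega D = of_int c + of_int d * omega D"
  shows "a = c \<and> b = d"
  using rat_unique[OF _ _ _ _ assms] by simp

lemma four_omega_norm: "4 * omega_norm D = int D * (int D - 1)"
proof -
  have "4 dvd int D * (int D - 1)"
    using D_disc unfolding discriminant_def
  proof
    assume "D mod 4 = 0"
    then have "4 dvd int D" by presburger
    then show ?thesis by simp
  next
    assume "D mod 4 = 1"
    then have "4 dvd int D - 1" by presburger
    then show ?thesis by simp
  qed
  then show ?thesis
    by (simp add: omega_norm_def)
qed

lemma four_omega_norm_real: "4 * real_of_int (omega_norm D) = real D * (real D - 1)"
proof -
  have "real_of_int (4 * omega_norm D) = real_of_int (int D * (int D - 1))"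
    by (simp only: four_omega_norm)
  then show ?thesis by simp
qed

lemma omega_sq: "omega D * omega D = real D * omega D - of_int (omega_norm D)"
proof -
  have "4 * (omega D * omega D) = 4 * (real D * omega D) - real D * (real D - 1)"
    by (simp add: omega_def field_simps)
  then show ?thesis using four_omega_norm_real by simp
qed

lemma omega'_sq: "omega' D * omega' D = real D * omega' D - of_int (omega_norm D)"
proof -
  have "4 * (omega' D * omega' D) = 4 * (real D * omega' D) - real D * (real D - 1)"
    by (simp add: omega'_def field_simps)
  then show ?thesis using four_omega_norm_real by simp
qed

lemma omega_mult_omega': "omega D * omega' D = of_int (omega_norm D)"
proof -
  have "4 * (omega D * omega' D) = real D * (real D - 1)"
    by (simp add: omega_def omega'_def field_simps)
  then show ?thesis using four_omega_norm_real by simp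
qed

lemma omega_neq: "omega D \<noteq> omega' D"
  using omega_diff_omega'[of D] sqrt_pos by linarith

lemma quad_field_eq: "quad_field D = {x. \<exists>a\<in>\<rat>. \<exists>b\<in>\<rat>. x = a + b * omega D}"
proof (intro equalityI subsetI)
  fix x assume "x \<in> quad_field D"
  then obtain a b where ab: "a \<in> \<rat>" "b \<in> \<rat>" "x = a + b * sqrt (real D)"
    by (auto simp: quad_field_def)
  then have "x = (a - b * real D) + (2 * b) * omega D" "a - b * real D \<in> \<rat>" "2 * b \<in> \<rat>"
    by (simp_all add: omega_def field_simps)
  then show "x \<in> {x. \<exists>a\<in>\<rat>. \<exists>b\<in>\<rat>. x = a + b * omega D}" by blast
next
  fix x assume "x \<in> {x. \<exists>a\<in>\<rat>. \<exists>b\<in>\<rat>. x = a + b * omega D}"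
  then obtain a b where ab: "a \<in> \<rat>" "b \<in> \<rat>" "x = a + b * omega D" by auto
  then have "x = (a + b * real D / 2) + (b / 2) * sqrt (real D)"
      "a + b * real D / 2 \<in> \<rat>" "b / 2 \<in> \<rat>"
    by (simp_all add: omega_def field_simps)
  then show "x \<in> quad_field D"
    unfolding quad_field_def by blast
qed

lemma fieldE:
  assumes "x \<in> quad_field D"
  obtains a b where "a \<in> \<rat>" "b \<in> \<rat>" "x = a + b * omega D"
  using assms by (auto simp: quad_field_eq)

lemma fieldI: "a \<in> \<rat> \<Longrightarrow> b \<in> \<rat> \<Longrightarrow> a + b * omega D \<in> quad_field D"
  by (auto simp: quad_field_eq)

text \<open>Irrationality of sqrt D makes the description in \<open>quad_conj_def\<close>
  unambiguous; the rest is the change of coordinates from (1, sqrt D) to (1, omega).\<close>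

lemma conj_eq:
  assumes ab: "a \<in> \<rat>" "b \<in> \<rat>"
  shows "quad_conj D (a + b * omega D) = a + b * omega' D"
  unfolding quad_conj_def
proof (rule the_equality)
  have "a + b * omega D = (a + b * real D / 2) + (b / 2) * sqrt (real D)"
      "a + b * omega' D = (a + b * real D / 2) - (b / 2) * sqrt (real D)"
      "a + b * real D / 2 \<in> \<rat>" "b / 2 \<in> \<rat>"
    using ab by (simp_all add: omega_def omega'_def field_simps)
  then show "\<exists>c\<in>\<rat>. \<exists>d\<in>\<rat>. a + b * omega D = c + d * sqrt (real D) \<and>
      a + b * omega' D = c - d * sqrt (real D)" by blast
next
  fix y assume "\<exists>c\<in>\<rat>. \<exists>d\<in>\<rat>. a + b * omega D = c + d * sqrt (real D) \<and> y = c - d * sqrt (real D)"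
  then obtain c d where cd: "c \<in> \<rat>" "d \<in> \<rat>" "a + b * omega D = c + d * sqrt (real D)"
    "y = c - d * sqrt (real D)" by blast
  have "a + b * omega D = (c - d * real D) + (2 * d) * omega D"
    using cd(3) by (simp add: omega_def field_simps)
  then have "a = c - d * real D \<and> b = 2 * d"
    using ab cd by (intro rat_unique) auto
  then show "y = a + b * omega' D"
    using cd by (simp add: omega'_def field_simps)
qed

lemma conj_int [simp]:
  "quad_conj D (of_int m + of_int n * omega D) = of_int m + of_int n * omega' D"
  by (rule conj_eq) auto

lemma conj_rat [simp]: "a \<in> \<rat> \<Longrightarrow> quad_conj D a = a"
  using conj_eq[of a 0] by simp

lemma conj_omega [simp]: "quad_conj D (omega D) = omega' D"
  using conj_eq[of 0 1] by simp

lemma field_rat: "a \<in> \<rat> \<Longrightarrow> a \<in> quad_field D"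
  using fieldI[of a 0] by simp

lemma field_omega: "omega D \<in> quad_field D"
  using fieldI[of 0 1] by simp

lemma omega'_in_order: "omega' D \<in> quad_order D"
  using quad_orderI[of "int D" "-1" D] by (simp add: omega'_eq)

lemma field_add: "x \<in> quad_field D \<Longrightarrow> y \<in> quad_field D \<Longrightarrow> x + y \<in> quad_field D"
proof (elim fieldE)
  fix a b c d assume "a \<in> \<rat>" "b \<in> \<rat>" "c \<in> \<rat>" "d \<in> \<rat>" "x = a + b * omega D" "y = c + d * omega D"
  then show ?thesis using fieldI[of "a + c" "b + d"] by (simp add: algebra_simps)
qed

lemma conj_add [simp]:
  "x \<in> quad_field D \<Longrightarrow> y \<in> quad_field D \<Longrightarrow> quad_conj D (x + y) = quad_conj D x + quad_conj D y"
proof (elim fieldE)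
  fix a b c d assume h: "a \<in> \<rat>" "b \<in> \<rat>" "c \<in> \<rat>" "d \<in> \<rat>" "x = a + b * omega D" "y = c + d * omega D"
  then have "x + y = (a + c) + (b + d) * omega D" by (simp add: algebra_simps)
  then have "quad_conj D (x + y) = (a + c) + (b + d) * omega' D"
    using h by (simp only: conj_eq Rats_add)
  with h show ?thesis by (simp add: conj_eq algebra_simps)
qed

lemma mult_omega_form:
  "(a + b * omega D) * (c + d * omega D) =
    (a * c - b * d * of_int (omega_norm D)) + (a * d + b * c + b * d * real D) * omega D"
proof -
  have "(a + b * omega D) * (c + d * omega D) =
      a * c + (a * d + b * c) * omega D + b * d * (omega D * omega D)"
    by (simp add: algebra_simps)
  then show ?thesis by (simp add: omega_sq algebra_simps)
qed

lemma mult_omega'_form: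
  "(a + b * omega' D) * (c + d * omega' D) =
    (a * c - b * d * of_int (omega_norm D)) + (a * d + b * c + b * d * real D) * omega' D"
proof -
  have "(a + b * omega' D) * (c + d * omega' D) =
      a * c + (a * d + b * c) * omega' D + b * d * (omega' D * omega' D)"
    by (simp add: algebra_simps)
  then show ?thesis by (simp add: omega'_sq algebra_simps)
qed

lemma field_mult: "x \<in> quad_field D \<Longrightarrow> y \<in> quad_field D \<Longrightarrow> x * y \<in> quad_field D"
  by (elim fieldE) (simp add: mult_omega_form fieldI)

lemma conj_mult [simp]:
  "x \<in> quad_field D \<Longrightarrow> y \<in> quad_field D \<Longrightarrow> quad_conj D (x * y) = quad_conj D x * quad_conj D y"
  by (elim fieldE) (simp add: mult_omega_form mult_omega'_form conj_eq)

lemma field_minus: "x \<in> quad_field D \<Longrightarrow> - x \<in> quad_field D"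
  using field_mult[of "-1" x] field_rat by simp

lemma conj_minus [simp]: "x \<in> quad_field D \<Longrightarrow> quad_conj D (- x) = - quad_conj D x"
  using conj_mult[of "-1" x] field_rat[of "-1"] by simp

lemma field_diff: "x \<in> quad_field D \<Longrightarrow> y \<in> quad_field D \<Longrightarrow> x - y \<in> quad_field D"
  using field_add[of x "-y"] field_minus by simp

lemma conj_diff [simp]:
  "x \<in> quad_field D \<Longrightarrow> y \<in> quad_field D \<Longrightarrow> quad_conj D (x - y) = quad_conj D x - quad_conj D y"
  using conj_add[of x "-y"] field_minus by simp

lemma field_conj: "x \<in> quad_field D \<Longrightarrow> quad_conj D x \<in> quad_field D"
proof (elim fieldE)
  fix a b assume "a \<in> \<rat>" "b \<in> \<rat>" "x = a + b * omega D"
  then have "quad_conj D x = (a + b * real D) + (- b) * omega D" "a + b * real D \<in> \<rat>" "- b \<in> \<rat>"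
    using omega_add_omega'[of D] by (simp_all add: conj_eq algebra_simps flip: distrib_left)
  then show ?thesis by (simp only: fieldI)
qed

lemma conj_conj [simp]: "x \<in> quad_field D \<Longrightarrow> quad_conj D (quad_conj D x) = x"
proof (elim fieldE)
  fix a b assume h: "a \<in> \<rat>" "b \<in> \<rat>" "x = a + b * omega D"
  then have "quad_conj D x = (a + b * real D) + (- b) * omega D" "a + b * real D \<in> \<rat>" "- b \<in> \<rat>"
    using omega_add_omega'[of D] by (simp_all add: conj_eq algebra_simps flip: distrib_left)
  then have "quad_conj D (quad_conj D x) = (a + b * real D) + (- b) * omega' D"
    by (simp only: conj_eq)
  then show ?thesis
    using h by (simp add: omega'_eq algebra_simps)
qed

lemma conj_0 [simp]: "quad_conj D 0 = 0" and conj_1 [simp]: "quad_conj D 1 = 1"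
  by simp_all

lemma conj_eq_0_iff [simp]: "x \<in> quad_field D \<Longrightarrow> quad_conj D x = 0 \<longleftrightarrow> x = 0"
  using conj_conj[of x] conj_0 by metis

lemma conj_mult_rat: "x \<in> quad_field D \<Longrightarrow> x * quad_conj D x \<in> \<rat>"
proof (elim fieldE)
  fix a b assume h: "a \<in> \<rat>" "b \<in> \<rat>" "x = a + b * omega D"
  have "x * quad_conj D x = a * a + a * b * (omega D + omega' D) + b * b * (omega D * omega' D)"
    using h by (simp add: conj_eq algebra_simps)
  with h show ?thesis by (simp add: omega_add_omega' omega_mult_omega')
qed

lemma field_inverse: "x \<in> quad_field D \<Longrightarrow> inverse x \<in> quad_field D"
proof (cases "x = 0")
  case False
  assume x: "x \<in> quad_field D"
  then have "inverse x = inverse (x * quad_conj D x) * quad_conj D x"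
    using False by (simp add: field_simps)
  then show ?thesis
    using x by (metis Rats_inverse conj_mult_rat field_conj field_mult field_rat)
qed (simp add: field_rat)

lemma field_divide: "x \<in> quad_field D \<Longrightarrow> y \<in> quad_field D \<Longrightarrow> x / y \<in> quad_field D"
  by (simp add: divide_inverse field_inverse field_mult)

lemma conj_divide [simp]:
  assumes "x \<in> quad_field D" "y \<in> quad_field D" "y \<noteq> 0"
  shows "quad_conj D (x / y) = quad_conj D x / quad_conj D y"
proof -
  have "quad_conj D x = quad_conj D (x / y * y)"
    using assms by simp
  also have "\<dots> = quad_conj D (x / y) * quad_conj D y"
    using assms by (intro conj_mult field_divide)
  finally show ?thesis using assms by simp
qed

lemma order_in_field: "x \<in> quad_order D \<Longrightarrow> x \<in> quad_field D"
  by (elim quad_orderE) (simp add: fieldI)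

lemma order_add: "x \<in> quad_order D \<Longrightarrow> y \<in> quad_order D \<Longrightarrow> x + y \<in> quad_order D"
proof (elim quad_orderE)
  fix a b c d assume "x = of_int a + of_int b * omega D" "y = of_int c + of_int d * omega D"
  then show ?thesis using quad_orderI[of "a + c" "b + d" D] by (simp add: algebra_simps)
qed

lemma order_mult: "x \<in> quad_order D \<Longrightarrow> y \<in> quad_order D \<Longrightarrow> x * y \<in> quad_order D"
proof (elim quad_orderE)
  fix a b c d assume "x = of_int a + of_int b * omega D" "y = of_int c + of_int d * omega D"
  then show ?thesis
    using quad_orderI[of "a * c - b * d * omega_norm D" "a * d + b * c + b * d * int D" D]
    by (simp add: mult_omega_form)
qed

lemma order_int: "of_int m \<in> quad_order D"
  using quad_orderI[of m 0 D] by simp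

lemma order_Ints: "x \<in> \<int> \<Longrightarrow> x \<in> quad_order D"
  by (elim Ints_cases) (simp add: order_int)

lemma order_0: "0 \<in> quad_order D" and order_1: "1 \<in> quad_order D"
  by (simp_all add: order_Ints)

lemma order_omega: "omega D \<in> quad_order D"
  using quad_orderI[of 0 1 D] by simp

lemma order_minus: "x \<in> quad_order D \<Longrightarrow> - x \<in> quad_order D"
  using order_mult[of "-1" x] order_Ints by simp

lemma order_diff: "x \<in> quad_order D \<Longrightarrow> y \<in> quad_order D \<Longrightarrow> x - y \<in> quad_order D"
  using order_add[of x "- y"] order_minus by simp

lemma order_conj: "x \<in> quad_order D \<Longrightarrow> quad_conj D x \<in> quad_order D"
  by (elim quad_orderE) (simp add: order_add order_mult order_int omega'_in_order)

lemma order_rat: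
  assumes "x \<in> quad_order D" "x \<in> \<rat>" shows "x \<in> \<int>"
proof -
  obtain m n where mn: "x = of_int m + of_int n * omega D"
    using assms by (elim quad_orderE)
  have "of_int m - x \<in> \<rat>" "of_int m - x + of_int n * omega D = 0"
    by (intro Rats_diff Rats_of_int assms(2)) (simp add: mn)
  then have "n = 0"
    using rat_indep(2)[of "of_int m - x" "of_int n"] by simp
  with mn show ?thesis by simp
qed

lemma trace_add: "x \<in> quad_field D \<Longrightarrow> y \<in> quad_field D \<Longrightarrow>
    quad_trace D (x + y) = quad_trace D x + quad_trace D y"
  by (simp add: quad_trace_def)

lemma trace_diff: "x \<in> quad_field D \<Longrightarrow> y \<in> quad_field D \<Longrightarrow>
    quad_trace D (x - y) = quad_trace D x - quad_trace D y"
  by (simp add: quad_trace_def)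

lemma trace_minus: "x \<in> quad_field D \<Longrightarrow> quad_trace D (- x) = - quad_trace D x"
  by (simp add: quad_trace_def)

lemma trace_rat_mult: "a \<in> \<rat> \<Longrightarrow> x \<in> quad_field D \<Longrightarrow> quad_trace D (a * x) = a * quad_trace D x"
  by (simp add: quad_trace_def field_rat algebra_simps)

text \<open>Testing with 1 and omega gives a linear system for x and its conjugate whose determinant
  is, up to sign, sqrt D. Used to pass from identities of traces to identities in K.\<close>

lemma trace_nondeg:
  assumes "x \<in> quad_field D" "\<And>k. k \<in> quad_order D \<Longrightarrow> quad_trace D (k * x) = 0"
  shows "x = 0"
proof -
  have "x + quad_conj D x = 0" "omega D * x + omega' D * quad_conj D x = 0"
    using assms(2)[OF order_1] assms(2)[OF order_omega] assms(1)
    by (simp_all add: quad_trace_def field_omega)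
  then have "(omega D - omega' D) * x = 0"
    by (simp add: algebra_simps add_eq_0_iff)
  then show ?thesis using omega_neq by simp
qed

section \<open>Ideals of the quadratic order as sets of real numbers\<close>

lemma cring_order: "cring (real_ring (quad_order D))"
proof (rule cringI)
  show "abelian_group (real_ring (quad_order D))"
  proof (rule abelian_groupI)
    fix x assume "x \<in> carrier (real_ring (quad_order D))"
    then show "\<exists>y\<in>carrier (real_ring (quad_order D)). y \<oplus>\<^bsub>real_ring (quad_order D)\<^esub> x = \<zero>\<^bsub>real_ring (quad_order D)\<^esub>"
      by (intro bexI[of _ "- x"]) (auto simp: order_minus)
  qed (auto simp: order_add order_0)
  show "Group.comm_monoid (real_ring (quad_order D))"
    by (rule comm_monoidI) (auto simp: order_mult order_1)
qed (auto simp: algebra_simps)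

text \<open>Negation is multiplication by -1, an element of the order, so closure under addition and
  multiples already gives a subgroup.\<close>

lemma ideal_order_iff:
  "ideal I (real_ring (quad_order D)) \<longleftrightarrow> I \<subseteq> quad_order D \<and> 0 \<in> I \<and>
    (\<forall>x\<in>I. \<forall>y\<in>I. x + y \<in> I) \<and> (\<forall>k\<in>quad_order D. \<forall>x\<in>I. k * x \<in> I)" (is "?L \<longleftrightarrow> ?R")
proof
  interpret cring "real_ring (quad_order D)" by (rule cring_order)
  show ?R if I: ?L
  proof -
    interpret I: ideal I "real_ring (quad_order D)" by (rule I)
    show ?R
      using I.a_subset I.zero_closed I.a_closed I.I_l_closed by auto
  qed
  have comm: "a * x \<in> I" if ?R "a \<in> I" "x \<in> quad_order D" for a x
    using that by (metis mult.commute)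
  show ?L if I: ?R
  proof (rule idealI)
    show "subgroup I (add_monoid (real_ring (quad_order D)))"
    proof (rule add.subgroupI)
      fix a assume a: "a \<in> I"
      have "- a = (-1) * a" by simp
      also have "\<dots> \<in> I" using a I order_Ints[of "-1"] by (metis Ints_1 Ints_minus)
      finally have "- a \<in> I" .
      moreover have "\<ominus>\<^bsub>real_ring (quad_order D)\<^esub> a = - a"
        using minus_equality[of "- a" a] a I \<open>- a \<in> I\<close> by auto
      ultimately show "\<ominus>\<^bsub>real_ring (quad_order D)\<^esub> a \<in> I" by simp
    qed (use I in auto)
  qed (use I in \<open>auto simp: ring_axioms comm[OF I]\<close>)
qed

end

section \<open>Orders and the conductor\<close>

lemma zbasis_iff:
  fixes b :: "'i::finite \<Rightarrow> 'a::real_vector"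
  shows "zbasis b L \<longleftrightarrow> L = range (\<lambda>k. \<Sum>i\<in>UNIV. of_int (k i) *\<^sub>R b i) \<and>
    (\<forall>k. (\<Sum>i\<in>UNIV. of_int (k i) *\<^sub>R b i) = 0 \<longrightarrow> k = (\<lambda>_. 0))" (is "_ \<longleftrightarrow> _ \<and> ?I")
proof -
  have "inj (\<lambda>k::'i \<Rightarrow> int. \<Sum>i\<in>UNIV. of_int (k i) *\<^sub>R b i) \<longleftrightarrow> ?I"
  proof
    show ?I if i: "inj (\<lambda>k::'i \<Rightarrow> int. \<Sum>i\<in>UNIV. of_int (k i) *\<^sub>R b i)"
    proof (intro allI impI)
      fix k assume "(\<Sum>i\<in>UNIV. of_int (k i) *\<^sub>R b i) = 0"
      then have "(\<Sum>i\<in>UNIV. of_int (k i) *\<^sub>R b i) = (\<Sum>i\<in>UNIV. of_int ((\<lambda>_. 0) i) *\<^sub>R b i)"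
        by simp
      then show "k = (\<lambda>_. 0)" by (rule injD[OF i])
    qed
    show "inj (\<lambda>k::'i \<Rightarrow> int. \<Sum>i\<in>UNIV. of_int (k i) *\<^sub>R b i)" if i: ?I
    proof (rule injI)
      fix k l :: "'i \<Rightarrow> int"
      assume "(\<Sum>i\<in>UNIV. of_int (k i) *\<^sub>R b i) = (\<Sum>i\<in>UNIV. of_int (l i) *\<^sub>R b i)"
      then have "(\<Sum>i\<in>UNIV. of_int (k i - l i) *\<^sub>R b i) = 0"
        by (simp add: algebra_simps sum_subtractf)
      with spec[OF i, of "\<lambda>i. k i - l i"] have "(\<lambda>i. k i - l i) = (\<lambda>_. 0)" by simp
      then show "k = l" by (auto simp: fun_eq_iff)
    qed
  qed
  then show ?thesis
    unfolding zbasis_def bij_betw_def by auto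
qed

lemma zbasis_indep:
  "zbasis b L \<Longrightarrow> (\<Sum>i\<in>UNIV. of_int (k i) *\<^sub>R b i) = 0 \<Longrightarrow> k i = 0"
  unfolding zbasis_iff by metis

lemma zbasis_span:
  fixes b :: "'i::finite \<Rightarrow> 'a::real_vector"
  assumes "zbasis b L" "v \<in> L"
  obtains k where "v = (\<Sum>i\<in>UNIV. of_int (k i) *\<^sub>R b i)"
  using assms unfolding zbasis_iff by auto

lemma zbasis_comb: "zbasis b L \<Longrightarrow> (\<Sum>i\<in>UNIV. of_int (k i) *\<^sub>R b i) \<in> L"
  unfolding zbasis_iff by auto

lemma zbasis_2_iff:
  fixes b :: "2 \<Rightarrow> 'a::real_vector"
  shows "zbasis b L \<longleftrightarrow> (\<forall>x. x \<in> L \<longleftrightarrow> (\<exists>m n::int. x = of_int m *\<^sub>R b 1 + of_int n *\<^sub>R b 2)) \<and>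
    (\<forall>m n::int. of_int m *\<^sub>R b 1 + of_int n *\<^sub>R b 2 = 0 \<longrightarrow> m = 0 \<and> n = 0)"
proof -
  have ne: "(2::2) \<noteq> 1"
    by simp
  have ex: "(\<exists>k. P (k (1::2)) (k 2)) \<longleftrightarrow> (\<exists>m n::int. P m n)" for P
  proof
    assume "\<exists>m n. P m n"
    then obtain m n where "P m n" by blast
    then show "\<exists>k. P (k (1::2)) (k 2)"
      using ne by (intro exI[of _ "\<lambda>i. if i = 1 then m else n"]) simp
  qed blast
  have f: "k = (\<lambda>_::2. 0) \<longleftrightarrow> k 1 = 0 \<and> k 2 = 0" for k :: "2 \<Rightarrow> int"
    by (simp add: fun_eq_iff forall_2)
  have all: "(\<forall>k. P (k (1::2)) (k 2)) \<longleftrightarrow> (\<forall>m n::int. P m n)" for P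
    using ex[of "\<lambda>m n. \<not> P m n"] by blast
  show ?thesis
    unfolding zbasis_iff sum_2 f
    using all[of "\<lambda>m n. of_int m *\<^sub>R b 1 + of_int n *\<^sub>R b 2 = 0 \<longrightarrow> m = 0 \<and> n = 0"]
      ex[of "\<lambda>m n. x = of_int m *\<^sub>R b 1 + of_int n *\<^sub>R b 2" for x]
    by (simp add: set_eq_iff image_iff)
qed

context quad_disc
begin

lemma subring_field_iff:
  "subring R (real_ring (quad_field D)) \<longleftrightarrow> R \<subseteq> quad_field D \<and> 1 \<in> R \<and> (\<forall>x\<in>R. - x \<in> R) \<and>
    (\<forall>x\<in>R. \<forall>y\<in>R. x * y \<in> R \<and> x + y \<in> R)" (is "?L \<longleftrightarrow> ?R")
proof -
  interpret cring "real_ring (quad_field D)"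
  proof (rule cringI)
    show "abelian_group (real_ring (quad_field D))"
    proof (rule abelian_groupI)
      fix x assume "x \<in> carrier (real_ring (quad_field D))"
      then show "\<exists>y\<in>carrier (real_ring (quad_field D)). y \<oplus>\<^bsub>real_ring (quad_field D)\<^esub> x = \<zero>\<^bsub>real_ring (quad_field D)\<^esub>"
        by (intro bexI[of _ "- x"]) (auto simp: field_minus)
    qed (auto simp: field_add field_rat)
    show "Group.comm_monoid (real_ring (quad_field D))"
      by (rule comm_monoidI) (auto simp: field_mult field_rat)
  qed (auto simp: algebra_simps)
  have m: "\<ominus>\<^bsub>real_ring (quad_field D)\<^esub> x = - x" if "x \<in> quad_field D" for x
    using minus_equality[of "- x" x] that field_minus by auto
  show ?thesis
  proof
    assume L: ?L
    then interpret S: subring R "real_ring (quad_field D)" .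
    have "\<ominus>\<^bsub>real_ring (quad_field D)\<^esub> x \<in> R" if "x \<in> R" for x
      using subringE(5)[OF L that] .
    then have "\<forall>x\<in>R. - x \<in> R"
      using m subringE(1)[OF L] by (metis real_ring_simps(1) subsetD)
    then show ?R
      using subringE(1,3,6,7)[OF L] by simp
  next
    assume ?R
    then show ?L
      by (intro subringI) (auto simp: m subset_iff)
  qed
qed

lemma zbasis_order: "zbasis (\<lambda>i::2. if i = 1 then 1 else omega D) (quad_order D)"
  unfolding zbasis_2_iff using rat_indep[of "of_int m" "of_int n" for m n]
  by (auto simp: quad_order_eq)

lemma is_order_order: "is_order D (quad_order D)"
  unfolding is_order_def subring_field_iff
  using zbasis_order by (auto simp: order_in_field order_1 order_minus order_mult order_add)

text \<open>A multiplier of a rank two lattice in \<open>K\<close> is a root of the characteristic polynomial of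
  its integral \<open>2 \<times> 2\<close> matrix.\<close>

lemma multiplier_integral:
  fixes b :: "2 \<Rightarrow> real"
  assumes M: "zbasis b M" and t: "t \<in> quad_field D" and tM: "\<And>x. x \<in> M \<Longrightarrow> t * x \<in> M"
  shows "quad_trace D t \<in> \<int>" "t * quad_conj D t \<in> \<int>"
proof -
  have mem: "x \<in> M \<longleftrightarrow> (\<exists>m n::int. x = of_int m * b 1 + of_int n * b 2)" for x
    using M unfolding zbasis_2_iff by simp
  have ind: "m = 0 \<and> n = 0" if "of_int m * b 1 + of_int n * b 2 = 0" for m n :: int
    using M that unfolding zbasis_2_iff by simp
  have b: "b 1 \<in> M" "b 2 \<in> M"
    unfolding mem by (rule exI[of _ 1], rule exI[of _ 0], simp) (rule exI[of _ 0], rule exI[of _ 1], simp)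
  have b0: "b 1 \<noteq> 0" "b 2 \<noteq> 0"
    using ind[of 1 0] ind[of 0 1] by auto
  obtain m n where 1: "t * b 1 = of_int m * b 1 + of_int n * b 2"
    using tM[OF b(1)] mem by blast
  obtain p q where 2: "t * b 2 = of_int p * b 1 + of_int q * b 2"
    using tM[OF b(2)] mem by blast
  have "quad_trace D t \<in> \<int> \<and> t * quad_conj D t \<in> \<int>"
  proof (cases "t \<in> \<rat>")
    case True
    then obtain u v :: int where uv: "v > 0" "t = of_int u / of_int v"
      by (metis Rats_cases')
    have "of_int (u - v * m) * b 1 + of_int (- v * n) * b 2 = 0"
      using 1 uv by (simp add: field_simps)
    then have "u = v * m"
      using ind by fastforce
    then have "t \<in> \<int>" using uv by simp
    then show ?thesis using True by (simp add: quad_trace_def)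
  next
    case False
    have "(t - of_int m) * (t - of_int q) * (b 1 * b 2) = of_int n * of_int p * (b 1 * b 2)"
    proof -
      have "(t - of_int m) * b 1 = of_int n * b 2" "(t - of_int q) * b 2 = of_int p * b 1"
        using 1 2 by (simp_all add: algebra_simps)
      then have "((t - of_int m) * b 1) * ((t - of_int q) * b 2) = (of_int n * b 2) * (of_int p * b 1)"
        by simp
      then show ?thesis by (simp add: mult_ac)
    qed
    then have e1: "(t - of_int m) * (t - of_int q) = of_int n * of_int p"
      using b0 by simp
    define T N where "T = quad_trace D t" and "N = t * quad_conj D t"
    obtain x y where xy: "x \<in> \<rat>" "y \<in> \<rat>" "t = x + y * omega D"
      using t by (rule fieldE)
    have TR: "T = 2 * x + y * real D"
      using xy by (simp add: T_def quad_trace_def conj_eq omega'_eq algebra_simps)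
    have NR: "N \<in> \<rat>"
      using t conj_mult_rat by (simp add: N_def)
    have e2: "t * t - T * t + N = 0"
      by (simp add: T_def N_def quad_trace_def algebra_simps)
    \<comment> \<open>The relation \<open>e1\<close> and the minimal equation \<open>e2\<close> are
      monic quadratics for t. Their difference is linear with rational coefficients, so an
      irrational t makes both coefficients vanish.\<close>
    have e3: "(T - of_int (m + q)) * t = N - of_int (m * q - n * p)"
      using e1 e2 by (simp add: algebra_simps)
    have "T = of_int (m + q)"
    proof (rule ccontr)
      assume ne: "T \<noteq> of_int (m + q)"
      then have "t = (N - of_int (m * q - n * p)) / (T - of_int (m + q))"
        using e3 by (simp add: field_simps)
      moreover have "\<dots> \<in> \<rat>"
        using NR TR xy by simp
      ultimately show False using False by simp
    qed
    with e3 have "N = of_int (m * q - n * p)" by simp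
    with \<open>T = of_int (m + q)\<close> show ?thesis
      unfolding T_def N_def by (metis Ints_of_int)
  qed
  then show "quad_trace D t \<in> \<int>" "t * quad_conj D t \<in> \<int>" by auto
qed

end

text \<open>A fundamental discriminant, characterised without reference to squarefreeness.\<close>

locale fundamental_disc = quad_disc +
  assumes fundamental: "0 < q \<Longrightarrow> q\<^sup>2 dvd D \<Longrightarrow> discriminant (D div q\<^sup>2) \<Longrightarrow> q = 1"
begin

text \<open>Write the omega-coordinate as u/v in lowest terms. Trace t and norm N satisfy u^2 D =
  (t^2 - 4N) v^2, so v^2 divides D; the quotient is again a discriminant, and fundamentality gives v
  = 1. The parity of t - uD then makes the other coordinate integral.\<close>

lemma integral_in_order:
  assumes x: "x \<in> quad_field D" and tr: "quad_trace D x \<in> \<int>" and nm: "x * quad_conj D x \<in> \<int>"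
  shows "x \<in> quad_order D"
proof -
  obtain a s where as: "a \<in> \<rat>" "s \<in> \<rat>" "x = a + s * omega D"
    using x by (rule fieldE)
  obtain t where t: "quad_trace D x = of_int t"
    using tr by (auto elim: Ints_cases)
  obtain N where N: "x * quad_conj D x = of_int N"
    using nm by (auto elim: Ints_cases)
  have t': "of_int t = 2 * a + s * real D"
    using as t by (simp add: quad_trace_def conj_eq omega'_eq algebra_simps)
  have xc': "quad_conj D x = a + s * omega' D"
    using as conj_eq by simp
  have xc: "x = (of_int t + s * sqrt (real D)) / 2" "quad_conj D x = (of_int t - s * sqrt (real D)) / 2"
    unfolding xc' using as by (simp_all add: t' omega_def omega'_def field_simps)
  have "4 * (x * quad_conj D x) = (of_int t)\<^sup>2 - s\<^sup>2 * (sqrt (real D))\<^sup>2"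
    unfolding xc(2) unfolding xc(1) by (simp add: field_simps power2_eq_square)
  then have e: "s\<^sup>2 * real D = of_int (t\<^sup>2 - 4 * N)"
    using N by simp
  obtain u :: int and v where uv: "0 < v" "coprime u v" "s = of_int u / of_int v"
    using as(2) by (metis Rats_cases')
  have "of_int u ^ 2 * real D = of_int (t\<^sup>2 - 4 * N) * of_int v ^ 2"
    using e uv by (simp add: field_simps)
  then have "real_of_int (u\<^sup>2 * int D) = real_of_int ((t\<^sup>2 - 4 * N) * v\<^sup>2)"
    by simp
  then have e2: "u\<^sup>2 * int D = (t\<^sup>2 - 4 * N) * v\<^sup>2"
    by (simp only: of_int_eq_iff)
  then have "v\<^sup>2 dvd u\<^sup>2 * int D" by simp
  moreover have "coprime (v\<^sup>2) (u\<^sup>2)"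
    using uv(2) by (simp add: coprime_commute)
  ultimately have "v\<^sup>2 dvd int D"
    by (simp add: coprime_dvd_mult_right_iff)
  then obtain m where m: "int D = v\<^sup>2 * m" by auto
  have e3: "u\<^sup>2 * m = t\<^sup>2 - 4 * N"
    using e2 uv(1) unfolding m by (simp add: mult.left_commute mult.commute)
  have sq: "z\<^sup>2 mod 4 = (if even z then 0 else 1)" for z :: int
  proof -
    have "z mod 4 = 0 \<or> z mod 4 = 1 \<or> z mod 4 = 2 \<or> z mod 4 = 3" by presburger
    moreover have "even z \<longleftrightarrow> z mod 4 = 0 \<or> z mod 4 = 2" by presburger
    ultimately show ?thesis
      unfolding power_mod[symmetric, of z] by auto
  qed
  \<comment> \<open>For even v the numerator u is odd, so m has the residue of the square t^2; for
    odd v it has the residue of D.\<close>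
  have "m mod 4 = 0 \<or> m mod 4 = 1"
  proof (cases "even v")
    case True
    then have "odd u" using uv(2) by (metis coprime_common_divisor odd_one)
    then have "u\<^sup>2 * m mod 4 = m mod 4"
      using sq[of u] by (metis mod_mult_left_eq mult_1)
    moreover have "(t\<^sup>2 - 4 * N) mod 4 = t\<^sup>2 mod 4"
      by (metis mod_diff_right_eq mod_mult_self1_is_0 diff_zero)
    ultimately show ?thesis using e3 sq[of t] by (auto split: if_splits)
  next
    case False
    then have "v\<^sup>2 * m mod 4 = m mod 4"
      using sq[of v] by (metis mod_mult_left_eq mult_1)
    moreover have "int D mod 4 = 0 \<or> int D mod 4 = 1"
      using D_disc unfolding discriminant_def by presburger
    ultimately show ?thesis using m by simp
  qed
  moreover have m0: "m \<ge> 0"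
    using m uv(1) by (metis of_nat_0_le_iff zero_le_mult_iff zero_less_power not_le)
  then obtain m' where m': "m = int m'" by (rule nonneg_int_cases)
  ultimately have dm: "discriminant (nat m)"
    unfolding discriminant_def by (simp add: m') presburger
  have "D = (nat v)\<^sup>2 * nat m"
  proof -
    have "int D = int ((nat v)\<^sup>2 * nat m)" using m m0 uv(1) by simp
    then show ?thesis by (simp only: of_nat_eq_iff)
  qed
  then have "(nat v)\<^sup>2 dvd D" "D div (nat v)\<^sup>2 = nat m"
    using uv(1) by auto
  with dm fundamental[of "nat v"] uv(1) have "v = 1" by auto
  then have s: "s = of_int u" and mD: "m = int D"
    using uv m by auto
  have "even (t - u * int D)"
  proof -
    have "even (u\<^sup>2 * int D) \<longleftrightarrow> even (t\<^sup>2 - 4 * N)" using e3 mD by simp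
    then show ?thesis by auto
  qed
  then obtain r where r: "t - u * int D = 2 * r" by (elim evenE)
  have "2 * a = of_int (t - u * int D)" using t' s by simp
  then have "a = of_int r" using r by simp
  then show ?thesis using as(3) s by auto
qed

text \<open>An order is a rank two lattice stable under multiplication by each of its elements, so
  these are integral by \<open>multiplier_integral\<close>.\<close>

lemma is_order_subset: "is_order D R \<Longrightarrow> R \<subseteq> quad_order D"
proof
  fix x assume R: "is_order D R" and x: "x \<in> R"
  then obtain b :: "2 \<Rightarrow> real" where b: "zbasis b R" by (auto simp: is_order_def)
  have "R \<subseteq> quad_field D" "\<And>y. y \<in> R \<Longrightarrow> x * y \<in> R"
    using R x unfolding is_order_def subring_field_iff by blast+
  with multiplier_integral[OF b, of x] x show "x \<in> quad_order D"
    by (intro integral_in_order) auto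
qed

text \<open>A change of integral basis has determinant 1 or -1, which the square absorbs; the basis
  1, omega gives D.\<close>

lemma order_disc_order_iff: "order_disc D (quad_order D) d \<longleftrightarrow> d = int D"
proof
  have "(omega' D - omega D)\<^sup>2 = real D"
    using omega_diff_omega'[of D] by (simp add: power2_commute)
  then show "order_disc D (quad_order D) d" if "d = int D"
    unfolding order_disc_def using zbasis_order that by (intro exI[of _ "\<lambda>i::2. if i = 1 then 1 else omega D"]) simp
next
  assume "order_disc D (quad_order D) d"
  then obtain b :: "2 \<Rightarrow> real" where b: "zbasis b (quad_order D)"
    and d: "of_int d = (b 1 * quad_conj D (b 2) - b 2 * quad_conj D (b 1))\<^sup>2"
    by (auto simp: order_disc_def)
  have mem: "x \<in> quad_order D \<longleftrightarrow> (\<exists>m n::int. x = of_int m * b 1 + of_int n * b 2)" for x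
    using b unfolding zbasis_2_iff by simp
  have "b 1 \<in> quad_order D" "b 2 \<in> quad_order D"
    unfolding mem by (rule exI[of _ 1], rule exI[of _ 0], simp) (rule exI[of _ 0], rule exI[of _ 1], simp)
  then obtain p q r s where pq: "b 1 = of_int p + of_int q * omega D" "b 2 = of_int r + of_int s * omega D"
    by (elim quad_orderE)
  obtain k l where kl: "of_int 1 + of_int 0 * omega D = of_int k * b 1 + of_int l * b 2"
    using order_1 mem by auto
  obtain m n where mn: "of_int 0 + of_int 1 * omega D = of_int m * b 1 + of_int n * b 2"
    using order_omega mem by auto
  have "of_int 1 + of_int 0 * omega D = of_int (k * p + l * r) + of_int (k * q + l * s) * omega D"
    "of_int 0 + of_int 1 * omega D = of_int (m * p + n * r) + of_int (m * q + n * s) * omega D"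
    unfolding kl mn pq by (simp_all add: algebra_simps)
  then have eqs: "1 = k * p + l * r" "0 = k * q + l * s" "0 = m * p + n * r" "1 = m * q + n * s"
    by (blast dest!: int_unique)+
  \<comment> \<open>Multiplicativity of the determinant for the two mutually inverse base change
    matrices.\<close>
  have "(k * n - l * m) * (p * s - q * r) = (k * p + l * r) * (m * q + n * s) - (k * q + l * s) * (m * p + n * r)"
    by (simp add: algebra_simps)
  then have "(k * n - l * m) * (p * s - q * r) = 1" using eqs by simp
  then have "(p * s - q * r)\<^sup>2 = 1"
    by (auto simp: zmult_eq_1_iff)
  have "b 1 * quad_conj D (b 2) - b 2 * quad_conj D (b 1) = of_int (p * s - q * r) * (omega' D - omega D)"
    unfolding pq by (simp add: algebra_simps)
  then have "of_int d = of_int ((p * s - q * r)\<^sup>2) * (omega' D - omega D)\<^sup>2"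
    unfolding d by (simp add: power_mult_distrib)
  also have "\<dots> = real D"
    using \<open>(p * s - q * r)\<^sup>2 = 1\<close> omega_diff_omega'[of D] by (simp add: power2_commute)
  finally show "d = int D" by linarith
qed

end

text \<open>Every D of \<open>quad_disc\<close> has such a decomposition by
  \<open>obtain_conductor\<close>, and \<open>conductor_D\<close> identifies f with the conductor
  occurring in the theorem.\<close>

locale quad_conductor = quad_disc D + F: fundamental_disc \<Delta> for D \<Delta> +
  fixes f :: nat
  assumes f_pos: "0 < f" and D_eq: "D = f\<^sup>2 * \<Delta>"
begin

lemma sqrt_D: "sqrt (real D) = real f * sqrt (real \<Delta>)"
  by (simp add: D_eq real_sqrt_mult)

lemma omega_shift:
  obtains c :: int where "omega D = of_int c + of_int (int f) * omega \<Delta>"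
    and "2 * c = (int f ^ 2 - int f) * int \<Delta>"
proof -
  have "even ((int f ^ 2 - int f) * int \<Delta>)" by (simp add: power2_eq_square)
  then obtain c where c: "(int f ^ 2 - int f) * int \<Delta> = 2 * c" by (elim evenE)
  then have "real_of_int ((int f ^ 2 - int f) * int \<Delta>) = 2 * of_int c" by simp
  then have "(real f ^ 2 - real f) * real \<Delta> = 2 * of_int c" by simp
  then have "omega D = of_int c + of_int (int f) * omega \<Delta>"
    unfolding omega_def sqrt_D by (simp add: D_eq field_simps)
  with c that show ?thesis by simp
qed

lemma field_D: "quad_field D = quad_field \<Delta>"
proof -
  have "(\<exists>a\<in>\<rat>. \<exists>b\<in>\<rat>. x = a + b * (real f * sqrt (real \<Delta>))) \<longleftrightarrow>
        (\<exists>a\<in>\<rat>. \<exists>b\<in>\<rat>. x = a + b * sqrt (real \<Delta>))" for x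
  proof (intro iffI; elim bexE)
    fix a b assume "a \<in> \<rat>" "b \<in> \<rat>" "x = a + b * (real f * sqrt (real \<Delta>))"
    then show "\<exists>a\<in>\<rat>. \<exists>b\<in>\<rat>. x = a + b * sqrt (real \<Delta>)"
      by (intro bexI[of _ a] bexI[of _ "b * real f"]) auto
  next
    fix a b assume "a \<in> \<rat>" "b \<in> \<rat>" "x = a + b * sqrt (real \<Delta>)"
    then show "\<exists>a\<in>\<rat>. \<exists>b\<in>\<rat>. x = a + b * (real f * sqrt (real \<Delta>))"
      using f_pos by (intro bexI[of _ a] bexI[of _ "b / real f"]) auto
  qed
  then show ?thesis
    by (simp add: quad_field_def sqrt_D)
qed

lemma conj_D: "quad_conj D = quad_conj \<Delta>"
proof -
  have "(\<exists>a\<in>\<rat>. \<exists>b\<in>\<rat>. x = a + b * (real f * sqrt (real \<Delta>)) \<and> y = a - b * (real f * sqrt (real \<Delta>))) \<longleftrightarrow>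
        (\<exists>a\<in>\<rat>. \<exists>b\<in>\<rat>. x = a + b * sqrt (real \<Delta>) \<and> y = a - b * sqrt (real \<Delta>))" for x y
  proof (intro iffI; elim bexE)
    fix a b assume "a \<in> \<rat>" "b \<in> \<rat>"
      "x = a + b * (real f * sqrt (real \<Delta>)) \<and> y = a - b * (real f * sqrt (real \<Delta>))"
    then show "\<exists>a\<in>\<rat>. \<exists>b\<in>\<rat>. x = a + b * sqrt (real \<Delta>) \<and> y = a - b * sqrt (real \<Delta>)"
      by (intro bexI[of _ a] bexI[of _ "b * real f"]) auto
  next
    fix a b assume "a \<in> \<rat>" "b \<in> \<rat>" "x = a + b * sqrt (real \<Delta>) \<and> y = a - b * sqrt (real \<Delta>)"
    then show "\<exists>a\<in>\<rat>. \<exists>b\<in>\<rat>. x = a + b * (real f * sqrt (real \<Delta>)) \<and> y = a - b * (real f * sqrt (real \<Delta>))"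
      using f_pos by (intro bexI[of _ a] bexI[of _ "b / real f"]) auto
  qed
  then show ?thesis
    unfolding quad_conj_def[abs_def] sqrt_D by simp
qed

lemma is_order_D: "is_order D = is_order \<Delta>"
  by (simp add: is_order_def[abs_def] field_D)

lemma max_order_D: "max_order D = quad_order \<Delta>"
  unfolding max_order_def is_order_D
  by (rule Greatest_equality) (auto simp: F.is_order_order dest: F.is_order_subset)

lemma conductor_D: "conductor D = f"
proof -
  have "order_disc D (quad_order \<Delta>) d \<longleftrightarrow> d = int \<Delta>" for d
    using F.order_disc_order_iff by (simp add: order_disc_def conj_D)
  moreover have "int D = int g ^ 2 * int \<Delta> \<longleftrightarrow> D = g\<^sup>2 * \<Delta>" for g
    by (simp flip: of_nat_power of_nat_mult)
  moreover have "g = f" if "f\<^sup>2 * \<Delta> = g\<^sup>2 * \<Delta>" for g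
    using that F.D_pos by simp
  ultimately show ?thesis
    unfolding conductor_def max_order_D using f_pos D_eq
    by (intro the_equality) auto
qed

text \<open>An integral (omega - c)/p lies in the maximal order, whose second basis vector occurs in
  omega with coefficient f; comparing coefficients shows that p divides f. It turns both a scalar
  action modulo p and a multiple root modulo \<open>p\<^sup>2\<close> into statements about the
  conductor.\<close>

lemma conductor_dvd:
  fixes p c :: int
  assumes p: "p > 0" and tr: "quad_trace D ((omega D - of_int c) / of_int p) \<in> \<int>"
    and nm: "(omega D - of_int c) / of_int p * quad_conj D ((omega D - of_int c) / of_int p) \<in> \<int>"
  shows "p dvd int f"
proof -
  have "(omega D - of_int c) / of_int p \<in> quad_field D"
    by (intro field_divide field_diff field_omega field_rat) auto
  then have "(omega D - of_int c) / of_int p \<in> quad_order \<Delta>"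
    using tr nm by (intro F.integral_in_order) (simp_all add: field_D conj_D quad_trace_def)
  then obtain m n where mn: "(omega D - of_int c) / of_int p = of_int m + of_int n * omega \<Delta>"
    by (rule quad_orderE)
  obtain e where e: "omega D = of_int e + of_int (int f) * omega \<Delta>"
    using omega_shift by metis
  have "of_int (e - c) + of_int (int f) * omega \<Delta> = of_int (p * m) + of_int (p * n) * omega \<Delta>"
    using mn e p by (simp add: field_simps)
  then have "int f = p * n" by (blast dest: F.int_unique)
  then show ?thesis by simp
qed

end

text \<open>Take f maximal such that D/f^2 is a discriminant. A further square factor q^2 of the
  quotient with discriminant cofactor would make f q admissible as well.\<close>

lemma (in quad_disc) obtain_conductor:
  obtains \<Delta> f where "quad_conductor D \<Delta> f"
proof -
  define S where "S = {f. 0 < f \<and> f\<^sup>2 dvd D \<and> discriminant (D div f\<^sup>2)}"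
  have "S \<subseteq> {..D}"
  proof
    fix f assume "f \<in> S"
    then have "f\<^sup>2 \<le> D" using D_pos by (auto simp: S_def intro: dvd_imp_le)
    then show "f \<in> {..D}" by (simp add: power2_nat_le_imp_le)
  qed
  then have fin: "finite S" by (rule finite_subset) simp
  have "1 \<in> S" using D_disc by (simp add: S_def)
  define f where "f = Max S"
  have f: "f \<in> S" and fmax: "\<And>g. g \<in> S \<Longrightarrow> g \<le> f"
    using fin \<open>1 \<in> S\<close> unfolding f_def by (auto intro: Max_in)
  define \<Delta> where "\<Delta> = D div f\<^sup>2"
  have D: "D = f\<^sup>2 * \<Delta>" using f by (simp add: S_def \<Delta>_def)
  have "quad_disc \<Delta>"
  proof
    show "0 < \<Delta>" using D D_pos by (cases \<Delta>) auto
    show "discriminant \<Delta>" using f by (simp add: S_def \<Delta>_def)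
    show "\<nexists>k. \<Delta> = k\<^sup>2" using D D_nonsquare by (metis power_mult_distrib)
  qed
  moreover have "q = 1" if q: "0 < q" "q\<^sup>2 dvd \<Delta>" "discriminant (\<Delta> div q\<^sup>2)" for q
  proof -
    have "(f * q)\<^sup>2 dvd D" using q by (simp add: D power_mult_distrib)
    moreover have "D div (f * q)\<^sup>2 = \<Delta> div q\<^sup>2"
      by (simp add: \<Delta>_def power_mult_distrib div_mult2_eq)
    ultimately have "f * q \<in> S" using q f by (simp add: S_def)
    then have "f * q \<le> f" by (rule fmax)
    then show "q = 1" using f q by (simp add: S_def)
  qed
  ultimately have "quad_conductor D \<Delta> f"
    using f D quad_disc_axioms
    by (simp add: quad_conductor_def fundamental_disc_def fundamental_disc_axioms_def
        quad_conductor_axioms_def S_def)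
  then show ?thesis by (rule that)
qed

section \<open>Decomposition of primes\<close>

definition omega_poly :: "nat \<Rightarrow> int \<Rightarrow> int" where
  "omega_poly D r = r\<^sup>2 - int D * r + omega_norm D"

text \<open>When p divides \<open>omega_poly D r\<close> this is the ideal <p, omega - r>, the
  kernel of the ring homomorphism from the order to Z/p that sends omega to r.\<close>

definition root_ideal :: "nat \<Rightarrow> int \<Rightarrow> int \<Rightarrow> real set" where
  "root_ideal D p r = {of_int m + of_int n * omega D | m n. p dvd m + r * n}"

context quad_disc
begin

abbreviation RO :: "real ring" where "RO \<equiv> real_ring (quad_order D)"

lemma primeideal_order_iff:
  "primeideal I RO \<longleftrightarrow> ideal I RO \<and> I \<noteq> quad_order D \<and>
    (\<forall>a\<in>quad_order D. \<forall>b\<in>quad_order D. a * b \<in> I \<longrightarrow> a \<in> I \<or> b \<in> I)"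
  using cring_order unfolding primeideal_def primeideal_axioms_def by auto

lemma mem_cgenideal_iff:
  "of_int m + of_int n * omega D \<in> cgenideal RO (of_int p) \<longleftrightarrow> p dvd m \<and> p dvd n"
proof
  assume "of_int m + of_int n * omega D \<in> cgenideal RO (of_int p)"
  then obtain k where k: "k \<in> quad_order D" "of_int m + of_int n * omega D = k * of_int p"
    by (auto simp: cgenideal_def)
  from k(1) obtain u v where "k = of_int u + of_int v * omega D" by (rule quad_orderE)
  with k(2) have "of_int m + of_int n * omega D = of_int (u * p) + of_int (v * p) * omega D"
    by (simp add: algebra_simps)
  then have "m = u * p \<and> n = v * p" by (rule int_unique)
  then show "p dvd m \<and> p dvd n" by simp
next
  assume "p dvd m \<and> p dvd n"
  then obtain u v where "m = p * u" "n = p * v" by (metis dvdE)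
  then have "of_int m + of_int n * omega D = (of_int u + of_int v * omega D) * of_int p"
    by (simp add: algebra_simps)
  then show "of_int m + of_int n * omega D \<in> cgenideal RO (of_int p)"
    by (auto simp: cgenideal_def)
qed

lemma ideal_cgenideal: "p \<in> quad_order D \<Longrightarrow> ideal (cgenideal RO p) RO"
  using cring.cgenideal_ideal[OF cring_order] by simp

lemma int_mult_form:
  "(of_int m + of_int n * omega D) * (of_int k + of_int l * omega D) =
    of_int (m * k - n * l * omega_norm D) + of_int (m * l + n * k + n * l * int D) * omega D"
  by (simp add: mult_omega_form)

lemma mem_root_ideal_iff:
  "of_int m + of_int n * omega D \<in> root_ideal D p r \<longleftrightarrow> p dvd m + r * n"
  unfolding root_ideal_def using int_unique by blast

lemma root_ideal_subset: "root_ideal D p r \<subseteq> quad_order D"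
  by (auto simp: root_ideal_def)

text \<open>Evaluation at r is multiplicative up to a multiple of \<open>omega_poly D r\<close>,
  hence multiplicative modulo p.\<close>

lemma root_ideal_mult_iff:
  assumes "p dvd omega_poly D r"
  shows "(of_int m + of_int n * omega D) * (of_int k + of_int l * omega D) \<in> root_ideal D p r \<longleftrightarrow>
    p dvd (m + r * n) * (k + r * l)"
proof -
  have "m * k - n * l * omega_norm D + r * (m * l + n * k + n * l * int D) =
      (m + r * n) * (k + r * l) - n * l * omega_poly D r"
    by (simp add: omega_poly_def algebra_simps power2_eq_square)
  then show ?thesis
    unfolding int_mult_form mem_root_ideal_iff using assms
    by (metis dvd_mult dvd_diff dvd_add_right_iff diff_add_cancel)
qed

lemma ideal_root_ideal:
  assumes "p dvd omega_poly D r"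
  shows "ideal (root_ideal D p r) RO"
  unfolding ideal_order_iff
proof (intro conjI ballI root_ideal_subset)
  show "0 \<in> root_ideal D p r" using mem_root_ideal_iff[of 0 0 p r] by simp
next
  fix x y assume "x \<in> root_ideal D p r" "y \<in> root_ideal D p r"
  then obtain m n k l where x: "x = of_int m + of_int n * omega D" "p dvd m + r * n"
    and y: "y = of_int k + of_int l * omega D" "p dvd k + r * l"
    by (auto simp: root_ideal_def)
  have "p dvd (m + k) + r * (n + l)"
    using dvd_add[OF x(2) y(2)] by (simp add: algebra_simps)
  then show "x + y \<in> root_ideal D p r"
    using mem_root_ideal_iff[of "m + k" "n + l" p r] x y by (simp add: algebra_simps)
next
  fix x y assume "x \<in> quad_order D" "y \<in> root_ideal D p r"
  then obtain m n k l where x: "x = of_int m + of_int n * omega D"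
    and y: "y = of_int k + of_int l * omega D" "p dvd k + r * l"
    by (auto simp: root_ideal_def quad_order_eq)
  show "x * y \<in> root_ideal D p r"
    unfolding x y using root_ideal_mult_iff[OF assms] y by simp
qed

text \<open>The quotient is the field Z/p; concretely, p divides a product of two values at r only
  if it divides one of them.\<close>

lemma primeideal_root_ideal:
  assumes "p dvd omega_poly D r" "prime p"
  shows "primeideal (root_ideal D p r) RO"
  unfolding primeideal_order_iff
proof (intro conjI ballI impI ideal_root_ideal assms(1))
  have "\<not> p dvd 1" using assms(2) not_prime_unit by blast
  then have "1 \<notin> root_ideal D p r"
    using mem_root_ideal_iff[of 1 0 p r] by simp
  then show "root_ideal D p r \<noteq> quad_order D" using order_1 by auto
next
  fix a b assume ab: "a \<in> quad_order D" "b \<in> quad_order D" "a * b \<in> root_ideal D p r"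
  then obtain m n k l where "a = of_int m + of_int n * omega D" "b = of_int k + of_int l * omega D"
    by (elim quad_orderE)
  with ab(3) show "a \<in> root_ideal D p r \<or> b \<in> root_ideal D p r"
    using root_ideal_mult_iff[OF assms(1)] assms(2)
    by (simp add: prime_dvd_mult_iff mem_root_ideal_iff)
qed

lemma ideal_prod_subset:
  assumes "\<And>a b. a \<in> P \<Longrightarrow> b \<in> Q \<Longrightarrow> a * b \<in> I" "\<And>a b. a \<in> I \<Longrightarrow> b \<in> I \<Longrightarrow> a + b \<in> I"
  shows "ideal_prod RO P Q \<subseteq> I"
proof
  fix x assume "x \<in> ideal_prod RO P Q"
  then show "x \<in> I"
    by (induction rule: ideal_prod.induct) (use assms in auto)
qed

lemma prod_in_ideal_prod: "a \<in> P \<Longrightarrow> b \<in> Q \<Longrightarrow> a * b \<in> ideal_prod RO P Q"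
  using ideal_prod.prod[of a P b Q RO] by simp

lemma ideal_ideal_prod: "ideal P RO \<Longrightarrow> ideal Q RO \<Longrightarrow> ideal (ideal_prod RO P Q) RO"
  using ring.ideal_prod_is_ideal[OF cring.axioms(1)[OF cring_order]] .

lemma cgenideal_subset_ideal: "ideal I RO \<Longrightarrow> p \<in> I \<Longrightarrow> cgenideal RO p \<subseteq> I"
  unfolding ideal_order_iff cgenideal_def by auto

text \<open>The two evaluations at the conjugate roots r and D - r differ by (2r - D) n, and 2r - D
  is invertible modulo p.\<close>

lemma root_ideals_inter:
  assumes "prime p" "\<not> p dvd 2 * r - int D"
    "of_int m + of_int n * omega D \<in> root_ideal D p r"
    "of_int m + of_int n * omega D \<in> root_ideal D p (int D - r)"
  shows "p dvd m \<and> p dvd n"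
proof -
  have 1: "p dvd m + r * n" "p dvd m + (int D - r) * n"
    using assms(3,4) by (simp_all only: mem_root_ideal_iff)
  then have "p dvd (m + r * n) - (m + (int D - r) * n)" by (rule dvd_diff)
  then have "p dvd (2 * r - int D) * n" by (simp add: algebra_simps)
  then have "p dvd n" using assms(1,2) by (simp add: prime_dvd_mult_iff)
  moreover from this 1(1) have "p dvd m" by (simp add: dvd_add_left_iff)
  ultimately show ?thesis by simp
qed

lemma omega_poly_conj: "omega_poly D (int D - r) = omega_poly D r"
  by (simp add: omega_poly_def algebra_simps power2_eq_square)

lemma omega_poly_disc: "(2 * r - int D)\<^sup>2 = int D + 4 * omega_poly D r"
  using four_omega_norm by (simp add: omega_poly_def algebra_simps power2_eq_square)

lemma omega_poly_diff: "omega_poly D s - omega_poly D r = (s - r) * (s + r - int D)"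
  by (simp add: omega_poly_def algebra_simps power2_eq_square)

text \<open>At a root, the square of the derivative 2r - D is congruent to D. Going through the
  square rather than solving for r treats p = 2 like the other primes.\<close>

lemma root_dvd_disc_iff:
  assumes "prime p" "p dvd omega_poly D r"
  shows "p dvd 2 * r - int D \<longleftrightarrow> p dvd int D"
proof -
  have "p dvd 2 * r - int D \<longleftrightarrow> p dvd (2 * r - int D)\<^sup>2"
    using assms(1) by (simp add: prime_dvd_power_iff)
  also have "\<dots> \<longleftrightarrow> p dvd int D"
    unfolding omega_poly_disc using assms(2) by (simp add: dvd_add_left_iff)
  finally show ?thesis .
qed

text \<open>A root r gives zero divisors omega - r and omega' - r modulo p. Without a root, the norm
  form \<open>N\<close> vanishes modulo p only at multiples of p, and as it is multiplicative this
  makes (p) prime.\<close>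

lemma primeideal_cgenideal_iff:
  assumes p: "prime (p::int)"
  shows "primeideal (cgenideal RO (of_int p)) RO \<longleftrightarrow> (\<forall>r. \<not> p dvd omega_poly D r)"
proof
  assume P: "primeideal (cgenideal RO (of_int p)) RO"
  show "\<forall>r. \<not> p dvd omega_poly D r"
  proof (intro allI notI)
    fix r assume r: "p dvd omega_poly D r"
    have a: "(of_int (- r) + of_int 1 * omega D) * (of_int (int D - r) + of_int (- 1) * omega D) =
        of_int (omega_poly D r) + of_int 0 * omega D"
      unfolding int_mult_form by (simp add: omega_poly_def algebra_simps power2_eq_square)
    have "(of_int (- r) + of_int 1 * omega D) * (of_int (int D - r) + of_int (- 1) * omega D)
        \<in> cgenideal RO (of_int p)"
      unfolding a mem_cgenideal_iff using r by simp
    then have "of_int (- r) + of_int 1 * omega D \<in> cgenideal RO (of_int p) \<or>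
        of_int (int D - r) + of_int (- 1) * omega D \<in> cgenideal RO (of_int p)"
      using P unfolding primeideal_order_iff by blast
    then have "p dvd 1"
      unfolding mem_cgenideal_iff by auto
    then show False using p not_prime_unit by blast
  qed
next
  assume noroot: "\<forall>r. \<not> p dvd omega_poly D r"
  define N where "N m n = m * m + m * n * int D + n * n * omega_norm D" for m n
  have N0: "p dvd m \<and> p dvd n" if "p dvd N m n" for m n
  proof -
    have "p dvd n"
    proof (rule ccontr)
      assume "\<not> p dvd n"
      then have "coprime n p" using p by (metis coprime_commute prime_imp_coprime)
      then obtain u where u: "[n * u = 1] (mod p)" by (metis cong_solve_coprime_int)
      \<comment> \<open>Dividing by n, with inverse u modulo p, turns a zero of the norm form into a
        root of \<open>omega_poly D\<close>.\<close>
      have "[N m n * (u * u) = (m * u) * (m * u) + (m * u) * int D * (n * u) + omega_norm D * ((n * u) * (n * u))] (mod p)"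
        by (simp add: N_def algebra_simps)
      also have "[(m * u) * (m * u) + (m * u) * int D * (n * u) + omega_norm D * ((n * u) * (n * u)) =
          (m * u) * (m * u) + (m * u) * int D * 1 + omega_norm D * (1 * 1)] (mod p)"
        by (intro cong_add cong_mult cong_refl u)
      also have "(m * u) * (m * u) + (m * u) * int D * 1 + omega_norm D * (1 * 1) = omega_poly D (- m * u)"
        by (simp add: omega_poly_def power2_eq_square)
      finally have "p dvd omega_poly D (- m * u)"
        using that by (meson cong_dvd_iff dvd_mult2)
      then show False using noroot by blast
    qed
    moreover from this have "p dvd m * m"
      using that unfolding N_def by (metis dvd_add_left_iff dvd_mult dvd_mult2)
    ultimately show ?thesis using p by (simp add: prime_dvd_mult_iff)
  qed
  have Nmult: "N (m * k - n * l * omega_norm D) (m * l + n * k + n * l * int D) = N m n * N k l" for m n k l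
    unfolding N_def by (simp add: algebra_simps)
  show "primeideal (cgenideal RO (of_int p)) RO"
    unfolding primeideal_order_iff
  proof (intro conjI ballI impI)
    show "ideal (cgenideal RO (of_int p)) RO" by (intro ideal_cgenideal order_int)
    have "\<not> p dvd 1" using p not_prime_unit by blast
    then have "1 \<notin> cgenideal RO (of_int p)" using mem_cgenideal_iff[of 1 0] by simp
    then show "cgenideal RO (of_int p) \<noteq> quad_order D" using order_1 by auto
  next
    fix a b assume "a \<in> quad_order D" "b \<in> quad_order D" and ab: "a * b \<in> cgenideal RO (of_int p)"
    then obtain m n k l where e: "a = of_int m + of_int n * omega D" "b = of_int k + of_int l * omega D"
      by (elim quad_orderE)
    have "p dvd m * k - n * l * omega_norm D \<and> p dvd m * l + n * k + n * l * int D"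
      using ab unfolding e int_mult_form mem_cgenideal_iff .
    then have "p dvd N (m * k - n * l * omega_norm D) (m * l + n * k + n * l * int D)"
      unfolding N_def by (simp add: dvd_add)
    then have "p dvd N m n \<or> p dvd N k l"
      unfolding Nmult using p by (simp add: prime_dvd_mult_iff)
    then show "a \<in> cgenideal RO (of_int p) \<or> b \<in> cgenideal RO (of_int p)"
      unfolding e mem_cgenideal_iff using N0 by blast
  qed
qed

text \<open>The hypothesis \<open>red\<close> says that (p) is a radical ideal. If (p) were the
  square of P, then P would be contained in (p), so (p) would be contained in (p^2).\<close>

lemma not_square_ideal:
  assumes p: "prime (p::int)" and P: "ideal P RO"
    and red: "\<And>a. a \<in> quad_order D \<Longrightarrow> a * a \<in> cgenideal RO (of_int p) \<Longrightarrow> a \<in> cgenideal RO (of_int p)"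
  shows "cgenideal RO (of_int p) \<noteq> ideal_prod RO P P"
proof
  assume e: "cgenideal RO (of_int p) = ideal_prod RO P P"
  have PO: "P \<subseteq> quad_order D" using P unfolding ideal_order_iff by blast
  have sub: "a \<in> cgenideal RO (of_int p)" if "a \<in> P" for a
    using red[of a] PO prod_in_ideal_prod[OF that that] that unfolding e by blast
  have "ideal_prod RO P P \<subseteq> cgenideal RO (of_int (p * p))"
  proof (rule ideal_prod_subset)
    fix a b assume "a \<in> P" "b \<in> P"
    then have "a \<in> cgenideal RO (of_int p)" "b \<in> cgenideal RO (of_int p)" using sub by auto
    then obtain k l where "k \<in> quad_order D" "a = k * of_int p" "l \<in> quad_order D" "b = l * of_int p"
      by (auto simp: cgenideal_def)
    then show "a * b \<in> cgenideal RO (of_int (p * p))"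
      using order_mult[of k l] by (auto simp: cgenideal_def mult_ac intro!: exI[of _ "k * l"])
  next
    show "a + b \<in> cgenideal RO (of_int (p * p))" if "a \<in> cgenideal RO (of_int (p * p))" "b \<in> cgenideal RO (of_int (p * p))" for a b
      using that ideal_cgenideal[of "of_int (p * p)"] order_int unfolding ideal_order_iff by blast
  qed
  moreover have "of_int p + of_int 0 * omega D \<in> cgenideal RO (of_int p)"
    unfolding mem_cgenideal_iff by simp
  ultimately have "of_int p + of_int 0 * omega D \<in> cgenideal RO (of_int (p * p))"
    using e by blast
  then have "p * p dvd p" unfolding mem_cgenideal_iff by simp
  then show False using p by (simp add: not_prime_unit)
qed

text \<open>An element outside the root ideal has a value at r that is invertible modulo p, so it
  generates 1 together with p and multiples of omega - r.\<close>

lemma root_ideal_maximal: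
  assumes "prime p" "primeideal P RO" "root_ideal D p r \<subseteq> P"
  shows "P = root_ideal D p r"
proof (rule ccontr)
  assume "P \<noteq> root_ideal D p r"
  then obtain x where x: "x \<in> P" "x \<notin> root_ideal D p r" using assms(3) by blast
  have P: "P \<subseteq> quad_order D" "\<And>x y. x \<in> P \<Longrightarrow> y \<in> P \<Longrightarrow> x + y \<in> P"
    "\<And>k x. k \<in> quad_order D \<Longrightarrow> x \<in> P \<Longrightarrow> k * x \<in> P" "P \<noteq> quad_order D"
    using assms(2) unfolding primeideal_order_iff ideal_order_iff by auto
  obtain m n where mn: "x = of_int m + of_int n * omega D" using P(1) x(1) by (blast elim: quad_orderE)
  have "coprime (m + r * n) p"
    using x(2) assms(1) unfolding mn mem_root_ideal_iff by (metis coprime_commute prime_imp_coprime)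
  then obtain u v where uv: "u * (m + r * n) + v * p = 1"
    by (metis bezout_int coprime_iff_gcd_eq_1)
  have "of_int (r * n) + of_int (- n) * omega D \<in> P"
    using assms(3) mem_root_ideal_iff[of "r * n" "- n" p r] by auto
  from P(2)[OF x(1) this] have "of_int (m + r * n) \<in> P"
    by (simp add: mn algebra_simps)
  from P(3)[OF order_int this] have "of_int u * of_int (m + r * n) \<in> P" .
  moreover have "of_int p + of_int 0 * omega D \<in> P"
    using assms(3) mem_root_ideal_iff[of p 0 p r] by auto
  from P(3)[OF order_int this] have "of_int v * of_int p \<in> P" by simp
  ultimately have "of_int u * of_int (m + r * n) + of_int v * of_int p \<in> P" by (rule P(2))
  moreover have "of_int u * of_int (m + r * n) + of_int v * of_int p = real_of_int (u * (m + r * n) + v * p)"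
    by simp
  ultimately have "1 \<in> P" using uv by (metis of_int_1)
  then have "quad_order D \<subseteq> P" using P(3) by (metis mult.right_neutral subsetI)
  then show False using P by blast
qed

text \<open>The product of the two conjugate ideals contains p^2 and p(2r - D), and Bezout for p and
  2r - D gives p. The other inclusion is \<open>root_ideals_inter\<close>.\<close>

lemma splitting_prod:
  assumes p: "prime p" and r: "p dvd omega_poly D r" "\<not> p dvd 2 * r - int D"
  shows "cgenideal RO (of_int p) = ideal_prod RO (root_ideal D p r) (root_ideal D p (int D - r))"
proof
  have r': "p dvd omega_poly D (int D - r)" using r by (simp add: omega_poly_conj)
  have I: "ideal (root_ideal D p r) RO" "ideal (root_ideal D p (int D - r)) RO"
    using r(1) r' by (auto intro: ideal_root_ideal)
  show "ideal_prod RO (root_ideal D p r) (root_ideal D p (int D - r)) \<subseteq> cgenideal RO (of_int p)"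
  proof (rule ideal_prod_subset)
    fix a b assume ab: "a \<in> root_ideal D p r" "b \<in> root_ideal D p (int D - r)"
    then have "a * b \<in> root_ideal D p r \<and> a * b \<in> root_ideal D p (int D - r)"
      using I root_ideal_subset unfolding ideal_order_iff by (metis mult.commute subsetD)
    moreover have "a * b \<in> quad_order D" using ab root_ideal_subset order_mult by blast
    ultimately show "a * b \<in> cgenideal RO (of_int p)"
      using root_ideals_inter[OF p r(2)] by (elim quad_orderE) (auto simp: mem_cgenideal_iff)
  next
    show "a + b \<in> cgenideal RO (of_int p)" if "a \<in> cgenideal RO (of_int p)" "b \<in> cgenideal RO (of_int p)" for a b
      using that ideal_cgenideal[of "of_int p"] order_int unfolding ideal_order_iff by blast
  qed
  let ?I = "ideal_prod RO (root_ideal D p r) (root_ideal D p (int D - r))"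
  have PQ: "\<And>x y. x \<in> ?I \<Longrightarrow> y \<in> ?I \<Longrightarrow> x + y \<in> ?I" "\<And>k x. k \<in> quad_order D \<Longrightarrow> x \<in> ?I \<Longrightarrow> k * x \<in> ?I"
    using ideal_ideal_prod[OF I] unfolding ideal_order_iff by auto
  have "coprime (2 * r - int D) p"
    using r(2) p by (metis coprime_commute prime_imp_coprime)
  then obtain u v where uv: "u * (2 * r - int D) + v * p = 1"
    by (metis bezout_int coprime_iff_gcd_eq_1)
  have mem: "of_int p \<in> root_ideal D p r" "of_int p \<in> root_ideal D p (int D - r)"
    "of_int (- r) + of_int 1 * omega D \<in> root_ideal D p r"
    "of_int (r - int D) + of_int 1 * omega D \<in> root_ideal D p (int D - r)"
    using mem_root_ideal_iff[of p 0] mem_root_ideal_iff[of "- r" 1] mem_root_ideal_iff[of "r - int D" 1]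
    by (auto simp: algebra_simps)
  have in1: "of_int p * of_int p \<in> ?I" "of_int p * (of_int (r - int D) + of_int 1 * omega D) \<in> ?I"
    "(of_int (- r) + of_int 1 * omega D) * of_int p \<in> ?I"
    by (intro prod_in_ideal_prod mem)+
  \<comment> \<open>Subtracting p(omega - r) from p(omega - (D - r)) leaves p(2r - D).\<close>
  have "of_int v * (of_int p * of_int p) + (of_int u * (of_int p * (of_int (r - int D) + of_int 1 * omega D))
      + of_int (- u) * ((of_int (- r) + of_int 1 * omega D) * of_int p)) \<in> ?I"
    by (rule PQ(1)[OF PQ(2)[OF order_int in1(1)] PQ(1)[OF PQ(2)[OF order_int in1(2)] PQ(2)[OF order_int in1(3)]]])
  also have "of_int v * (of_int p * of_int p) + (of_int u * (of_int p * (of_int (r - int D) + of_int 1 * omega D))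
      + of_int (- u) * ((of_int (- r) + of_int 1 * omega D) * of_int p)) = of_int p * of_int (u * (2 * r - int D) + v * p)"
    by (simp add: algebra_simps)
  finally have "of_int p \<in> ?I" using uv by simp
  then show "cgenideal RO (of_int p) \<subseteq> ?I"
    by (intro cgenideal_subset_ideal ideal_ideal_prod I)
qed

text \<open>If the prime ideal (p) equals PQ, one factor lies in (p). If P does, every element of PQ
  is p times an element of Q, and p itself being of this form puts 1 into Q.\<close>

lemma inert_not_prod:
  assumes p: "prime (p::int)" and PP: "primeideal (cgenideal RO (of_int p)) RO"
    and P: "primeideal P RO" and Q: "primeideal Q RO"
  shows "cgenideal RO (of_int p) \<noteq> ideal_prod RO P Q"
proof
  assume e: "cgenideal RO (of_int p) = ideal_prod RO P Q"
  have *: False if P: "P \<subseteq> cgenideal RO (of_int p)" and Q: "primeideal Q RO"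
    and sub: "\<And>a b. a \<in> P \<Longrightarrow> b \<in> Q \<Longrightarrow> a * b \<in> A" "of_int p \<in> ideal_prod RO P Q" for A P Q
  proof -
    have Q': "Q \<subseteq> quad_order D" "\<And>x y. x \<in> Q \<Longrightarrow> y \<in> Q \<Longrightarrow> x + y \<in> Q"
      "\<And>k x. k \<in> quad_order D \<Longrightarrow> x \<in> Q \<Longrightarrow> k * x \<in> Q" "Q \<noteq> quad_order D"
      using Q unfolding primeideal_order_iff ideal_order_iff by auto
    have "ideal_prod RO P Q \<subseteq> {of_int p * q | q. q \<in> Q}"
    proof (rule ideal_prod_subset)
      fix a b assume "a \<in> P" "b \<in> Q"
      then obtain k where "k \<in> quad_order D" "a = k * of_int p" using P by (auto simp: cgenideal_def)
      then show "a * b \<in> {of_int p * q | q. q \<in> Q}"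
        using Q'(3)[OF _ \<open>b \<in> Q\<close>] by (auto simp: mult_ac intro!: exI[of _ "k * b"])
    next
      fix a b assume "a \<in> {of_int p * q | q. q \<in> Q}" "b \<in> {of_int p * q | q. q \<in> Q}"
      then show "a + b \<in> {of_int p * q | q. q \<in> Q}" using Q'(2) by (auto simp flip: distrib_left)
    qed
    then obtain q where "q \<in> Q" "of_int p = of_int p * q" using sub by auto
    then have "1 \<in> Q" using p by auto
    then have "quad_order D \<subseteq> Q" using Q'(3) by (metis mult.right_neutral subsetI)
    then show False using Q' by blast
  qed
  have PO: "P \<subseteq> quad_order D" "Q \<subseteq> quad_order D"
    using P Q unfolding primeideal_order_iff ideal_order_iff by auto
  have pm: "of_int p \<in> ideal_prod RO P Q"
    using mem_cgenideal_iff[of p 0 p] by (simp add: e)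
  show False
  proof (cases "P \<subseteq> cgenideal RO (of_int p)")
    case True
    then show False using *[of P Q UNIV] Q pm by blast
  next
    case False
    then obtain a where a: "a \<in> P" "a \<notin> cgenideal RO (of_int p)" by blast
    have "Q \<subseteq> cgenideal RO (of_int p)"
    proof
      fix b assume b: "b \<in> Q"
      have "a * b \<in> cgenideal RO (of_int p)" unfolding e using a b by (intro prod_in_ideal_prod)
      then show "b \<in> cgenideal RO (of_int p)"
        using PP a b PO unfolding primeideal_order_iff by blast
    qed
    moreover have "ideal_prod RO P Q \<subseteq> ideal_prod RO Q P"
      by (rule ideal_prod_subset) (metis mult.commute prod_in_ideal_prod, use ideal_prod.sum[of _ RO] in auto)
    ultimately show False using *[of Q P UNIV] P pm by blast
  qed
qed

end

context fundamental_disc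
begin

text \<open>At a double root the square of the root ideal lies in (p) by a computation with
  coordinates. It contains p^2 and \<open>omega_poly D r\<close> = p t; fundamentality gives that p
  does not divide t, so Bezout yields p.\<close>

lemma ramified_prod:
  assumes p: "prime p" and r: "p dvd omega_poly D r" "p dvd 2 * r - int D"
  shows "cgenideal RO (of_int p) = ideal_prod RO (root_ideal D p r) (root_ideal D p r)"
proof
  have I: "ideal (root_ideal D p r) RO" using r(1) by (rule ideal_root_ideal)
  show "ideal_prod RO (root_ideal D p r) (root_ideal D p r) \<subseteq> cgenideal RO (of_int p)"
  proof (rule ideal_prod_subset)
    fix a b assume "a \<in> root_ideal D p r" "b \<in> root_ideal D p r"
    then obtain m n k l where x: "a = of_int m + of_int n * omega D" "p dvd m + r * n"
      and y: "b = of_int k + of_int l * omega D" "p dvd k + r * l"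
      by (auto simp: root_ideal_def)
    obtain e where e: "m = p * e - r * n"
      using x(2) by (metis add_diff_cancel_right' dvdE)
    obtain g where g: "k = p * g - r * l"
      using y(2) by (metis add_diff_cancel_right' dvdE)
    obtain h where h: "omega_norm D = p * h - r\<^sup>2 + int D * r"
    proof -
      from r(1) obtain h where "omega_poly D r = p * h" by (elim dvdE)
      then have "omega_norm D = p * h - r\<^sup>2 + int D * r" by (simp add: omega_poly_def)
      with that show thesis .
    qed
    obtain t where t: "int D = 2 * r - p * t"
    proof -
      from r(2) obtain t where "2 * r - int D = p * t" by (elim dvdE)
      then have "int D = 2 * r - p * t" by simp
      with that show thesis .
    qed
    have "m * k - n * l * omega_norm D = p * (e * (p * g - r * l) - r * n * g - n * l * (h - r * t))"
      unfolding e g h t by (simp add: algebra_simps power2_eq_square)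
    moreover have "m * l + n * k + n * l * int D = p * (e * l + n * g - n * l * t)"
      unfolding e g t by (simp add: algebra_simps)
    ultimately show "a * b \<in> cgenideal RO (of_int p)"
      unfolding x y int_mult_form mem_cgenideal_iff by (metis dvd_triv_left)
  next
    show "a + b \<in> cgenideal RO (of_int p)" if "a \<in> cgenideal RO (of_int p)" "b \<in> cgenideal RO (of_int p)" for a b
      using that ideal_cgenideal[of "of_int p"] order_int unfolding ideal_order_iff by blast
  qed
  let ?I = "ideal_prod RO (root_ideal D p r) (root_ideal D p r)"
  have PQ: "\<And>x y. x \<in> ?I \<Longrightarrow> y \<in> ?I \<Longrightarrow> x + y \<in> ?I" "\<And>k x. k \<in> quad_order D \<Longrightarrow> x \<in> ?I \<Longrightarrow> k * x \<in> ?I"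
    using ideal_ideal_prod[OF I I] unfolding ideal_order_iff by auto
  obtain s where s: "2 * r - int D = p * s" using r(2) by auto
  obtain t where t: "omega_poly D r = p * t" using r(1) by auto
  have "\<not> p dvd t"
  proof
    assume "p dvd t"
    then obtain h where h: "t = p * h" by auto
    \<comment> \<open>If p divided t, removing p^2 from D would leave s^2 - 4h, a positive number
      that is 0 or 1 modulo 4 and hence a discriminant.\<close>
    have "int D = p\<^sup>2 * (s\<^sup>2 - 4 * h)"
      using omega_poly_disc[of r] unfolding s t h by (simp add: power2_eq_square algebra_simps)
    moreover from this have pos: "s\<^sup>2 - 4 * h > 0"
      using D_pos by (metis of_nat_0_less_iff zero_less_mult_iff zero_le_power2 not_less)
    moreover have "(s\<^sup>2 - 4 * h) mod 4 = 0 \<or> (s\<^sup>2 - 4 * h) mod 4 = 1"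
    proof -
      have "even s \<or> odd s" by simp
      then obtain k where "s = 2 * k \<or> s = 2 * k + 1" by (metis evenE oddE)
      then have "s\<^sup>2 - 4 * h = 4 * (k * k - h) \<or> s\<^sup>2 - 4 * h = 4 * (k * k + k - h) + 1"
        by (auto simp: power2_eq_square algebra_simps)
      then obtain y where "s\<^sup>2 - 4 * h = 4 * y \<or> s\<^sup>2 - 4 * h = 4 * y + 1" by blast
      then show ?thesis by (elim disjE) (simp_all only:, simp_all)
    qed
    moreover obtain q where q: "p = int q" using p prime_ge_0_int nonneg_int_cases by metis
    moreover obtain n where n: "s\<^sup>2 - 4 * h = int n" using pos by (metis less_imp_le nonneg_int_cases)
    ultimately have "int D = int (q\<^sup>2 * n)" "n mod 4 = 0 \<or> n mod 4 = 1" by (simp, presburger)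
    then have "D = q\<^sup>2 * n" "discriminant n" by (simp_all only: of_nat_eq_iff discriminant_def)
    then have "q = 1"
      using p prime_gt_0_int[of p] fundamental[of q] q by simp
    then show False using p prime_gt_1_int[of p] q by simp
  qed
  then have "coprime t p" using p by (metis coprime_commute prime_imp_coprime)
  then obtain u v where uv: "u * t + v * p = 1"
    by (metis bezout_int coprime_iff_gcd_eq_1)
  have mem: "of_int p \<in> root_ideal D p r" "of_int (- r) + of_int 1 * omega D \<in> root_ideal D p r"
    using mem_root_ideal_iff[of p 0] mem_root_ideal_iff[of "- r" 1] by auto
  have in1: "of_int p * of_int p \<in> ?I" "of_int p * (of_int (- r) + of_int 1 * omega D) \<in> ?I"
    "(of_int (- r) + of_int 1 * omega D) * (of_int (- r) + of_int 1 * omega D) \<in> ?I"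
    by (intro prod_in_ideal_prod mem)+
  \<comment> \<open>Since p s = 2r - D, this combination is (omega - r)(omega' - r), the integer
    \<open>omega_poly D r\<close>.\<close>
  have "of_int (- s) * (of_int p * (of_int (- r) + of_int 1 * omega D)) +
      of_int (- 1) * ((of_int (- r) + of_int 1 * omega D) * (of_int (- r) + of_int 1 * omega D)) \<in> ?I"
    by (rule PQ(1)[OF PQ(2)[OF order_int in1(2)] PQ(2)[OF order_int in1(3)]])
  also have "of_int (- s) * (of_int p * (of_int (- r) + of_int 1 * omega D)) +
      of_int (- 1) * ((of_int (- r) + of_int 1 * omega D) * (of_int (- r) + of_int 1 * omega D)) =
      real_of_int (omega_poly D r)"
  proof -
    have "real_of_int s * of_int p = 2 * of_int r - real D"
      using s by (metis of_int_diff of_int_mult of_int_numeral of_int_of_nat_eq mult.commute)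
    moreover have "of_int (- s) * (of_int p * (of_int (- r) + of_int 1 * omega D)) =
        - (real_of_int s * of_int p) * (omega D - of_int r)"
      by simp
    ultimately have "of_int (- s) * (of_int p * (of_int (- r) + of_int 1 * omega D)) =
        - (2 * of_int r - real D) * (omega D - of_int r)"
      by metis
    then show ?thesis
      by (simp add: omega_poly_def algebra_simps power2_eq_square omega_sq)
  qed
  finally have in2: "real_of_int (omega_poly D r) \<in> ?I" .
  have "of_int u * of_int (omega_poly D r) + of_int v * (of_int p * of_int p) \<in> ?I"
    by (rule PQ(1)[OF PQ(2)[OF order_int in2] PQ(2)[OF order_int in1(1)]])
  also have "of_int u * of_int (omega_poly D r) + of_int v * (of_int p * of_int p) = real_of_int (p * (u * t + v * p))"
    unfolding t by (simp add: algebra_simps)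
  finally have "of_int p \<in> ?I" using uv by simp
  then show "cgenideal RO (of_int p) \<subseteq> ?I"
    by (intro cgenideal_subset_ideal ideal_ideal_prod I)
qed

text \<open>If there is no root, (p) is prime; if the two roots are distinct, it is the intersection
  of two primes. In both cases it is radical, and \<open>not_square_ideal\<close> excludes a
  square.\<close>

lemma ex_square_ideal_iff:
  assumes p: "prime (p::int)"
  shows "(\<exists>P. primeideal P RO \<and> cgenideal RO (of_int p) = ideal_prod RO P P) \<longleftrightarrow>
    (\<exists>r. p dvd omega_poly D r) \<and> p dvd int D" (is "?L \<longleftrightarrow> ?R")
proof
  assume ?R
  then obtain r where r: "p dvd omega_poly D r" "p dvd int D" by auto
  then have "p dvd 2 * r - int D" using root_dvd_disc_iff[OF p] by blast
  then show ?L using ramified_prod[OF p r(1)] primeideal_root_ideal[OF r(1) p] by blast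
next
  assume ?L
  then obtain P where P: "ideal P RO" "cgenideal RO (of_int p) = ideal_prod RO P P"
    by (auto simp: primeideal_order_iff)
  show ?R
  proof (rule ccontr)
    assume nR: "\<not> ?R"
    have "a \<in> cgenideal RO (of_int p)" if a: "a \<in> quad_order D" "a * a \<in> cgenideal RO (of_int p)" for a
    proof (cases "\<exists>r. p dvd omega_poly D r")
      case False
      then have "primeideal (cgenideal RO (of_int p)) RO" using primeideal_cgenideal_iff[OF p] by blast
      then show ?thesis using a unfolding primeideal_order_iff by blast
    next
      case True
      then obtain r where r: "p dvd omega_poly D r" by auto
      then have nr: "\<not> p dvd 2 * r - int D" using root_dvd_disc_iff[OF p r] nR by blast
      have r': "p dvd omega_poly D (int D - r)" using r by (simp add: omega_poly_conj)
      have pp: "primeideal (root_ideal D p r) RO" "primeideal (root_ideal D p (int D - r)) RO"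
        using r r' p by (auto intro: primeideal_root_ideal)
      have "of_int p \<in> root_ideal D p r" "of_int p \<in> root_ideal D p (int D - r)"
        using mem_root_ideal_iff[of p 0] by auto
      then have "a * a \<in> root_ideal D p r" "a * a \<in> root_ideal D p (int D - r)"
        using cgenideal_subset_ideal[OF ideal_root_ideal] r r' a(2) by blast+
      then have "a \<in> root_ideal D p r" "a \<in> root_ideal D p (int D - r)"
        using pp a(1) unfolding primeideal_order_iff by blast+
      then show ?thesis
        using root_ideals_inter[OF p nr] a(1) by (elim quad_orderE) (auto simp: mem_cgenideal_iff)
    qed
    from not_square_ideal[OF p P(1) this] P(2) show False by blast
  qed
qed

text \<open>For the converse, \<open>inert_not_prod\<close> supplies a root. If p divided D, then
  (p) would be the square of the root ideal, so both primes would contain that maximal ideal and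
  coincide.\<close>

lemma ex_split_ideals_iff:
  assumes p: "prime (p::int)"
  shows "(\<exists>P Q. primeideal P RO \<and> primeideal Q RO \<and> P \<noteq> Q \<and> cgenideal RO (of_int p) = ideal_prod RO P Q) \<longleftrightarrow>
    (\<exists>r. p dvd omega_poly D r) \<and> \<not> p dvd int D" (is "?L \<longleftrightarrow> ?R")
proof
  assume ?R
  then obtain r where r: "p dvd omega_poly D r" "\<not> p dvd int D" by auto
  then have nr: "\<not> p dvd 2 * r - int D" using root_dvd_disc_iff[OF p] by blast
  have r': "p dvd omega_poly D (int D - r)" using r by (simp add: omega_poly_conj)
  have "of_int (- r) + of_int 1 * omega D \<in> root_ideal D p r"
    "of_int (- r) + of_int 1 * omega D \<notin> root_ideal D p (int D - r)"
    using nr unfolding mem_root_ideal_iff by (auto simp: algebra_simps dvd_diff_commute)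
  then have "root_ideal D p r \<noteq> root_ideal D p (int D - r)" by blast
  then show ?L
    using splitting_prod[OF p r(1) nr] primeideal_root_ideal[OF r(1) p] primeideal_root_ideal[OF r' p] by blast
next
  assume ?L
  then obtain P Q where PQ: "primeideal P RO" "primeideal Q RO" "P \<noteq> Q"
    "cgenideal RO (of_int p) = ideal_prod RO P Q" by blast
  show ?R
  proof (intro conjI notI)
    show "\<exists>r. p dvd omega_poly D r"
      using inert_not_prod[OF p _ PQ(1,2)] PQ(4) primeideal_cgenideal_iff[OF p] by blast
    then obtain r where r: "p dvd omega_poly D r" by blast
    assume "p dvd int D"
    then have "p dvd 2 * r - int D" using root_dvd_disc_iff[OF p r] by blast
    note e = ramified_prod[OF p r this]
    have I: "ideal P RO" "ideal Q RO" using PQ by (auto simp: primeideal_order_iff)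
    have sub: "ideal_prod RO P Q \<subseteq> P \<inter> Q"
      using ring.ideal_prod_inter[OF cring.axioms(1)[OF cring_order] I] .
    have "root_ideal D p r \<subseteq> P" "root_ideal D p r \<subseteq> Q"
    proof -
      have "a \<in> P \<and> a \<in> Q" if a: "a \<in> root_ideal D p r" for a
      proof -
        have "a * a \<in> P \<inter> Q" using prod_in_ideal_prod[OF a a] e PQ(4) sub by auto
        then show ?thesis
          using PQ(1,2) a root_ideal_subset unfolding primeideal_order_iff by blast
      qed
      then show "root_ideal D p r \<subseteq> P" "root_ideal D p r \<subseteq> Q" by auto
    qed
    then show False using root_ideal_maximal[OF p] PQ by blast
  qed
qed

end

context quad_conductor
begin

text \<open>\<open>omega_poly D r\<close> is the norm of omega - r. Substituting c + f times the
  generator of the maximal order for omega, and c + f x for r, takes a factor f out of the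
  difference, so f^2 out of the norm.\<close>

lemma omega_poly_shift:
  obtains c :: int where "\<And>x. omega_poly D (c + int f * x) = int f ^ 2 * omega_poly \<Delta> x"
proof -
  obtain c where c: "2 * c = (int f ^ 2 - int f) * int \<Delta>" using omega_shift by metis
  have "omega_poly D (c + int f * x) = int f ^ 2 * omega_poly \<Delta> x" for x
  proof -
    have "4 * omega_poly D (c + int f * x) = (2 * c + 2 * int f * x - int D)\<^sup>2 - int D"
      using omega_poly_disc[of "c + int f * x"] by (simp add: algebra_simps)
    also have "\<dots> = int f ^ 2 * ((2 * x - int \<Delta>)\<^sup>2 - int \<Delta>)"
      unfolding c D_eq by (simp add: power2_eq_square algebra_simps)
    also have "\<dots> = int f ^ 2 * (4 * omega_poly \<Delta> x)"
      using F.omega_poly_disc[of x] by simp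
    finally show ?thesis by simp
  qed
  then show ?thesis by (rule that)
qed

text \<open>The substitution x -> c + f x is a bijection modulo p because f is invertible
  there.\<close>

lemma ex_root_conductor_iff:
  assumes p: "prime p" "coprime p (int f)"
  shows "(\<exists>r. p dvd omega_poly \<Delta> r) \<longleftrightarrow> (\<exists>r. p dvd omega_poly D r)"
proof -
  obtain c where c: "\<And>x. omega_poly D (c + int f * x) = int f ^ 2 * omega_poly \<Delta> x"
    using omega_poly_shift by blast
  have cp: "p dvd omega_poly D (c + int f * x) \<longleftrightarrow> p dvd omega_poly \<Delta> x" for x
    unfolding c using p(2) by (simp add: coprime_dvd_mult_right_iff)
  have "\<exists>x. p dvd omega_poly \<Delta> x" if r: "p dvd omega_poly D r" for r
  proof -
    obtain u where u: "[int f * u = 1] (mod p)"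
      using p(2) by (metis coprime_commute cong_solve_coprime_int)
    have "[int f * u * (r - c) = 1 * (r - c)] (mod p)" using u by (rule cong_scalar_right)
    then have "p dvd int f * u * (r - c) - (r - c)" by (simp add: cong_iff_dvd_diff)
    then have "p dvd c + int f * (u * (r - c)) - r"
      by (simp add: algebra_simps)
    then have "p dvd (c + int f * (u * (r - c)) - r) * (c + int f * (u * (r - c)) + r - int D)"
      by simp
    then have "p dvd omega_poly D (c + int f * (u * (r - c))) - omega_poly D r"
      unfolding omega_poly_diff .
    then have "p dvd omega_poly D (c + int f * (u * (r - c)))"
      using r by (metis dvd_add diff_add_cancel)
    then show ?thesis using cp by blast
  qed
  then show ?thesis using cp by blast
qed

text \<open>The notions refer to the maximal order, whereas ideals of given type involve D; away
  from the conductor both are governed by the roots of the same polynomial.\<close>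

lemma prime_types:
  assumes p: "prime p" "coprime p f"
  shows "inert D p \<longleftrightarrow> (\<forall>r. \<not> int p dvd omega_poly D r)"
    "ramified D p \<longleftrightarrow> (\<exists>r. int p dvd omega_poly D r) \<and> p dvd D"
    "splitting D p \<longleftrightarrow> (\<exists>r. int p dvd omega_poly D r) \<and> \<not> p dvd D"
proof -
  have p': "prime (int p)" "coprime (int p) (int f)" using p by simp_all
  have nr: "(\<forall>r. \<not> int p dvd omega_poly \<Delta> r) \<longleftrightarrow> (\<forall>r. \<not> int p dvd omega_poly D r)"
    using ex_root_conductor_iff[OF p'] by blast
  have "int p dvd int \<Delta> \<longleftrightarrow> p dvd D"
    using p(2) by (simp add: D_eq coprime_dvd_mult_right_iff)
  then show "inert D p \<longleftrightarrow> (\<forall>r. \<not> int p dvd omega_poly D r)"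
    "ramified D p \<longleftrightarrow> (\<exists>r. int p dvd omega_poly D r) \<and> p dvd D"
    "splitting D p \<longleftrightarrow> (\<exists>r. int p dvd omega_poly D r) \<and> \<not> p dvd D"
    unfolding inert_def ramified_def splitting_def Let_def max_order_D
    using F.primeideal_cgenideal_iff[OF p'(1)] F.ex_square_ideal_iff[OF p'(1)]
      F.ex_split_ideals_iff[OF p'(1)] ex_root_conductor_iff[OF p'] nr by simp_all
qed

end

section \<open>Roots of the minimal polynomial of \<open>\<omega>\<close> modulo \<open>n\<close>\<close>

definition omega_roots :: "nat \<Rightarrow> nat \<Rightarrow> int set" where
  "omega_roots D n = {r \<in> {0..<int n}. int n dvd omega_poly D r}"

context quad_disc
begin

lemma omega_poly_cong: "[r = s] (mod n) \<Longrightarrow> n dvd omega_poly D r \<longleftrightarrow> n dvd omega_poly D s"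
proof -
  assume "[r = s] (mod n)"
  then have "[omega_poly D r = omega_poly D s] (mod n)"
    unfolding omega_poly_def by (intro cong_add cong_diff cong_mult cong_pow cong_refl)
  then show ?thesis by (rule cong_dvd_iff)
qed

lemma finite_omega_roots [simp]: "finite (omega_roots D n)"
  unfolding omega_roots_def by (rule finite_subset[of _ "{0..<int n}"]) auto

lemma mod_in_omega_roots_iff: "0 < n \<Longrightarrow> r mod int n \<in> omega_roots D n \<longleftrightarrow> int n dvd omega_poly D r"
  using omega_poly_cong[of "r mod int n" r "int n"] by (simp add: omega_roots_def cong_def)

lemma card_omega_roots_mult:
  assumes "coprime m n" "0 < m" "0 < n"
  shows "card (omega_roots D (m * n)) = card (omega_roots D m) * card (omega_roots D n)"
proof -
  have cop: "coprime (int m) (int n)" using assms(1) by simp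
  have "bij_betw (\<lambda>r. (r mod int m, r mod int n)) (omega_roots D (m * n)) (omega_roots D m \<times> omega_roots D n)"
  proof (rule bij_betw_imageI)
    show "inj_on (\<lambda>r. (r mod int m, r mod int n)) (omega_roots D (m * n))"
    proof (rule inj_onI)
      fix r s assume rs: "r \<in> omega_roots D (m * n)" "s \<in> omega_roots D (m * n)"
        "(r mod int m, r mod int n) = (s mod int m, s mod int n)"
      then have "[r = s] (mod int m)" "[r = s] (mod int n)" by (simp_all add: cong_def)
      then have "[r = s] (mod (int m * int n))" using cop by (intro coprime_cong_mult)
      then show "r = s"
        using rs by (intro cong_less_imp_eq_int[of r "int m * int n" s]) (auto simp: omega_roots_def)
    qed
    show "(\<lambda>r. (r mod int m, r mod int n)) ` omega_roots D (m * n) = omega_roots D m \<times> omega_roots D n"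
    proof (intro equalityI subsetI)
      fix x assume "x \<in> (\<lambda>r. (r mod int m, r mod int n)) ` omega_roots D (m * n)"
      then obtain r where "x = (r mod int m, r mod int n)" "int m * int n dvd omega_poly D r"
        by (auto simp: omega_roots_def)
      then show "x \<in> omega_roots D m \<times> omega_roots D n"
        using assms by (auto simp: mod_in_omega_roots_iff intro: dvd_mult_left dvd_mult_right)
    next
      fix x assume "x \<in> omega_roots D m \<times> omega_roots D n"
      then obtain s t where st: "x = (s, t)" "s \<in> omega_roots D m" "t \<in> omega_roots D n" by auto
      obtain r where r: "[r = s] (mod int m)" "[r = t] (mod int n)"
        using binary_chinese_remainder_int[OF cop] by blast
      have "int m dvd omega_poly D r" "int n dvd omega_poly D r"
        using omega_poly_cong r st by (auto simp: omega_roots_def)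
      then have "int (m * n) dvd omega_poly D r" using cop by (simp add: divides_mult)
      then have "r mod int (m * n) \<in> omega_roots D (m * n)"
        using assms by (subst mod_in_omega_roots_iff) auto
      moreover have "(r mod int (m * n)) mod int m = s" "(r mod int (m * n)) mod int n = t"
        using r st by (auto simp: mod_mod_cancel cong_def omega_roots_def)
      ultimately show "x \<in> (\<lambda>r. (r mod int m, r mod int n)) ` omega_roots D (m * n)"
        using st(1) by (intro image_eqI[of _ _ "r mod int (m * n)"]) auto
    qed
  qed
  then show ?thesis by (simp add: bij_betw_same_card card_cartesian_product)
qed

text \<open>Newton iteration: the derivative 2s - D stays invertible modulo p because p does not
  divide D.\<close>

lemma hensel_root:
  assumes p: "prime p" and r: "p dvd omega_poly D r" and D: "\<not> p dvd int D"
  shows "\<exists>s. p ^ Suc k dvd omega_poly D s"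
proof (induction k)
  case 0
  then show ?case using r by auto
next
  case (Suc k)
  then obtain s where s: "p ^ Suc k dvd omega_poly D s" by auto
  then obtain e where e: "omega_poly D s = p ^ Suc k * e" by auto
  have "p dvd omega_poly D s" using s by (metis dvd_mult_left power_Suc)
  then have "\<not> p dvd 2 * s - int D" using root_dvd_disc_iff[OF p] D by blast
  then have "coprime (2 * s - int D) p" using p by (metis coprime_commute prime_imp_coprime)
  then obtain u where "[(2 * s - int D) * u = 1] (mod p)" by (metis cong_solve_coprime_int)
  then obtain v where v: "(2 * s - int D) * u - 1 = p * v" by (auto simp: cong_iff_dvd_diff)
  \<comment> \<open>u inverts the derivative modulo p, so this is the Newton correction that cancels
    the error term \<open>p ^ Suc k * e\<close> modulo the next power.\<close>
  define t where "t = - e * u"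
  have "omega_poly D (s + p ^ Suc k * t) =
      omega_poly D s + p ^ Suc k * t * (2 * s - int D) + (p ^ Suc k * t)\<^sup>2"
    by (simp add: omega_poly_def power2_eq_square algebra_simps)
  also have "\<dots> = p ^ Suc k * (e * (1 - (2 * s - int D) * u)) + (p ^ Suc k * t)\<^sup>2"
    unfolding e t_def by (simp add: algebra_simps)
  also have "1 - (2 * s - int D) * u = - (p * v)" using v by simp
  also have "p ^ Suc k * (e * - (p * v)) + (p ^ Suc k * t)\<^sup>2 = p ^ Suc (Suc k) * (- e * v + p ^ k * t * t)"
    by (simp add: power2_eq_square algebra_simps)
  finally show ?case by (metis dvd_triv_left)
qed

text \<open>The values at x and s differ by (x - s)(x + s - D). Since p cannot divide both factors,
  the full prime power divides one of them, which gives the two roots s and D - s.\<close>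

lemma card_omega_roots_prime_power:
  assumes p: "prime p" and r: "int p dvd omega_poly D r" and D: "\<not> p dvd D"
  shows "card (omega_roots D (p ^ Suc k)) = 2"
proof -
  have p': "prime (int p)" "\<not> int p dvd int D" using p D by simp_all
  obtain s where s: "int p ^ Suc k dvd omega_poly D s" using hensel_root[OF p'(1) r p'(2)] by blast
  define q where "q = p ^ Suc k"
  have q: "0 < q" "int q = int p ^ Suc k" "p dvd q" using p prime_gt_0_nat by (auto simp: q_def)
  have "int p dvd omega_poly D s" using s by (metis dvd_mult_left power_Suc)
  then have ns: "\<not> int p dvd 2 * s - int D" using root_dvd_disc_iff[OF p'(1)] p'(2) by blast
  have "omega_roots D q = {s mod int q, (int D - s) mod int q}"
  proof (intro equalityI subsetI)
    fix x assume "x \<in> {s mod int q, (int D - s) mod int q}"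
    moreover have "int q dvd omega_poly D s" "int q dvd omega_poly D (int D - s)"
      using s by (simp_all only: q(2) omega_poly_conj)
    ultimately show "x \<in> omega_roots D q"
      using mod_in_omega_roots_iff[OF q(1)] by auto
  next
    fix x assume x: "x \<in> omega_roots D q"
    then have "int q dvd omega_poly D x - omega_poly D s"
      using s q by (auto simp: omega_roots_def intro!: dvd_diff)
    then have dv: "int p ^ Suc k dvd (x - s) * (x + s - int D)"
      by (simp add: omega_poly_diff q)
    have xq: "x = x mod int q" using x by (simp add: omega_roots_def)
    have "\<not> (int p dvd x - s \<and> int p dvd x + s - int D)"
    proof
      assume "int p dvd x - s \<and> int p dvd x + s - int D"
      then have "int p dvd (x + s - int D) - (x - s)" by (metis dvd_diff)
      then show False using ns by simp
    qed
    then have "int p ^ Suc k dvd x - s \<or> int p ^ Suc k dvd x + s - int D"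
    proof (cases "int p dvd x - s")
      case True
      with \<open>\<not> (int p dvd x - s \<and> int p dvd x + s - int D)\<close>
      have "coprime (int p) (x + s - int D)" using p'(1) by (simp add: prime_imp_coprime)
      then have "coprime (int p ^ Suc k) (x + s - int D)" by simp
      then show ?thesis using dv coprime_dvd_mult_left_iff by blast
    next
      case False
      then have "coprime (int p) (x - s)" using p'(1) by (simp add: prime_imp_coprime)
      then have "coprime (int p ^ Suc k) (x - s)" by simp
      then show ?thesis using dv coprime_dvd_mult_right_iff by blast
    qed
    then have "int q dvd x - s \<or> int q dvd x - (int D - s)" unfolding q by (simp add: algebra_simps)
    then have "x mod int q = s mod int q \<or> x mod int q = (int D - s) mod int q"
      by (simp add: mod_eq_dvd_iff)
    with xq show "x \<in> {s mod int q, (int D - s) mod int q}" by simp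
  qed
  moreover have "s mod int q \<noteq> (int D - s) mod int q"
  proof
    assume "s mod int q = (int D - s) mod int q"
    then have "int q dvd s - (int D - s)" by (simp add: mod_eq_dvd_iff)
    moreover have "int p dvd int q" using q by simp
    ultimately have "int p dvd s - (int D - s)" by (rule dvd_trans[rotated])
    then show False using ns by (simp add: algebra_simps)
  qed
  ultimately show ?thesis by (simp add: q_def)
qed

text \<open>For p dividing D the factors x - r and x + r - D agree modulo p, so the root is
  double.\<close>

lemma card_omega_roots_prime:
  assumes p: "prime p" and r: "int p dvd omega_poly D r" and D: "p dvd D"
  shows "card (omega_roots D p) = 1"
proof -
  have p': "prime (int p)" "int p dvd int D" "0 < p" using p D prime_gt_0_nat by simp_all
  have "omega_roots D p = {r mod int p}"
  proof (intro equalityI subsetI)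
    fix x assume "x \<in> {r mod int p}"
    then show "x \<in> omega_roots D p" using r p' by (simp add: mod_in_omega_roots_iff)
  next
    fix x assume x: "x \<in> omega_roots D p"
    then have "int p dvd omega_poly D x - omega_poly D r"
      using r by (auto simp: omega_roots_def intro!: dvd_diff)
    then have "int p dvd x - r \<or> int p dvd x + r - int D"
      unfolding omega_poly_diff using p'(1) by (simp add: prime_dvd_mult_iff)
    moreover have "int p dvd x - r" if "int p dvd x + r - int D"
    proof -
      have "int p dvd 2 * r - int D" using root_dvd_disc_iff[OF p'(1) r] p'(2) by blast
      with that have "int p dvd (x + r - int D) - (2 * r - int D)" by (rule dvd_diff)
      then show ?thesis by simp
    qed
    ultimately have "x mod int p = r mod int p" by (auto simp: mod_eq_dvd_iff)
    then show "x \<in> {r mod int p}" using x by (simp add: omega_roots_def)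
  qed
  then show ?thesis by simp
qed

text \<open>Induction that splits off the full power of one prime: primes not dividing D contribute
  a factor 2, those dividing D occur once and contribute 1.\<close>

lemma card_omega_roots:
  assumes "0 < n" "\<And>p. p \<in> prime_factors n \<Longrightarrow> \<exists>r. int p dvd omega_poly D r"
    "\<And>p. p \<in> prime_factors n \<Longrightarrow> p dvd D \<Longrightarrow> multiplicity p n = 1"
  shows "card (omega_roots D n) = 2 ^ card {p \<in> prime_factors n. \<not> p dvd D}"
  using assms
proof (induction n rule: less_induct)
  case (less n)
  show ?case
  proof (cases "n = 1")
    case True
    then have "omega_roots D n = {0}" by (auto simp: omega_roots_def)
    then show ?thesis using True by simp
  next
    case False
    then obtain p where p: "prime p" "p dvd n" by (metis prime_factor_nat)
    define k where "k = multiplicity p n"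
    obtain m where m: "n = p ^ k * m" "\<not> p dvd m"
      using less.prems(1) p multiplicity_decompose'[of n p] unfolding k_def
      by (metis not_prime_unit not_gr_zero)
    have "k > 0" using p less.prems(1) by (simp add: k_def prime_multiplicity_gt_zero_iff)
    have m0: "0 < m" using m less.prems(1) by (cases m) auto
    have cop: "coprime (p ^ k) m" using m(2) p(1) by (simp add: prime_imp_coprime)
    have pf: "prime_factors n = insert p (prime_factors m)"
      using m0 p \<open>k > 0\<close> unfolding m(1)
      by (auto simp: prime_factors_dvd prime_dvd_mult_iff prime_dvd_power_iff primes_dvd_imp_eq)
    have pn: "p \<notin> prime_factors m" using m(2) by auto
    have "m < n"
    proof -
      have "1 < p ^ k" using p(1) \<open>k > 0\<close> prime_gt_1_nat by (metis one_less_power)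
      then show ?thesis using m0 m(1) by simp
    qed
    have IH: "card (omega_roots D m) = 2 ^ card {q \<in> prime_factors m. \<not> q dvd D}"
    proof (rule less.IH[OF \<open>m < n\<close> m0])
      fix q assume q: "q \<in> prime_factors m"
      then show "\<exists>r. int q dvd omega_poly D r" using less.prems(2) pf by blast
      assume "q dvd D"
      then have "multiplicity q n = 1" using less.prems(3) pf q by blast
      moreover have "multiplicity q n = multiplicity q (p ^ k) + multiplicity q m"
        unfolding m(1) using q m0 p(1) by (intro prime_elem_multiplicity_mult_distrib) auto
      moreover have "multiplicity q m > 0" using q by (simp add: prime_factors_multiplicity)
      ultimately show "multiplicity q m = 1" by linarith
    qed
    obtain r where r: "int p dvd omega_poly D r" using less.prems(2) pf by blast
    have "card (omega_roots D (p ^ k)) = (if p dvd D then 1 else 2)"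
    proof (cases "p dvd D")
      case True
      then have "k = 1" using less.prems(3)[of p] pf by (simp add: k_def)
      then show ?thesis using card_omega_roots_prime[OF p(1) r True] True by simp
    next
      case False
      then show ?thesis
        using card_omega_roots_prime_power[OF p(1) r False, of "k - 1"] \<open>k > 0\<close> by simp
    qed
    moreover have "card {q \<in> prime_factors n. \<not> q dvd D} =
        (if p dvd D then 0 else 1) + card {q \<in> prime_factors m. \<not> q dvd D}"
    proof -
      have "{q \<in> prime_factors n. \<not> q dvd D} = (if p dvd D then {} else {p}) \<union> {q \<in> prime_factors m. \<not> q dvd D}"
        unfolding pf by auto
      then show ?thesis using pn by auto
    qed
    ultimately show ?thesis
      unfolding m(1) using card_omega_roots_mult[OF cop] p(1) m0 IH prime_gt_0_nat[of p]
      by (simp add: m(1)[symmetric])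
  qed
qed

end

context quad_conductor
begin

text \<open>If p divided D, then (omega - r)/p would have integral trace and norm, and
  \<open>conductor_dvd\<close> would make p a divisor of the conductor. This is the source of the
  condition that ramified primes occur only once.\<close>

lemma ramified_root_squarefree:
  assumes p: "prime p" "\<not> p dvd int f" and r: "p\<^sup>2 dvd omega_poly D r"
  shows "\<not> p dvd int D"
proof
  assume "p dvd int D"
  moreover have "p dvd omega_poly D r" using r by (metis dvd_mult_left power2_eq_square)
  ultimately have "p dvd 2 * r - int D" using root_dvd_disc_iff[OF p(1)] by blast
  then obtain t where t: "2 * r - int D = p * t" by auto
  obtain u where u: "omega_poly D r = p\<^sup>2 * u" using r by auto
  have p0: "p > 0" using p(1) by (rule prime_gt_0_int)
  have c: "quad_conj D ((omega D - of_int r) / of_int p) = (omega' D - of_int r) / of_int p"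
    using p0 by (subst conj_divide) (auto simp: field_rat field_omega field_diff)
  have "quad_trace D ((omega D - of_int r) / of_int p) = of_int (- t)"
  proof -
    have "real_of_int (2 * r - int D) = real_of_int (p * t)" by (simp only: t)
    then show ?thesis
      using p0 by (simp add: quad_trace_def c omega'_eq field_simps)
  qed
  moreover have "(omega D - of_int r) / of_int p * quad_conj D ((omega D - of_int r) / of_int p) = of_int u"
  proof -
    have "(omega D - of_int r) * (omega' D - of_int r) = of_int (omega_poly D r)"
      using omega_mult_omega' by (simp add: omega_poly_def omega'_eq algebra_simps power2_eq_square)
    also have "\<dots> = of_int p * of_int p * of_int u" by (simp add: u power2_eq_square)
    finally show ?thesis using p0 by (simp add: c field_simps)
  qed
  ultimately have "p dvd int f" by (intro conductor_dvd[OF p0, of r]) (simp_all only: Ints_of_int)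
  with p(2) show False by blast
qed

text \<open>Necessity is local: a root modulo n is a root modulo every prime power dividing n.
  Sufficiency follows from the count, which is a power of two and hence positive.\<close>

lemma omega_roots_prime_factor_condition:
  assumes n: "0 < d1" "d1 dvd d2" "0 < d2" "coprime (d2 div d1) f"
  shows "omega_roots D (d2 div d1) \<noteq> {} \<longleftrightarrow> prime_factor_condition D d1 d2"
    "prime_factor_condition D d1 d2 \<Longrightarrow>
      card (omega_roots D (d2 div d1)) = 2 ^ card {p \<in> prime_factors (d2 div d1). splitting D p}"
proof -
  define n where "n = d2 div d1"
  have n0: "0 < n" using n by (auto simp: n_def elim!: dvdE)
  have cop: "coprime p f" if "p \<in> prime_factors n" for p
    using that n(4) unfolding n_def by (metis coprime_divisors dvd_refl in_prime_factors_imp_dvd)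
  have types: "inert D p \<longleftrightarrow> (\<forall>r. \<not> int p dvd omega_poly D r)"
    "ramified D p \<longleftrightarrow> (\<exists>r. int p dvd omega_poly D r) \<and> p dvd D"
    "splitting D p \<longleftrightarrow> (\<exists>r. int p dvd omega_poly D r) \<and> \<not> p dvd D" if "p \<in> prime_factors n" for p
    using prime_types[OF _ cop[OF that]] that by auto
  show card: "card (omega_roots D (d2 div d1)) = 2 ^ card {p \<in> prime_factors (d2 div d1). splitting D p}"
    if pf: "prime_factor_condition D d1 d2"
  proof -
    have ex: "\<exists>r. int p dvd omega_poly D r" if "p \<in> prime_factors n" for p
      using pf that types(1)[OF that] unfolding prime_factor_condition_def n_def by blast
    have "multiplicity p n = 1" if "p \<in> prime_factors n" "p dvd D" for p
      using pf that types(2)[OF that(1)] ex[OF that(1)] unfolding prime_factor_condition_def n_def by blast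
    then have "card (omega_roots D n) = 2 ^ card {p \<in> prime_factors n. \<not> p dvd D}"
      using n0 ex by (intro card_omega_roots) auto
    moreover have "{p \<in> prime_factors n. \<not> p dvd D} = {p \<in> prime_factors n. splitting D p}"
      using types(3) ex by blast
    ultimately show ?thesis by (simp add: n_def)
  qed
  show "omega_roots D (d2 div d1) \<noteq> {} \<longleftrightarrow> prime_factor_condition D d1 d2"
  proof
    assume "prime_factor_condition D d1 d2"
    from card[OF this] show "omega_roots D (d2 div d1) \<noteq> {}" by auto
  next
    assume "omega_roots D (d2 div d1) \<noteq> {}"
    then obtain r where r: "int n dvd omega_poly D r" by (auto simp: omega_roots_def n_def)
    have "\<not> inert D p \<and> (ramified D p \<longrightarrow> multiplicity p n = 1)" if p: "p \<in> prime_factors n" for p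
    proof (intro conjI impI)
      have "int p dvd int n" using p by (simp add: in_prime_factors_imp_dvd)
      then have "int p dvd omega_poly D r" using r by (rule dvd_trans)
      then show "\<not> inert D p" using types(1)[OF p] by blast
      assume "ramified D p"
      then have pD: "int p dvd int D" using types(2)[OF p] by simp
      have pp: "prime p" using p by auto
      have "\<not> int p dvd int f" using cop[OF p] pp by (metis coprime_absorb_left int_dvd_int_iff not_prime_unit)
      then have "\<not> (int p)\<^sup>2 dvd omega_poly D r"
        using ramified_root_squarefree[of "int p" r] pD pp by auto
      then have "\<not> (int p)\<^sup>2 dvd int n" using r dvd_trans by blast
      then have "\<not> p\<^sup>2 dvd n" by (simp flip: of_nat_power)
      then have "multiplicity p n < 2"
        using n0 pp by (metis multiplicity_dvd' not_less)
      moreover have "multiplicity p n > 0" using p by (simp add: prime_factors_multiplicity)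
      ultimately show "multiplicity p n = 1" by linarith
    qed
    then show "prime_factor_condition D d1 d2"
      by (simp add: prime_factor_condition_def n_def)
  qed
qed

end

section \<open>Symplectic bases and ideals of given type\<close>

definition additive_on :: "'a::ab_group_add set \<Rightarrow> ('a \<Rightarrow> 'b::ab_group_add) \<Rightarrow> bool" where
  "additive_on L f \<longleftrightarrow> (\<forall>x\<in>L. \<forall>y\<in>L. f (x + y) = f x + f y)"

lemma zbasis_basis_mem:
  fixes b :: "'i::finite \<Rightarrow> 'a::real_vector"
  assumes "zbasis b L" shows "b j \<in> L"
proof -
  have "(\<Sum>i\<in>UNIV. of_int (if i = j then 1 else 0) *\<^sub>R b i) = (\<Sum>i\<in>UNIV. if i = j then b i else 0)"
    by (intro sum.cong) auto
  also have "\<dots> = b j" by simp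
  finally show ?thesis using zbasis_comb[OF assms, of "\<lambda>i. if i = j then 1 else 0"] by simp
qed

lemma zbasis_subgroup:
  fixes b :: "'i::finite \<Rightarrow> 'a::real_vector"
  assumes b: "zbasis b L"
  shows "0 \<in> L" "x \<in> L \<Longrightarrow> y \<in> L \<Longrightarrow> x + y \<in> L" "x \<in> L \<Longrightarrow> of_int n *\<^sub>R x \<in> L"
    "x \<in> L \<Longrightarrow> y \<in> L \<Longrightarrow> x - y \<in> L" "x \<in> L \<Longrightarrow> - x \<in> L"
proof -
  show zero: "0 \<in> L" using zbasis_comb[OF b, of "\<lambda>_. 0"] by simp
  show add: "x + y \<in> L" if "x \<in> L" "y \<in> L" for x y
  proof -
    obtain k where "x = (\<Sum>i\<in>UNIV. of_int (k i) *\<^sub>R b i)"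
      using b \<open>x \<in> L\<close> by (rule zbasis_span)
    moreover obtain l where "y = (\<Sum>i\<in>UNIV. of_int (l i) *\<^sub>R b i)"
      using b \<open>y \<in> L\<close> by (rule zbasis_span)
    ultimately show ?thesis
      using zbasis_comb[OF b, of "\<lambda>i. k i + l i"] by (simp add: scaleR_add_left sum.distrib)
  qed
  show scale: "of_int n *\<^sub>R x \<in> L" if "x \<in> L" for x n
  proof -
    obtain k where "x = (\<Sum>i\<in>UNIV. of_int (k i) *\<^sub>R b i)"
      using b \<open>x \<in> L\<close> by (rule zbasis_span)
    then show ?thesis
      using zbasis_comb[OF b, of "\<lambda>i. n * k i"] by (simp add: scaleR_sum_right)
  qed
  show minus: "- x \<in> L" if "x \<in> L" for x using scale[OF that, of "-1"] by simp
  show "x - y \<in> L" if "x \<in> L" "y \<in> L" for x y using add[OF that(1) minus[OF that(2)]] by simp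
qed

lemma additive_on_scale:
  fixes L :: "'a::real_vector set" and f :: "'a \<Rightarrow> 'b::real_vector"
  assumes L: "0 \<in> L" "\<And>x y. x \<in> L \<Longrightarrow> y \<in> L \<Longrightarrow> x + y \<in> L" "\<And>x. x \<in> L \<Longrightarrow> - x \<in> L"
    and f: "additive_on L f" and x: "x \<in> L"
  shows "f (of_int n *\<^sub>R x) = of_int n *\<^sub>R f x"
proof -
  have add: "f (x + y) = f x + f y" if "x \<in> L" "y \<in> L" for x y
    using f that by (simp add: additive_on_def)
  have 0: "f 0 = 0" using add[OF L(1) L(1)] by simp
  have nat: "of_nat n *\<^sub>R y \<in> L \<and> f (of_nat n *\<^sub>R y) = of_nat n *\<^sub>R f y" if y: "y \<in> L" for n :: nat and y
  proof (induction n)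
    case (Suc n)
    have "of_nat (Suc n) *\<^sub>R y = y + of_nat n *\<^sub>R y" by (simp add: scaleR_add_left)
    then show ?case using Suc add[OF y] L(2)[OF y] by (simp add: scaleR_add_left)
  qed (simp add: 0 L)
  have minus: "f (- x) = - f x"
    using add[OF x L(3)[OF x]] 0 by (simp add: eq_neg_iff_add_eq_0 add.commute)
  show ?thesis
  proof (cases n)
    case (nonneg m)
    then show ?thesis using nat[OF x, of m] by simp
  next
    case (neg m)
    then have e: "real_of_int n = - real (Suc m)" by simp
    have "real_of_int n *\<^sub>R x = real (Suc m) *\<^sub>R (- x)" "real_of_int n *\<^sub>R f x = real (Suc m) *\<^sub>R (- f x)"
      by (simp_all only: e scaleR_minus_left scaleR_minus_right)
    then show ?thesis using nat[OF L(3)[OF x], of "Suc m"] minus by (simp only:)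
  qed
qed

lemma zbasis_additive:
  fixes b :: "'i::finite \<Rightarrow> 'a::real_vector" and f :: "'a \<Rightarrow> 'b::real_vector"
  assumes b: "zbasis b L" and f: "additive_on L f"
  shows "f (\<Sum>i\<in>UNIV. of_int (k i) *\<^sub>R b i) = (\<Sum>i\<in>UNIV. of_int (k i) *\<^sub>R f (b i))"
proof -
  note L = zbasis_subgroup[OF b]
  have "(\<Sum>i\<in>A. of_int (k i) *\<^sub>R b i) \<in> L \<and>
      f (\<Sum>i\<in>A. of_int (k i) *\<^sub>R b i) = (\<Sum>i\<in>A. of_int (k i) *\<^sub>R f (b i))" if "finite A" for A
    using that
  proof (induction A)
    case empty
    have "f (0 + 0) = f 0 + f 0" using f L(1) unfolding additive_on_def by blast
    then show ?case using L(1) by simp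
  next
    case (insert j A)
    have j: "of_int (k j) *\<^sub>R b j \<in> L" using L(3) zbasis_basis_mem[OF b] by blast
    have "f (of_int (k j) *\<^sub>R b j) = of_int (k j) *\<^sub>R f (b j)"
      using L f zbasis_basis_mem[OF b] by (intro additive_on_scale) auto
    moreover have "f (of_int (k j) *\<^sub>R b j + (\<Sum>i\<in>A. of_int (k i) *\<^sub>R b i)) =
        f (of_int (k j) *\<^sub>R b j) + f (\<Sum>i\<in>A. of_int (k i) *\<^sub>R b i)"
      using f insert.IH j by (simp add: additive_on_def)
    ultimately show ?case using insert L(2)[OF j] by simp
  qed
  then show ?thesis by simp
qed

lemma sum_UNIV_plus:
  fixes f :: "'a::finite + 'b::finite \<Rightarrow> 'c::comm_monoid_add"
  shows "sum f UNIV = (\<Sum>i\<in>UNIV. f (Inl i)) + (\<Sum>j\<in>UNIV. f (Inr j))"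
  unfolding UNIV_Plus_UNIV[symmetric] by (subst sum.Plus) auto

lemma zbasis_22_iff:
  fixes u v :: "2 \<Rightarrow> 'a::real_vector"
  shows "zbasis (case_sum u v) L \<longleftrightarrow>
    (\<forall>x. x \<in> L \<longleftrightarrow> (\<exists>m n k l::int. x = of_int m *\<^sub>R u 1 + of_int n *\<^sub>R u 2 + of_int k *\<^sub>R v 1 + of_int l *\<^sub>R v 2)) \<and>
    (\<forall>m n k l::int. of_int m *\<^sub>R u 1 + of_int n *\<^sub>R u 2 + of_int k *\<^sub>R v 1 + of_int l *\<^sub>R v 2 = 0 \<longrightarrow>
      m = 0 \<and> n = 0 \<and> k = 0 \<and> l = 0)"
proof -
  have ne: "(2::2) \<noteq> 1" by simp
  have ex: "(\<exists>c. P (c (Inl (1::2))) (c (Inl 2)) (c (Inr (1::2))) (c (Inr 2))) \<longleftrightarrow> (\<exists>m n k l::int. P m n k l)" for P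
  proof
    assume "\<exists>m n k l. P m n k l"
    then obtain m n k l where "P m n k l" by blast
    then show "\<exists>c. P (c (Inl (1::2))) (c (Inl 2)) (c (Inr (1::2))) (c (Inr 2))"
      using ne by (intro exI[of _ "case_sum (\<lambda>i. if i = 1 then m else n) (\<lambda>i. if i = 1 then k else l)"]) simp
  qed blast
  have f: "c = (\<lambda>_. 0) \<longleftrightarrow> c (Inl 1) = 0 \<and> c (Inl 2) = 0 \<and> c (Inr 1) = 0 \<and> c (Inr 2) = 0"
    for c :: "2 + 2 \<Rightarrow> int"
    by (simp add: fun_eq_iff split_sum_all forall_2)
  have all: "(\<forall>c. P (c (Inl (1::2))) (c (Inl 2)) (c (Inr (1::2))) (c (Inr 2))) \<longleftrightarrow> (\<forall>m n k l::int. P m n k l)" for P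
    using ex[of "\<lambda>m n k l. \<not> P m n k l"] by blast
  show ?thesis
    unfolding zbasis_iff sum_UNIV_plus sum_2 f
    using all[of "\<lambda>m n k l. of_int m *\<^sub>R u 1 + of_int n *\<^sub>R u 2 + of_int k *\<^sub>R v 1 + of_int l *\<^sub>R v 2 = 0 \<longrightarrow>
      m = 0 \<and> n = 0 \<and> k = 0 \<and> l = 0"]
      ex[of "\<lambda>m n k l. x = of_int m *\<^sub>R u 1 + of_int n *\<^sub>R u 2 + of_int k *\<^sub>R v 1 + of_int l *\<^sub>R v 2" for x]
    by (simp add: set_eq_iff image_iff add.assoc)
qed

lemma zbasis_22_span:
  fixes u v :: "2 \<Rightarrow> 'a::real_vector"
  assumes "zbasis (case_sum u v) L" "x \<in> L"
  obtains m n k l :: int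
  where "x = of_int m *\<^sub>R u 1 + of_int n *\<^sub>R u 2 + of_int k *\<^sub>R v 1 + of_int l *\<^sub>R v 2"
  using iffD1[OF spec[OF conjunct1[OF iffD1[OF zbasis_22_iff assms(1)]]] assms(2)] by (elim exE)

lemma zbasis_22_comb:
  fixes u v :: "2 \<Rightarrow> 'a::real_vector"
  assumes "zbasis (case_sum u v) L"
  shows "of_int m *\<^sub>R u 1 + of_int n *\<^sub>R u 2 + of_int k *\<^sub>R v 1 + of_int l *\<^sub>R v 2 \<in> L"
  using iffD2[OF spec[OF conjunct1[OF iffD1[OF zbasis_22_iff assms]]]] by metis

definition biadditive_on :: "'a::ab_group_add set \<Rightarrow> ('a \<Rightarrow> 'a \<Rightarrow> real) \<Rightarrow> bool" where
  "biadditive_on L E \<longleftrightarrow> (\<forall>x\<in>L. additive_on L (E x) \<and> additive_on L (\<lambda>y. E y x))"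

lemma form_typeE:
  assumes "form_type L E d1 d2"
  obtains u v :: "2 \<Rightarrow> 'a::real_vector" where "0 < d1" "0 < d2" "d1 dvd d2" "zbasis (case_sum u v) L"
    "\<forall>i j. E (u i) (u j) = 0" "\<forall>i j. E (v i) (v j) = 0"
    "E (u 1) (v 1) = real d1" "E (u 1) (v 2) = 0" "E (u 2) (v 1) = 0" "E (u 2) (v 2) = real d2"
    "E (v 1) (u 1) = - real d1" "E (v 2) (u 1) = 0" "E (v 1) (u 2) = 0" "E (v 2) (u 2) = - real d2"
proof -
  obtain u v :: "2 \<Rightarrow> 'a" where d: "0 < d1" "0 < d2" "d1 dvd d2" and b: "zbasis (case_sum u v) L"
    and E: "\<And>i j. E (u i) (u j) = 0 \<and> E (v i) (v j) = 0 \<and>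
        E (u i) (v j) = (if i \<noteq> j then 0 else if i = 1 then real d1 else real d2) \<and>
        E (v j) (u i) = - E (u i) (v j)"
    using assms unfolding form_type_def by blast
  have uu: "E (u i) (u j) = 0" and vv: "E (v i) (v j) = 0"
    and uv: "E (u i) (v j) = (if i \<noteq> j then 0 else if i = 1 then real d1 else real d2)"
    and vu: "E (v j) (u i) = - (if i \<noteq> j then 0 else if i = 1 then real d1 else real d2)" for i j
    using E[of i j] by simp_all
  show ?thesis
    by (rule that[OF d b]) (simp_all add: uu vv uv vu)
qed

lemma symplectic_coordinates:
  fixes u v :: "2 \<Rightarrow> 'a::real_vector"
  assumes b: "zbasis (case_sum u v) L" and E: "biadditive_on L E"
    and x: "x = of_int m *\<^sub>R u 1 + of_int n *\<^sub>R u 2 + of_int k *\<^sub>R v 1 + of_int l *\<^sub>R v 2" and y: "y \<in> L"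
  shows "E x y = of_int m * E (u 1) y + of_int n * E (u 2) y + of_int k * E (v 1) y + of_int l * E (v 2) y"
    "E y x = of_int m * E y (u 1) + of_int n * E y (u 2) + of_int k * E y (v 1) + of_int l * E y (v 2)"
proof -
  let ?c = "case_sum (\<lambda>i::2. if i = 1 then m else n) (\<lambda>i::2. if i = 1 then k else l)"
  have x': "x = (\<Sum>i\<in>UNIV. of_int (?c i) *\<^sub>R (case_sum u v) i)"
    unfolding sum_UNIV_plus sum_2 x by simp
  show "E x y = of_int m * E (u 1) y + of_int n * E (u 2) y + of_int k * E (v 1) y + of_int l * E (v 2) y"
    unfolding x' using E y
    by (subst zbasis_additive[OF b, of "\<lambda>z. E z y"])
      (auto simp: biadditive_on_def sum_UNIV_plus sum_2)
  show "E y x = of_int m * E y (u 1) + of_int n * E y (u 2) + of_int k * E y (v 1) + of_int l * E y (v 2)"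
    unfolding x' using E y
    by (subst zbasis_additive[OF b, of "E y"])
      (auto simp: biadditive_on_def sum_UNIV_plus sum_2)
qed

lemma symplectic_mem:
  fixes u v :: "2 \<Rightarrow> 'a::real_vector"
  assumes "zbasis (case_sum u v) L"
  shows "u i \<in> L" "v i \<in> L"
  using zbasis_basis_mem[OF assms, of "Inl i"] zbasis_basis_mem[OF assms, of "Inr i"] by simp_all

lemma form_type_values:
  fixes L :: "'a::real_vector set"
  assumes t: "form_type L E d1 d2" and E: "biadditive_on L E" and x: "x \<in> L" "y \<in> L"
  shows "\<exists>c. E x y = of_int c * real d1"
proof -
  obtain u v :: "2 \<Rightarrow> 'a" where uv: "0 < d1" "0 < d2" "d1 dvd d2" "zbasis (case_sum u v) L"
    "\<forall>i j. E (u i) (u j) = 0" "\<forall>i j. E (v i) (v j) = 0"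
    "E (u 1) (v 1) = real d1" "E (u 1) (v 2) = 0" "E (u 2) (v 1) = 0" "E (u 2) (v 2) = real d2"
    "E (v 1) (u 1) = - real d1" "E (v 2) (u 1) = 0" "E (v 1) (u 2) = 0" "E (v 2) (u 2) = - real d2"
    using t by (rule form_typeE)
  obtain m n k l where X: "x = of_int m *\<^sub>R u 1 + of_int n *\<^sub>R u 2 + of_int k *\<^sub>R v 1 + of_int l *\<^sub>R v 2"
    using uv(4) x(1) by (rule zbasis_22_span)
  obtain m' n' k' l' where Y: "y = of_int m' *\<^sub>R u 1 + of_int n' *\<^sub>R u 2 + of_int k' *\<^sub>R v 1 + of_int l' *\<^sub>R v 2"
    using uv(4) x(2) by (rule zbasis_22_span)
  note m = symplectic_mem[OF uv(4)]
  note C = symplectic_coordinates[OF uv(4) E]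
  obtain q where q: "d2 = d1 * q" using uv(3) by auto
  have "E x y = of_int (m * k' + int q * n * l' - k * m' - int q * l * n') * real d1"
    unfolding C(1)[OF X x(2)] C(2)[OF Y m(1)] C(2)[OF Y m(2)] using uv by (simp add: q algebra_simps)
  then show ?thesis by blast
qed

text \<open>Each value of E is a multiple of d1, so d1 divides e1. For the second divisor, the
  functional d2/e2 times E(u'_2, .) is represented by a lattice vector z; evaluated at v'_2 it gives
  d2, while E(z, v'_2) is a multiple of e2.\<close>

lemma form_type_dvd:
  fixes L :: "'a::real_vector set"
  assumes t: "form_type L E d1 d2" and t': "form_type L E e1 e2" and E: "biadditive_on L E"
  shows "d1 dvd e1" "e2 dvd d2"
proof -
  obtain u v :: "2 \<Rightarrow> 'a" where uv: "0 < d1" "0 < d2" "d1 dvd d2" "zbasis (case_sum u v) L"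
    "\<forall>i j. E (u i) (u j) = 0" "\<forall>i j. E (v i) (v j) = 0"
    "E (u 1) (v 1) = real d1" "E (u 1) (v 2) = 0" "E (u 2) (v 1) = 0" "E (u 2) (v 2) = real d2"
    "E (v 1) (u 1) = - real d1" "E (v 2) (u 1) = 0" "E (v 1) (u 2) = 0" "E (v 2) (u 2) = - real d2"
    using t by (rule form_typeE)
  obtain u' v' :: "2 \<Rightarrow> 'a" where uv': "0 < e1" "0 < e2" "e1 dvd e2" "zbasis (case_sum u' v') L"
    "\<forall>i j. E (u' i) (u' j) = 0" "\<forall>i j. E (v' i) (v' j) = 0"
    "E (u' 1) (v' 1) = real e1" "E (u' 1) (v' 2) = 0" "E (u' 2) (v' 1) = 0" "E (u' 2) (v' 2) = real e2"
    "E (v' 1) (u' 1) = - real e1" "E (v' 2) (u' 1) = 0" "E (v' 1) (u' 2) = 0" "E (v' 2) (u' 2) = - real e2"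
    using t' by (rule form_typeE)
  note m = symplectic_mem[OF uv(4)] and m' = symplectic_mem[OF uv'(4)]
  note C = symplectic_coordinates[OF uv(4) E] and C' = symplectic_coordinates[OF uv'(4) E]
  obtain c where "E (u' 1) (v' 1) = of_int c * real d1"
    using form_type_values[OF t E m'(1) m'(2)] by blast
  then have "real_of_int (int e1) = real_of_int (c * int d1)" using uv' by simp
  then have "int e1 = c * int d1" by (simp only: of_int_eq_iff)
  then show "d1 dvd e1" by (metis dvd_triv_right int_dvd_int_iff)
  have phi: "\<exists>c. E (u' 2) x = of_int c * real e2" if x: "x \<in> L" for x
  proof -
    obtain m n k l where X: "x = of_int m *\<^sub>R u' 1 + of_int n *\<^sub>R u' 2 + of_int k *\<^sub>R v' 1 + of_int l *\<^sub>R v' 2"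
      using uv'(4) x by (rule zbasis_22_span)
    show ?thesis unfolding C'(2)[OF X m'(1)] using uv' by auto
  qed
  obtain q where q: "d2 = d1 * q" using uv(3) by auto
  obtain a1 where a1: "E (u' 2) (u 1) = of_int a1 * real e2" using phi m by blast
  obtain a2 where a2: "E (u' 2) (u 2) = of_int a2 * real e2" using phi m by blast
  obtain b1 where b1: "E (u' 2) (v 1) = of_int b1 * real e2" using phi m by blast
  obtain b2 where b2: "E (u' 2) (v 2) = of_int b2 * real e2" using phi m by blast
  \<comment> \<open>Duality for the symplectic basis u, v: coefficients are exchanged between u and
    v with a sign, and q = d2/d1 compensates for the smaller divisor in the first plane.\<close>
  define z where "z = of_int (int q * b1) *\<^sub>R u 1 + of_int b2 *\<^sub>R u 2 + of_int (- int q * a1) *\<^sub>R v 1 + of_int (- a2) *\<^sub>R v 2"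
  have zL: "z \<in> L" unfolding z_def by (rule zbasis_22_comb[OF uv(4)])
  have zE: "E z x * real e2 = real d2 * E (u' 2) x" if x: "x \<in> L" for x
  proof -
    obtain m n k l where X: "x = of_int m *\<^sub>R u 1 + of_int n *\<^sub>R u 2 + of_int k *\<^sub>R v 1 + of_int l *\<^sub>R v 2"
      using uv(4) x by (rule zbasis_22_span)
    show ?thesis
      unfolding C(1)[OF z_def x] C(2)[OF X m'(1)] a1 a2 b1 b2 C(2)[OF X m(1)] C(2)[OF X m(2)]
      using uv by (simp add: q algebra_simps)
  qed
  have "E z (v' 2) = real d2" using zE[OF m'(2), of 2] uv' by simp
  moreover obtain m n k l where Z: "z = of_int m *\<^sub>R u' 1 + of_int n *\<^sub>R u' 2 + of_int k *\<^sub>R v' 1 + of_int l *\<^sub>R v' 2"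
    using uv'(4) zL by (rule zbasis_22_span)
  have "E z (v' 2) = of_int n * real e2" unfolding C'(1)[OF Z m'(2)] using uv' by simp
  ultimately have "real_of_int (int d2) = real_of_int (n * int e2)" by simp
  then have "int d2 = n * int e2" by (simp only: of_int_eq_iff)
  then show "e2 dvd d2" by (metis dvd_triv_right int_dvd_int_iff)
qed

lemma form_type_unique:
  assumes "form_type L E d1 d2" "form_type L E e1 e2" "biadditive_on L E"
  shows "d1 = e1" "d2 = e2"
  using form_type_dvd[OF assms] form_type_dvd[OF assms(2,1,3)] by (simp_all add: dvd_antisym)

section \<open>Normal form and type of ideals\<close>

lemma int_subgroup_generator:
  fixes S :: "int set"
  assumes S: "\<And>x y. x \<in> S \<Longrightarrow> y \<in> S \<Longrightarrow> x - y \<in> S" and a: "a \<in> S" "a \<noteq> 0"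
  obtains g where "g > 0" "\<And>x. x \<in> S \<longleftrightarrow> g dvd x"
proof -
  have 0: "0 \<in> S" using S[OF a(1) a(1)] by simp
  have neg: "- x \<in> S" if "x \<in> S" for x using S[OF 0 that] by simp
  have add: "x + y \<in> S" if "x \<in> S" "y \<in> S" for x y using S[OF that(1) neg[OF that(2)]] by simp
  define g where "g = (LEAST n. 0 < n \<and> int n \<in> S)"
  have "int (nat \<bar>a\<bar>) \<in> S" using a(1) neg by (cases "a \<ge> 0") auto
  then have ex: "0 < nat \<bar>a\<bar> \<and> int (nat \<bar>a\<bar>) \<in> S" using a by simp
  have g: "0 < g" "int g \<in> S" using LeastI[of "\<lambda>n. 0 < n \<and> int n \<in> S", OF ex] by (auto simp: g_def)
  have min: "g \<le> n" if "0 < n" "int n \<in> S" for n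
    unfolding g_def using that by (intro Least_le) simp
  have mul: "int g * int n \<in> S" for n
    by (induction n) (auto simp: 0 algebra_simps intro: add g)
  have mul': "int g * k \<in> S" for k
    by (cases k rule: int_cases2) (use mul neg in auto)
  have "x \<in> S \<longleftrightarrow> int g dvd x" for x
  proof
    assume x: "x \<in> S"
    have "x mod int g = x - int g * (x div int g)" by (simp add: minus_mult_div_eq_mod)
    also have "\<dots> \<in> S" using S[OF x mul'] .
    finally have "int (nat (x mod int g)) \<in> S" using g by simp
    moreover have "nat (x mod int g) < g" using g by (simp add: nat_less_iff)
    ultimately have "nat (x mod int g) = 0" using min by (meson not_le neq0_conv)
    then have "x mod int g = 0" using g pos_mod_sign[of "int g" x] by linarith
    then show "int g dvd x" by auto
  next
    assume "int g dvd x"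
    then show "x \<in> S" using mul' by auto
  qed
  with g that[of "int g"] show ?thesis by simp
qed

context quad_disc
begin

text \<open>Two subgroups of Z determine the ideal: its integers \<open>S\<close>, generated by s,
  and the set \<open>M\<close> of its omega-coordinates, generated by g. Stability under omega makes
  g divide everything in sight, and a = s/g.\<close>

lemma ideal_normal_form:
  assumes I: "ideal I RO" and nz: "I \<noteq> {0}"
  obtains g a r where "0 < g" "0 < a" "a dvd omega_poly D r" "I = (\<lambda>x. of_int g * x) ` root_ideal D a r"
proof -
  have I': "I \<subseteq> quad_order D" "0 \<in> I" "\<And>x y. x \<in> I \<Longrightarrow> y \<in> I \<Longrightarrow> x + y \<in> I"
    "\<And>k x. k \<in> quad_order D \<Longrightarrow> x \<in> I \<Longrightarrow> k * x \<in> I"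
    using I unfolding ideal_order_iff by auto
  have Idiff: "x - y \<in> I" if "x \<in> I" "y \<in> I" for x y
    using I'(3)[OF that(1) I'(4)[OF order_int[of "-1"] that(2)]] by simp
  define S where "S = {m. of_int m \<in> I}"
  define M where "M = {n. \<exists>m. of_int m + of_int n * omega D \<in> I}"
  obtain x where x: "x \<in> I" "x \<noteq> 0" using nz I'(2) by auto
  have xO: "x \<in> quad_order D" using x I'(1) by auto
  have "quad_conj D x * x \<in> I" using I'(4)[OF order_conj[OF xO] x(1)] .
  moreover have "quad_conj D x * x \<in> \<int>"
    using conj_mult_rat[OF order_in_field[OF xO]] order_mult[OF order_conj[OF xO] xO]
    by (intro order_rat) (simp_all add: mult.commute)
  moreover have "quad_conj D x * x \<noteq> 0" using x xO by (simp add: order_in_field)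
  moreover obtain z where "quad_conj D x * x = of_int z" using calculation(2) by (auto elim: Ints_cases)
  ultimately have z: "z \<in> S" "z \<noteq> 0" by (auto simp: S_def)
  have "s - t \<in> S" if "s \<in> S" "t \<in> S" for s t
    using Idiff[of "of_int s" "of_int t"] that by (simp add: S_def)
  then obtain s where s: "s > 0" "\<And>x. x \<in> S \<longleftrightarrow> s dvd x"
    using int_subgroup_generator[of S z] z by blast
  have zM: "z \<in> M"
    using I'(4)[OF order_omega, of "of_int z"] z unfolding S_def M_def
    by (auto intro!: exI[of _ 0] simp: mult.commute)
  have "s - t \<in> M" if "s \<in> M" "t \<in> M" for s t
  proof -
    obtain u v where "of_int u + of_int s * omega D \<in> I" "of_int v + of_int t * omega D \<in> I"
      using \<open>s \<in> M\<close> \<open>t \<in> M\<close> unfolding M_def by blast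
    then have "of_int (u - v) + of_int (s - t) * omega D \<in> I"
      using Idiff by (fastforce simp: algebra_simps)
    then show ?thesis unfolding M_def by blast
  qed
  then obtain g where g: "g > 0" "\<And>x. x \<in> M \<longleftrightarrow> g dvd x"
    using int_subgroup_generator[of M z] zM z by blast
  have "s \<in> M"
    using I'(4)[OF order_omega, of "of_int s"] s(2)[of s] unfolding S_def M_def
    by (auto intro!: exI[of _ 0] simp: mult.commute)
  then obtain a where a: "s = g * a" using g by auto
  have a0: "a > 0" using s(1) g(1) a by (simp add: zero_less_mult_iff)
  obtain x0 where x0: "of_int x0 + of_int g * omega D \<in> I" using g(2)[of g] unfolding M_def by auto
  \<comment> \<open>The omega-coordinate of this product is x0 + g D. It lies in \<open>M\<close>,
    so g divides x0, which allows the factor g to be taken out of the second generator.\<close>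
  have "omega D * (of_int x0 + of_int g * omega D) = of_int (- g * omega_norm D) + of_int (x0 + g * int D) * omega D"
    using int_mult_form[of 0 1 x0 g] by simp
  then have "of_int (- g * omega_norm D) + of_int (x0 + g * int D) * omega D \<in> I"
    using I'(4)[OF order_omega x0] by simp
  then have "x0 + g * int D \<in> M" unfolding M_def by blast
  then have "g dvd x0" using g(2) by (simp add: dvd_add_left_iff)
  then obtain r where r: "x0 = g * - r" by (metis dvdE minus_minus)
  have gen: "of_int (- g * r) + of_int g * omega D \<in> I" using x0 r by simp
  have mem: "of_int m + of_int n * omega D \<in> I \<longleftrightarrow> (\<exists>k l. n = g * l \<and> m = g * (a * k - r * l))" for m n
  proof
    assume mn: "of_int m + of_int n * omega D \<in> I"
    then have "n \<in> M" unfolding M_def by blast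
    then obtain l where l: "n = g * l" using g by auto
    have "(of_int m + of_int n * omega D) - of_int l * (of_int (- g * r) + of_int g * omega D) \<in> I"
      by (intro Idiff mn I'(4) order_int gen)
    then have "of_int (m + g * r * l) \<in> I" by (simp add: l algebra_simps)
    then have "m + g * r * l \<in> S" by (simp add: S_def)
    then have "s dvd m + g * r * l" by (simp only: s(2))
    then obtain k where "m + g * r * l = s * k" by auto
    then have "m = g * (a * k - r * l)" by (simp add: a algebra_simps)
    with l show "\<exists>k l. n = g * l \<and> m = g * (a * k - r * l)" by blast
  next
    assume "\<exists>k l. n = g * l \<and> m = g * (a * k - r * l)"
    then obtain k l where kl: "n = g * l" "m = g * (a * k - r * l)" by blast
    have "of_int s \<in> I" using s(2)[of s] by (simp add: S_def)
    then have "of_int k * of_int s + of_int l * (of_int (- g * r) + of_int g * omega D) \<in> I"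
      by (intro I'(3,4) order_int gen)
    then show "of_int m + of_int n * omega D \<in> I" by (simp add: kl a algebra_simps)
  qed
  have "I = (\<lambda>x. of_int g * x) ` root_ideal D a r"
  proof (intro equalityI subsetI)
    fix y assume y: "y \<in> I"
    then obtain m n where mn: "y = of_int m + of_int n * omega D" using I'(1) by (blast elim: quad_orderE)
    then obtain k l where kl: "n = g * l" "m = g * (a * k - r * l)" using y mem by blast
    have "of_int (a * k - r * l) + of_int l * omega D \<in> root_ideal D a r"
      unfolding mem_root_ideal_iff by simp
    moreover have "y = of_int g * (of_int (a * k - r * l) + of_int l * omega D)"
      by (simp add: mn kl algebra_simps)
    ultimately show "y \<in> (\<lambda>x. of_int g * x) ` root_ideal D a r" by blast
  next
    fix y assume "y \<in> (\<lambda>x. of_int g * x) ` root_ideal D a r"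
    then obtain m n where y: "y = of_int g * (of_int m + of_int n * omega D)" "a dvd m + r * n"
      unfolding root_ideal_def by auto
    then obtain k where "m + r * n = a * k" by auto
    then have "m = a * k - r * n" by simp
    then have "of_int (g * m) + of_int (g * n) * omega D \<in> I" unfolding mem by auto
    then show "y \<in> I" by (simp add: y algebra_simps)
  qed
  moreover have "a dvd omega_poly D r"
  proof -
    \<comment> \<open>Multiplying the generator g(omega - r) by omega' - r gives the integer g
      \<open>omega_poly D r\<close>, which must be a multiple of s = g a.\<close>
    have "(of_int (int D - r) + of_int (-1) * omega D) * (of_int (- g * r) + of_int g * omega D) =
        of_int (g * omega_poly D r) + of_int 0 * omega D"
      unfolding int_mult_form by (simp add: omega_poly_def algebra_simps power2_eq_square)
    moreover have "(of_int (int D - r) + of_int (-1) * omega D) * (of_int (- g * r) + of_int g * omega D) \<in> I"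
      by (intro I'(4) quad_orderI gen)
    ultimately have "g * omega_poly D r \<in> S" by (simp add: S_def)
    then show ?thesis using s(2) a g(1) by simp
  qed
  ultimately show ?thesis using that[of g a r] g(1) a0 by blast
qed

lemma sqrt_in_order: "sqrt (real D) \<in> quad_order D"
  using order_diff[OF order_omega omega'_in_order] omega_diff_omega' by simp

lemma conj_omega' [simp]: "quad_conj D (omega' D) = omega D"
  using conj_conj[OF field_omega] by simp

lemma conj_sqrt [simp]: "quad_conj D (sqrt (real D)) = - sqrt (real D)"
  using conj_diff[OF field_omega field_conj[OF field_omega]]
  by (simp add: omega_diff_omega'[symmetric])

lemma mem_twisted_ideal_iff: "y \<in> twisted_ideal D I \<longleftrightarrow> sqrt (real D) * y \<in> I"
  using sqrt_pos by (auto simp: twisted_ideal_def image_iff field_simps)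

lemma twisted_ideal_field: "ideal I RO \<Longrightarrow> y \<in> twisted_ideal D I \<Longrightarrow> y \<in> quad_field D"
  unfolding twisted_ideal_def ideal_order_iff
  using field_divide[OF order_in_field order_in_field[OF sqrt_in_order]] by auto

text \<open>Conjugation changes the sign of sqrt D, so the trace of x/sqrt D is (x - x')/sqrt D with
  x' the conjugate of x, the omega-coordinate of x. This is why the factor 1/sqrt D makes the trace
  pairing integral.\<close>

lemma trace_div_sqrt:
  "quad_trace D ((of_int m + of_int n * omega D) / sqrt (real D)) = of_int n"
proof -
  have "quad_conj D ((of_int m + of_int n * omega D) / sqrt (real D)) =
      - ((of_int m + of_int n * omega' D) / sqrt (real D))"
    using sqrt_pos by (subst conj_divide) (auto simp: order_in_field[OF quad_orderI] order_in_field[OF sqrt_in_order])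
  then show ?thesis
    using sqrt_pos omega_diff_omega'[of D]
    by (simp add: quad_trace_def field_simps flip: right_diff_distrib)
qed

lemma biadditive_trace_pairing:
  assumes "ideal I RO" shows "biadditive_on (ideal_module D I) (trace_pairing D)"
  using twisted_ideal_field[OF assms] unfolding biadditive_on_def additive_on_def ideal_module_def trace_pairing_def
  by (auto simp: quad_trace_def order_in_field field_add field_mult field_diff algebra_simps)

text \<open>The symplectic basis pairs \<open>1, \<omega> - D + r\<close> with \<open>g(\<omega> - r) / \<surd>D, g a / \<surd>D\<close>.\<close>

lemma form_type_root_ideal:
  assumes g: "0 < g" "0 < a" "int a dvd omega_poly D r"
  shows "form_type (ideal_module D ((\<lambda>x. real g * x) ` root_ideal D a r)) (trace_pairing D) g (g * a)"
proof -
  define s where "s = sqrt (real D)"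
  have s: "s > 0" using sqrt_pos by (simp add: s_def)
  define p q where "p = (\<lambda>i::2. if i = 1 then 1 else r - int D)" and "q = (\<lambda>i::2. if i = 1 then 0 else 1 :: int)"
  \<comment> \<open>The minus signs offset that of the pairing: (x, 0) with (0, y) gives minus the
    trace of x y.\<close>
  define x y where "x = (\<lambda>i::2. if i = 1 then int g * r else - int g * int a)" and "y = (\<lambda>i::2. if i = 1 then - int g else 0)"
  define u where "u = (\<lambda>i. (of_int (p i) + of_int (q i) * omega D, 0::real))"
  define v where "v = (\<lambda>i. (0::real, (of_int (x i) + of_int (y i) * omega D) / s))"
  have comb: "of_int m *\<^sub>R u 1 + of_int n *\<^sub>R u 2 + of_int k *\<^sub>R v 1 + of_int l *\<^sub>R v 2 =
      (of_int (m + n * (r - int D)) + of_int n * omega D,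
       real g * (of_int (k * r - l * int a) + of_int (- k) * omega D) / s)" for m n k l
    using s by (simp add: u_def v_def p_def q_def x_def y_def field_simps)
  have zb: "zbasis (case_sum u v) (ideal_module D ((\<lambda>x. real g * x) ` root_ideal D a r))"
    unfolding zbasis_22_iff comb
  proof (intro conjI allI impI iffI)
    fix x assume "x \<in> ideal_module D ((\<lambda>x. real g * x) ` root_ideal D a r)"
    then obtain M N K L where x: "x = (of_int M + of_int N * omega D, real g * (of_int K + of_int L * omega D) / s)"
      and "int a dvd K + r * L"
      by (auto simp: ideal_module_def twisted_ideal_def root_ideal_def s_def quad_order_eq)
    then obtain t where "K + r * L = int a * t" by auto
    then have "K = (- L) * r - (- t) * int a" by (simp add: algebra_simps)
    then show "\<exists>m n k l. x = (of_int (m + n * (r - int D)) + of_int n * omega D,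
       real g * (of_int (k * r - l * int a) + of_int (- k) * omega D) / s)"
      using x by (intro exI[of _ "M - N * (r - int D)"] exI[of _ N] exI[of _ "- L"] exI[of _ "- t"]) simp
  next
    fix x assume "\<exists>m n k l. x = (of_int (m + n * (r - int D)) + of_int n * omega D,
       real g * (of_int (k * r - l * int a) + of_int (- k) * omega D) / s)"
    then obtain m n k l where "x = (of_int (m + n * (r - int D)) + of_int n * omega D,
       real g * (of_int (k * r - l * int a) + of_int (- k) * omega D) / s)" by blast
    moreover have "of_int (k * r - l * int a) + of_int (- k) * omega D \<in> root_ideal D a r"
      unfolding mem_root_ideal_iff by (simp add: algebra_simps)
    ultimately show "x \<in> ideal_module D ((\<lambda>x. real g * x) ` root_ideal D a r)"
      by (auto simp: ideal_module_def twisted_ideal_def s_def simp del: of_int_add of_int_mult of_int_diff of_int_minus)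
  next
    fix m n k l
    assume "(of_int (m + n * (r - int D)) + of_int n * omega D,
       real g * (of_int (k * r - l * int a) + of_int (- k) * omega D) / s) = 0"
    then have "of_int (m + n * (r - int D)) + of_int n * omega D = 0"
      "of_int (k * r - l * int a) + of_int (- k) * omega D = 0"
      using s g by (simp_all add: zero_prod_def)
    from rat_indep[OF _ _ this(1)] rat_indep[OF _ _ this(2)]
    have "n = 0" "m + n * (r - int D) = 0" "k = 0" "k * r - l * int a = 0"
      by (simp_all del: of_int_add of_int_mult of_int_diff)
    then show "m = 0" "n = 0" "k = 0" "l = 0" using g by auto
  qed
  have T: "trace_pairing D (x, 0) (0, y) = - quad_trace D (x * y)"
      "trace_pairing D (0, y) (x, 0) = quad_trace D (x * y)"
    if "x * y \<in> quad_field D" for x y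
    using that by (simp_all add: trace_pairing_def trace_minus)
  have fld: "(of_int m + of_int n * omega D) / s \<in> quad_field D"
    "(of_int k + of_int l * omega D) * ((of_int m + of_int n * omega D) / s) \<in> quad_field D" for m n k l
    unfolding s_def by (intro field_mult field_divide order_in_field sqrt_in_order quad_orderI)+
  have tr: "quad_trace D ((of_int k + of_int l * omega D) * ((of_int m + of_int n * omega D) / s)) =
      of_int (k * n + l * m + l * n * int D)" for k l m n
    using trace_div_sqrt[of "k * m - l * n * omega_norm D" "k * n + l * m + l * n * int D"]
    unfolding s_def by (simp only: times_divide_eq_right int_mult_form)
  have uv: "trace_pairing D (u i) (v j) = of_int (- (p i * y j + q i * x j + q i * y j * int D))"
    "trace_pairing D (v j) (u i) = - trace_pairing D (u i) (v j)" for i j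
    unfolding u_def v_def T(1,2)[OF fld(2)] tr by simp_all
  have "- (p i * y j + q i * x j + q i * y j * int D) = (if i \<noteq> j then 0 else if i = 1 then int g else int (g * a))" for i j
    using exhaust_2[of i] exhaust_2[of j] by (elim disjE) (simp_all add: p_def q_def x_def y_def algebra_simps)
  then have "trace_pairing D (u i) (v j) = (if i \<noteq> j then 0 else if i = 1 then real g else real (g * a))" for i j
    unfolding uv(1) by (simp only:) simp
  moreover have "trace_pairing D (u i) (u j) = 0" "trace_pairing D (v i) (v j) = 0" for i j
    by (simp_all add: u_def v_def trace_pairing_def quad_trace_def)
  ultimately show ?thesis
    using g zb uv(2) unfolding form_type_def by (intro conjI exI[of _ u] exI[of _ v] allI) auto
qed

lemma ideal_scale_root_ideal:
  assumes "int a dvd omega_poly D r"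
  shows "ideal ((\<lambda>x. real g * x) ` root_ideal D a r) RO"
proof -
  have I: "root_ideal D a r \<subseteq> quad_order D" "0 \<in> root_ideal D a r"
    "\<And>x y. x \<in> root_ideal D a r \<Longrightarrow> y \<in> root_ideal D a r \<Longrightarrow> x + y \<in> root_ideal D a r"
    "\<And>k x. k \<in> quad_order D \<Longrightarrow> x \<in> root_ideal D a r \<Longrightarrow> k * x \<in> root_ideal D a r"
    using ideal_root_ideal[OF assms] unfolding ideal_order_iff by auto
  show ?thesis
    unfolding ideal_order_iff
  proof (intro conjI ballI)
    show "(\<lambda>x. real g * x) ` root_ideal D a r \<subseteq> quad_order D"
      using I(1) order_mult order_int[of "int g"] by auto
    show "0 \<in> (\<lambda>x. real g * x) ` root_ideal D a r" using I(2) by force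
  next
    fix x y assume "x \<in> (\<lambda>x. real g * x) ` root_ideal D a r" "y \<in> (\<lambda>x. real g * x) ` root_ideal D a r"
    then show "x + y \<in> (\<lambda>x. real g * x) ` root_ideal D a r" using I(3) by (auto simp flip: distrib_left)
  next
    fix k x assume "k \<in> quad_order D" "x \<in> (\<lambda>x. real g * x) ` root_ideal D a r"
    then show "k * x \<in> (\<lambda>x. real g * x) ` root_ideal D a r" using I(4) by (auto simp: mult.left_commute)
  qed
qed

text \<open>The normal form of the ideal has some type (g, g a) by
  \<open>form_type_root_ideal\<close>, and uniqueness of the type forces g = d1 and a = d2/d1. The
  zero ideal is excluded because its pairing vanishes.\<close>

lemma type_idealsE:
  assumes "\<aa> \<in> type_ideals D d1 d2"
  obtains r where "int (d2 div d1) dvd omega_poly D r" "\<aa> = (\<lambda>x. real d1 * x) ` root_ideal D (d2 div d1) r"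
    "d2 = d1 * (d2 div d1)" "0 < d1" "0 < d2 div d1"
proof -
  have I: "ideal \<aa> RO" and t: "form_type (ideal_module D \<aa>) (trace_pairing D) d1 d2"
    using assms by (auto simp: type_ideals_def)
  have "\<aa> \<noteq> {0}"
  proof
    assume "\<aa> = {0}"
    then have z: "trace_pairing D x y = 0" if "x \<in> ideal_module D \<aa>" "y \<in> ideal_module D \<aa>" for x y
      using that by (auto simp: ideal_module_def twisted_ideal_def trace_pairing_def quad_trace_def)
    show False
    proof (rule form_typeE[OF t])
      fix u v :: "2 \<Rightarrow> real \<times> real"
      assume uv: "0 < d1" "zbasis (case_sum u v) (ideal_module D \<aa>)" "trace_pairing D (u 1) (v 1) = real d1"
      show False using z[OF symplectic_mem[OF uv(2)], of 1 1] uv by simp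
    qed
  qed
  then obtain g a r where gar: "0 < g" "0 < a" "a dvd omega_poly D r" "\<aa> = (\<lambda>x. of_int g * x) ` root_ideal D a r"
    using ideal_normal_form[OF I] by metis
  obtain g' a' where ga: "g = int g'" "a = int a'" using gar by (metis less_imp_le nonneg_int_cases)
  have "form_type (ideal_module D \<aa>) (trace_pairing D) g' (g' * a')"
    using form_type_root_ideal[of g' a' r] gar by (simp add: ga)
  then have "d1 = g'" "d2 = g' * a'"
    using form_type_unique[OF t _ biadditive_trace_pairing[OF I]] by auto
  then show ?thesis using that[of r] gar ga by simp
qed

text \<open>The ideal determines r modulo n because, after division by d1, it contains omega - r;
  conversely it depends only on r modulo n.\<close>

lemma card_type_ideals:
  assumes d: "0 < d1" "d1 dvd d2" "0 < d2"
  shows "card (type_ideals D d1 d2) = card (omega_roots D (d2 div d1))"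
proof -
  define n where "n = d2 div d1"
  have n: "0 < n" "d2 = d1 * n" using d by (auto simp: n_def elim!: dvdE)
  let ?f = "\<lambda>r. (\<lambda>x. real d1 * x) ` root_ideal D n r"
  have "inj_on ?f (omega_roots D n)"
  proof (rule inj_onI)
    fix r s assume rs: "r \<in> omega_roots D n" "s \<in> omega_roots D n" "?f r = ?f s"
    have "root_ideal D n r = root_ideal D n s"
      using rs(3) d(1) by (subst (asm) inj_image_eq_iff) (auto intro!: injI)
    moreover have "of_int (- r) + of_int 1 * omega D \<in> root_ideal D n r"
      unfolding mem_root_ideal_iff by simp
    ultimately have "int n dvd s - r" by (simp add: mem_root_ideal_iff del: of_int_1 of_int_minus)
    then have "[r = s] (mod int n)" by (simp add: cong_iff_dvd_diff dvd_diff_commute)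
    then show "r = s" using rs by (intro cong_less_imp_eq_int[of r "int n" s]) (auto simp: omega_roots_def)
  qed
  moreover have "?f ` omega_roots D n = type_ideals D d1 d2"
  proof (intro equalityI subsetI)
    fix x assume "x \<in> ?f ` omega_roots D n"
    then obtain r where "x = ?f r" "int n dvd omega_poly D r" by (auto simp: omega_roots_def)
    then show "x \<in> type_ideals D d1 d2"
      using form_type_root_ideal[OF d(1) n(1)] ideal_scale_root_ideal n(2) by (simp add: type_ideals_def)
  next
    fix x assume "x \<in> type_ideals D d1 d2"
    then obtain r where r: "int n dvd omega_poly D r" "x = ?f r"
      unfolding n_def by (rule type_idealsE)
    have "root_ideal D n r = root_ideal D n (r mod int n)"
    proof -
      have "int n dvd k + r * l \<longleftrightarrow> int n dvd k + (r mod int n) * l" for k l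
        by (intro cong_dvd_iff) (auto simp: cong_def intro!: mod_add_cong mod_mult_cong)
      then show ?thesis by (simp add: root_ideal_def)
    qed
    then show "x \<in> ?f ` omega_roots D n"
      using r mod_in_omega_roots_iff[OF n(1)] by auto
  qed
  ultimately show ?thesis unfolding n_def by (metis card_image)
qed

end

section \<open>Symplectic modules over the order\<close>

lemma common_denominator:
  fixes x :: "'i \<Rightarrow> rat"
  assumes "finite A"
  shows "\<exists>d::int. 0 < d \<and> (\<forall>i\<in>A. \<exists>m::int. of_int d * x i = of_int m)"
  using assms
proof (induction A)
  case empty
  then show ?case by (intro exI[of _ 1]) auto
next
  case (insert j A)
  then obtain d where d: "0 < d" "\<forall>i\<in>A. \<exists>m::int. of_int d * x i = of_int m" by blast
  obtain a b where ab: "x j = Fract a b" "b > 0" by (cases "x j") auto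
  show ?case
  proof (rule exI[of _ "d * b"], rule conjI, goal_cases)
    case 1
    show ?case using d ab by simp
  next
    case 2
    show ?case
    proof
    fix i assume "i \<in> insert j A"
    then consider "i = j" | "i \<in> A" by blast
    then show "\<exists>m::int. of_int (d * b) * x i = of_int m"
    proof cases
      case 1
      then have "of_int (d * b) * x i = of_int (d * a)"
        using ab by (simp add: Fract_of_int_quotient)
      then show ?thesis by blast
    next
      case 2
      then obtain m where "of_int d * x i = of_int m" using d by blast
      then have "of_int (d * b) * x i = of_int (b * m)" by (simp add: mult.commute mult.left_commute)
      then show ?thesis by blast
    qed
    qed
  qed
qed

text \<open>As many integrally independent vectors as the rank span a subgroup of finite index: the
  coordinate matrix is injective over the rationals after clearing denominators, hence invertible,
  and N is a common denominator of the inverse.\<close>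

lemma zbasis_full_rank:
  fixes b c :: "'i::finite \<Rightarrow> 'a::real_vector"
  assumes b: "zbasis b L" and c: "\<And>i. c i \<in> L"
    and ind: "\<And>k. (\<Sum>i\<in>UNIV. of_int (k i) *\<^sub>R c i) = 0 \<Longrightarrow> k = (\<lambda>_. 0)"
  shows "\<exists>N::int. 0 < N \<and> (\<forall>l\<in>L. \<exists>k. of_int N *\<^sub>R l = (\<Sum>i\<in>UNIV. of_int (k i) *\<^sub>R c i))"
proof -
  have "\<forall>j. \<exists>a. c j = (\<Sum>i\<in>UNIV. of_int (a i) *\<^sub>R b i)"
    using zbasis_span[OF b c] by metis
  then obtain A where A: "\<And>j. c j = (\<Sum>i\<in>UNIV. of_int (A j i) *\<^sub>R b i)" by metis
  have comb: "(\<Sum>j\<in>UNIV. of_int (k j) *\<^sub>R c j) = (\<Sum>i\<in>UNIV. of_int (\<Sum>j\<in>UNIV. k j * A j i) *\<^sub>R b i)" for k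
  proof -
    have "(\<Sum>j\<in>UNIV. of_int (k j) *\<^sub>R c j) = (\<Sum>j\<in>UNIV. \<Sum>i\<in>UNIV. of_int (k j * A j i) *\<^sub>R b i)"
      by (simp add: A scaleR_sum_right)
    also have "\<dots> = (\<Sum>i\<in>UNIV. \<Sum>j\<in>UNIV. of_int (k j * A j i) *\<^sub>R b i)" by (rule sum.swap)
    finally show ?thesis by (simp add: scaleR_sum_left)
  qed
  define M :: "rat^'i^'i" where "M = (\<chi> i j. of_int (A j i))"
  have "inj ((*v) M)"
  proof (rule injI)
    fix x y assume "M *v x = M *v y"
    then have z: "M *v (x - y) = 0" by (simp add: matrix_vector_mult_diff_distrib)
    obtain d m where d: "0 < d" and m: "\<And>i. of_int d * (x - y) $ i = of_int (m i)"
      using common_denominator[of "UNIV :: 'i set" "\<lambda>i. (x - y) $ i"] by (auto, metis)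
    have "(\<Sum>j\<in>UNIV. m j * A j i) = 0" for i
    proof -
      have "rat_of_int (\<Sum>j\<in>UNIV. m j * A j i) = (\<Sum>j\<in>UNIV. of_int (A j i) * of_int (m j))"
        by (simp add: mult.commute)
      also have "\<dots> = of_int d * (\<Sum>j\<in>UNIV. of_int (A j i) * (x - y) $ j)"
        unfolding m[symmetric] by (simp add: sum_distrib_left mult_ac)
      also have "(\<Sum>j\<in>UNIV. of_int (A j i) * (x - y) $ j) = (M *v (x - y)) $ i"
        by (simp add: M_def matrix_vector_mult_def)
      finally show ?thesis using z by (metis mult_zero_right of_int_eq_0_iff zero_index)
    qed
    then have "m = (\<lambda>_. 0)" by (intro ind) (simp add: comb)
    then have "(x - y) $ i = 0" for i using m[of i] d by simp
    then show "x = y" by (simp add: vec_eq_iff)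
  qed
  then obtain B where "B ** M = mat 1" using matrix_left_invertible_injective by blast
  then have MB: "M ** B = mat 1" by (simp add: matrix_left_right_inverse)
  obtain N where N: "0 < N" "\<forall>(i, j)\<in>UNIV. \<exists>m::int. of_int N * B $ i $ j = of_int m"
    using common_denominator[of "UNIV :: ('i \<times> 'i) set" "\<lambda>(i, j). B $ i $ j"] by (auto simp: split_def)
  then obtain C where C: "\<And>i j. of_int N * B $ i $ j = of_int (C i j)" by (simp, metis)
  have CN: "(\<Sum>j\<in>UNIV. C j i' * A j i) = (if i = i' then N else 0)" for i i'
  proof -
    have "rat_of_int (\<Sum>j\<in>UNIV. C j i' * A j i) = (\<Sum>j\<in>UNIV. of_int (A j i) * of_int (C j i'))"
      by (simp add: mult.commute)
    also have "\<dots> = of_int N * (M ** B) $ i $ i'"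
      unfolding C[symmetric] by (simp add: M_def matrix_matrix_mult_def sum_distrib_left mult_ac)
    also have "\<dots> = of_int (if i = i' then N else 0)" by (simp add: MB mat_def)
    finally show ?thesis by (simp only: of_int_eq_iff)
  qed
  have bN: "of_int N *\<^sub>R b i' = (\<Sum>j\<in>UNIV. of_int (C j i') *\<^sub>R c j)" for i'
  proof -
    have "(\<Sum>j\<in>UNIV. of_int (C j i') *\<^sub>R c j) = (\<Sum>i\<in>UNIV. if i = i' then of_int N *\<^sub>R b i else 0)"
      unfolding comb CN by (intro sum.cong) auto
    then show ?thesis by simp
  qed
  show ?thesis
  proof (intro exI[of _ N] conjI ballI N(1))
    fix l assume "l \<in> L"
    with b obtain k where k: "l = (\<Sum>i\<in>UNIV. of_int (k i) *\<^sub>R b i)" by (rule zbasis_span)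
    have "of_int N *\<^sub>R l = (\<Sum>i\<in>UNIV. of_int (k i) *\<^sub>R (of_int N *\<^sub>R b i))"
      by (simp add: k scaleR_sum_right mult.commute)
    also have "\<dots> = (\<Sum>i\<in>UNIV. \<Sum>j\<in>UNIV. of_int (k i * C j i) *\<^sub>R c j)"
      unfolding bN by (simp add: scaleR_sum_right)
    also have "\<dots> = (\<Sum>j\<in>UNIV. \<Sum>i\<in>UNIV. of_int (k i * C j i) *\<^sub>R c j)" by (rule sum.swap)
    also have "\<dots> = (\<Sum>j\<in>UNIV. of_int (\<Sum>i\<in>UNIV. k i * C j i) *\<^sub>R c j)" by (simp add: scaleR_sum_left)
    finally show "\<exists>k. of_int N *\<^sub>R l = (\<Sum>i\<in>UNIV. of_int (k i) *\<^sub>R c i)"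
      by (intro exI[of _ "\<lambda>j. \<Sum>i\<in>UNIV. k i * C j i"])
  qed
qed

lemma (in quad_disc) ideal_zbasis:
  assumes M: "ideal M RO" "M \<noteq> {0}"
  shows "\<exists>b::2 \<Rightarrow> real. zbasis b M"
proof -
  obtain g a r where gar: "0 < g" "0 < a" "a dvd omega_poly D r" "M = (\<lambda>x. of_int g * x) ` root_ideal D a r"
    using ideal_normal_form[OF M] by metis
  have "zbasis (\<lambda>i::2. if i = 1 then real_of_int g * of_int a else of_int g * (of_int (- r) + of_int 1 * omega D)) M"
    unfolding zbasis_2_iff
  proof (intro conjI allI impI iffI)
    fix x assume "x \<in> M"
    then obtain m n where x: "x = of_int g * (of_int m + of_int n * omega D)" "a dvd m + r * n"
      unfolding gar(4) root_ideal_def by auto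
    then obtain s where "m + r * n = a * s" by auto
    then have "m = a * s - r * n" by simp
    with x(1) have x': "x = of_int g * (of_int (a * s - r * n) + of_int n * omega D)" by (simp only:)
    show "\<exists>m n. x = of_int m *\<^sub>R (if (1::2) = 1 then real_of_int g * of_int a else of_int g * (of_int (- r) + of_int 1 * omega D)) +
        of_int n *\<^sub>R (if (2::2) = 1 then real_of_int g * of_int a else of_int g * (of_int (- r) + of_int 1 * omega D))"
      by (rule exI[of _ s], rule exI[of _ n]) (simp add: x' algebra_simps)
  next
    fix x assume "\<exists>m n. x = of_int m *\<^sub>R (if (1::2) = 1 then real_of_int g * of_int a else of_int g * (of_int (- r) + of_int 1 * omega D)) +
        of_int n *\<^sub>R (if (2::2) = 1 then real_of_int g * of_int a else of_int g * (of_int (- r) + of_int 1 * omega D))"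
    then obtain m n where "x = of_int g * (of_int (m * a - r * n) + of_int n * omega D)"
      by (auto simp: algebra_simps)
    moreover have "of_int (m * a - r * n) + of_int n * omega D \<in> root_ideal D a r"
      unfolding mem_root_ideal_iff by simp
    ultimately show "x \<in> M" unfolding gar(4) by blast
  next
    fix m n :: int
    assume "of_int m *\<^sub>R (if (1::2) = 1 then real_of_int g * of_int a else of_int g * (of_int (- r) + of_int 1 * omega D)) +
        of_int n *\<^sub>R (if (2::2) = 1 then real_of_int g * of_int a else of_int g * (of_int (- r) + of_int 1 * omega D)) = 0"
    then have "of_int g * (of_int (m * a - r * n) + of_int n * omega D) = 0" by (simp add: algebra_simps)
    then have "of_int (m * a - r * n) + of_int n * omega D = of_int 0 + of_int 0 * omega D" using gar(1) by simp
    then have "m * a - r * n = 0 \<and> n = 0" by (rule int_unique)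
    then show "m = 0" "n = 0" using gar(2) by auto
  qed
  then show ?thesis by blast
qed

text \<open>The lattice of a polarized surface is an instance, with \<open>\<rho> k\<close> as
  action and the imaginary part of the Hermitian form as E. All laws are required on L and the order
  only, since the action of K does not preserve L.\<close>

locale symplectic_order_module = quad_conductor D \<Delta> f for D \<Delta> f +
  fixes L :: "'a::real_vector set" and act :: "real \<Rightarrow> 'a \<Rightarrow> 'a" and E :: "'a \<Rightarrow> 'a \<Rightarrow> real" and d1 d2 :: nat
  assumes act_closed: "k \<in> quad_order D \<Longrightarrow> v \<in> L \<Longrightarrow> act k v \<in> L"
    and act_vadd: "k \<in> quad_order D \<Longrightarrow> v \<in> L \<Longrightarrow> w \<in> L \<Longrightarrow> act k (v + w) = act k v + act k w"
    and act_add: "k \<in> quad_order D \<Longrightarrow> l \<in> quad_order D \<Longrightarrow> v \<in> L \<Longrightarrow> act (k + l) v = act k v + act l v"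
    and act_mult: "k \<in> quad_order D \<Longrightarrow> l \<in> quad_order D \<Longrightarrow> v \<in> L \<Longrightarrow> act (k * l) v = act k (act l v)"
    and act_one: "v \<in> L \<Longrightarrow> act 1 v = v"
    and E_add: "biadditive_on L E"
    and E_anti: "v \<in> L \<Longrightarrow> w \<in> L \<Longrightarrow> E w v = - E v w"
    and E_act: "k \<in> quad_order D \<Longrightarrow> v \<in> L \<Longrightarrow> w \<in> L \<Longrightarrow> E (act k v) w = E v (act k w)"
    and E_type: "form_type L E d1 d2"
begin

lemma lattice_basis: obtains b :: "2 + 2 \<Rightarrow> 'a" where "zbasis b L"
  using E_type unfolding form_type_def by blast

lemma L_0: "0 \<in> L"
  by (rule lattice_basis) (rule zbasis_subgroup(1))

lemma L_add: "x \<in> L \<Longrightarrow> y \<in> L \<Longrightarrow> x + y \<in> L"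
  by (rule lattice_basis) (rule zbasis_subgroup(2))

lemma L_scale: "x \<in> L \<Longrightarrow> of_int n *\<^sub>R x \<in> L"
  by (rule lattice_basis) (rule zbasis_subgroup(3))

lemma L_diff: "x \<in> L \<Longrightarrow> y \<in> L \<Longrightarrow> x - y \<in> L"
  by (rule lattice_basis) (rule zbasis_subgroup(4))

lemma L_minus: "x \<in> L \<Longrightarrow> - x \<in> L"
  by (rule lattice_basis) (rule zbasis_subgroup(5))

lemma act_int:
  assumes v: "v \<in> L" shows "act (of_int n) v = of_int n *\<^sub>R v"
proof -
  have "additive_on (quad_order D) (\<lambda>k. act k v)"
    unfolding additive_on_def using act_add v by blast
  then have "act (of_int n *\<^sub>R 1) v = of_int n *\<^sub>R act 1 v"
    by (intro additive_on_scale[where L = "quad_order D" and f = "\<lambda>k. act k v"])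
      (auto intro: order_0 order_add order_minus order_1)
  then show ?thesis by (simp add: act_one[OF v])
qed

lemma act_scale:
  assumes "k \<in> quad_order D" "v \<in> L" shows "act k (of_int n *\<^sub>R v) = of_int n *\<^sub>R act k v"
proof -
  have "act k (of_int n *\<^sub>R v) = act (k * of_int n) v"
    by (simp only: act_mult[OF assms(1) order_int assms(2)] act_int[OF assms(2)])
  also have "\<dots> = act (of_int n * k) v" by (simp only: mult.commute)
  also have "\<dots> = of_int n *\<^sub>R act k v"
    by (simp only: act_mult[OF order_int assms] act_int[OF act_closed[OF assms]])
  finally show ?thesis .
qed

lemma act_diff: "k \<in> quad_order D \<Longrightarrow> v \<in> L \<Longrightarrow> w \<in> L \<Longrightarrow> act k (v - w) = act k v - act k w"
  using act_vadd[of k "v - w" w] L_diff[of v w] by simp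

lemma act_0: "v \<in> L \<Longrightarrow> act 0 v = 0"
  using act_int[of v 0] by simp

lemma act_form: "v \<in> L \<Longrightarrow> act (of_int m + of_int n * omega D) v = of_int m *\<^sub>R v + of_int n *\<^sub>R act (omega D) v"
  by (simp add: act_add order_int order_mult order_omega act_mult act_int act_closed)

lemma act_minus: "k \<in> quad_order D \<Longrightarrow> v \<in> L \<Longrightarrow> act (- k) v = - act k v"
  using act_mult[of "-1" k v] act_int[of "act k v" "-1"] act_closed[of k v] order_int[of "-1"] by simp

lemma act_sub: "k \<in> quad_order D \<Longrightarrow> l \<in> quad_order D \<Longrightarrow> v \<in> L \<Longrightarrow> act (k - l) v = act k v - act l v"
  using act_add[of k "- l" v] act_minus[of l v] order_minus by simp

lemma E_addl: "x \<in> L \<Longrightarrow> y \<in> L \<Longrightarrow> z \<in> L \<Longrightarrow> E (x + y) z = E x z + E y z"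
  and E_addr: "x \<in> L \<Longrightarrow> y \<in> L \<Longrightarrow> z \<in> L \<Longrightarrow> E z (x + y) = E z x + E z y"
  using E_add by (auto simp: biadditive_on_def additive_on_def)

lemma E_scaler: "x \<in> L \<Longrightarrow> z \<in> L \<Longrightarrow> E z (of_int n *\<^sub>R x) = of_int n * E z x"
  and E_scalel: "x \<in> L \<Longrightarrow> z \<in> L \<Longrightarrow> E (of_int n *\<^sub>R x) z = of_int n * E x z"
  using additive_on_scale[of L "E z" x n] additive_on_scale[of L "\<lambda>x. E x z" x n] E_add L_0 L_add L_minus
  by (auto simp: biadditive_on_def)

text \<open>Self-adjointness moves both scalars to one side in either order, so E(v, k l v) equals
  E(k l v, v), which is its negative.\<close>

lemma E_isotropic:
  assumes "v \<in> L" "k \<in> quad_order D" "l \<in> quad_order D"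
  shows "E (act k v) (act l v) = 0"
proof -
  have "E (act k v) (act l v) = E v (act (k * l) v)"
    using assms by (simp add: E_act act_closed act_mult)
  moreover have "E v (act (k * l) v) = E (act (k * l) v) v"
    using assms by (simp add: E_act order_mult act_closed)
  moreover have "E (act (k * l) v) v = - E v (act (k * l) v)"
    using assms by (intro E_anti) (auto simp: order_mult act_closed)
  ultimately show ?thesis by linarith
qed

lemma E_Ints: "v \<in> L \<Longrightarrow> w \<in> L \<Longrightarrow> \<exists>c. E v w = of_int c * real d1"
  using form_type_values[OF E_type E_add] .

lemma E_nondeg:
  assumes "v \<in> L" "\<And>w. w \<in> L \<Longrightarrow> E v w = 0" shows "v = 0"
proof (rule form_typeE[OF E_type])
  fix u w :: "2 \<Rightarrow> 'a"
  assume b: "0 < d1" "0 < d2" "zbasis (case_sum u w) L"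
    "\<forall>i j. E (u i) (u j) = 0" "\<forall>i j. E (w i) (w j) = 0"
    "E (u 1) (w 1) = real d1" "E (u 1) (w 2) = 0" "E (u 2) (w 1) = 0" "E (u 2) (w 2) = real d2"
    "E (w 1) (u 1) = - real d1" "E (w 2) (u 1) = 0" "E (w 1) (u 2) = 0" "E (w 2) (u 2) = - real d2"
  obtain m n k l where v: "v = of_int m *\<^sub>R u 1 + of_int n *\<^sub>R u 2 + of_int k *\<^sub>R w 1 + of_int l *\<^sub>R w 2"
    using b(3) assms(1) by (rule zbasis_22_span)
  note M = symplectic_mem[OF b(3)]
  note C = symplectic_coordinates(1)[OF b(3) E_add v]
  have "m = 0" "n = 0" "k = 0" "l = 0"
    using C[OF M(1), of 1] C[OF M(1), of 2] C[OF M(2), of 1] C[OF M(2), of 2] assms(2)[OF M(1)] assms(2)[OF M(2)] b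
    by auto
  then show "v = 0" using v by simp
qed

text \<open>L is torsion-free over the order: applying the conjugate of k turns k into its norm, a
  nonzero integer.\<close>

lemma act_eq_0:
  assumes "k \<in> quad_order D" "v \<in> L" "act k v = 0" "v \<noteq> 0" shows "k = 0"
proof (rule ccontr)
  assume k: "k \<noteq> 0"
  have "quad_conj D k * k \<in> \<int>"
    using conj_mult_rat[OF order_in_field[OF assms(1)]] order_mult[OF order_conj[OF assms(1)] assms(1)]
    by (intro order_rat) (simp_all add: mult.commute)
  then obtain n where n: "quad_conj D k * k = of_int n" by (auto elim: Ints_cases)
  have "of_int n *\<^sub>R v = act (quad_conj D k * k) v" by (simp only: n act_int assms(2))
  also have "\<dots> = act (quad_conj D k) (act k v)" using assms order_conj by (intro act_mult)
  also have "\<dots> = 0"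
    using act_vadd[of "quad_conj D k" 0 0] assms(1,3) L_0 order_conj by simp
  finally have "n = 0" using assms(4) by simp
  with n k show False using assms(1) by (simp add: order_in_field)
qed

section \<open>The action modulo a prime\<close>

definition pdvd :: "int \<Rightarrow> 'a \<Rightarrow> bool" where
  "pdvd p v \<longleftrightarrow> (\<exists>w\<in>L. v = of_int p *\<^sub>R w)"

lemma pdvd_add: "pdvd p v \<Longrightarrow> pdvd p w \<Longrightarrow> pdvd p (v + w)"
  unfolding pdvd_def using L_add by (metis scaleR_add_right)

lemma pdvd_scale: "pdvd p v \<Longrightarrow> pdvd p (of_int n *\<^sub>R v)"
  unfolding pdvd_def using L_scale by (metis scaleR_left_commute)

lemma pdvd_diff: "pdvd p v \<Longrightarrow> pdvd p w \<Longrightarrow> pdvd p (v - w)"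
  unfolding pdvd_def using L_diff by (metis scaleR_diff_right)

lemma pdvd_multiple: "v \<in> L \<Longrightarrow> p dvd n \<Longrightarrow> pdvd p (of_int n *\<^sub>R v)"
  unfolding pdvd_def using L_scale by (auto elim!: dvdE intro!: bexI[of _ "of_int (n div p) *\<^sub>R v"])

lemma pdvd_in: "pdvd p v \<Longrightarrow> v \<in> L"
  unfolding pdvd_def using L_scale by blast

lemma pdvd_act: "pdvd p v \<Longrightarrow> k \<in> quad_order D \<Longrightarrow> pdvd p (act k v)"
  unfolding pdvd_def using act_closed act_scale by metis

lemma pdvd_cancel:
  assumes p: "prime p" and v: "v \<in> L" "pdvd p (of_int n *\<^sub>R v)" "\<not> p dvd n"
  shows "pdvd p v"
proof -
  have "coprime n p" using p v(3) by (metis coprime_commute prime_imp_coprime)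
  then obtain a b where ab: "a * n + b * p = 1" by (metis bezout_int coprime_iff_gcd_eq_1)
  have "v = of_int (a * n + b * p) *\<^sub>R v" using ab by simp
  also have "\<dots> = of_int a *\<^sub>R (of_int n *\<^sub>R v) + of_int (b * p) *\<^sub>R v" by (simp add: scaleR_add_left)
  also have "pdvd p \<dots>"
    by (rule pdvd_add[OF pdvd_scale[OF v(2)] pdvd_multiple[OF v(1)]]) simp
  finally show ?thesis .
qed

text \<open>The vectors v and omega v are linearly independent in L/pL; equivalently, an element k
  of the order satisfies k v in pL only if k lies in p times the order.\<close>

definition good :: "int \<Rightarrow> 'a \<Rightarrow> bool" where
  "good p v \<longleftrightarrow> (\<forall>x y::int. pdvd p (of_int x *\<^sub>R v + of_int y *\<^sub>R act (omega D) v) \<longrightarrow> p dvd x \<and> p dvd y)"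

text \<open>In L/pL the image of v is zero or an eigenvector of omega with eigenvalue c.\<close>

definition eigen :: "int \<Rightarrow> int \<Rightarrow> 'a \<Rightarrow> bool" where
  "eigen p c v \<longleftrightarrow> pdvd p (act (omega D - of_int c) v)"

lemma act_omega_diff: "v \<in> L \<Longrightarrow> act (omega D - of_int c) v = act (omega D) v - of_int c *\<^sub>R v"
  by (simp add: act_sub order_omega order_int act_int)

text \<open>A nontrivial relation x v + y omega v = 0 in L/pL with v nonzero there has y invertible,
  so it can be solved for omega v.\<close>

lemma bad_eigen:
  assumes p: "prime p" and v: "v \<in> L" "\<not> good p v"
  shows "\<exists>c. eigen p c v"
proof (cases "pdvd p v")
  case True
  then have "eigen p 0 v" unfolding eigen_def using pdvd_act order_omega by simp
  then show ?thesis by blast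
next
  case False
  obtain x y where xy: "pdvd p (of_int x *\<^sub>R v + of_int y *\<^sub>R act (omega D) v)" "\<not> (p dvd x \<and> p dvd y)"
    using v(2) unfolding good_def by blast
  have "\<not> p dvd y"
  proof
    assume y: "p dvd y"
    then have "pdvd p (of_int x *\<^sub>R v)"
      using pdvd_diff[OF xy(1) pdvd_multiple[OF act_closed[OF order_omega v(1)] y]] by simp
    then show False using pdvd_cancel[OF p v(1)] xy(2) y False by blast
  qed
  then have "coprime y p" using p by (metis coprime_commute prime_imp_coprime)
  then obtain a b where ab: "a * y + b * p = 1" by (metis bezout_int coprime_iff_gcd_eq_1)
  have "act (omega D) v - of_int (- a * x) *\<^sub>R v =
      of_int (a * y + b * p) *\<^sub>R act (omega D) v + of_int (a * x) *\<^sub>R v" by (simp add: ab)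
  also have "\<dots> = of_int a *\<^sub>R (of_int x *\<^sub>R v + of_int y *\<^sub>R act (omega D) v) + of_int (b * p) *\<^sub>R act (omega D) v"
    by (simp add: algebra_simps)
  also have "pdvd p \<dots>"
    by (rule pdvd_add[OF pdvd_scale[OF xy(1)] pdvd_multiple[OF act_closed[OF order_omega v(1)]]]) simp
  finally have "eigen p (- a * x) v" unfolding eigen_def act_omega_diff[OF v(1)] .
  then show ?thesis by blast
qed

lemma eigen_cong:
  assumes "v \<in> L" "eigen p c v" "p dvd c - c'" shows "eigen p c' v"
proof -
  have "act (omega D) v - of_int c' *\<^sub>R v = (act (omega D) v - of_int c *\<^sub>R v) + of_int (c - c') *\<^sub>R v"
    by (simp add: algebra_simps)
  then show ?thesis
    using assms pdvd_add pdvd_multiple unfolding eigen_def act_omega_diff[OF assms(1)] by metis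
qed

text \<open>An operator for which every vector is an eigenvector is a scalar. The eigenvalues of v,
  v0 and v + v0 are compared in L/pL.\<close>

lemma eigen_scalar:
  assumes p: "prime p" and S: "S \<subseteq> L" "\<And>v w. v \<in> S \<Longrightarrow> w \<in> S \<Longrightarrow> v + w \<in> S"
    and eig: "\<And>v. v \<in> S \<Longrightarrow> \<exists>c. eigen p c v"
  shows "\<exists>c. \<forall>v\<in>S. eigen p c v"
proof (cases "\<forall>v\<in>S. pdvd p v")
  case True
  then have "\<forall>v\<in>S. eigen p 0 v" unfolding eigen_def using pdvd_act order_omega by simp
  then show ?thesis by blast
next
  case False
  then obtain v0 where v0: "v0 \<in> S" "\<not> pdvd p v0" by blast
  obtain c0 where c0: "eigen p c0 v0" using eig v0 by blast
  have "eigen p c0 v" if v: "v \<in> S" for v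
  proof -
    have L: "v \<in> L" "v0 \<in> L" using S(1) v v0 by auto
    obtain c where c: "eigen p c v" using eig v by blast
    obtain m where m: "eigen p m (v + v0)" using eig S(2) v v0 by blast
    have "pdvd p ((act (omega D) (v + v0) - of_int m *\<^sub>R (v + v0)) - (act (omega D) v - of_int c *\<^sub>R v)
        - (act (omega D) v0 - of_int c0 *\<^sub>R v0))"
      using pdvd_diff[OF pdvd_diff[OF m[unfolded eigen_def] c[unfolded eigen_def]] c0[unfolded eigen_def]]
      unfolding act_omega_diff[OF L(1)] act_omega_diff[OF L(2)] act_omega_diff[OF L_add[OF L]] .
    also have "(act (omega D) (v + v0) - of_int m *\<^sub>R (v + v0)) - (act (omega D) v - of_int c *\<^sub>R v)
        - (act (omega D) v0 - of_int c0 *\<^sub>R v0) = of_int (c - m) *\<^sub>R v + of_int (c0 - m) *\<^sub>R v0"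
      using L by (simp add: act_vadd order_omega algebra_simps)
    finally have d: "pdvd p (of_int (c - m) *\<^sub>R v + of_int (c0 - m) *\<^sub>R v0)" .
    show ?thesis
    proof (cases "p dvd c - m")
      case True
      then have "pdvd p (of_int (c0 - m) *\<^sub>R v0)"
        using pdvd_diff[OF d pdvd_multiple[OF L(1) True]] by simp
      then have "p dvd c0 - m" using pdvd_cancel[OF p L(2)] v0 by blast
      then have "p dvd (c - m) - (c0 - m)" using True by (simp only: dvd_diff)
      then show ?thesis using eigen_cong[OF L(1) c, of c0] by simp
    next
      case False
      \<comment> \<open>Here v is a multiple of v0 in L/pL, so it inherits the eigenvalue of
        v0.\<close>
      have "of_int (c - m) *\<^sub>R act (omega D - of_int c0) v =
          act (omega D - of_int c0) (of_int (c - m) *\<^sub>R v + of_int (c0 - m) *\<^sub>R v0) -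
          of_int (c0 - m) *\<^sub>R act (omega D - of_int c0) v0"
        using L by (simp add: act_vadd act_scale L_scale order_diff order_omega order_int del: of_int_diff)
      also have "pdvd p \<dots>"
        by (rule pdvd_diff[OF pdvd_act[OF d order_diff[OF order_omega order_int]] pdvd_scale[OF c0[unfolded eigen_def]]])
      finally show ?thesis
        unfolding eigen_def using pdvd_cancel[OF p act_closed[OF order_diff[OF order_omega order_int] L(1)]] False
        by blast
    qed
  qed
  then show ?thesis by blast
qed

lemma good_cong:
  assumes "v \<in> L" "good p v" "pdvd p (w - v)"
  shows "good p w"
  unfolding good_def
proof (intro allI impI)
  fix x y assume xy: "pdvd p (of_int x *\<^sub>R w + of_int y *\<^sub>R act (omega D) w)"
  have w: "w \<in> L" using L_add[OF pdvd_in[OF assms(3)] assms(1)] by simp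
  have "of_int x *\<^sub>R v + of_int y *\<^sub>R act (omega D) v = (of_int x *\<^sub>R w + of_int y *\<^sub>R act (omega D) w)
      - (of_int x *\<^sub>R (w - v) + of_int y *\<^sub>R act (omega D) (w - v))"
    using w assms(1) by (simp add: act_diff order_omega algebra_simps)
  also have "pdvd p \<dots>"
    by (rule pdvd_diff[OF xy pdvd_add[OF pdvd_scale[OF assms(3)] pdvd_scale[OF pdvd_act[OF assms(3) order_omega]]]])
  finally show "p dvd x \<and> p dvd y" using assms(2) unfolding good_def by blast
qed

lemma vector_crt:
  assumes P: "finite P" "\<And>p. p \<in> P \<Longrightarrow> prime (p::int)"
    and S: "S \<subseteq> L" "0 \<in> S" "\<And>v w. v \<in> S \<Longrightarrow> w \<in> S \<Longrightarrow> v + w \<in> S" "\<And>v n. v \<in> S \<Longrightarrow> of_int n *\<^sub>R v \<in> S"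
    and v: "\<And>p. p \<in> P \<Longrightarrow> v p \<in> S"
  shows "\<exists>w\<in>S. \<forall>p\<in>P. pdvd p (w - v p)"
  using P v
proof (induction P)
  case empty
  then show ?case using S by blast
next
  case (insert q P)
  then obtain w where w: "w \<in> S" "\<forall>p\<in>P. pdvd p (w - v p)" by auto
  define m where "m = \<Prod>P"
  have "coprime q p" if "p \<in> P" for p
    using insert.prems(1) insert.hyps(2) that by (intro primes_coprime) auto
  then have "coprime m q" unfolding m_def by (intro prod_coprime_left) (auto simp: coprime_commute)
  then obtain a b where ab: "a * m + b * q = 1" by (metis bezout_int coprime_iff_gcd_eq_1)
  \<comment> \<open>Since a m = 1 - b q, this is congruent to w modulo the primes of P and to
    \<open>v q\<close> modulo q.\<close>
  define w' where "w' = w + of_int (a * m) *\<^sub>R (v q + of_int (- 1) *\<^sub>R w)"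
  have L: "w \<in> L" "v q \<in> L" using S w insert.prems by auto
  have "w' \<in> S" unfolding w'_def by (intro S w insert.prems) simp
  moreover have "pdvd p (w' - v p)" if p: "p \<in> insert q P" for p
  proof (cases "p = q")
    case True
    have "w' - v q = of_int (b * q) *\<^sub>R (w - v q)"
    proof -
      have "w' - v q = of_int (1 - a * m) *\<^sub>R (w - v q)" by (simp add: w'_def algebra_simps)
      also have "1 - a * m = b * q" using ab by simp
      finally show ?thesis .
    qed
    then show ?thesis using True L by (simp only:) (intro pdvd_multiple L_diff, auto)
  next
    case False
    then have pP: "p \<in> P" using p by simp
    then have "p dvd m" unfolding m_def using insert.hyps(1) dvd_prodI[of P p "\<lambda>x. x"] by simp
    have "w' - v p = (w - v p) + of_int (a * m) *\<^sub>R (v q - w)" by (simp add: w'_def algebra_simps)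
    also have "pdvd p \<dots>" using w pP L \<open>p dvd m\<close> by (intro pdvd_add pdvd_multiple L_diff) auto
    finally show ?thesis .
  qed
  ultimately show ?case by blast
qed

text \<open>The form is the norm of x + y omega, and the norm vanishes only at 0.\<close>

lemma norm_form_eq_0:
  assumes "x * x + x * y * int D + y * y * omega_norm D = 0" shows "x = 0 \<and> y = 0"
proof -
  have "(of_int x + of_int y * omega D) * (of_int x + of_int y * omega' D) =
      of_int x * of_int x + of_int x * of_int y * (omega D + omega' D) + of_int y * of_int y * (omega D * omega' D)"
    by (simp add: algebra_simps)
  also have "\<dots> = of_int (x * x + x * y * int D + y * y * omega_norm D)"
    by (simp add: omega_add_omega' omega_mult_omega')
  finally have "of_int x + of_int y * omega D = 0 \<or> quad_conj D (of_int x + of_int y * omega D) = 0"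
    using assms by simp
  then have "of_int x + of_int y * omega D = 0"
    using order_in_field[OF quad_orderI[of x y D]] conj_eq_0_iff by blast
  then show ?thesis using int_unique[of x y 0 0] by simp
qed

text \<open>The \<open>K\<close>-lines in the lattice are their own orthogonal complements.\<close>

definition line :: "'a \<Rightarrow> 'a set" where
  "line e = {l \<in> L. E e l = 0 \<and> E (act (omega D) e) l = 0}"

lemma line_closed:
  assumes "e \<in> L"
  shows "line e \<subseteq> L" "0 \<in> line e" "v \<in> line e \<Longrightarrow> w \<in> line e \<Longrightarrow> v + w \<in> line e"
    "v \<in> line e \<Longrightarrow> of_int n *\<^sub>R v \<in> line e" "e \<in> line e"
    "prime p \<Longrightarrow> v \<in> L \<Longrightarrow> of_int p *\<^sub>R v \<in> line e \<Longrightarrow> v \<in> line e"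
    "v \<in> line e \<Longrightarrow> k \<in> quad_order D \<Longrightarrow> act k v \<in> line e"
proof -
  have Te: "act (omega D) e \<in> L" using act_closed order_omega assms by blast
  show "line e \<subseteq> L" by (auto simp: line_def)
  show "0 \<in> line e"
    using E_scaler[OF assms assms, of 0] E_scaler[OF assms Te, of 0] L_0 by (simp add: line_def)
  show "v \<in> line e \<Longrightarrow> w \<in> line e \<Longrightarrow> v + w \<in> line e"
    using assms Te by (simp add: line_def L_add E_addr)
  show sc: "v \<in> line e \<Longrightarrow> of_int n *\<^sub>R v \<in> line e" for n
    using assms Te by (simp add: line_def L_scale E_scaler)
  show "e \<in> line e"
    using E_isotropic[OF assms order_1 order_1] E_isotropic[OF assms order_omega order_1] assms
    by (simp add: line_def act_one)
  show "prime p \<Longrightarrow> v \<in> L \<Longrightarrow> of_int p *\<^sub>R v \<in> line e \<Longrightarrow> v \<in> line e"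
    using assms Te by (auto simp: line_def E_scaler)
  have om: "act (omega D) v \<in> line e" if v: "v \<in> line e"
  proof -
    have vL: "v \<in> L" using v by (simp add: line_def)
    have 1: "E e (act (omega D) v) = 0"
      using v E_act[OF order_omega assms vL] by (simp add: line_def)
    have "act (omega D) (act (omega D) e) = act (of_int (- omega_norm D) + of_int (int D) * omega D) e"
      using omega_sq by (simp flip: act_mult add: order_omega assms)
    then have "act (omega D) (act (omega D) e) = of_int (- omega_norm D) *\<^sub>R e + of_int (int D) *\<^sub>R act (omega D) e"
      by (simp only: act_form[OF assms])
    then have "E (act (omega D) (act (omega D) e)) v = 0"
      using v assms Te by (simp only: E_addl L_scale vL E_scalel) (simp add: line_def)
    then have 2: "E (act (omega D) e) (act (omega D) v) = 0"
      using E_act[OF order_omega Te vL] by simp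
    show ?thesis using 1 2 vL by (simp add: line_def act_closed order_omega)
  qed
  show "v \<in> line e \<Longrightarrow> k \<in> quad_order D \<Longrightarrow> act k v \<in> line e"
  proof (elim quad_orderE)
    fix m n assume v: "v \<in> line e" and k: "k = of_int m + of_int n * omega D"
    have vL: "v \<in> L" using v by (simp add: line_def)
    show ?thesis
      unfolding k act_form[OF vL] using sc[OF v, of m] om[OF v] assms Te
      by (simp add: line_def L_add L_scale E_addr E_scaler)
  qed
qed

text \<open>Nondegeneracy supplies v with E(e, v) nonzero. Then e, omega e, v, omega v are
  independent, because no nontrivial combination of v and omega v is orthogonal to the line;
  \<open>zbasis_full_rank\<close> gives N.\<close>

lemma line_index:
  assumes e: "e \<in> L" "e \<noteq> 0"
  obtains v N where "v \<in> L" "0 < N"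
    "\<And>l. l \<in> L \<Longrightarrow> \<exists>x y z w. of_int N *\<^sub>R l = of_int x *\<^sub>R e + of_int y *\<^sub>R act (omega D) e + of_int z *\<^sub>R v + of_int w *\<^sub>R act (omega D) v"
    "\<And>z w. of_int z *\<^sub>R v + of_int w *\<^sub>R act (omega D) v \<in> line e \<Longrightarrow> z = 0 \<and> w = 0"
proof -
  obtain v where v: "v \<in> L" "E e v \<noteq> 0" using E_nondeg[OF e(1)] e(2) by blast
  define T where "T = act (omega D)"
  have T: "T e \<in> L" "T v \<in> L" unfolding T_def using act_closed order_omega v e by auto
  obtain a where a: "E e v = of_int a" using E_Ints[OF e(1) v(1)] by (metis of_int_mult of_int_of_nat_eq)
  obtain b where b: "E e (T v) = of_int b" using E_Ints[OF e(1) T(2)] by (metis of_int_mult of_int_of_nat_eq)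
  have b': "E (T e) v = of_int b" using b E_act[OF order_omega e(1) v(1)] by (simp add: T_def)
  have c: "E (T e) (T v) = of_int (int D * b - omega_norm D * a)"
  proof -
    have "E (T e) (T v) = E e (act (of_int (- omega_norm D) + of_int (int D) * omega D) v)"
      using E_act[OF order_omega e(1) T(2)] omega_sq
      by (simp add: T_def v(1) order_omega flip: act_mult)
    also have "\<dots> = E e (of_int (- omega_norm D) *\<^sub>R v + of_int (int D) *\<^sub>R T v)"
      by (simp only: act_form[OF v(1)] T_def)
    also have "\<dots> = of_int (- omega_norm D) * of_int a + of_int (int D) * of_int b"
      using e T v by (simp only: E_addr L_scale E_scaler a b)
    finally show ?thesis by simp
  qed
  have ind: "z = 0 \<and> w = 0" if l: "of_int z *\<^sub>R v + of_int w *\<^sub>R T v \<in> line e" for z w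
  proof -
    have 1: "of_int z * E e v + of_int w * E e (T v) = 0" "of_int z * E (T e) v + of_int w * E (T e) (T v) = 0"
      using l e T v unfolding line_def by (simp_all add: E_addr L_scale E_scaler T_def)
    then have "real_of_int (z * a + w * b) = 0" "real_of_int (z * b + w * (int D * b - omega_norm D * a)) = 0"
      unfolding a b b' c by simp_all
    then have z1: "z * a + w * b = 0" and z2: "z * b + w * (int D * b - omega_norm D * a) = 0"
      by (simp_all only: of_int_eq_0_iff)
    \<comment> \<open>Eliminating b from the two orthogonality relations leaves a times the norm
      form of (z, w).\<close>
    have "a * (z * z + z * w * int D + w * w * omega_norm D) =
        (z * a + w * b) * (z + w * int D) - w * (z * b + w * (int D * b - omega_norm D * a))"
      by (simp add: algebra_simps)
    then have "a * (z * z + z * w * int D + w * w * omega_norm D) = 0" by (simp only: z1 z2)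
    moreover have "a \<noteq> 0" using v(2) a by auto
    ultimately have "z * z + z * w * int D + w * w * omega_norm D = 0" by (metis mult_eq_0_iff)
    then show ?thesis by (rule norm_form_eq_0)
  qed
  note lc = line_closed[OF e(1)]
  define cc where "cc = case_sum (\<lambda>i::2. if i = 1 then e else T e) (\<lambda>i::2. if i = 1 then v else T v)"
  have cc_sum: "(\<Sum>i\<in>UNIV. of_int (k i) *\<^sub>R cc i) = of_int (k (Inl 1)) *\<^sub>R e + of_int (k (Inl 2)) *\<^sub>R T e
      + of_int (k (Inr 1)) *\<^sub>R v + of_int (k (Inr 2)) *\<^sub>R T v" for k
    unfolding sum_UNIV_plus sum_2 by (simp add: cc_def)
  have "k = (\<lambda>_. 0)" if "(\<Sum>i\<in>UNIV. of_int (k i) *\<^sub>R cc i) = 0" for k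
  proof -
    have s: "of_int (k (Inr 1)) *\<^sub>R v + of_int (k (Inr 2)) *\<^sub>R T v =
        of_int (- k (Inl 1)) *\<^sub>R e + of_int (- k (Inl 2)) *\<^sub>R T e"
      using that unfolding cc_sum by (simp add: algebra_simps eq_neg_iff_add_eq_0)
    also have "\<dots> \<in> line e"
      unfolding T_def by (rule lc(3)[OF lc(4)[OF lc(5)] lc(4)[OF lc(7)[OF lc(5) order_omega]]])
    finally have k: "k (Inr 1) = 0" "k (Inr 2) = 0" using ind by auto
    then have "act (of_int (- k (Inl 1)) + of_int (- k (Inl 2)) * omega D) e = 0"
      using s unfolding act_form[OF e(1)] T_def by simp
    then have "of_int (- k (Inl 1)) + of_int (- k (Inl 2)) * omega D = 0"
      using act_eq_0[OF quad_orderI e(1)] e(2) by blast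
    then have "of_int (- k (Inl 1)) + of_int (- k (Inl 2)) * omega D = of_int 0 + of_int 0 * omega D" by simp
    then have "- k (Inl 1) = 0 \<and> - k (Inl 2) = 0" by (rule int_unique)
    then have "k (Inl 1) = 0" "k (Inl 2) = 0" by auto
    with k show ?thesis by (simp add: fun_eq_iff split_sum_all forall_2)
  qed
  moreover obtain bb :: "2 + 2 \<Rightarrow> 'a" where "zbasis bb L" by (rule lattice_basis)
  moreover have "cc i \<in> L" for i using e v T by (cases i) (simp_all add: cc_def)
  ultimately obtain N where N: "0 < N" "\<forall>l\<in>L. \<exists>k. of_int N *\<^sub>R l = (\<Sum>i\<in>UNIV. of_int (k i) *\<^sub>R cc i)"
    using zbasis_full_rank[of bb L cc] by blast
  show ?thesis
  proof (rule that[OF v(1) N(1)])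
    fix l assume "l \<in> L"
    then obtain k where "of_int N *\<^sub>R l = (\<Sum>i\<in>UNIV. of_int (k i) *\<^sub>R cc i)" using N by blast
    then show "\<exists>x y z w. of_int N *\<^sub>R l = of_int x *\<^sub>R e + of_int y *\<^sub>R act (omega D) e + of_int z *\<^sub>R v + of_int w *\<^sub>R act (omega D) v"
      unfolding cc_sum T_def by blast
  qed (use ind in \<open>simp add: T_def\<close>)
qed

text \<open>Expanding N l in the four independent vectors, the components along v and omega v must
  vanish for l in the line.\<close>

lemma line_multiple:
  assumes e: "e \<in> L" "e \<noteq> 0"
  obtains N where "0 < N" "\<And>l. l \<in> line e \<Longrightarrow> \<exists>k\<in>quad_order D. of_int N *\<^sub>R l = act k e"
proof -
  obtain v N where v: "v \<in> L" "0 < N"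
    "\<And>l. l \<in> L \<Longrightarrow> \<exists>x y z w. of_int N *\<^sub>R l = of_int x *\<^sub>R e + of_int y *\<^sub>R act (omega D) e + of_int z *\<^sub>R v + of_int w *\<^sub>R act (omega D) v"
    "\<And>z w. of_int z *\<^sub>R v + of_int w *\<^sub>R act (omega D) v \<in> line e \<Longrightarrow> z = 0 \<and> w = 0"
    using line_index[OF e] by blast
  have "\<exists>k\<in>quad_order D. of_int N *\<^sub>R l = act k e" if l: "l \<in> line e" for l
  proof -
    note lc = line_closed[OF e(1)]
    have "l \<in> L" using l by (simp add: line_def)
    then obtain x y z w where xyzw: "of_int N *\<^sub>R l = of_int x *\<^sub>R e + of_int y *\<^sub>R act (omega D) e
        + of_int z *\<^sub>R v + of_int w *\<^sub>R act (omega D) v" using v(3) by blast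
    have "of_int z *\<^sub>R v + of_int w *\<^sub>R act (omega D) v = of_int N *\<^sub>R l + (of_int (- x) *\<^sub>R e + of_int (- y) *\<^sub>R act (omega D) e)"
      unfolding xyzw by simp
    also have "\<dots> \<in> line e"
      by (rule lc(3)[OF lc(4)[OF l] lc(3)[OF lc(4)[OF lc(5)] lc(4)[OF lc(7)[OF lc(5) order_omega]]]])
    finally have "z = 0 \<and> w = 0" by (rule v(4))
    then have "of_int N *\<^sub>R l = act (of_int x + of_int y * omega D) e"
      using xyzw by (simp add: act_form[OF e(1)])
    then show ?thesis by blast
  qed
  with v(2) show ?thesis by (rule that)
qed

text \<open>If omega is the scalar c on the line modulo p, then (omega - c)/p multiplies the
  coefficient lattice of the line into itself. A multiplier of a rank two lattice is
  integral.\<close>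

lemma scalar_line_integral:
  assumes e: "e \<in> L" "e \<noteq> 0" and p: "prime p" and eig: "\<forall>l\<in>line e. eigen p c l"
  shows "quad_trace D ((omega D - of_int c) / of_int p) \<in> \<int>"
    "(omega D - of_int c) / of_int p * quad_conj D ((omega D - of_int c) / of_int p) \<in> \<int>"
proof -
  obtain N where N: "0 < N" "\<And>l. l \<in> line e \<Longrightarrow> \<exists>k\<in>quad_order D. of_int N *\<^sub>R l = act k e"
    using line_multiple[OF e] by blast
  \<comment> \<open>N times the module of all k in K with k e in the line; the factor N brings it
    into the order, where it is an ideal.\<close>
  define M where "M = {k \<in> quad_order D. \<exists>l\<in>line e. act k e = of_int N *\<^sub>R l}"
  note lc = line_closed[OF e(1)]
  have M: "ideal M RO"
    unfolding ideal_order_iff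
  proof (intro conjI ballI)
    show "M \<subseteq> quad_order D" by (auto simp: M_def)
    show "0 \<in> M" using lc(2) by (auto simp: M_def order_0 act_0 e intro!: bexI[of _ 0])
  next
    fix x y assume "x \<in> M" "y \<in> M"
    then obtain l l' where "l \<in> line e" "l' \<in> line e" "act x e = of_int N *\<^sub>R l" "act y e = of_int N *\<^sub>R l'"
      "x \<in> quad_order D" "y \<in> quad_order D" by (auto simp: M_def)
    then show "x + y \<in> M"
      using lc(3) by (auto simp: M_def order_add act_add e scaleR_add_right intro!: bexI[of _ "l + l'"])
  next
    fix k x assume "k \<in> quad_order D" "x \<in> M"
    moreover from this obtain l where "l \<in> line e" "act x e = of_int N *\<^sub>R l" "x \<in> quad_order D" by (auto simp: M_def)
    ultimately show "k * x \<in> M"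
      using lc(1,7) act_scale[of k l N] by (auto simp: M_def order_mult act_mult e intro!: bexI[of _ "act k l"])
  qed
  have NM: "of_int N \<in> M" using lc(5) by (auto simp: M_def order_int act_int e)
  define t where "t = (omega D - of_int c) / of_int p"
  have p0: "p > 0" using p by (rule prime_gt_0_int)
  have tM: "t * k \<in> M" if k: "k \<in> M" for k
  proof -
    obtain l where l: "l \<in> line e" "act k e = of_int N *\<^sub>R l" "k \<in> quad_order D" using k by (auto simp: M_def)
    obtain l' where l': "l' \<in> L" "act (omega D - of_int c) l = of_int p *\<^sub>R l'"
      using eig l(1) unfolding eigen_def pdvd_def by blast
    have "act (omega D - of_int c) l \<in> line e" using lc(7)[OF l(1)] order_diff[OF order_omega order_int] by blast
    \<comment> \<open>The line is defined by orthogonality, so it is saturated in L.\<close>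
    then have l'l: "l' \<in> line e" using lc(6)[OF p l'(1)] l'(2) by simp
    obtain k' where k': "k' \<in> quad_order D" "of_int N *\<^sub>R l' = act k' e" using N(2)[OF l'l] by blast
    have lL: "l \<in> L" using l(1) lc(1) by blast
    have "act ((omega D - of_int c) * k) e = act (of_int p * k') e"
    proof -
      have "act ((omega D - of_int c) * k) e = act (omega D - of_int c) (of_int N *\<^sub>R l)"
        using l e by (simp add: act_mult order_diff order_omega order_int)
      also have "\<dots> = of_int N *\<^sub>R (of_int p *\<^sub>R l')"
        using act_scale[OF order_diff[OF order_omega order_int] lL] l'(2) by simp
      also have "\<dots> = of_int p *\<^sub>R act k' e" using k'(2) by (metis scaleR_left_commute)
      also have "\<dots> = act (of_int p * k') e"
        using k' e by (simp add: act_mult order_int act_int act_closed)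
      finally show ?thesis .
    qed
    then have "act ((omega D - of_int c) * k - of_int p * k') e = 0"
      using l k' e by (simp add: act_sub order_mult order_diff order_omega order_int)
    then have "(omega D - of_int c) * k - of_int p * k' = 0"
      using l k' e by (intro act_eq_0[of _ e]) (auto intro!: order_diff order_mult order_omega order_int)
    then have "t * k = k'" using p0 by (simp add: t_def field_simps)
    then show ?thesis using k'(1) k'(2)[symmetric] l'l unfolding M_def by blast
  qed
  obtain b :: "2 \<Rightarrow> real" where "zbasis b M"
    using ideal_zbasis[OF M] NM N(1) by (metis of_int_eq_0_iff order_less_irrefl singletonD)
  moreover have "t \<in> quad_field D"
    unfolding t_def by (intro field_divide field_diff field_omega field_rat) auto
  ultimately show "quad_trace D ((omega D - of_int c) / of_int p) \<in> \<int>"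
    "(omega D - of_int c) / of_int p * quad_conj D ((omega D - of_int c) / of_int p) \<in> \<int>"
    using multiplier_integral tM unfolding t_def by blast+
qed

text \<open>At primes not dividing the conductor this is automatic, because \<open>\<O>\<^sub>D\<close> is maximal there.\<close>

lemma line_not_scalar:
  assumes e: "e \<in> L" "e \<noteq> 0" and p: "prime p" and cond: "p dvd int f \<Longrightarrow> good p e"
  shows "\<not> (\<forall>l\<in>line e. eigen p c l)"
proof
  assume eig: "\<forall>l\<in>line e. eigen p c l"
  show False
  proof (cases "p dvd int f")
    case True
    have "pdvd p (of_int (- c) *\<^sub>R e + of_int 1 *\<^sub>R act (omega D) e)"
      using eig line_closed(5)[OF e(1)] unfolding eigen_def by (auto simp: act_omega_diff e)
    then have "p dvd 1" using cond[OF True] unfolding good_def by blast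
    then show False using p not_prime_unit by blast
  next
    case False
    have "p dvd int f"
      using scalar_line_integral[OF e p eig] prime_gt_0_int[OF p] by (intro conductor_dvd[of p c])
    with False show False by blast
  qed
qed

lemma exists_nonzero: "\<exists>v\<in>L. v \<noteq> 0"
proof (rule form_typeE[OF E_type])
  fix u v :: "2 \<Rightarrow> 'a"
  assume b: "0 < d1" "zbasis (case_sum u v) L" "E (u 1) (v 1) = real d1"
  have "u 1 \<noteq> 0"
  proof
    assume "u 1 = 0"
    moreover have "E 0 (v 1) = 0"
      using E_scalel[OF L_0 symplectic_mem(2)[OF b(2)], of 0 1] by simp
    ultimately show False using b by simp
  qed
  then show ?thesis using symplectic_mem(1)[OF b(2)] by blast
qed

end

text \<open>No element (omega - c)/p acts on L. For the lattice of a surface this is derived from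
  properness of the multiplication in \<open>rm_surface_module\<close>.\<close>

locale proper_order_module = symplectic_order_module +
  assumes proper: "prime (p::int) \<Longrightarrow> \<not> (\<forall>v\<in>L. \<exists>w\<in>L. act (omega D - of_int c) v = of_int p *\<^sub>R w)"
begin

text \<open>Otherwise every vector is an eigenvector modulo p, so omega is a scalar on L/pL, against
  \<open>proper\<close>.\<close>

lemma exists_good: assumes "prime p" shows "\<exists>v\<in>L. good p v"
proof (rule ccontr)
  assume "\<not> ?thesis"
  then have "\<exists>c. \<forall>v\<in>L. eigen p c v"
    using bad_eigen[OF assms] by (intro eigen_scalar[OF assms]) (auto simp: L_add)
  then show False using proper[OF assms] unfolding eigen_def pdvd_def by blast
qed

text \<open>The auxiliary e is good at the conductor primes, which is what
  \<open>line_not_scalar\<close> asks for. The result is v + l with l on the line of e: if all such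
  vectors were bad at some p, then omega would be a scalar on the line modulo p.\<close>

lemma exists_universally_good: "\<exists>e\<in>L. \<forall>p. prime p \<longrightarrow> good p e"
proof -
  define Pf where "Pf = {p. prime p \<and> p dvd int f}"
  have fin: "finite Pf" "\<And>p. p \<in> Pf \<Longrightarrow> prime p"
    unfolding Pf_def using f_pos by (auto intro: finite_prime_divisors)
  have "\<forall>p\<in>Pf. \<exists>v. v \<in> L \<and> good p v" using fin exists_good by blast
  then obtain vv where vv: "\<And>p. p \<in> Pf \<Longrightarrow> vv p \<in> L \<and> good p (vv p)" by metis
  obtain u where u: "u \<in> L" "\<forall>p\<in>Pf. pdvd p (u - vv p)"
    using vector_crt[OF fin, of L vv] vv L_0 L_add L_scale by blast
  have ugood: "good p u" if "p \<in> Pf" for p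
    using good_cong[of "vv p" p u] vv u that by blast
  obtain e where e: "e \<in> L" "e \<noteq> 0" "\<And>p. prime p \<Longrightarrow> p dvd int f \<Longrightarrow> good p e"
  proof (cases "u = 0")
    case False
    then show ?thesis using that u ugood unfolding Pf_def by blast
  next
    \<comment> \<open>The zero vector is good at no prime, so the conductor has no prime divisor and
      any nonzero vector serves.\<close>
    case True
    have np: "\<not> (prime p \<and> p dvd int f)" for p
    proof
      assume "prime p \<and> p dvd int f"
      then have p: "prime p" "good p 0" using ugood[of p] True by (auto simp: Pf_def)
      have "pdvd p (of_int 1 *\<^sub>R 0 + of_int 0 *\<^sub>R act (omega D) 0)" unfolding pdvd_def using L_0 by auto
      then have "p dvd 1" using p(2) unfolding good_def by blast
      then show False using p(1) not_prime_unit by blast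
    qed
    obtain w where "w \<in> L" "w \<noteq> 0" using exists_nonzero by blast
    then show ?thesis using that np by blast
  qed
  obtain v N where v: "v \<in> L" "0 < N"
    "\<And>l. l \<in> L \<Longrightarrow> \<exists>x y z w. of_int N *\<^sub>R l = of_int x *\<^sub>R e + of_int y *\<^sub>R act (omega D) e + of_int z *\<^sub>R v + of_int w *\<^sub>R act (omega D) v"
    "\<And>z w. of_int z *\<^sub>R v + of_int w *\<^sub>R act (omega D) v \<in> line e \<Longrightarrow> z = 0 \<and> w = 0"
    using line_index[OF e(1,2)] by blast
  note lc = line_closed[OF e(1)]
  have ex: "\<exists>l\<in>line e. good p (v + l)" if p: "prime p" for p
  proof (rule ccontr)
    assume no: "\<not> ?thesis"
    have eig: "\<exists>c. eigen p c (v + l)" if "l \<in> line e" for l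
      using bad_eigen[OF p, of "v + l"] no that v(1) lc(1) L_add by blast
    obtain c where c: "eigen p c v" using eig[OF lc(2)] by auto
    show False
    proof (cases "\<exists>l\<in>line e. pdvd p (v - l)")
      \<comment> \<open>If v is congruent to l on the line, then v + (m - l) is congruent to m, so
        every m on the line is an eigenvector.\<close>
      case True
      then obtain l where l: "l \<in> line e" "pdvd p (v - l)" by blast
      have "\<exists>c. eigen p c m" if m: "m \<in> line e" for m
      proof -
        have "m + of_int (- 1) *\<^sub>R l \<in> line e" using lc m l by blast
        then obtain c where c: "eigen p c (v + (m + of_int (- 1) *\<^sub>R l))" using eig by blast
        have ml: "m \<in> L" "l \<in> L" using m l lc(1) by auto
        have "act (omega D - of_int c) m = act (omega D - of_int c) (v + (m + of_int (- 1) *\<^sub>R l)) - act (omega D - of_int c) (v - l)"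
          using v(1) ml by (subst act_diff[symmetric]) (auto simp: order_diff order_omega order_int L_add L_diff)
        also have "pdvd p \<dots>"
          by (rule pdvd_diff[OF c[unfolded eigen_def] pdvd_act[OF l(2) order_diff[OF order_omega order_int]]])
        finally show ?thesis unfolding eigen_def by blast
      qed
      then have "\<exists>c. \<forall>m\<in>line e. eigen p c m"
        by (intro eigen_scalar[OF p lc(1,3)])
      then show False using line_not_scalar[OF e(1,2) p] e(3)[OF p] by blast
    next
      \<comment> \<open>If v is not congruent to any vector of the line, then v and v + l being
        eigenvectors forces equal eigenvalues, and every l has the eigenvalue of v.\<close>
      case False
      have "eigen p c l" if l: "l \<in> line e" for l
      proof -
        have lL: "l \<in> L" using l lc by auto
        obtain c' where c': "eigen p c' (v + l)" using eig[OF l] by blast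
        have "pdvd p ((act (omega D) (v + l) - of_int c' *\<^sub>R (v + l)) - (act (omega D) v - of_int c *\<^sub>R v))"
          using pdvd_diff[OF c'[unfolded eigen_def] c[unfolded eigen_def]]
          unfolding act_omega_diff[OF v(1)] act_omega_diff[OF L_add[OF v(1) lL]] .
        also have "(act (omega D) (v + l) - of_int c' *\<^sub>R (v + l)) - (act (omega D) v - of_int c *\<^sub>R v) =
            of_int (c - c') *\<^sub>R v + act (omega D - of_int c') l"
          using v(1) lL by (simp add: act_vadd order_omega act_omega_diff algebra_simps)
        finally have d: "pdvd p (of_int (c - c') *\<^sub>R v + act (omega D - of_int c') l)" .
        have "p dvd c - c'"
        proof (rule ccontr)
          assume "\<not> p dvd c - c'"
          then have "coprime (c - c') p" using p by (metis coprime_commute prime_imp_coprime)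
          then obtain a b where ab: "a * (c - c') + b * p = 1" by (metis bezout_int coprime_iff_gcd_eq_1)
          have "v - of_int (- a) *\<^sub>R act (omega D - of_int c') l =
              of_int (a * (c - c') + b * p) *\<^sub>R v + of_int a *\<^sub>R act (omega D - of_int c') l" by (simp add: ab)
          also have "\<dots> = of_int a *\<^sub>R (of_int (c - c') *\<^sub>R v + act (omega D - of_int c') l) + of_int (b * p) *\<^sub>R v"
            by (simp add: algebra_simps)
          also have "pdvd p \<dots>" by (rule pdvd_add[OF pdvd_scale[OF d] pdvd_multiple[OF v(1)]]) simp
          finally show False
            using False lc(4)[OF lc(7)[OF l order_diff[OF order_omega order_int]]] by blast
        qed
        then have "pdvd p (act (omega D - of_int c') l)"
          using pdvd_diff[OF d pdvd_multiple[OF v(1) \<open>p dvd c - c'\<close>]] by simp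
        then show ?thesis using eigen_cong[OF lL, of p c' c] \<open>p dvd c - c'\<close> by (simp add: eigen_def dvd_diff_commute)
      qed
      then show False using line_not_scalar[OF e(1,2) p] e(3)[OF p] by blast
    qed
  qed
  define PN where "PN = {p. prime p \<and> p dvd N}"
  have finN: "finite PN" "\<And>p. p \<in> PN \<Longrightarrow> prime p"
    unfolding PN_def using v(2) by (auto intro: finite_prime_divisors)
  have "\<forall>p\<in>PN. \<exists>l. l \<in> line e \<and> good p (v + l)" using finN ex by blast
  then obtain ll where ll: "\<And>p. p \<in> PN \<Longrightarrow> ll p \<in> line e \<and> good p (v + ll p)" by metis
  obtain l where l: "l \<in> line e" "\<forall>p\<in>PN. pdvd p (l - ll p)"
    using vector_crt[OF finN lc(1,2), of ll] lc(3,4) ll by blast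
  have lL: "l \<in> L" using l lc by auto
  have "good p (v + l)" if p: "prime p" for p
  proof (cases "p dvd N")
    case True
    then have "p \<in> PN" using p by (simp add: PN_def)
    moreover from this have "ll p \<in> L" using ll lc by blast
    ultimately show ?thesis
      using good_cong[of "v + ll p" p "v + l"] ll l(2) v(1) L_add by simp
  next
    case False
    show ?thesis unfolding good_def
    proof (intro allI impI)
      fix x y assume "pdvd p (of_int x *\<^sub>R (v + l) + of_int y *\<^sub>R act (omega D) (v + l))"
      then obtain h where h: "h \<in> L" "of_int x *\<^sub>R (v + l) + of_int y *\<^sub>R act (omega D) (v + l) = of_int p *\<^sub>R h"
        unfolding pdvd_def by blast
      obtain x' y' z w where H: "of_int N *\<^sub>R h = of_int x' *\<^sub>R e + of_int y' *\<^sub>R act (omega D) e + of_int z *\<^sub>R v + of_int w *\<^sub>R act (omega D) v"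
        using v(3) h(1) by blast
      \<comment> \<open>Multiplication by N expresses h in the four basic vectors. Comparing modulo
        the line gives N x = p z and N y = p w, and p does not divide N.\<close>
      have "of_int N *\<^sub>R (of_int x *\<^sub>R (v + l) + of_int y *\<^sub>R act (omega D) (v + l)) = of_int p *\<^sub>R (of_int N *\<^sub>R h)"
        unfolding h(2) by (rule scaleR_left_commute)
      then have "of_int (N * x - p * z) *\<^sub>R v + of_int (N * y - p * w) *\<^sub>R act (omega D) v =
          of_int p *\<^sub>R (of_int x' *\<^sub>R e + of_int y' *\<^sub>R act (omega D) e) + of_int (- N) *\<^sub>R (of_int x *\<^sub>R l + of_int y *\<^sub>R act (omega D) l)"
        unfolding H using v(1) lL by (simp add: act_vadd order_omega algebra_simps)
      also have "\<dots> \<in> line e"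
        by (intro lc(3,4) lc(7) lc(5) l(1) order_omega)
      finally have "N * x - p * z = 0 \<and> N * y - p * w = 0" by (rule v(4))
      then have "p dvd N * x" "p dvd N * y" by (metis dvd_triv_left eq_iff_diff_eq_0)+
      then show "p dvd x \<and> p dvd y" using p False by (simp add: prime_dvd_mult_iff)
    qed
  qed
  then show ?thesis using v(1) lL L_add by blast
qed

end

lemma zbasis_image:
  fixes b :: "'i::finite \<Rightarrow> 'a::real_vector" and h :: "'a \<Rightarrow> 'b::real_vector"
  assumes b: "zbasis b L" and h: "additive_on L h" "inj_on h L"
  shows "zbasis (h \<circ> b) (h ` L)"
  unfolding zbasis_iff
proof (intro conjI allI impI)
  have L: "L = range (\<lambda>k. \<Sum>i\<in>UNIV. of_int (k i) *\<^sub>R b i)" using b unfolding zbasis_iff by blast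
  have hs: "h (\<Sum>i\<in>UNIV. of_int (k i) *\<^sub>R b i) = (\<Sum>i\<in>UNIV. of_int (k i) *\<^sub>R (h \<circ> b) i)" for k
    using zbasis_additive[OF b h(1)] by simp
  show "h ` L = range (\<lambda>k. \<Sum>i\<in>UNIV. of_int (k i) *\<^sub>R (h \<circ> b) i)"
    unfolding L image_image hs ..
  fix k assume "(\<Sum>i\<in>UNIV. of_int (k i) *\<^sub>R (h \<circ> b) i) = 0"
  moreover have "h 0 = 0" using hs[of "\<lambda>_. 0"] by simp
  ultimately have "h (\<Sum>i\<in>UNIV. of_int (k i) *\<^sub>R b i) = h 0" by (simp add: hs)
  then have "(\<Sum>i\<in>UNIV. of_int (k i) *\<^sub>R b i) = 0"
    using h(2) zbasis_comb[OF b] zbasis_subgroup(1)[OF b] by (simp only: inj_on_eq_iff)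
  then show "k = (\<lambda>_. 0)" using zbasis_indep[OF b] by (simp add: fun_eq_iff)
qed

lemma form_type_image:
  fixes L :: "'a::real_vector set" and h :: "'a \<Rightarrow> 'b::real_vector"
  assumes t: "form_type L E d1 d2" and h: "additive_on L h" "inj_on h L"
    and E: "\<And>x y. x \<in> L \<Longrightarrow> y \<in> L \<Longrightarrow> F (h x) (h y) = E x y"
  shows "form_type (h ` L) F d1 d2"
proof -
  obtain u v :: "2 \<Rightarrow> 'a" where d: "0 < d1" "0 < d2" "d1 dvd d2" and b: "zbasis (case_sum u v) L"
    and uv: "\<forall>i j. E (u i) (u j) = 0 \<and> E (v i) (v j) = 0 \<and>
        E (u i) (v j) = (if i \<noteq> j then 0 else if i = 1 then real d1 else real d2) \<and>
        E (v j) (u i) = - E (u i) (v j)"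
    using t unfolding form_type_def by blast
  have "h \<circ> case_sum u v = case_sum (h \<circ> u) (h \<circ> v)" by (auto simp: fun_eq_iff split: sum.split)
  then have "zbasis (case_sum (h \<circ> u) (h \<circ> v)) (h ` L)" using zbasis_image[OF b h] by simp
  with d uv symplectic_mem[OF b] show ?thesis
    unfolding form_type_def by (intro conjI exI[of _ "h \<circ> u"] exI[of _ "h \<circ> v"]) (auto simp: E)
qed

lemma (in quad_disc) trace_mult_div_sqrt:
  "quad_trace D ((of_int k + of_int l * omega D) * ((of_int m + of_int n * omega D) / sqrt (real D))) =
    of_int (k * n + l * m + l * n * int D)"
  using trace_div_sqrt[of "k * m - l * n * omega_norm D" "k * n + l * m + l * n * int D"]
  by (simp only: times_divide_eq_right int_mult_form)

context symplectic_order_module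
begin

text \<open>Away from d2/d1 the form E/d1 is unimodular at p, so membership in pL can be tested by
  pairing with L.\<close>

lemma pdvd_of_form:
  assumes p: "prime p" "\<not> p dvd int (d2 div d1)" and v: "v \<in> L"
    and dv: "\<And>w. w \<in> L \<Longrightarrow> \<exists>c. E v w = of_int (p * c) * real d1"
  shows "pdvd p v"
proof (rule form_typeE[OF E_type])
  fix u w :: "2 \<Rightarrow> 'a"
  assume b: "0 < d1" "0 < d2" "d1 dvd d2" "zbasis (case_sum u w) L"
    "\<forall>i j. E (u i) (u j) = 0" "\<forall>i j. E (w i) (w j) = 0"
    "E (u 1) (w 1) = real d1" "E (u 1) (w 2) = 0" "E (u 2) (w 1) = 0" "E (u 2) (w 2) = real d2"
    "E (w 1) (u 1) = - real d1" "E (w 2) (u 1) = 0" "E (w 1) (u 2) = 0" "E (w 2) (u 2) = - real d2"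
  obtain m n k l where V: "v = of_int m *\<^sub>R u 1 + of_int n *\<^sub>R u 2 + of_int k *\<^sub>R w 1 + of_int l *\<^sub>R w 2"
    using b(4) v by (rule zbasis_22_span)
  note M = symplectic_mem[OF b(4)]
  note C = symplectic_coordinates(1)[OF b(4) E_add V]
  have d2: "real d2 = real_of_int (int (d2 div d1)) * real d1"
    using b(3) by (metis dvd_div_mult_self of_int_of_nat_eq of_nat_mult)
  have can: "p dvd x" if "of_int x * real d1 = of_int (p * c) * real d1" for x c
  proof -
    have "real_of_int x = of_int (p * c)" using that b(1) by simp
    then have "x = p * c" by (simp only: of_int_eq_iff)
    then show ?thesis by simp
  qed
  have "p dvd m"
  proof -
    obtain c where "E v (w 1) = of_int (p * c) * real d1" using dv M by blast
    then show ?thesis using can[of m c] C[OF M(2), of 1] b by simp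
  qed
  moreover have "p dvd n"
  proof -
    obtain c where "E v (w 2) = of_int (p * c) * real d1" using dv M by blast
    then have "of_int (n * int (d2 div d1)) * real d1 = of_int (p * c) * real d1"
      using C[OF M(2), of 2] b d2 by simp
    then have "p dvd n * int (d2 div d1)" by (rule can)
    then show ?thesis using p by (simp add: prime_dvd_mult_iff)
  qed
  moreover have "p dvd k"
  proof -
    obtain c where "E v (u 1) = of_int (p * c) * real d1" using dv M by blast
    then have "of_int (- k) * real d1 = of_int (p * c) * real d1" using C[OF M(1), of 1] b by simp
    then have "p dvd - k" by (rule can)
    then show ?thesis by simp
  qed
  moreover have "p dvd l"
  proof -
    obtain c where "E v (u 2) = of_int (p * c) * real d1" using dv M by blast
    then have "of_int (- l * int (d2 div d1)) * real d1 = of_int (p * c) * real d1"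
      using C[OF M(1), of 2] b d2 by simp
    then have "p dvd - l * int (d2 div d1)" by (rule can)
    then show ?thesis using p by (simp add: prime_dvd_mult_iff)
  qed
  ultimately show ?thesis
    unfolding V using M by (intro pdvd_add pdvd_multiple)
qed

lemma good_nonzero:
  assumes "prime p" "good p v" shows "v \<noteq> 0"
proof
  assume "v = 0"
  moreover have "pdvd p (of_int 1 *\<^sub>R 0 + of_int 0 *\<^sub>R act (omega D) 0)" unfolding pdvd_def using L_0 by auto
  ultimately have "p dvd 1" using assms(2) unfolding good_def by blast
  then show False using assms(1) not_prime_unit by blast
qed

text \<open>By \<open>line_multiple\<close> some n l lies in the orbit of e. The prime factors of n
  are removed one at a time: goodness of e at p lets p be cancelled from the coefficient.\<close>

lemma line_of_good:
  assumes e: "e \<in> L" "\<And>p. prime p \<Longrightarrow> good p e" and l: "l \<in> line e"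
  shows "\<exists>k\<in>quad_order D. l = act k e"
proof -
  have False: "e \<noteq> 0" using good_nonzero[of 2] e(2)[of 2] by simp
  obtain N where N: "0 < N" "\<exists>k\<in>quad_order D. of_int N *\<^sub>R l = act k e"
    using line_multiple[OF e(1) False] l by metis
  have lL: "l \<in> L" using l by (simp add: line_def)
  have "\<exists>k\<in>quad_order D. l = act k e" if "0 < n" "k \<in> quad_order D" "of_int (int n) *\<^sub>R l = act k e" for n k
    using that
  proof (induction n arbitrary: k rule: less_induct)
    case (less n)
    show ?case
    proof (cases "n = 1")
      case False
      then obtain p where p: "prime p" "p dvd n" by (metis prime_factor_nat)
      then obtain q where q: "n = p * q" by auto
      obtain x y where k: "k = of_int x + of_int y * omega D" using less.prems(2) by (rule quad_orderE)
      have "act k e = of_int (int p) *\<^sub>R (of_int (int q) *\<^sub>R l)" using less.prems(3) q by simp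
      then have "pdvd (int p) (of_int x *\<^sub>R e + of_int y *\<^sub>R act (omega D) e)"
        unfolding k act_form[OF e(1)] pdvd_def using L_scale[OF lL] by blast
      then have "int p dvd x \<and> int p dvd y" using e(2) p(1) unfolding good_def by auto
      then obtain x' y' where xy: "x = int p * x'" "y = int p * y'" by (metis dvdE)
      define k' where "k' = of_int x' + of_int y' * omega D"
      have k': "k' \<in> quad_order D" "k = of_int (int p) * k'" by (auto simp: k'_def k xy algebra_simps)
      have "of_int (int p) *\<^sub>R (of_int (int q) *\<^sub>R l) = of_int (int p) *\<^sub>R act k' e"
        using \<open>act k e = of_int (int p) *\<^sub>R (of_int (int q) *\<^sub>R l)\<close> k' e(1)
        by (simp only: act_mult[OF order_int] act_int act_closed)
      then have "of_int (int q) *\<^sub>R l = act k' e"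
        by (rule scaleR_left_imp_eq[rotated]) (use p(1) in auto)
      moreover have "q < n" "0 < q" using q less.prems(1) prime_gt_1_nat[OF p(1)] by auto
      ultimately show ?thesis using less.IH k'(1) by blast
    qed (use less.prems in auto)
  qed
  from this[of "nat N"] N show ?thesis by auto
qed

end

context proper_order_module
begin

text \<open>E is the trace of a K-bilinear form, and \<open>A\<close> is that form paired with e,
  rescaled to take values in the order. It is O_D-linear with kernel the orbit of e. Invertibility
  of its image yields a linear section \<open>S\<close>, so L is the sum of the orbit of e and the
  image of \<open>S\<close>, both isotropic.\<close>

lemma module_structure:
  assumes cop: "coprime (d2 div d1) f"
  obtains I \<psi> where "ideal I RO" "bij_betw \<psi> (ideal_module D I) L" "additive_on (ideal_module D I) \<psi>"
    "\<And>p q. p \<in> ideal_module D I \<Longrightarrow> q \<in> ideal_module D I \<Longrightarrow> E (\<psi> p) (\<psi> q) = trace_pairing D p q"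
    "\<And>k x y. k \<in> quad_order D \<Longrightarrow> (x, y) \<in> ideal_module D I \<Longrightarrow> \<psi> (k * x, k * y) = act k (\<psi> (x, y))"
proof -
  obtain e where e: "e \<in> L" "\<And>p. prime p \<Longrightarrow> good p e" using exists_universally_good by blast
  note Om = order_omega order_int order_add order_mult order_diff
  define s where "s = sqrt (real D)"
  have s0: "s > 0" using sqrt_pos by (simp add: s_def)
  have sO: "s \<in> quad_order D" using sqrt_in_order by (simp add: s_def)
  have Te: "act (omega D) e \<in> L" using e(1) order_omega by (rule act_closed[rotated])
  \<comment> \<open>The two coordinates solve tr(A/sqrt D) = -E(e, l) and tr(omega A/sqrt D) =
    -E(omega e, l).\<close>
  define A where "A l = (E e l * real D - E (act (omega D) e) l) + (- E e l) * omega D" for l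
  have Aint: "\<exists>m n. E e l = of_int (- n) \<and> E (act (omega D) e) l = of_int (- (m + n * int D)) \<and>
      A l = of_int m + of_int n * omega D" if l: "l \<in> L" for l
  proof -
    obtain a where a: "E e l = of_int a" using E_Ints[OF e(1) l] by (metis of_int_mult of_int_of_nat_eq)
    obtain b where b: "E (act (omega D) e) l = of_int b" using E_Ints[OF Te l] by (metis of_int_mult of_int_of_nat_eq)
    show ?thesis
      by (intro exI[of _ "a * int D - b"] exI[of _ "- a"]) (simp add: A_def a b)
  qed
  have AO: "A l \<in> quad_order D" if "l \<in> L" for l using Aint[OF that] by auto
  have AE: "E (act k e) l = - quad_trace D (k * (A l / s))" if k: "k \<in> quad_order D" and l: "l \<in> L" for k l
  proof -
    obtain m n where mn: "E e l = of_int (- n)" "E (act (omega D) e) l = of_int (- (m + n * int D))"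
      "A l = of_int m + of_int n * omega D" using Aint[OF l] by blast
    obtain x y where xy: "k = of_int x + of_int y * omega D" using k by (rule quad_orderE)
    have "E (act k e) l = of_int x * E e l + of_int y * E (act (omega D) e) l"
      unfolding xy act_form[OF e(1)] using e Te l by (simp add: E_addl L_scale E_scalel)
    then show ?thesis
      unfolding mn xy s_def trace_mult_div_sqrt by (simp add: algebra_simps)
  qed
  have fld: "x / s \<in> quad_field D" if "x \<in> quad_order D" for x
    using that sO by (intro field_divide order_in_field)
  have Aadd: "A (l + l') = A l + A l'" if "l \<in> L" "l' \<in> L" for l l'
    using that e Te by (simp add: A_def E_addr algebra_simps)
  have Aact: "A (act k l) = k * A l" if k: "k \<in> quad_order D" and l: "l \<in> L" for k l
  proof -
    have f1: "quad_trace D (k' * (A (act k l) / s - k * (A l / s))) = 0" if k': "k' \<in> quad_order D" for k'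
    proof -
      have "quad_trace D (k' * (A (act k l) / s)) = - E (act k' e) (act k l)"
        using AE[OF k' act_closed[OF k l]] by simp
      also have "E (act k' e) (act k l) = E (act (k * k') e) l"
        using E_act[OF k act_closed[OF k' e(1)] l] by (simp add: act_mult k k' e)
      also have "- E (act (k * k') e) l = quad_trace D (k' * (k * (A l / s)))"
        using AE[OF order_mult[OF k k'] l] by (simp add: mult_ac)
      finally have "quad_trace D (k' * (A (act k l) / s)) - quad_trace D (k' * (k * (A l / s))) = 0" by simp
      moreover have "k' * (A (act k l) / s) \<in> quad_field D" "k' * (k * (A l / s)) \<in> quad_field D"
        by (rule field_mult[OF order_in_field[OF k'] fld[OF AO[OF act_closed[OF k l]]]],
            rule field_mult[OF order_in_field[OF k'] field_mult[OF order_in_field[OF k] fld[OF AO[OF l]]]])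
      ultimately show ?thesis by (simp only: right_diff_distrib trace_diff)
    qed
    have "A (act k l) / s - k * (A l / s) \<in> quad_field D"
      by (intro field_diff field_mult fld AO act_closed k l order_in_field[OF k])
    then have "A (act k l) / s - k * (A l / s) = 0" using f1 by (rule trace_nondeg)
    then have "A (act k l) / s = k * A l / s" by simp
    then show ?thesis using s0 by simp
  qed
  have A0: "\<exists>k\<in>quad_order D. l = act k e" if l: "l \<in> L" "A l = 0" for l
  proof -
    obtain m n where mn: "E e l = of_int (- n)" "E (act (omega D) e) l = of_int (- (m + n * int D))"
      "A l = of_int m + of_int n * omega D" using Aint[OF l(1)] by blast
    then have "of_int m + of_int n * omega D = of_int 0 + of_int 0 * omega D" using l by simp
    then have "m = 0 \<and> n = 0" by (rule int_unique)
    then have "l \<in> line e" using mn l by (simp add: line_def)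
    then show ?thesis using line_of_good e by blast
  qed
  define I where "I = A ` L"
  have I: "ideal I RO"
    unfolding ideal_order_iff
  proof (intro conjI ballI)
    show "I \<subseteq> quad_order D" using AO by (auto simp: I_def)
    have "A 0 = 0" using Aadd[OF L_0 L_0] by simp
    then show "0 \<in> I" using L_0 unfolding I_def by force
  next
    fix x y assume "x \<in> I" "y \<in> I"
    then show "x + y \<in> I" unfolding I_def using Aadd L_add by (metis (no_types, lifting) image_iff)
  next
    fix k x assume "k \<in> quad_order D" "x \<in> I"
    then show "k * x \<in> I" unfolding I_def using Aact act_closed by (metis (no_types, lifting) image_iff)
  qed
  have Imem: "I \<subseteq> quad_order D" "0 \<in> I" "\<And>x y. x \<in> I \<Longrightarrow> y \<in> I \<Longrightarrow> x + y \<in> I"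
    "\<And>k x. k \<in> quad_order D \<Longrightarrow> x \<in> I \<Longrightarrow> k * x \<in> I"
    using I unfolding ideal_order_iff by auto
  have d0: "0 < d1" "d1 dvd d2" "0 < d2" using E_type by (auto simp: form_type_def)
  have e0: "e \<noteq> 0" using good_nonzero[of 2] e(2)[of 2] by simp
  have "I \<noteq> {0}"
  proof
    assume "I = {0}"
    then have "A l = 0" if "l \<in> L" for l using that unfolding I_def by blast
    then have "E e l = 0" if "l \<in> L" for l using AE[OF order_1 that] that by (simp add: act_one e quad_trace_def)
    then show False using E_nondeg[OF e(1)] e0 by blast
  qed
  then obtain g a r where gar: "0 < g" "0 < a" "a dvd omega_poly D r" "I = (\<lambda>x. of_int g * x) ` root_ideal D a r"
    using ideal_normal_form[OF I] by metis
  have "of_int (- r) + of_int 1 * omega D \<in> root_ideal D a r" "of_int a + of_int 0 * omega D \<in> root_ideal D a r"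
    unfolding mem_root_ideal_iff by simp_all
  then have gens: "of_int g * (of_int (- r) + of_int 1 * omega D) \<in> I" "of_int g * (of_int a + of_int 0 * omega D) \<in> I"
    unfolding gar(4) by blast+
  obtain w1 where w1: "w1 \<in> L" "A w1 = of_int g * of_int a" using gens(2) unfolding I_def by auto
  obtain w2 where w2: "w2 \<in> L" "A w2 = of_int g * (omega D - of_int r)" using gens(1) unfolding I_def by auto
  text \<open>The primes dividing the norm of the ideal divide \<open>d\<^sub>2 / d\<^sub>1\<close>, since elsewhere
    the form \<open>E / d\<^sub>1\<close> is unimodular.\<close>
  have pa: "p dvd int (d2 div d1)" if p: "prime p" "p dvd a" for p
  proof (rule ccontr)
    assume np: "\<not> p dvd int (d2 div d1)"
    obtain cg where cg: "g = cg * int d1"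
    proof -
      obtain m n where mn: "E e w2 = of_int (- n)" "E (act (omega D) e) w2 = of_int (- (m + n * int D))"
        "A w2 = of_int m + of_int n * omega D" using Aint[OF w2(1)] by blast
      have "of_int m + of_int n * omega D = of_int (- g * r) + of_int g * omega D"
        using mn(3) w2(2) by (simp add: algebra_simps)
      then have "n = g" by (blast dest: int_unique)
      obtain c where "E e w2 = of_int c * real d1" using E_Ints[OF e(1) w2(1)] by blast
      then have "real_of_int (- g) = real_of_int (c * int d1)" using mn(1) \<open>n = g\<close> by simp
      then have "- g = c * int d1" by (simp only: of_int_eq_iff)
      then have "g = (- c) * int d1" by simp
      then show thesis by (rule that)
    qed
    \<comment> \<open>k = omega' - r pairs every value of \<open>A\<close> to g times an integer
      divisible by a. Hence k e would be divisible by p in L, although its omega-coefficient is -1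
      and e is good at p.\<close>
    define k where "k = of_int (int D - r) + of_int (- 1) * omega D"
    have kO: "k \<in> quad_order D" unfolding k_def by (rule quad_orderI)
    have "pdvd p (act k e)"
    proof (rule pdvd_of_form[OF p(1) np act_closed[OF kO e(1)]])
      fix l assume l: "l \<in> L"
      then have "A l \<in> I" by (simp add: I_def)
      then obtain m n where mn: "A l = of_int g * (of_int m + of_int n * omega D)" "a dvd m + r * n"
        unfolding gar(4) root_ideal_def by auto
      then obtain t where t: "m + r * n = p * t" using p(2) by (meson dvd_trans dvdE)
      have "A l = of_int (g * m) + of_int (g * n) * omega D" using mn(1) by (simp add: algebra_simps)
      then have "quad_trace D (k * (A l / s)) = of_int ((int D - r) * (g * n) + (- 1) * (g * m) + (- 1) * (g * n) * int D)"
        unfolding k_def s_def by (simp only: trace_mult_div_sqrt)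
      then have "E (act k e) l = - of_int ((int D - r) * (g * n) + (- 1) * (g * m) + (- 1) * (g * n) * int D)"
        by (simp only: AE[OF kO l])
      also have "\<dots> = of_int (g * (m + r * n))" by (simp add: algebra_simps)
      also have "\<dots> = of_int (p * (cg * t)) * real d1" unfolding t cg by simp
      finally show "\<exists>c. E (act k e) l = of_int (p * c) * real d1" by blast
    qed
    then have "pdvd p (of_int (int D - r) *\<^sub>R e + of_int (- 1) *\<^sub>R act (omega D) e)"
      by (simp only: k_def act_form[OF e(1)])
    then have "p dvd - 1" using e(2)[OF p(1)] unfolding good_def by blast
    then show False using p(1) not_prime_unit by (metis dvd_minus_iff)
  qed
  obtain h where h: "omega_poly D r = a * h" using gar(3) by auto
  \<comment> \<open>A common prime p would divide D and its square would divide
    \<open>omega_poly D r\<close>, while p, a divisor of d2/d1, does not divide the conductor: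
    impossible by \<open>ramified_root_squarefree\<close>.\<close>
  have "gcd a (gcd (int D - 2 * r) h) = 1"
  proof (rule ccontr)
    assume "gcd a (gcd (int D - 2 * r) h) \<noteq> 1"
    then have "\<not> is_unit (gcd a (gcd (int D - 2 * r) h))" by simp
    moreover have "gcd a (gcd (int D - 2 * r) h) \<noteq> 0" using gar(2) by simp
    ultimately obtain p where p: "prime p" "p dvd gcd a (gcd (int D - 2 * r) h)"
      by (metis prime_divisor_exists)
    then have pd: "p dvd a" "p dvd int D - 2 * r" "p dvd h" by simp_all
    have "p dvd omega_poly D r" using pd(1) h by simp
    moreover have "p dvd 2 * r - int D" using pd(2) by (simp add: dvd_diff_commute)
    ultimately have "p dvd int D" using root_dvd_disc_iff[OF p(1)] by blast
    moreover have "p\<^sup>2 dvd omega_poly D r" using pd by (simp add: h power2_eq_square mult_dvd_mono)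
    moreover have "\<not> p dvd int f"
    proof
      assume "p dvd int f"
      moreover have "coprime (int (d2 div d1)) (int f)" using cop by simp
      ultimately have "is_unit p" using pa[OF p(1) pd(1)] by (meson coprime_common_divisor)
      then show False using p(1) not_prime_unit by blast
    qed
    ultimately show False using ramified_root_squarefree[OF p(1)] by blast
  qed
  moreover obtain u v where "u * (int D - 2 * r) + v * h = gcd (int D - 2 * r) h" using bezout_int by blast
  moreover obtain u' v' where "u' * a + v' * gcd (int D - 2 * r) h = gcd a (gcd (int D - 2 * r) h)" using bezout_int by blast
  ultimately have "u' * a + (v' * u) * (int D - 2 * r) + (v' * v) * h = 1"
    by (metis distrib_left mult.assoc add.assoc)
  then obtain \<alpha> \<beta> \<gamma> where bez: "\<alpha> * a + \<beta> * (int D - 2 * r) + \<gamma> * h = 1" by blast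
  \<comment> \<open>b1 and b2 lie in <1, (omega' - r)/a>, the inverse of the ideal <a, omega - r>.
    The Bezout relation \<open>bez\<close> is exactly what makes a b1 + (omega - r) b2 equal to
    1.\<close>
  define b1 where "b1 = of_int \<alpha> + of_int \<beta> * ((omega' D - of_int r) / of_int a)"
  define b2 where "b2 = of_int \<beta> + of_int \<gamma> * ((omega' D - of_int r) / of_int a)"
  have b12: "of_int a * b1 + (omega D - of_int r) * b2 = 1"
  proof -
    have hr: "(omega D - of_int r) * (omega' D - of_int r) = of_int a * of_int h"
    proof -
      have "(omega D - of_int r) * (omega' D - of_int r) = of_int (omega_poly D r)"
        using omega_mult_omega' by (simp add: omega_poly_def omega'_eq algebra_simps power2_eq_square)
      then show ?thesis by (simp add: h)
    qed
    have "of_int a * b1 + (omega D - of_int r) * b2 =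
        of_int \<alpha> * of_int a + of_int \<beta> * (omega D + omega' D - 2 * of_int r) +
        of_int \<gamma> * ((omega D - of_int r) * (omega' D - of_int r)) / of_int a"
      using gar(2) by (simp add: b1_def b2_def field_simps)
    also have "\<dots> = of_int (\<alpha> * a + \<beta> * (int D - 2 * r) + \<gamma> * h)"
      using gar(2) unfolding hr omega_add_omega' by simp
    finally show ?thesis using bez by simp
  qed
  have bO: "x * b1 / of_int g \<in> quad_order D" "x * b2 / of_int g \<in> quad_order D" if x: "x \<in> I" for x
  proof -
    obtain m n where mn: "x = of_int g * (of_int m + of_int n * omega D)" "a dvd m + r * n"
      using x unfolding gar(4) root_ideal_def by auto
    then obtain t where t: "m + r * n = a * t" by auto
    then have m: "m = a * t - r * n" by simp
    \<comment> \<open>An element of <a, omega - r> times omega' - r is a multiple of a, because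
      (omega - r)(omega' - r) = a h.\<close>
    have "(of_int m + of_int n * omega D) * (of_int (int D - r) + of_int (- 1) * omega D) =
        of_int (a * (t * (int D - r) + n * h)) + of_int (a * (- t)) * omega D"
    proof -
      have on: "omega_norm D = a * h - r * r + int D * r"
        using h by (simp add: omega_poly_def power2_eq_square)
      have "m * (int D - r) - n * (- 1) * omega_norm D = a * (t * (int D - r) + n * h)"
        "m * (- 1) + n * (int D - r) + n * (- 1) * int D = a * (- t)"
        by (simp_all add: m on algebra_simps)
      then show ?thesis by (simp only: int_mult_form)
    qed
    then have y: "(of_int m + of_int n * omega D) * ((omega' D - of_int r) / of_int a) =
        of_int (t * (int D - r) + n * h) + of_int (- t) * omega D" (is "?y = _")
      using gar(2) by (simp add: omega'_eq field_simps)
    have yO: "?y \<in> quad_order D" unfolding y by (rule quad_orderI)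
    have "x * b1 / of_int g = of_int \<alpha> * (of_int m + of_int n * omega D) + of_int \<beta> * ?y"
      "x * b2 / of_int g = of_int \<beta> * (of_int m + of_int n * omega D) + of_int \<gamma> * ?y"
    proof -
      have "G * X * (u + v * Z) / G = u * X + v * (X * Z)" if "G \<noteq> 0" for G X Z u v :: real
        using that by (simp add: field_simps)
      moreover have "real_of_int g \<noteq> 0" using gar(1) by simp
      ultimately show "x * b1 / of_int g = of_int \<alpha> * (of_int m + of_int n * omega D) + of_int \<beta> * ?y"
        "x * b2 / of_int g = of_int \<beta> * (of_int m + of_int n * omega D) + of_int \<gamma> * ?y"
        unfolding mn(1) b1_def b2_def by blast+
    qed
    moreover have "of_int i * (of_int m + of_int n * omega D) + of_int j * ?y \<in> quad_order D" for i j
      by (intro order_add order_mult order_int yO order_omega)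
    ultimately show "x * b1 / of_int g \<in> quad_order D" "x * b2 / of_int g \<in> quad_order D" by simp_all
  qed
  \<comment> \<open>w1 and w2 lie over the generators g a and g(omega - r), so \<open>b12\<close>
    recombines the coefficients to x and \<open>S\<close> is a section of \<open>A\<close>.\<close>
  define S where "S x = act (x * b1 / of_int g) w1 + act (x * b2 / of_int g) w2" for x
  have SL: "S x \<in> L" if "x \<in> I" for x
    unfolding S_def using bO[OF that] w1 w2 by (intro L_add act_closed)
  have Sadd: "S (x + y) = S x + S y" if "x \<in> I" "y \<in> I" for x y
    using bO[OF that(1)] bO[OF that(2)] w1 w2 by (simp add: S_def distrib_right add_divide_distrib act_add)
  have Sact: "S (k * x) = act k (S x)" if k: "k \<in> quad_order D" and x: "x \<in> I" for k x
  proof -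
    have "k * x * b1 / of_int g = k * (x * b1 / of_int g)" "k * x * b2 / of_int g = k * (x * b2 / of_int g)" by simp_all
    then show ?thesis
      using bO[OF x] k w1 w2 by (simp only: S_def act_mult act_vadd act_closed)
  qed
  have AS: "A (S x) = x" if x: "x \<in> I" for x
  proof -
    have "A (S x) = x * b1 / of_int g * A w1 + x * b2 / of_int g * A w2"
      unfolding S_def using bO[OF x] w1(1) w2(1) by (simp only: Aadd Aact act_closed)
    also have "\<dots> = x * (of_int a * b1 + (omega D - of_int r) * b2)"
      unfolding w1 w2 using gar(1) by (simp add: field_simps)
    finally show ?thesis using b12 by simp
  qed
  \<comment> \<open>A nonzero multiple m of \<open>S x\<close> equals x applied to the single vector
    S(m), so the image of \<open>S\<close> lies on one K-line and is isotropic.\<close>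
  have ESS: "E (S x) (S y) = 0" if xy: "x \<in> I" "y \<in> I" for x y
  proof -
    define m where "m = g * a"
    have m: "of_int m \<in> I" "m \<noteq> 0" using gens(2) gar(1,2) by (simp_all add: m_def)
    have xO: "x \<in> quad_order D" "y \<in> quad_order D" using xy Imem(1) by auto
    have "of_int m *\<^sub>R S z = act z (S (of_int m))" if z: "z \<in> I" for z
    proof -
      have zO: "z \<in> quad_order D" using z Imem(1) by auto
      have "of_int m *\<^sub>R S z = S (of_int m * z)" using Sact[OF order_int z] act_int[OF SL[OF z]] by simp
      also have "\<dots> = S (z * of_int m)" by (simp only: mult.commute)
      finally show ?thesis using Sact[OF zO m(1)] by simp
    qed
    then have "E (of_int m *\<^sub>R S x) (of_int m *\<^sub>R S y) = E (act x (S (of_int m))) (act y (S (of_int m)))"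
      using xy by simp
    also have "\<dots> = 0" using xO by (intro E_isotropic SL m)
    finally show ?thesis using SL xy m(2) by (simp add: E_scalel E_scaler L_scale)
  qed
  define \<psi> where "\<psi> = (\<lambda>(x, y). act x e + S (s * y))"
  have mod: "(x, y) \<in> ideal_module D I \<longleftrightarrow> x \<in> quad_order D \<and> s * y \<in> I" for x y
    by (simp add: ideal_module_def mem_twisted_ideal_iff s_def)
  have Aact0: "A (act x e) = 0" if x: "x \<in> quad_order D" for x
    using E_isotropic[OF e(1) order_1 x] E_isotropic[OF e(1) order_omega x] by (simp add: A_def act_one e)
  have A\<psi>: "A (\<psi> (x, y)) = s * y" if "(x, y) \<in> ideal_module D I" for x y
    using that by (simp add: mod \<psi>_def Aadd Aact0 act_closed e SL AS)
  have \<psi>L: "\<psi> p \<in> L" if "p \<in> ideal_module D I" for p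
    using that by (cases p) (simp add: mod \<psi>_def L_add act_closed e SL)
  show ?thesis
  proof (rule that[OF I, of \<psi>])
    show "bij_betw \<psi> (ideal_module D I) L"
    proof (rule bij_betw_imageI)
      show "inj_on \<psi> (ideal_module D I)"
      proof (rule inj_onI)
        fix p q assume pq: "p \<in> ideal_module D I" "q \<in> ideal_module D I" "\<psi> p = \<psi> q"
        obtain x y x' y' where xy: "p = (x, y)" "q = (x', y')" by fastforce
        have "s * y = s * y'" using A\<psi> pq unfolding xy by metis
        then have y: "y = y'" using s0 by simp
        then have "act x e = act x' e" using pq(3) by (simp add: xy \<psi>_def)
        then have "act (x - x') e = 0" using pq xy mod e by (simp add: act_sub)
        then have "x - x' = 0" using pq xy mod e(1) e0 order_diff by (intro act_eq_0[of _ e]) auto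
        then show "p = q" using y xy by simp
      qed
      show "\<psi> ` ideal_module D I = L"
      proof (intro equalityI subsetI)
        fix l assume l: "l \<in> L"
        then have Al: "A l \<in> I" by (simp add: I_def)
        have "A (l - S (A l)) + A (S (A l)) = A l"
          using Aadd[OF L_diff[OF l SL[OF Al]] SL[OF Al]] by simp
        then have "A (l - S (A l)) = 0" using AS[OF Al] by simp
        then obtain k where k: "k \<in> quad_order D" "l - S (A l) = act k e"
          using A0 L_diff[OF l SL[OF Al]] by blast
        have "l = \<psi> (k, A l / s)" using k(2) s0 by (simp add: \<psi>_def algebra_simps)
        moreover have "(k, A l / s) \<in> ideal_module D I" using k Al s0 by (simp add: mod)
        ultimately show "l \<in> \<psi> ` ideal_module D I" by blast
      qed (use \<psi>L in auto)
    qed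
    show "additive_on (ideal_module D I) \<psi>"
      unfolding additive_on_def
    proof (intro ballI)
      fix p q assume pq: "p \<in> ideal_module D I" "q \<in> ideal_module D I"
      obtain x y x' y' where xy: "p = (x, y)" "q = (x', y')" by fastforce
      show "\<psi> (p + q) = \<psi> p + \<psi> q"
        using pq e(1) unfolding xy mod by (simp add: \<psi>_def distrib_left act_add Sadd)
    qed
    show "E (\<psi> p) (\<psi> q) = trace_pairing D p q" if pq: "p \<in> ideal_module D I" "q \<in> ideal_module D I" for p q
    proof -
      obtain x y x' y' where xy: "p = (x, y)" "q = (x', y')" by fastforce
      have m: "x \<in> quad_order D" "x' \<in> quad_order D" "s * y \<in> I" "s * y' \<in> I" using pq unfolding xy mod by auto
      have L: "act x e \<in> L" "act x' e \<in> L" "S (s * y) \<in> L" "S (s * y') \<in> L"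
        using m e SL act_closed by auto
      have y: "y \<in> quad_field D" "y' \<in> quad_field D"
        using pq twisted_ideal_field[OF I] by (auto simp: xy ideal_module_def)
      have "E (\<psi> p) (\<psi> q) = E (act x e) (act x' e) + E (act x e) (S (s * y')) + (E (S (s * y)) (act x' e) + E (S (s * y)) (S (s * y')))"
        using L by (simp add: xy \<psi>_def E_addl E_addr L_add)
      also have "\<dots> = E (act x e) (S (s * y')) - E (act x' e) (S (s * y))"
        using E_isotropic[OF e(1) m(1,2)] ESS[OF m(3,4)] E_anti[OF L(2,3)] by simp
      also have "\<dots> = quad_trace D (x' * y) - quad_trace D (x * y')"
        using AE[OF m(1) L(4)] AE[OF m(2) L(3)] AS[OF m(3)] AS[OF m(4)] s0 by simp
      also have "\<dots> = trace_pairing D p q"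
        using m y by (simp add: xy trace_pairing_def trace_diff field_mult order_in_field)
      finally show ?thesis .
    qed
    show "\<psi> (k * x, k * y) = act k (\<psi> (x, y))" if k: "k \<in> quad_order D" and xy: "(x, y) \<in> ideal_module D I" for k x y
    proof -
      have "s * y \<in> I" using xy by (simp add: mod)
      from Sact[OF k this] have "S (s * (k * y)) = act k (S (s * y))" by (simp only: mult.left_commute)
      then show ?thesis
        using k xy e(1) SL by (simp add: \<psi>_def mod act_mult act_vadd act_closed)
    qed
  qed
qed

end

section \<open>Period surfaces\<close>

lemma scaleR_vec_complex: "a *\<^sub>R (v :: complex ^ 2) = of_real a *s v"
  by (simp add: vec_eq_iff) (simp add: scaleR_conv_of_real)

lemma matrix_vector_scaleR: "(A :: complex ^ 2 ^ 2) *v (a *\<^sub>R v) = a *\<^sub>R (A *v v)"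
  by (simp add: vec_eq_iff matrix_vector_mult_def sum_2 scaleR_right_distrib)

lemma scaleR_matrix_vector: "(a *\<^sub>R (A :: complex ^ 2 ^ 2)) *v v = a *\<^sub>R (A *v v)"
  by (simp add: vec_eq_iff matrix_vector_mult_def sum_2 scaleR_right_distrib)

lemma scaleR_matrix_mult: "(a *\<^sub>R (A :: complex ^ 2 ^ 2)) ** (b *\<^sub>R B) = (a * b) *\<^sub>R (A ** B)"
  by (simp add: vec_eq_iff matrix_matrix_mult_def sum_2 scaleR_right_distrib mult.commute)

lemma polarizationD:
  assumes "polarization L H"
  shows "H (u + v) w = H u w + H v w" "H (c *s v) w = c * H v w" "H w v = cnj (H v w)"
    "v \<noteq> 0 \<Longrightarrow> 0 < Re (H v v)" "v \<in> L \<Longrightarrow> w \<in> L \<Longrightarrow> Im (H v w) \<in> \<int>"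
    "H w (u + v) = H w u + H w v" "H w (c *s v) = cnj c * H w v"
    "H (a *\<^sub>R v) w = of_real a * H v w" "H w (a *\<^sub>R v) = of_real a * H w v"
proof -
  show 1: "H (u + v) w = H u w + H v w" and 2: "H (c *s v) w = c * H v w" and 3: "H w v = cnj (H v w)"
    and "v \<noteq> 0 \<Longrightarrow> 0 < Re (H v v)" "v \<in> L \<Longrightarrow> w \<in> L \<Longrightarrow> Im (H v w) \<in> \<int>" for u v w c
    using assms unfolding polarization_def by blast+
  show 4: "H w (u + v) = H w u + H w v" using 3[of w] 1 by (metis complex_cnj_add)
  show 5: "H w (c *s v) = cnj c * H w v" for c using 3[of w] 2 by (metis complex_cnj_mult)
  show "H (a *\<^sub>R v) w = of_real a * H v w" by (simp only: scaleR_vec_complex 2)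
  show "H w (a *\<^sub>R v) = of_real a * H w v" by (simp add: scaleR_vec_complex 5)
qed

text \<open>The imaginary part extends from L to its real span, and the real part is recovered from
  it by Re H(v, w) = Im H(iv, w).\<close>

lemma polarization_unique:
  assumes H: "polarization L H" and H': "polarization L' H'" and L: "span L = UNIV"
    and eq: "\<And>v w. v \<in> L \<Longrightarrow> w \<in> L \<Longrightarrow> Im (H v w) = Im (H' v w)"
  shows "H = H'"
proof -
  note P = polarizationD[OF H] polarizationD[OF H']
  have zero: "H 0 w = 0" "H' 0 w = 0" "H w 0 = 0" "H' w 0 = 0" for w
    using P(1)[of 0 0 w] P(10)[of 0 0 w] P(6)[of w 0 0] P(15)[of w 0 0] by simp_all
  note PP = P(1,2,6,7,8,9,10,11,15,16,17,18)
  have 1: "Im (H v w) = Im (H' v w)" if w: "w \<in> L" for v w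
  proof (rule span_induct[of v L "\<lambda>v. Im (H v w) = Im (H' v w)"])
    show "v \<in> span L" using L by simp
    show "subspace {v. Im (H v w) = Im (H' v w)}" by (auto simp: subspace_def zero PP)
  qed (use eq w in blast)
  have 2: "Im (H v w) = Im (H' v w)" for v w
  proof (rule span_induct[of w L "\<lambda>w. Im (H v w) = Im (H' v w)"])
    show "w \<in> span L" using L by simp
    show "subspace {w. Im (H v w) = Im (H' v w)}" by (auto simp: subspace_def zero PP)
  qed (use 1 in blast)
  have "H v w = H' v w" for v w
    using 2[of v w] 2[of "\<i> *s v" w] by (simp add: PP complex_eq_iff)
  then show ?thesis by blast
qed

lemma zbasis_reindex:
  fixes b :: "'i::finite \<Rightarrow> 'a::real_vector" and g :: "'j::finite \<Rightarrow> 'i"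
  assumes "bij g" "zbasis b L" shows "zbasis (b \<circ> g) L"
proof -
  have g: "g (inv_into UNIV g i) = i" "inv_into UNIV g (g j) = j" for i j
    using assms(1) by (simp_all add: bij_is_surj surj_f_inv_f bij_is_inj inv_f_f)
  have s: "(\<Sum>j\<in>UNIV. of_int (k j) *\<^sub>R b (g j)) = (\<Sum>i\<in>UNIV. of_int (k (inv_into UNIV g i)) *\<^sub>R b i)" for k
    using sum.reindex_bij_betw[of g UNIV UNIV "\<lambda>i. of_int (k (inv_into UNIV g i)) *\<^sub>R b i"] assms(1) by (simp add: g)
  show ?thesis
    unfolding zbasis_iff comp_def s
  proof (intro conjI allI impI)
    have "L = range (\<lambda>k. \<Sum>i\<in>UNIV. of_int (k i) *\<^sub>R b i)" using assms(2) unfolding zbasis_iff by blast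
    also have "\<dots> = range (\<lambda>k. \<Sum>i\<in>UNIV. of_int (k (inv_into UNIV g i)) *\<^sub>R b i)"
    proof (intro equalityI subsetI)
      fix x assume "x \<in> range (\<lambda>k. \<Sum>i\<in>UNIV. of_int (k i) *\<^sub>R b i)"
      then obtain k where "x = (\<Sum>i\<in>UNIV. of_int (k i) *\<^sub>R b i)" by blast
      then show "x \<in> range (\<lambda>k. \<Sum>i\<in>UNIV. of_int (k (inv_into UNIV g i)) *\<^sub>R b i)"
        by (intro image_eqI[of _ _ "k \<circ> g"]) (simp_all add: g)
    qed auto
    finally show "L = range (\<lambda>k. \<Sum>i\<in>UNIV. of_int (k (inv_into UNIV g i)) *\<^sub>R b i)" .
    fix k assume "(\<Sum>i\<in>UNIV. of_int (k (inv_into UNIV g i)) *\<^sub>R b i) = 0"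
    then have "k (inv_into UNIV g (g j)) = 0" for j by (rule zbasis_indep[OF assms(2)])
    then show "k = (\<lambda>_. 0)" by (simp add: g fun_eq_iff)
  qed
qed

lemma independent_rangeI:
  fixes b :: "'i::finite \<Rightarrow> 'a::real_vector"
  assumes "\<And>r i. (\<Sum>i\<in>UNIV. r i *\<^sub>R b i) = 0 \<Longrightarrow> r i = 0"
  shows "inj b" "independent (range b)"
proof -
  show i: "inj b"
  proof (rule injI, rule ccontr)
    fix i j assume ij: "b i = b j" "i \<noteq> j"
    have "(\<Sum>k\<in>UNIV. ((if k = i then 1 else 0) - (if k = j then 1 else 0)) *\<^sub>R b k) =
        (\<Sum>k\<in>UNIV. if k = i then b k else 0) - (\<Sum>k\<in>UNIV. if k = j then b k else 0)"
      unfolding sum_subtractf[symmetric] by (intro sum.cong) auto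
    also have "\<dots> = 0" using ij by simp
    finally show False using assms[of "\<lambda>k. (if k = i then 1 else 0) - (if k = j then 1 else 0)" i] ij by simp
  qed
  show "independent (range b)"
  proof
    assume "dependent (range b)"
    then obtain u where u: "\<exists>v\<in>range b. u v \<noteq> 0" "(\<Sum>v\<in>range b. u v *\<^sub>R v) = 0"
      by (auto simp: dependent_finite)
    then have "(\<Sum>i\<in>UNIV. u (b i) *\<^sub>R b i) = 0" using sum.reindex[OF i, of "\<lambda>v. u v *\<^sub>R v"] by simp
    then have "u (b i) = 0" for i by (rule assms)
    with u(1) show False by auto
  qed
qed

text \<open>A symplectic basis is real-linearly independent, so the type condition forces a lattice.\<close>

lemma lattice_of_form_type:
  assumes H: "polarization L H" and t: "form_type L (\<lambda>v w. Im (H v w)) d1 d2"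
  shows "is_lattice L"
proof -
  obtain u v :: "2 \<Rightarrow> complex ^ 2" where b: "0 < d1" "0 < d2" "d1 dvd d2" "zbasis (case_sum u v) L"
    "\<forall>i j. Im (H (u i) (u j)) = 0" "\<forall>i j. Im (H (v i) (v j)) = 0"
    "Im (H (u 1) (v 1)) = real d1" "Im (H (u 1) (v 2)) = 0" "Im (H (u 2) (v 1)) = 0" "Im (H (u 2) (v 2)) = real d2"
    "Im (H (v 1) (u 1)) = - real d1" "Im (H (v 2) (u 1)) = 0" "Im (H (v 1) (u 2)) = 0" "Im (H (v 2) (u 2)) = - real d2"
    using t by (rule form_typeE)
  \<comment> \<open>\<open>form_type\<close> indexes its basis by 2 + 2 and
    \<open>is_lattice\<close> by 4, so the symplectic basis is transported along a
    bijection.\<close>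
  have "card (UNIV :: 4 set) = card (UNIV :: (2 + 2) set)" by (simp add: card_UNIV_sum)
  then obtain g :: "4 \<Rightarrow> 2 + 2" where g: "bij g"
    using finite_same_card_bij[of "UNIV :: 4 set" "UNIV :: (2 + 2) set"] by auto
  note P = polarizationD[OF H]
  have H0: "H 0 w = 0" for w using P(1)[of 0 0 w] by simp
  have ind: "r i = 0" if r: "(\<Sum>i\<in>UNIV. r i *\<^sub>R case_sum u v i) = 0" for r i
  proof -
    have e: "r (Inl 1) *\<^sub>R u 1 + r (Inl 2) *\<^sub>R u 2 + (r (Inr 1) *\<^sub>R v 1 + r (Inr 2) *\<^sub>R v 2) = 0"
      using r unfolding sum_UNIV_plus sum_2 by simp
    have E: "r (Inl 1) * Im (H (u 1) w) + r (Inl 2) * Im (H (u 2) w) + (r (Inr 1) * Im (H (v 1) w) + r (Inr 2) * Im (H (v 2) w)) = 0" for w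
      using arg_cong[OF e, of "\<lambda>x. Im (H x w)"] by (simp add: P(1,8) H0)
    have "r (Inl 1) = 0" "r (Inl 2) = 0" "r (Inr 1) = 0" "r (Inr 2) = 0"
      using E[of "v 1"] E[of "v 2"] E[of "u 1"] E[of "u 2"] b by simp_all
    then have "\<forall>i. r i = 0" by (simp add: split_sum_all forall_2)
    then show ?thesis by blast
  qed
  have ind': "r j = 0" if r: "(\<Sum>j\<in>UNIV. r j *\<^sub>R (case_sum u v \<circ> g) j) = 0" for r j
  proof -
    have gi: "g (inv_into UNIV g i) = i" "inv_into UNIV g (g j) = j" for i j
      using g by (simp_all add: bij_is_surj surj_f_inv_f bij_is_inj inv_f_f)
    have "(\<Sum>i\<in>UNIV. r (inv_into UNIV g i) *\<^sub>R case_sum u v i) = 0"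
      using r sum.reindex_bij_betw[of g UNIV UNIV "\<lambda>i. r (inv_into UNIV g i) *\<^sub>R case_sum u v i"] g by (simp add: gi)
    then have "r (inv_into UNIV g (g j)) = 0" by (rule ind)
    then show ?thesis by (simp add: gi)
  qed
  have "inj (case_sum u v \<circ> g)" "independent (range (case_sum u v \<circ> g))"
    by (rule independent_rangeI(1), erule ind', rule independent_rangeI(2), erule ind')
  then show ?thesis
    unfolding is_lattice_def using zbasis_reindex[OF g b(4)] by blast
qed

lemma is_lattice_span: assumes "is_lattice L" shows "span L = UNIV"
proof -
  obtain b :: "4 \<Rightarrow> complex ^ 2" where b: "inj b" "independent (range b)" "zbasis b L"
    using assms unfolding is_lattice_def by blast
  have "card (range b) = 4" using b(1) by (simp add: card_image)
  moreover have "dim (UNIV :: (complex ^ 2) set) = 4" by simp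
  ultimately have "UNIV \<subseteq> span (range b)"
    using b(2) by (intro card_ge_dim_independent) auto
  moreover have "range b \<subseteq> L" using zbasis_basis_mem[OF b(3)] by auto
  ultimately show ?thesis using span_mono by blast
qed

text \<open>The diagonal Hermitian form with entries 1/Im z_i. It is the polarization determined by
  the trace pairing, as \<open>period_polarization_eq\<close> shows.\<close>

definition std_form :: "complex \<times> complex \<Rightarrow> complex ^ 2 \<Rightarrow> complex ^ 2 \<Rightarrow> complex" where
  "std_form z v w = v $ 1 * cnj (w $ 1) / of_real (Im (fst z)) + v $ 2 * cnj (w $ 2) / of_real (Im (snd z))"

lemma period_map_nth [simp]:
  "period_map D z p $ 1 = of_real (fst p) + of_real (snd p) * fst z"
  "period_map D z p $ 2 = of_real (quad_conj D (fst p)) + of_real (quad_conj D (snd p)) * snd z"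
  by (simp_all add: period_map_def split_def)

lemma period_rm_mult [simp]:
  "(period_rm D k *v v) $ 1 = of_real k * v $ 1" "(period_rm D k *v v) $ 2 = of_real (quad_conj D k) * v $ 2"
  by (simp_all add: period_rm_def matrix_vector_mult_def sum_2)

lemma torus_End_simps [simp]:
  "carrier (torus_End L) = {M. \<forall>v\<in>L. M *v v \<in> L}" "mult (torus_End L) = (**)" "one (torus_End L) = mat 1"
  "add (torus_End L) = (+)"
  by (simp_all add: torus_End_def)

lemma upper2_iff: "z \<in> upper2 \<longleftrightarrow> 0 < Im (fst z) \<and> 0 < Im (snd z)"
  by (cases z) (simp add: upper2_def)

lemma rm_rho:
  assumes "real_multiplication D L H \<rho>" "k \<in> quad_order D"
  shows "l \<in> quad_order D \<Longrightarrow> \<rho> (k * l) = \<rho> k ** \<rho> l" "l \<in> quad_order D \<Longrightarrow> \<rho> (k + l) = \<rho> k + \<rho> l"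
    "\<rho> 1 = mat 1" "v \<in> L \<Longrightarrow> \<rho> k *v v \<in> L" "H (\<rho> k *v v) w = H v (\<rho> k *v w)"
    "l \<in> quad_order D \<Longrightarrow> \<rho> k = \<rho> l \<Longrightarrow> k = l"
proof -
  have h: "\<rho> \<in> ring_hom (real_ring (quad_order D)) (torus_End L)" "inj_on \<rho> (quad_order D)"
    "\<forall>k\<in>quad_order D. self_adjoint H (\<rho> k)"
    using assms(1) unfolding real_multiplication_def by auto
  show "l \<in> quad_order D \<Longrightarrow> \<rho> (k * l) = \<rho> k ** \<rho> l" "l \<in> quad_order D \<Longrightarrow> \<rho> (k + l) = \<rho> k + \<rho> l"
    "\<rho> 1 = mat 1"
    using ring_hom_mult[OF h(1), of k l] ring_hom_add[OF h(1), of k l] ring_hom_one[OF h(1)] assms(2) by simp_all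
  show "v \<in> L \<Longrightarrow> \<rho> k *v v \<in> L" using ring_hom_closed[OF h(1), of k] assms(2) by simp
  show "H (\<rho> k *v v) w = H v (\<rho> k *v w)" using h(3) assms(2) by (simp add: self_adjoint_def)
  show "l \<in> quad_order D \<Longrightarrow> \<rho> k = \<rho> l \<Longrightarrow> k = l" using h(2) assms(2) by (auto dest: inj_onD)
qed

lemma rm_surfacesD:
  assumes "(L, H, \<rho>) \<in> rm_surfaces D d1 d2"
  shows "is_lattice L" "polarization L H" "form_type L (\<lambda>v w. Im (H v w)) d1 d2" "real_multiplication D L H \<rho>"
  using assms by (auto simp: rm_surfaces_def)

context quad_disc
begin

lemma type_ideals_mem:
  assumes "\<aa> \<in> type_ideals D d1 d2"
  shows "ideal \<aa> RO" "form_type (ideal_module D \<aa>) (trace_pairing D) d1 d2" "biadditive_on (ideal_module D \<aa>) (trace_pairing D)"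
    "0 < d1" "0 < d2" "d1 dvd d2" "real d2 \<in> twisted_ideal D \<aa>"
    "(x, y) \<in> ideal_module D \<aa> \<longleftrightarrow> x \<in> quad_order D \<and> y \<in> twisted_ideal D \<aa>"
    "y \<in> twisted_ideal D \<aa> \<Longrightarrow> y \<in> quad_field D" "0 \<in> twisted_ideal D \<aa>"
    "y \<in> twisted_ideal D \<aa> \<Longrightarrow> y' \<in> twisted_ideal D \<aa> \<Longrightarrow> y + y' \<in> twisted_ideal D \<aa>"
    "k \<in> quad_order D \<Longrightarrow> y \<in> twisted_ideal D \<aa> \<Longrightarrow> k * y \<in> twisted_ideal D \<aa>"
proof -
  show I: "ideal \<aa> RO" and t: "form_type (ideal_module D \<aa>) (trace_pairing D) d1 d2"
    using assms by (auto simp: type_ideals_def)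
  show "biadditive_on (ideal_module D \<aa>) (trace_pairing D)" using biadditive_trace_pairing[OF I] .
  show d: "0 < d1" "0 < d2" "d1 dvd d2" using t by (auto simp: form_type_def)
  show "(x, y) \<in> ideal_module D \<aa> \<longleftrightarrow> x \<in> quad_order D \<and> y \<in> twisted_ideal D \<aa>"
    by (simp add: ideal_module_def)
  show "y \<in> twisted_ideal D \<aa> \<Longrightarrow> y \<in> quad_field D" using twisted_ideal_field[OF I] .
  show "0 \<in> twisted_ideal D \<aa>"
    "y \<in> twisted_ideal D \<aa> \<Longrightarrow> y' \<in> twisted_ideal D \<aa> \<Longrightarrow> y + y' \<in> twisted_ideal D \<aa>"
    "k \<in> quad_order D \<Longrightarrow> y \<in> twisted_ideal D \<aa> \<Longrightarrow> k * y \<in> twisted_ideal D \<aa>"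
    using I unfolding ideal_order_iff mem_twisted_ideal_iff by (auto simp: distrib_left mult.left_commute)
  obtain r where r: "\<aa> = (\<lambda>x. real d1 * x) ` root_ideal D (d2 div d1) r" using assms by (rule type_idealsE)
  define n where "n = int (d2 div d1)"
  \<comment> \<open>sqrt D = 2 omega - D, so d2 sqrt D is d1 times this element; hence (0, d2)
    always lies in the module, although (0, 1) need not.\<close>
  have "of_int (- n * int D) + of_int (2 * n) * omega D \<in> root_ideal D n r"
    unfolding mem_root_ideal_iff by simp
  then have "real d1 * (of_int (- n * int D) + of_int (2 * n) * omega D) \<in> \<aa>" unfolding r n_def by blast
  also have "real d1 * (of_int (- n * int D) + of_int (2 * n) * omega D) = (real d1 * of_int n) * sqrt (real D)"
    by (simp add: omega_def field_simps)
  also have "real d1 * of_int n = real d2" using d(3) by (simp add: n_def flip: of_nat_mult)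
  finally show "real d2 \<in> twisted_ideal D \<aa>" by (simp add: mem_twisted_ideal_iff mult.commute)
qed

text \<open>The first coordinate contributes x'y - xy' and the second one its conjugate; division by
  Im z_i normalises both.\<close>

lemma Im_std_form_period:
  assumes z: "z \<in> upper2" and p: "fst p \<in> quad_field D" "snd p \<in> quad_field D"
    and q: "fst q \<in> quad_field D" "snd q \<in> quad_field D"
  shows "Im (std_form z (period_map D z p) (period_map D z q)) = trace_pairing D p q"
proof -
  have "Im ((of_real x + of_real y * w) * cnj (of_real x' + of_real y' * w) / of_real (Im w)) = x' * y - x * y'"
    if "0 < Im w" for x y x' y' w
  proof -
    have "Im ((of_real x + of_real y * w) * cnj (of_real x' + of_real y' * w) / of_real (Im w)) =
        Im ((of_real x + of_real y * w) * cnj (of_real x' + of_real y' * w)) / Im w"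
      by (rule Im_divide_of_real)
    also have "Im ((of_real x + of_real y * w) * cnj (of_real x' + of_real y' * w)) = (x' * y - x * y') * Im w"
      by (simp add: algebra_simps)
    finally show ?thesis using that by simp
  qed
  then show ?thesis
    using z p q by (simp add: std_form_def upper2_iff trace_pairing_def split_def quad_trace_def field_mult field_diff)
qed

lemma inj_on_period_map:
  assumes z: "z \<in> upper2" shows "inj_on (period_map D z) UNIV"
proof (rule injI)
  fix p q assume e: "period_map D z p = period_map D z q"
  have "of_real (fst p) + of_real (snd p) * fst z = of_real (fst q) + of_real (snd q) * fst z"
    using arg_cong[OF e, of "\<lambda>v :: complex ^ 2. v $ 1"] by simp
  from arg_cong[OF this, of Im] arg_cong[OF this, of Re] show "p = q"
    using z by (simp add: upper2_iff prod_eq_iff)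
qed

lemma period_map_add:
  assumes "fst p \<in> quad_field D" "snd p \<in> quad_field D" "fst q \<in> quad_field D" "snd q \<in> quad_field D"
  shows "period_map D z (p + q) = period_map D z p + period_map D z q"
  using assms by (simp add: vec_eq_iff forall_2 algebra_simps)

lemma period_map_mult:
  assumes "k \<in> quad_field D" "x \<in> quad_field D" "y \<in> quad_field D"
  shows "period_map D z (k * x, k * y) = period_rm D k *v period_map D z (x, y)"
  using assms by (simp add: vec_eq_iff forall_2 algebra_simps)

lemma ideal_module_field:
  assumes "\<aa> \<in> type_ideals D d1 d2" "p \<in> ideal_module D \<aa>"
  shows "fst p \<in> quad_field D" "snd p \<in> quad_field D"
  using assms type_ideals_mem(8,9)[OF assms(1)] by (cases p, auto intro: order_in_field)+

lemma polarization_std_form: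
  assumes a: "\<aa> \<in> type_ideals D d1 d2" and z: "z \<in> upper2"
  shows "polarization (period_lattice D \<aa> z) (std_form z)"
  unfolding polarization_def
proof (intro conjI allI impI ballI)
  show "std_form z (u + v) w = std_form z u w + std_form z v w" for u v w
    by (simp add: std_form_def algebra_simps add_divide_distrib)
  show "std_form z (c *s v) w = c * std_form z v w" for c v w
    by (simp add: std_form_def algebra_simps)
  show "std_form z w v = cnj (std_form z v w)" for v w
    by (simp add: std_form_def algebra_simps)
  show "0 < Re (std_form z v v)" if "v \<noteq> 0" for v
  proof -
    have "Re (std_form z v v) = (cmod (v $ 1))\<^sup>2 / Im (fst z) + (cmod (v $ 2))\<^sup>2 / Im (snd z)"
      unfolding std_form_def plus_complex.sel Re_divide_of_real complex_norm_square[symmetric]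
      by (simp add: Re_divide_of_real flip: complex_norm_square)
    moreover have "v $ 1 \<noteq> 0 \<or> v $ 2 \<noteq> 0" using that by (auto simp: vec_eq_iff forall_2)
    ultimately show ?thesis using z unfolding upper2_iff by (auto intro: add_pos_nonneg add_nonneg_pos)
  qed
  fix v w assume "v \<in> period_lattice D \<aa> z" "w \<in> period_lattice D \<aa> z"
  then obtain p q where pq: "v = period_map D z p" "w = period_map D z q" "p \<in> ideal_module D \<aa>" "q \<in> ideal_module D \<aa>"
    by (auto simp: period_lattice_def)
  obtain c where "trace_pairing D p q = of_int c * real d1"
    using form_type_values[OF type_ideals_mem(2,3)[OF a] pq(3,4)] by blast
  then have "Im (std_form z v w) = of_int c * real d1"
    unfolding pq(1,2) using Im_std_form_period[OF z] ideal_module_field[OF a] pq by simp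
  then show "Im (std_form z v w) \<in> \<int>" by simp
qed

lemma form_type_period:
  assumes a: "\<aa> \<in> type_ideals D d1 d2" and z: "z \<in> upper2"
  shows "form_type (period_lattice D \<aa> z) (\<lambda>v w. Im (std_form z v w)) d1 d2"
  unfolding period_lattice_def
proof (rule form_type_image[OF type_ideals_mem(2)[OF a]])
  show "additive_on (ideal_module D \<aa>) (period_map D z)"
    using ideal_module_field[OF a] by (auto simp: additive_on_def intro!: period_map_add)
  show "inj_on (period_map D z) (ideal_module D \<aa>)"
    using inj_on_period_map[OF z] by (rule inj_on_subset) simp
  show "Im (std_form z (period_map D z x) (period_map D z y)) = trace_pairing D x y"
    if "x \<in> ideal_module D \<aa>" "y \<in> ideal_module D \<aa>" for x y
    using Im_std_form_period[OF z] ideal_module_field[OF a] that by simp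
qed

lemma span_period_lattice:
  assumes "\<aa> \<in> type_ideals D d1 d2" "z \<in> upper2" shows "span (period_lattice D \<aa> z) = UNIV"
  using is_lattice_span[OF lattice_of_form_type[OF polarization_std_form form_type_period]] assms by blast

lemma period_polarization_eq:
  assumes a: "\<aa> \<in> type_ideals D d1 d2" and z: "z \<in> upper2"
  shows "period_polarization D \<aa> z = std_form z"
  unfolding period_polarization_def
proof (rule the_equality)
  have m: "Im (std_form z (period_map D z p) (period_map D z q)) = trace_pairing D p q"
    if "p \<in> ideal_module D \<aa>" "q \<in> ideal_module D \<aa>" for p q
    using Im_std_form_period[OF z] ideal_module_field[OF a] that by simp
  then show "polarization (period_lattice D \<aa> z) (std_form z) \<and> (\<forall>p\<in>ideal_module D \<aa>. \<forall>q\<in>ideal_module D \<aa>.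
      Im (std_form z (period_map D z p) (period_map D z q)) = trace_pairing D p q)"
    using polarization_std_form[OF a z] by blast
  fix H assume H: "polarization (period_lattice D \<aa> z) H \<and> (\<forall>p\<in>ideal_module D \<aa>. \<forall>q\<in>ideal_module D \<aa>.
      Im (H (period_map D z p) (period_map D z q)) = trace_pairing D p q)"
  show "H = std_form z"
    by (rule polarization_unique[OF conjunct1[OF H] polarization_std_form[OF a z] span_period_lattice[OF a z]])
      (use H m in \<open>auto simp: period_lattice_def\<close>)
qed

lemma period_surface_eq:
  assumes "\<aa> \<in> type_ideals D d1 d2" "z \<in> upper2"
  shows "period_surface D \<aa> z = (period_lattice D \<aa> z, std_form z, period_rm D)"
  using period_polarization_eq[OF assms] by (simp add: period_surface_def)

text \<open>The point is properness. An extension to t in K must multiply the first coordinate by t,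
  because an integral multiple of t lies in the order; its effect on the image of (1, 0) then shows
  that t lies in the order.\<close>

lemma period_surface_rm:
  assumes a: "\<aa> \<in> type_ideals D d1 d2" and z: "z \<in> upper2"
  shows "period_surface D \<aa> z \<in> rm_surfaces D d1 d2"
proof -
  note A = type_ideals_mem[OF a]
  let ?L = "period_lattice D \<aa> z"
  have mem: "period_rm D k *v v \<in> ?L" if k: "k \<in> quad_order D" and v: "v \<in> ?L" for k v
  proof -
    obtain x y where xy: "v = period_map D z (x, y)" "x \<in> quad_order D" "y \<in> twisted_ideal D \<aa>"
      using v A(8) by (auto simp: period_lattice_def)
    have "period_rm D k *v v = period_map D z (k * x, k * y)"
      using xy k A(9) by (simp add: period_map_mult order_in_field)
    moreover have "(k * x, k * y) \<in> ideal_module D \<aa>" using xy k A by (simp add: order_mult)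
    ultimately show ?thesis by (auto simp: period_lattice_def)
  qed
  have hom: "period_rm D \<in> ring_hom (real_ring (quad_order D)) (torus_End ?L)"
  proof (rule ring_hom_memI)
    show "period_rm D x \<in> carrier (torus_End ?L)" if "x \<in> carrier (real_ring (quad_order D))" for x
      using that mem by simp
  qed (auto simp: period_rm_def vec_eq_iff forall_2 matrix_matrix_mult_def sum_2 order_in_field mat_def)
  have inj: "inj_on (period_rm D) (quad_order D)"
    by (rule inj_onI) (auto simp: period_rm_def vec_eq_iff forall_2)
  have sa: "self_adjoint (std_form z) (period_rm D k)" for k
    by (simp add: self_adjoint_def std_form_def mult_ac)
  have proper: "\<not> (\<exists>R \<rho>'. is_order D R \<and> quad_order D \<subset> R \<and> \<rho>' \<in> ring_hom (real_ring R) (torus_End ?L) \<and>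
      inj_on \<rho>' R \<and> (\<forall>k\<in>quad_order D. \<rho>' k = period_rm D k))"
  proof
    assume "\<exists>R \<rho>'. is_order D R \<and> quad_order D \<subset> R \<and> \<rho>' \<in> ring_hom (real_ring R) (torus_End ?L) \<and>
      inj_on \<rho>' R \<and> (\<forall>k\<in>quad_order D. \<rho>' k = period_rm D k)"
    then obtain R \<rho>' where R: "is_order D R" "quad_order D \<subset> R" "\<rho>' \<in> ring_hom (real_ring R) (torus_End ?L)"
      "\<forall>k\<in>quad_order D. \<rho>' k = period_rm D k" by blast
    then obtain t where t: "t \<in> R" "t \<notin> quad_order D" by blast
    have RK: "R \<subseteq> quad_field D" using R(1) by (simp add: is_order_def subring_field_iff)
    obtain x y where xy: "x \<in> \<rat>" "y \<in> \<rat>" "t = x + y * omega D" using t RK fieldE by blast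
    obtain a b where ab: "b > 0" "x = of_int a / of_int b" using xy(1) by (metis Rats_cases')
    obtain c d where cd: "d > 0" "y = of_int c / of_int d" using xy(2) by (metis Rats_cases')
    have Nt: "of_int (b * d) * t = of_int (a * d) + of_int (c * b) * omega D"
    proof -
      have xb: "x * of_int b = of_int a" "y * of_int d = of_int c" using ab cd by simp_all
      have "of_int (b * d) * t = of_int d * (x * of_int b) + of_int b * (y * of_int d) * omega D"
        by (simp add: xy(3) algebra_simps)
      then show ?thesis unfolding xb by (simp add: algebra_simps)
    qed
    have NR: "of_int (b * d) \<in> quad_order D" "of_int (b * d) * t \<in> quad_order D"
      unfolding Nt by (rule order_int, rule quad_orderI)
    have "period_rm D (of_int (b * d) * t) = \<rho>' (of_int (b * d) * t)" using R(4) NR by simp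
    also have "\<dots> = \<rho>' (of_int (b * d)) ** \<rho>' t"
      using ring_hom_mult[OF R(3), of "of_int (b * d)" t] t NR R(2) by auto
    also have "\<rho>' (of_int (b * d)) = period_rm D (of_int (b * d))" using R(4) NR by simp
    finally have "period_rm D (of_int (b * d) * t) *v v = period_rm D (of_int (b * d)) *v (\<rho>' t *v v)" for v
      by (simp add: matrix_vector_mul_assoc)
    from arg_cong[OF this, of "\<lambda>v :: complex ^ 2. v $ 1"] have "of_real (of_int (b * d) * t) * v $ 1 = of_real (of_int (b * d)) * (\<rho>' t *v v) $ 1" for v
      by simp
    then have t1: "(\<rho>' t *v v) $ 1 = of_real t * v $ 1" for v using ab cd by simp
    \<comment> \<open>The image of this vector has first coordinate t, which is real, so its
      component along z_1 vanishes and t is an element of the order.\<close>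
    have "period_map D z (1, 0) \<in> ?L" using A order_1 by (auto simp: period_lattice_def)
    then have "\<rho>' t *v period_map D z (1, 0) \<in> ?L" using ring_hom_closed[OF R(3), of t] t by simp
    then obtain x y where xy: "\<rho>' t *v period_map D z (1, 0) = period_map D z (x, y)" "x \<in> quad_order D"
      using A(8) by (auto simp: period_lattice_def)
    then have "of_real t = of_real x + of_real y * fst z"
      using t1[of "period_map D z (1, 0)"] by simp
    from arg_cong[OF this, of Im] arg_cong[OF this, of Re] have "t = x" using z by (simp add: upper2_iff)
    with xy t show False by simp
  qed
  have "real_multiplication D ?L (std_form z) (period_rm D)"
    unfolding real_multiplication_def using hom inj sa proper by blast
  then show ?thesis
    unfolding period_surface_eq[OF a z] rm_surfaces_def
    using polarization_std_form[OF a z] form_type_period[OF a z] lattice_of_form_type by blast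
qed

end

lemma rm_isoI:
  assumes "T \<in> rm_surfaces D d1 d2" "T' \<in> rm_surfaces D d1 d2" "T = (L, H, \<rho>)" "T' = (L', H', \<rho>')"
    "invertible F" "(\<lambda>v. F *v v) ` L = L'" "\<And>v w. H' (F *v v) (F *v w) = H v w"
    "\<And>k. k \<in> quad_order D \<Longrightarrow> F ** \<rho> k = \<rho>' k ** F"
  shows "(T, T') \<in> rm_iso D d1 d2"
  using assms unfolding rm_iso_def by blast

lemma rm_isoE:
  assumes "(T, T') \<in> rm_iso D d1 d2" "T = (L, H, \<rho>)" "T' = (L', H', \<rho>')"
  obtains F where "invertible F" "(\<lambda>v. F *v v) ` L = L'" "\<And>v w. H' (F *v v) (F *v w) = H v w"
    "\<And>k. k \<in> quad_order D \<Longrightarrow> F ** \<rho> k = \<rho>' k ** F"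
  using assms unfolding rm_iso_def by blast

lemma equiv_rm_iso: "equiv (rm_surfaces D d1 d2) (rm_iso D d1 d2)"
proof (rule equivI)
  show "rm_iso D d1 d2 \<subseteq> rm_surfaces D d1 d2 \<times> rm_surfaces D d1 d2" by (auto simp: rm_iso_def)
  show "refl_on (rm_surfaces D d1 d2) (rm_iso D d1 d2)"
  proof (rule refl_onI)
    fix T assume T: "T \<in> rm_surfaces D d1 d2"
    obtain L H \<rho> where "T = (L, H, \<rho>)" by (cases T) auto
    with T show "(T, T) \<in> rm_iso D d1 d2"
      by (intro rm_isoI[where F = "mat 1"]) (auto simp: invertible_def intro: exI[of _ "mat 1"])
  qed
  show "sym (rm_iso D d1 d2)"
  proof (rule symI)
    fix T T' assume i: "(T, T') \<in> rm_iso D d1 d2"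
    obtain L H \<rho> L' H' \<rho>' where T: "T = (L, H, \<rho>)" "T' = (L', H', \<rho>')" by (cases T, cases T') auto
    obtain F where F: "invertible F" "(\<lambda>v. F *v v) ` L = L'" "\<And>v w. H' (F *v v) (F *v w) = H v w"
      "\<And>k. k \<in> quad_order D \<Longrightarrow> F ** \<rho> k = \<rho>' k ** F" using rm_isoE[OF i T] by blast
    obtain G where G: "F ** G = mat 1" "G ** F = mat 1" using F(1) unfolding invertible_def by blast
    have FG: "F *v (G *v v) = v" "G *v (F *v v) = v" for v using G by (simp_all add: matrix_vector_mul_assoc)
    show "(T', T) \<in> rm_iso D d1 d2"
    proof (rule rm_isoI[OF _ _ T(2,1)])
      show "T \<in> rm_surfaces D d1 d2" "T' \<in> rm_surfaces D d1 d2" using i by (auto simp: rm_iso_def)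
      show "invertible G" using G unfolding invertible_def by blast
      show "(\<lambda>v. G *v v) ` L' = L" unfolding F(2)[symmetric] image_image FG by simp
      show "H (G *v v) (G *v w) = H' v w" for v w using F(3)[of "G *v v" "G *v w"] by (simp add: FG)
      show "G ** \<rho>' k = \<rho> k ** G" if "k \<in> quad_order D" for k
      proof -
        have "G ** \<rho>' k = G ** (\<rho>' k ** F) ** G" by (simp add: matrix_mul_assoc[symmetric] G)
        also have "\<dots> = G ** F ** \<rho> k ** G" by (simp add: F(4)[OF that, symmetric] matrix_mul_assoc)
        finally show ?thesis by (simp add: G)
      qed
    qed
  qed
  show "trans (rm_iso D d1 d2)"
  proof (rule transI)
    fix T T' T'' assume i: "(T, T') \<in> rm_iso D d1 d2" "(T', T'') \<in> rm_iso D d1 d2"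
    obtain L H \<rho> L' H' \<rho>' L'' H'' \<rho>'' where T: "T = (L, H, \<rho>)" "T' = (L', H', \<rho>')" "T'' = (L'', H'', \<rho>'')"
      by (cases T, cases T', cases T'') auto
    obtain F where F: "invertible F" "(\<lambda>v. F *v v) ` L = L'" "\<And>v w. H' (F *v v) (F *v w) = H v w"
      "\<And>k. k \<in> quad_order D \<Longrightarrow> F ** \<rho> k = \<rho>' k ** F" using rm_isoE[OF i(1) T(1,2)] by blast
    obtain G where G: "invertible G" "(\<lambda>v. G *v v) ` L' = L''" "\<And>v w. H'' (G *v v) (G *v w) = H' v w"
      "\<And>k. k \<in> quad_order D \<Longrightarrow> G ** \<rho>' k = \<rho>'' k ** G" using rm_isoE[OF i(2) T(2,3)] by blast
    show "(T, T'') \<in> rm_iso D d1 d2"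
    proof (rule rm_isoI[OF _ _ T(1,3)])
      show "T \<in> rm_surfaces D d1 d2" "T'' \<in> rm_surfaces D d1 d2" using i by (auto simp: rm_iso_def)
      show "invertible (G ** F)" using F(1) G(1) by (rule invertible_mult[rotated])
      show "(\<lambda>v. (G ** F) *v v) ` L = L''"
        by (simp add: F(2)[symmetric] G(2)[symmetric] image_image matrix_vector_mul_assoc)
      show "H'' ((G ** F) *v v) ((G ** F) *v w) = H v w" for v w
        by (simp add: F(3) G(3) flip: matrix_vector_mul_assoc)
      show "(G ** F) ** \<rho> k = \<rho>'' k ** (G ** F)" if "k \<in> quad_order D" for k
      proof -
        have "(G ** F) ** \<rho> k = G ** (\<rho>' k ** F)" by (simp add: matrix_mul_assoc[symmetric] F(4)[OF that])
        also have "\<dots> = \<rho>'' k ** (G ** F)" by (simp add: matrix_mul_assoc G(4)[OF that])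
        finally show ?thesis .
      qed
    qed
  qed
qed

context quad_conductor
begin

text \<open>If (omega - c)/p = t maps L into itself, then t is integral by
  \<open>scalar_line_integral\<close>, Z[t] is a strictly larger order, and the multiplication
  extends to it, against properness.\<close>

lemma rm_surface_module:
  assumes T: "(L, H, \<rho>) \<in> rm_surfaces D d1 d2"
  shows "proper_order_module D \<Delta> f L (\<lambda>k v. \<rho> k *v v) (\<lambda>v w. Im (H v w)) d1 d2"
proof -
  note R = rm_surfacesD[OF T]
  note P = polarizationD[OF R(2)]
  note \<rho> = rm_rho[OF R(4)]
  interpret M: symplectic_order_module D \<Delta> f L "\<lambda>k v. \<rho> k *v v" "\<lambda>v w. Im (H v w)" d1 d2
  proof unfold_locales
    show "biadditive_on L (\<lambda>v w. Im (H v w))" by (simp add: biadditive_on_def additive_on_def P(1,6))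
    show "Im (H w v) = - Im (H v w)" for v w by (subst P(3)) simp
    show "\<rho> (k * l) *v v = \<rho> k *v (\<rho> l *v v)" if "k \<in> quad_order D" "l \<in> quad_order D" for k l v
      using \<rho>(1)[OF that] by (simp add: matrix_vector_mul_assoc)
    show "\<rho> (k + l) *v v = \<rho> k *v v + \<rho> l *v v" if "k \<in> quad_order D" "l \<in> quad_order D" for k l v
      using \<rho>(2)[OF that] by (simp add: matrix_vector_mult_add_rdistrib)
    show "\<rho> 1 *v v = v" for v using \<rho>(3)[OF order_1] by simp
    show "\<rho> k *v (v + w) = \<rho> k *v v + \<rho> k *v w" for k v w by (rule matrix_vector_right_distrib)
    show "\<rho> k *v v \<in> L" if "k \<in> quad_order D" "v \<in> L" for k v using \<rho>(4) that by blast
    show "Im (H (\<rho> k *v v) w) = Im (H v (\<rho> k *v w))" if "k \<in> quad_order D" for k v w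
      using \<rho>(5)[OF that] by simp
    show "form_type L (\<lambda>v w. Im (H v w)) d1 d2" by (rule R(3))
  qed
  show ?thesis
  proof unfold_locales
    fix p c :: int assume p: "prime p"
    show "\<not> (\<forall>v\<in>L. \<exists>w\<in>L. \<rho> (omega D - of_int c) *v v = of_int p *\<^sub>R w)"
    proof
      assume sc: "\<forall>v\<in>L. \<exists>w\<in>L. \<rho> (omega D - of_int c) *v v = of_int p *\<^sub>R w"
      define t where "t = (omega D - of_int c) / of_int p"
      have p0: "p > 0" using p by (rule prime_gt_0_int)
      obtain e where e: "e \<in> L" "e \<noteq> 0" using M.exists_nonzero by blast
      have "\<forall>l\<in>M.line e. M.eigen p c l"
        using sc M.line_closed(1)[OF e(1)] unfolding M.eigen_def M.pdvd_def by blast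
      from M.scalar_line_integral[OF e p this] obtain s q where sq: "quad_trace D t = of_int s" "t * quad_conj D t = of_int q"
        unfolding t_def by (auto elim!: Ints_cases)
      have tt: "t * t = of_int s * t - of_int q"
        unfolding sq[symmetric] by (simp add: quad_trace_def algebra_simps)
      have tK: "t \<in> quad_field D" unfolding t_def by (intro field_divide field_diff field_omega field_rat) auto
      \<comment> \<open>Z[t]; closed under multiplication since trace and norm of t are
        integers.\<close>
      define R where "R = {of_int m + of_int n * t | m n :: int. True}"
      have RI: "of_int m + of_int n * t \<in> R" for m n by (auto simp: R_def)
      have pR: "of_int p * (of_int m + of_int n * t) = of_int (p * m - n * c) + of_int n * omega D" for m n
        using p0 by (simp add: t_def field_simps)
      have OR: "of_int m + of_int n * omega D = of_int (m + n * c) + of_int (n * p) * t" for m n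
        using p0 by (simp add: t_def field_simps)
      have mul: "(of_int m + of_int n * t) * (of_int k + of_int l * t) =
          of_int (m * k - n * l * q) + of_int (m * l + n * k + n * l * s) * t" for m n k l
      proof -
        have "(of_int m + of_int n * t) * (of_int k + of_int l * t) =
            of_int m * of_int k + (of_int m * of_int l + of_int n * of_int k) * t + of_int n * of_int l * (t * t)"
          by (simp add: algebra_simps)
        then show ?thesis unfolding tt by (simp add: algebra_simps)
      qed
      have Rmul: "x * y \<in> R" if xy: "x \<in> R" "y \<in> R" for x y
      proof -
        obtain m n k l where "x = of_int m + of_int n * t" "y = of_int k + of_int l * t"
          using xy unfolding R_def by blast
        then show ?thesis by (simp only: mul RI)
      qed
      have Radd: "x + y \<in> R" if xy: "x \<in> R" "y \<in> R" for x y
      proof -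
        obtain m n k l where "x = of_int m + of_int n * t" "y = of_int k + of_int l * t"
          using xy unfolding R_def by blast
        then have "x + y = of_int (m + k) + of_int (n + l) * t" by (simp add: algebra_simps)
        then show ?thesis by (simp only: RI)
      qed
      have "zbasis (\<lambda>i::2. if i = 1 then 1 else t) R"
        unfolding zbasis_2_iff
      proof (intro conjI allI impI)
        fix m n :: int assume "of_int m *\<^sub>R (if (1::2) = 1 then 1 else t) + of_int n *\<^sub>R (if (2::2) = 1 then 1 else t) = 0"
        then have "of_int p * (of_int m + of_int n * t) = 0" by simp
        then have "of_int (p * m - n * c) + of_int n * omega D = of_int 0 + of_int 0 * omega D" unfolding pR by simp
        then have "p * m - n * c = 0 \<and> n = 0" by (rule int_unique)
        then show "m = 0" "n = 0" using p0 by auto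
      qed (auto simp: R_def)
      moreover have "subring R (real_ring (quad_field D))"
        unfolding subring_field_iff
      proof (intro conjI ballI)
        show "R \<subseteq> quad_field D" using tK by (auto simp: R_def intro!: field_add[OF field_rat field_mult[OF field_rat]])
        show "1 \<in> R" using RI[of 1 0] by simp
        show "- x \<in> R" if "x \<in> R" for x using Rmul[OF that RI[of "-1" 0]] by simp
      qed (use Rmul Radd in auto)
      ultimately have ord: "is_order D R" unfolding is_order_def by blast
      have sub: "quad_order D \<subset> R"
      proof
        show "quad_order D \<subseteq> R"
        proof
          fix x assume "x \<in> quad_order D"
          then obtain m n where "x = of_int m + of_int n * omega D" by (rule quad_orderE)
          then show "x \<in> R" by (simp only: OR RI)
        qed
        have "t \<notin> quad_order D"
        proof
          assume "t \<in> quad_order D"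
          then obtain m n where "t = of_int m + of_int n * omega D" by (rule quad_orderE)
          then have "of_int (- c) + of_int 1 * omega D = of_int (p * m) + of_int (p * n) * omega D"
            using p0 by (simp add: t_def field_simps)
          then have "1 = p * n" by (blast dest: int_unique)
          then have "p dvd 1" by (metis dvd_triv_left)
          then show False using p not_prime_unit by blast
        qed
        then show "quad_order D \<noteq> R" using RI[of 0 1] by auto
      qed
      have pRO: "of_int p * x \<in> quad_order D" if xR: "x \<in> R" for x
      proof -
        obtain m n where "x = of_int m + of_int n * t" using xR unfolding R_def by blast
        then show ?thesis by (simp only: pR quad_orderI)
      qed
      have \<rho>s: "\<rho> (of_int n * k) = of_int n *\<^sub>R \<rho> k" if "k \<in> quad_order D" for n k
        using additive_on_scale[of "quad_order D" \<rho> k n] that \<rho>(2)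
        by (auto simp: additive_on_def order_0 order_add order_minus)
      \<comment> \<open>p R is contained in the order, so the extension is defined by dividing by p,
        and it preserves L because t does.\<close>
      define \<rho>' where "\<rho>' x = (1 / of_int p) *\<^sub>R \<rho> (of_int p * x)" for x
      have ext: "\<rho>' k = \<rho> k" if "k \<in> quad_order D" for k
        using \<rho>s[OF that, of p] p0 by (simp add: \<rho>'_def)
      have hom: "\<rho>' \<in> ring_hom (real_ring R) (torus_End L)"
      proof (rule ring_hom_memI)
        fix x assume x: "x \<in> carrier (real_ring R)"
        then obtain m n where mn: "x = of_int m + of_int n * t" by (auto simp: R_def)
        have "\<rho>' x *v v \<in> L" if v: "v \<in> L" for v
        proof -
          obtain w where w: "w \<in> L" "\<rho> (omega D - of_int c) *v v = of_int p *\<^sub>R w" using sc v by blast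
          have "of_int p * x = of_int p * of_int m + of_int n * (omega D - of_int c)"
            using p0 by (simp add: mn t_def field_simps)
          then have "\<rho> (of_int p * x) = \<rho> (of_int p * of_int m) + \<rho> (of_int n * (omega D - of_int c))"
            using \<rho>(2)[of "of_int p * of_int m" "of_int n * (omega D - of_int c)"]
            by (simp add: order_mult order_int order_diff order_omega)
          also have "\<dots> = of_int p *\<^sub>R (of_int m *\<^sub>R mat 1) + of_int n *\<^sub>R \<rho> (omega D - of_int c)"
            using \<rho>s[OF order_1, of m]
            by (simp add: \<rho>s order_diff order_omega order_int \<rho>(3)[OF order_1])
          finally have "\<rho> (of_int p * x) *v v = of_int p *\<^sub>R (of_int m *\<^sub>R v + of_int n *\<^sub>R w)"
            by (simp add: matrix_vector_mult_add_rdistrib scaleR_matrix_vector w(2) scaleR_right_distrib)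
          then have "\<rho>' x *v v = of_int m *\<^sub>R v + of_int n *\<^sub>R w"
            using p0 by (simp add: \<rho>'_def scaleR_matrix_vector)
          then show ?thesis using v w M.L_add M.L_scale by simp
        qed
        then show "\<rho>' x \<in> carrier (torus_End L)" by simp
      next
        fix x y assume xy: "x \<in> carrier (real_ring R)" "y \<in> carrier (real_ring R)"
        have "of_int p *\<^sub>R \<rho> (of_int p * (x * y)) = \<rho> (of_int p * (of_int p * (x * y)))"
          using \<rho>s pRO Rmul xy by simp
        also have "of_int p * (of_int p * (x * y)) = (of_int p * x) * (of_int p * y)" by simp
        also have "\<rho> \<dots> = \<rho> (of_int p * x) ** \<rho> (of_int p * y)" using \<rho>(1) pRO xy by simp
        finally have e: "\<rho> (of_int p * x) ** \<rho> (of_int p * y) = of_int p *\<^sub>R \<rho> (of_int p * (x * y))" ..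
        show "\<rho>' (x \<otimes>\<^bsub>real_ring R\<^esub> y) = \<rho>' x \<otimes>\<^bsub>torus_End L\<^esub> \<rho>' y"
          using p0 by (simp add: \<rho>'_def scaleR_matrix_mult e)
        show "\<rho>' (x \<oplus>\<^bsub>real_ring R\<^esub> y) = \<rho>' x \<oplus>\<^bsub>torus_End L\<^esub> \<rho>' y"
          using \<rho>(2) pRO xy by (simp add: \<rho>'_def distrib_left scaleR_right_distrib)
      next
        show "\<rho>' \<one>\<^bsub>real_ring R\<^esub> = \<one>\<^bsub>torus_End L\<^esub>" using ext[OF order_1] \<rho>(3)[OF order_1] by simp
      qed
      have inj: "inj_on \<rho>' R"
      proof (rule inj_onI)
        fix x y assume xy: "x \<in> R" "y \<in> R" "\<rho>' x = \<rho>' y"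
        then have "\<rho> (of_int p * x) = \<rho> (of_int p * y)" using p0 by (simp add: \<rho>'_def)
        then have "of_int p * x = of_int p * y" using \<rho>(6) pRO xy by blast
        then show "x = y" using p0 by simp
      qed
      have "\<not> (\<exists>R \<rho>'. is_order D R \<and> quad_order D \<subset> R \<and> \<rho>' \<in> ring_hom (real_ring R) (torus_End L) \<and>
          inj_on \<rho>' R \<and> (\<forall>k\<in>quad_order D. \<rho>' k = \<rho> k))"
        using R(4) unfolding real_multiplication_def by blast
      then show False using ord sub hom inj ext by blast
    qed
  qed
qed

end

section \<open>Uniformization\<close>

text \<open>The projections onto the eigenspaces of \<open>A = \<rho> \<omega>\<close> for the eigenvalues \<open>\<omega>\<close> and \<open>\<omega>'\<close>.\<close>

definition eigP :: "nat \<Rightarrow> complex ^ 2 ^ 2 \<Rightarrow> complex ^ 2 \<Rightarrow> complex ^ 2" where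
  "eigP D A v = (1 / sqrt (real D)) *\<^sub>R (A *v v - omega' D *\<^sub>R v)"

definition eigQ :: "nat \<Rightarrow> complex ^ 2 ^ 2 \<Rightarrow> complex ^ 2 \<Rightarrow> complex ^ 2" where
  "eigQ D A v = (1 / sqrt (real D)) *\<^sub>R (omega D *\<^sub>R v - A *v v)"

lemma eig_linear:
  "eigP D A (v + w) = eigP D A v + eigP D A w" "eigP D A (c *s v) = c *s eigP D A v"
  "eigQ D A (v + w) = eigQ D A v + eigQ D A w" "eigQ D A (c *s v) = c *s eigQ D A v"
  "eigP D A (a *\<^sub>R v) = a *\<^sub>R eigP D A v" "eigQ D A (a *\<^sub>R v) = a *\<^sub>R eigQ D A v"
  by (simp_all add: eigP_def eigQ_def vec_eq_iff matrix_vector_mult_def sum_2 algebra_simps scaleR_conv_of_real[where 'a = complex])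

section \<open>Isomorphism classes and loci\<close>

lemma rm_class_eq_iff:
  assumes "T \<in> rm_surfaces D d1 d2" "T' \<in> rm_surfaces D d1 d2"
  shows "rm_class D d1 d2 T = rm_class D d1 d2 T' \<longleftrightarrow> (T, T') \<in> rm_iso D d1 d2"
  unfolding rm_class_def by (rule eq_equiv_class_iff[OF equiv_rm_iso assms])

lemma rm_class_in_moduli: "T \<in> rm_surfaces D d1 d2 \<Longrightarrow> rm_class D d1 d2 T \<in> moduli_set D d1 d2"
  unfolding rm_class_def moduli_set_def by (rule quotientI)

lemma moduli_setE:
  assumes "c \<in> moduli_set D d1 d2"
  obtains T where "T \<in> rm_surfaces D d1 d2" "c = rm_class D d1 d2 T"
  using assms unfolding moduli_set_def rm_class_def by (rule quotientE)

lemma rm_class_self: "T \<in> rm_surfaces D d1 d2 \<Longrightarrow> T \<in> rm_class D d1 d2 T"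
  unfolding rm_class_def by (rule equiv_class_self[OF equiv_rm_iso])

lemma symplectic_module_iso_iff:
  "symplectic_module_iso D \<aa> (L, H, \<rho>) \<psi> \<longleftrightarrow> bij_betw \<psi> (ideal_module D \<aa>) L \<and>
    (\<forall>p\<in>ideal_module D \<aa>. \<forall>q\<in>ideal_module D \<aa>.
      \<psi> (p + q) = \<psi> p + \<psi> q \<and> Im (H (\<psi> p) (\<psi> q)) = trace_pairing D p q) \<and>
    (\<forall>k\<in>quad_order D. \<forall>(x, y)\<in>ideal_module D \<aa>. \<psi> (k * x, k * y) = \<rho> k *v \<psi> (x, y))"
  by (simp add: symplectic_module_iso_def)

lemma symplectic_module_isoD:
  assumes "symplectic_module_iso D \<aa> (L, H, \<rho>) \<psi>"
  shows "bij_betw \<psi> (ideal_module D \<aa>) L" "p \<in> ideal_module D \<aa> \<Longrightarrow> \<psi> p \<in> L"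
    "p \<in> ideal_module D \<aa> \<Longrightarrow> q \<in> ideal_module D \<aa> \<Longrightarrow> \<psi> (p + q) = \<psi> p + \<psi> q"
    "p \<in> ideal_module D \<aa> \<Longrightarrow> q \<in> ideal_module D \<aa> \<Longrightarrow> Im (H (\<psi> p) (\<psi> q)) = trace_pairing D p q"
    "k \<in> quad_order D \<Longrightarrow> (x, y) \<in> ideal_module D \<aa> \<Longrightarrow> \<psi> (k * x, k * y) = \<rho> k *v \<psi> (x, y)"
  using assms unfolding symplectic_module_iso_iff bij_betw_def by auto

lemma symplectic_module_iso_transport:
  assumes i: "(T, T') \<in> rm_iso D d1 d2" and \<psi>: "symplectic_module_iso D \<aa> T \<psi>"
  shows "\<exists>\<psi>'. symplectic_module_iso D \<aa> T' \<psi>'"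
proof -
  obtain L H \<rho> L' H' \<rho>' where T: "T = (L, H, \<rho>)" "T' = (L', H', \<rho>')" by (cases T, cases T') auto
  obtain F where F: "invertible F" "(\<lambda>v. F *v v) ` L = L'" "\<And>v w. H' (F *v v) (F *v w) = H v w"
    "\<And>k. k \<in> quad_order D \<Longrightarrow> F ** \<rho> k = \<rho>' k ** F" using rm_isoE[OF i T] by blast
  note S = symplectic_module_isoD[OF \<psi>[unfolded T(1)]]
  have "inj ((*v) F)" using F(1) by (metis invertible_left_inverse matrix_left_invertible_injective)
  then have "bij_betw ((*v) F) L L'"
    using F(2) by (auto simp: bij_betw_def intro: inj_on_subset)
  then have "bij_betw ((*v) F \<circ> \<psi>) (ideal_module D \<aa>) L'" by (rule bij_betw_trans[OF S(1)])
  moreover have "F *v (\<rho> k *v v) = \<rho>' k *v (F *v v)" if "k \<in> quad_order D" for k v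
    using F(4)[OF that] by (simp add: matrix_vector_mul_assoc)
  ultimately have "symplectic_module_iso D \<aa> (L', H', \<rho>') ((*v) F \<circ> \<psi>)"
    unfolding symplectic_module_iso_iff
    using S(3,4,5) F(3) by (auto simp: matrix_vector_right_distrib)
  then show ?thesis using T by blast
qed

lemma rm_class_in_locus_iff:
  assumes T: "T \<in> rm_surfaces D d1 d2"
  shows "rm_class D d1 d2 T \<in> ideal_locus D d1 d2 \<aa> \<longleftrightarrow> (\<exists>\<psi>. symplectic_module_iso D \<aa> T \<psi>)"
proof
  assume "rm_class D d1 d2 T \<in> ideal_locus D d1 d2 \<aa>"
  then obtain T' \<psi> where T': "T' \<in> rm_class D d1 d2 T" "symplectic_module_iso D \<aa> T' \<psi>"
    by (auto simp: ideal_locus_def)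
  then have "(T', T) \<in> rm_iso D d1 d2"
    using equiv_rm_iso[of D d1 d2] by (auto simp: rm_class_def equiv_def dest: symD)
  then show "\<exists>\<psi>. symplectic_module_iso D \<aa> T \<psi>" using T'(2) symplectic_module_iso_transport by blast
next
  assume "\<exists>\<psi>. symplectic_module_iso D \<aa> T \<psi>"
  then show "rm_class D d1 d2 T \<in> ideal_locus D d1 d2 \<aa>"
    using rm_class_in_moduli[OF T] rm_class_self[OF T] by (auto simp: ideal_locus_def)
qed

context quad_disc
begin

lemma rm_rho_form:
  assumes rm: "real_multiplication D L H \<rho>"
  shows "\<rho> (of_int m + of_int n * omega D) = of_int m *\<^sub>R mat 1 + of_int n *\<^sub>R \<rho> (omega D)"
proof -
  note \<rho> = rm_rho[OF rm]
  have s: "\<rho> (of_int n * k) = of_int n *\<^sub>R \<rho> k" if "k \<in> quad_order D" for n k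
    using additive_on_scale[of "quad_order D" \<rho> k n] that \<rho>(2)
    by (auto simp: additive_on_def order_0 order_add order_minus)
  show ?thesis
    using \<rho>(2)[OF order_int order_mult[OF order_int order_omega], of m n] s[OF order_1, of m] s[OF order_omega, of n]
    by (simp add: \<rho>(3)[OF order_1])
qed

text \<open>The matrix of omega satisfies the quadratic equation of omega, whose roots omega and
  omega' are distinct, so the two expressions are complementary projections onto its
  eigenspaces.\<close>

lemma eig_facts:
  assumes rm: "real_multiplication D L H \<rho>"
  defines "P \<equiv> eigP D (\<rho> (omega D))" and "Q \<equiv> eigQ D (\<rho> (omega D))"
  shows "P v + Q v = v" "P (P v) = P v" "P (Q v) = 0" "Q (P v) = 0" "Q (Q v) = Q v"
    "k \<in> quad_order D \<Longrightarrow> \<rho> k *v P v = k *\<^sub>R P v" "k \<in> quad_order D \<Longrightarrow> \<rho> k *v Q v = quad_conj D k *\<^sub>R Q v"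
    "k \<in> quad_order D \<Longrightarrow> P (\<rho> k *v v) = k *\<^sub>R P v" "k \<in> quad_order D \<Longrightarrow> Q (\<rho> k *v v) = quad_conj D k *\<^sub>R Q v"
proof -
  define s where "s = sqrt (real D)"
  define A where "A = \<rho> (omega D)"
  have s0: "s \<noteq> 0" using sqrt_pos by (simp add: s_def)
  have so: "s = omega D - omega' D" by (simp add: s_def omega_diff_omega')
  note form = rm_rho_form[OF rm]
  have AA: "A *v (A *v v) = real D *\<^sub>R (A *v v) - of_int (omega_norm D) *\<^sub>R v" for v
  proof -
    have "A ** A = \<rho> (omega D * omega D)"
      using rm_rho(1)[OF rm order_omega order_omega] by (simp add: A_def)
    also have "omega D * omega D = of_int (- omega_norm D) + of_int (int D) * omega D" by (simp add: omega_sq)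
    also have "\<rho> \<dots> = of_int (- omega_norm D) *\<^sub>R mat 1 + of_int (int D) *\<^sub>R A" unfolding A_def by (rule form)
    finally have e: "A ** A = of_int (- omega_norm D) *\<^sub>R mat 1 + of_int (int D) *\<^sub>R A" .
    have "A *v (A *v v) = (A ** A) *v v" by (simp add: matrix_vector_mul_assoc)
    also have "\<dots> = of_int (- omega_norm D) *\<^sub>R v + of_int (int D) *\<^sub>R (A *v v)"
      unfolding e by (simp only: matrix_vector_mult_add_rdistrib scaleR_matrix_vector matrix_vector_mul_lid)
    finally show ?thesis by simp
  qed
  have Pv: "P v = (1 / s) *\<^sub>R (A *v v - omega' D *\<^sub>R v)" and Qv: "Q v = (1 / s) *\<^sub>R (omega D *\<^sub>R v - A *v v)" for v
    by (simp_all add: P_def Q_def eigP_def eigQ_def s_def A_def)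
  have Dw: "real D = omega D + omega' D" "real_of_int (omega_norm D) = omega D * omega' D"
    by (simp_all add: omega_add_omega' omega_mult_omega')
  have AP: "A *v P v = omega D *\<^sub>R P v" for v
    unfolding Pv matrix_vector_scaleR matrix_vector_mult_diff_distrib AA Dw by (simp add: algebra_simps)
  have AQ: "A *v Q v = omega' D *\<^sub>R Q v" for v
    unfolding Qv matrix_vector_scaleR matrix_vector_mult_diff_distrib AA Dw by (simp add: algebra_simps)
  have PA: "P (A *v v) = A *v P v" and QA: "Q (A *v v) = A *v Q v" for v
    by (simp_all add: Pv Qv matrix_vector_scaleR matrix_vector_mult_diff_distrib)
  show "P v + Q v = v"
  proof -
    have "P v + Q v = (1 / s) *\<^sub>R ((omega D - omega' D) *\<^sub>R v)" unfolding Pv Qv by (simp add: algebra_simps)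
    then show ?thesis using s0 so by simp
  qed
  have "P (P v) = (1 / s) *\<^sub>R ((omega D - omega' D) *\<^sub>R P v)" "Q (Q v) = (1 / s) *\<^sub>R ((omega D - omega' D) *\<^sub>R Q v)"
    unfolding Pv[of "P v"] Qv[of "Q v"] AP AQ by (simp_all add: algebra_simps)
  then show "P (P v) = P v" "Q (Q v) = Q v" using s0 so by simp_all
  show "P (Q v) = 0" "Q (P v) = 0" unfolding Pv[of "Q v"] Qv[of "P v"] AP AQ by simp_all
  have A: "\<rho> k *v P v = k *\<^sub>R P v \<and> \<rho> k *v Q v = quad_conj D k *\<^sub>R Q v \<and> P (\<rho> k *v v) = k *\<^sub>R P v \<and> Q (\<rho> k *v v) = quad_conj D k *\<^sub>R Q v"
    if k: "k \<in> quad_order D"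
  proof -
    obtain m n where mn: "k = of_int m + of_int n * omega D" using k by (rule quad_orderE)
    have r: "\<rho> k *v w = of_int m *\<^sub>R w + of_int n *\<^sub>R (A *v w)" for w
      unfolding mn form by (simp add: matrix_vector_mult_add_rdistrib scaleR_matrix_vector A_def)
    have "P (\<rho> k *v v) = of_int m *\<^sub>R P v + of_int n *\<^sub>R P (A *v v)" "Q (\<rho> k *v v) = of_int m *\<^sub>R Q v + of_int n *\<^sub>R Q (A *v v)"
      unfolding r by (simp_all only: P_def Q_def eig_linear)
    then have PQk: "P (\<rho> k *v v) = of_int m *\<^sub>R P v + of_int n *\<^sub>R omega D *\<^sub>R P v"
      "Q (\<rho> k *v v) = of_int m *\<^sub>R Q v + of_int n *\<^sub>R omega' D *\<^sub>R Q v"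
      unfolding PA QA AP AQ .
    have ck: "quad_conj D k = of_int m + of_int n * omega' D" by (simp add: mn)
    have kv: "k *\<^sub>R w = of_int m *\<^sub>R w + of_int n *\<^sub>R omega D *\<^sub>R w" for w :: "complex ^ 2"
      by (simp add: mn scaleR_add_left)
    show ?thesis
      by (intro conjI; (unfold PQk)?; simp only: r AP AQ ck kv scaleR_add_left scaleR_scaleR)
  qed
  show "k \<in> quad_order D \<Longrightarrow> \<rho> k *v P v = k *\<^sub>R P v" "k \<in> quad_order D \<Longrightarrow> \<rho> k *v Q v = quad_conj D k *\<^sub>R Q v"
    "k \<in> quad_order D \<Longrightarrow> P (\<rho> k *v v) = k *\<^sub>R P v" "k \<in> quad_order D \<Longrightarrow> Q (\<rho> k *v v) = quad_conj D k *\<^sub>R Q v"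
    using A by blast+
qed

text \<open>The image of (0, 1) under the rational extension of the module isomorphism; only the
  multiple (0, d2) is known to lie in the module.\<close>

definition unif_basis :: "nat \<Rightarrow> (real \<times> real \<Rightarrow> complex ^ 2) \<Rightarrow> complex ^ 2" where
  "unif_basis d2 \<psi> = (1 / real d2) *\<^sub>R \<psi> (0, real d2)"

text \<open>In the coordinates of the eigenlines spanned by P e1 and Q e1 the vector e1 becomes (1,
  1) and e2 becomes the period z. Positivity of H puts z into the product of half planes, and
  agreement of the imaginary parts on the lattice identifies the polarizations.\<close>

lemma uniformize:
  assumes a: "\<aa> \<in> type_ideals D d1 d2" and T: "(L, H, \<rho>) \<in> rm_surfaces D d1 d2"
    and \<psi>: "symplectic_module_iso D \<aa> (L, H, \<rho>) \<psi>"
  defines "P \<equiv> eigP D (\<rho> (omega D))" and "Q \<equiv> eigQ D (\<rho> (omega D))"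
    and "e1 \<equiv> \<psi> (1, 0)" and "e2 \<equiv> unif_basis d2 \<psi>"
  shows "P e1 \<noteq> 0" "Q e1 \<noteq> 0"
    "\<exists>z. P e2 = fst z *s P e1 \<and> Q e2 = snd z *s Q e1"
    "P e2 = fst z *s P e1 \<Longrightarrow> Q e2 = snd z *s Q e1 \<Longrightarrow> z \<in> upper2 \<and> (period_surface D \<aa> z, (L, H, \<rho>)) \<in> rm_iso D d1 d2"
proof -
  note R = rm_surfacesD[OF T]
  note Hp = polarizationD[OF R(2)]
  note A = type_ideals_mem[OF a]
  note S = symplectic_module_isoD[OF \<psi>]
  note E = eig_facts[OF R(4), folded P_def Q_def]
  note EL = eig_linear[of D "\<rho> (omega D)", folded P_def Q_def]
  define s where "s = sqrt (real D)"
  have s0: "s > 0" using sqrt_pos by (simp add: s_def)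
  have m1: "(1, 0) \<in> ideal_module D \<aa>" and m2: "(0, real d2) \<in> ideal_module D \<aa>"
    using A(7,8,10) order_1 order_0 by auto
  have d2: "real d2 > 0" using A(5) by simp
  have H0: "H 0 w = 0" for w using Hp(1)[of 0 0 w] by simp
  have e2': "\<psi> (0, real d2) = real d2 *\<^sub>R e2" using d2 by (simp add: e2_def unif_basis_def)
  have \<rho>e2: "\<rho> (omega D) *v e2 = (1 / real d2) *\<^sub>R \<psi> (0, omega D * real d2)"
    using S(5)[OF order_omega m2] by (simp add: e2_def unif_basis_def matrix_vector_scaleR)
  have m3: "(0, omega D * real d2) \<in> ideal_module D \<aa>" using A(7,8,12) order_0 order_omega by simp
  have tr2: "quad_trace D 1 = 2" by (simp add: quad_trace_def)
  \<comment> \<open>Minus the trace of 1. Together with minus the trace of omega below, the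
    projections distribute it as -1 on each eigenline.\<close>
  have "Im (H e1 e2) = - 2"
  proof -
    have "Im (H e1 e2) = (1 / real d2) * trace_pairing D (1, 0) (0, real d2)"
      using S(4)[OF m1 m2] by (simp add: e1_def e2_def unif_basis_def Hp(9))
    also have "trace_pairing D (1, 0) (0, real d2) = - (2 * real d2)"
      by (simp add: trace_pairing_def trace_minus field_rat) (simp add: quad_trace_def)
    finally show ?thesis using d2 by simp
  qed
  moreover have "Im (H e1 (\<rho> (omega D) *v e2)) = - real D"
  proof -
    have "Im (H e1 (\<rho> (omega D) *v e2)) = (1 / real d2) * trace_pairing D (1, 0) (0, omega D * real d2)"
      using S(4)[OF m1 m3] by (simp add: e1_def \<rho>e2 Hp(9))
    also have "trace_pairing D (1, 0) (0, omega D * real d2) = - (real d2 * real D)"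
    proof -
      have "quad_trace D (omega D * real d2) = real d2 * quad_trace D (omega D)"
        using trace_rat_mult[OF _ field_omega, of "real d2"] by (simp add: mult.commute)
      moreover have "omega D * real d2 \<in> quad_field D" by (intro field_mult field_omega field_rat) simp
      ultimately show ?thesis by (simp add: trace_pairing_def trace_minus) (simp add: quad_trace_def omega_add_omega')
    qed
    finally show ?thesis using d2 by simp
  qed
  moreover have sub: "v - w = v + (- 1) *\<^sub>R w" for v w :: "complex ^ 2" by simp
  have "Im (H e1 (P e2)) = (1 / s) * (Im (H e1 (\<rho> (omega D) *v e2)) - omega' D * Im (H e1 e2))"
    "Im (H e1 (Q e2)) = (1 / s) * (omega D * Im (H e1 e2) - Im (H e1 (\<rho> (omega D) *v e2)))"
    unfolding P_def Q_def eigP_def eigQ_def sub by (simp_all only: Hp(6,9)) (simp_all add: s_def)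
  moreover have "- real D - omega' D * (- 2) = - s" "omega D * (- 2) - (- real D) = - s"
    using omega_add_omega'[of D] omega_diff_omega'[of D] by (simp_all add: s_def)
  ultimately have "Im (H e1 (P e2)) = (1 / s) * (- s)" "Im (H e1 (Q e2)) = (1 / s) * (- s)"
    by (simp_all only:)
  then have Im1: "Im (H e1 (P e2)) = -1" "Im (H e1 (Q e2)) = -1"
    using s0 by simp_all
  have sa: "H (P v) w = H v (P w)" "H (Q v) w = H v (Q w)" for v w
    unfolding P_def Q_def eigP_def eigQ_def sub
    by (simp_all only: Hp(1,6,8,9) rm_rho(5)[OF R(4) order_omega])
  have ImP: "Im (H (P e1) (P e2)) = -1" "Im (H (Q e1) (Q e2)) = -1"
    using Im1 by (simp_all add: sa E)
  show P1: "P e1 \<noteq> 0" and Q1: "Q e1 \<noteq> 0" using ImP by (auto simp: H0)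
  define a1 c1 where "a1 = P e1" and "c1 = Q e1"
  have PQ: "P a1 = a1" "P c1 = 0" "Q a1 = 0" "Q c1 = c1" by (simp_all add: a1_def c1_def E)
  \<comment> \<open>Vectors of the two eigenlines cannot be proportional, since P fixes one and
    kills the other.\<close>
  have det: "a1 $ 1 * c1 $ 2 - a1 $ 2 * c1 $ 1 \<noteq> 0"
  proof
    assume d0: "a1 $ 1 * c1 $ 2 - a1 $ 2 * c1 $ 1 = 0"
    have "\<exists>t. c1 = t *s a1"
    proof (cases "a1 $ 1 = 0")
      case True
      then have "a1 $ 2 \<noteq> 0" using P1 by (auto simp: a1_def vec_eq_iff forall_2)
      then show ?thesis
        using d0 True by (intro exI[of _ "c1 $ 2 / a1 $ 2"]) (auto simp: vec_eq_iff forall_2)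
    next
      case False
      then show ?thesis
        using d0 by (intro exI[of _ "c1 $ 1 / a1 $ 1"]) (auto simp: vec_eq_iff forall_2 field_simps)
    qed
    then obtain t where t: "c1 = t *s a1" by blast
    have "P c1 = t *s P a1" unfolding t by (rule EL)
    then have "c1 = 0" using PQ t by simp
    then show False using Q1 by (simp add: c1_def)
  qed
  show "\<exists>z. P e2 = fst z *s P e1 \<and> Q e2 = snd z *s Q e1"
  proof -
    define \<delta> where "\<delta> = a1 $ 1 * c1 $ 2 - a1 $ 2 * c1 $ 1"
    define \<alpha> where "\<alpha> = (e2 $ 1 * c1 $ 2 - e2 $ 2 * c1 $ 1) / \<delta>"
    define \<beta> where "\<beta> = (a1 $ 1 * e2 $ 2 - a1 $ 2 * e2 $ 1) / \<delta>"
    have "\<delta> \<noteq> 0" using det by (simp add: \<delta>_def)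
    have "\<delta> * (\<alpha> * a1 $ 1 + \<beta> * c1 $ 1) = \<delta> * e2 $ 1" "\<delta> * (\<alpha> * a1 $ 2 + \<beta> * c1 $ 2) = \<delta> * e2 $ 2"
      using \<open>\<delta> \<noteq> 0\<close> by (simp_all add: \<alpha>_def \<beta>_def field_simps) (simp_all add: \<delta>_def algebra_simps)
    then have e: "e2 = \<alpha> *s a1 + \<beta> *s c1" using \<open>\<delta> \<noteq> 0\<close> by (simp add: vec_eq_iff forall_2)
    have "P e2 = \<alpha> *s P a1 + \<beta> *s P c1" "Q e2 = \<alpha> *s Q a1 + \<beta> *s Q c1"
      unfolding e by (simp_all only: EL)
    then have "P e2 = \<alpha> *s a1" "Q e2 = \<beta> *s c1" by (simp_all add: PQ)
    then show ?thesis unfolding a1_def c1_def by (intro exI[of _ "(\<alpha>, \<beta>)"]) simp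
  qed
  assume z: "P e2 = fst z *s P e1" "Q e2 = snd z *s Q e1"
  \<comment> \<open>H is conjugate linear in the second argument, so Im H(v, t v) = -Im t times the
    positive number H(v, v).\<close>
  have up: "0 < Im t" if "Im (H v (t *s v)) = - 1" "v \<noteq> 0" for t v
  proof -
    have "Im (H v v) = 0" using arg_cong[OF Hp(3)[of v v], of Im] by simp
    then have "Im t * Re (H v v) = 1" using that(1) by (simp add: Hp(7))
    then show ?thesis using Hp(4)[OF that(2)] by (metis zero_less_mult_pos2 zero_less_one)
  qed
  have zu: "z \<in> upper2"
    using up[of "P e1" "fst z"] up[of "Q e1" "snd z"] ImP P1 Q1 by (simp add: upper2_iff z)
  define G :: "complex ^ 2 ^ 2" where "G = vector [vector [a1 $ 1, c1 $ 1], vector [a1 $ 2, c1 $ 2]]"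
  have Gv: "G *v v = v $ 1 *s a1 + v $ 2 *s c1" for v
    by (simp add: G_def vec_eq_iff forall_2 matrix_vector_mult_def sum_2 mult.commute)
  have "det G = a1 $ 1 * c1 $ 2 - c1 $ 1 * a1 $ 2" by (simp add: G_def det_2)
  then have Ginv: "invertible G" using det by (simp add: invertible_det_nz mult.commute)
  have G\<psi>: "G *v period_map D z (x, y) = \<psi> (x, y)" if xy: "(x, y) \<in> ideal_module D \<aa>" for x y
  proof -
    have x: "x \<in> quad_order D" "y \<in> twisted_ideal D \<aa>" using xy A(8) by auto
    have m: "(x, 0) \<in> ideal_module D \<aa>" "(0, y) \<in> ideal_module D \<aa>" using x A(8,10) order_0 by auto
    have "(x, y) = (x, 0) + (0, y)" by simp
    then have dec: "\<psi> (x, y) = \<psi> (x, 0) + \<psi> (0, y)" using S(3)[OF m] by simp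
    have "\<psi> (x, 0) = \<rho> x *v e1" using S(5)[OF x(1) m1] by (simp add: e1_def)
    then have Px: "P (\<psi> (x, 0)) = x *\<^sub>R a1" "Q (\<psi> (x, 0)) = quad_conj D x *\<^sub>R c1"
      using E(8,9)[OF x(1)] by (simp_all add: a1_def c1_def)
    \<comment> \<open>Only the order acts on L, and y is merely in K. Since D y is in the order, the
      relation between \<open>\<psi> (0, y)\<close> and e2 is proved first after multiplication by D
      d2.\<close>
    have Dy: "real D * y \<in> quad_order D"
    proof -
      have "s * y \<in> quad_order D"
        using x(2) A(1) unfolding mem_twisted_ideal_iff ideal_order_iff s_def by blast
      then have "s * (s * y) \<in> quad_order D" using sqrt_in_order by (simp add: s_def order_mult)
      moreover have "s * (s * y) = real D * y" by (simp add: s_def flip: mult.assoc)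
      ultimately show ?thesis by simp
    qed
    have Dd: "of_int (int (D * d2)) \<in> quad_order D" by (rule order_int)
    have "\<rho> (real D * y) *v \<psi> (0, real d2) = \<psi> (0, real D * y * real d2)" using S(5)[OF Dy m2] by simp
    also have "real D * y * real d2 = of_int (int (D * d2)) * y" by simp
    also have "\<psi> (0, of_int (int (D * d2)) * y) = \<rho> (of_int (int (D * d2))) *v \<psi> (0, y)"
      using S(5)[OF Dd m(2)] by simp
    finally have r: "\<rho> (real D * y) *v (real d2 *\<^sub>R e2) = \<rho> (of_int (int (D * d2))) *v \<psi> (0, y)" by (simp add: e2')
    have cy: "quad_conj D (real D * y) = real D * quad_conj D y"
      using A(9)[OF x(2)] by (simp add: field_rat)
    have "(real D * y) *\<^sub>R (real d2 *\<^sub>R P e2) = of_int (int (D * d2)) *\<^sub>R P (\<psi> (0, y))"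
      using arg_cong[OF r, of P] by (simp only: E(8)[OF Dy] E(8)[OF Dd] EL)
    then have "(real D * real d2) *\<^sub>R (y *\<^sub>R P e2) = (real D * real d2) *\<^sub>R P (\<psi> (0, y))" by (simp add: mult_ac)
    then have "y *\<^sub>R P e2 = P (\<psi> (0, y))" by (rule scaleR_left_imp_eq[rotated]) (use d2 D_pos in simp)
    then have Py: "P (\<psi> (0, y)) = y *\<^sub>R P e2" ..
    have "(real D * quad_conj D y) *\<^sub>R (real d2 *\<^sub>R Q e2) = of_int (int (D * d2)) *\<^sub>R Q (\<psi> (0, y))"
      using arg_cong[OF r, of Q] by (simp only: E(9)[OF Dy] E(9)[OF Dd] EL cy) simp
    then have "(real D * real d2) *\<^sub>R (quad_conj D y *\<^sub>R Q e2) = (real D * real d2) *\<^sub>R Q (\<psi> (0, y))" by (simp add: mult_ac)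
    then have "quad_conj D y *\<^sub>R Q e2 = Q (\<psi> (0, y))" by (rule scaleR_left_imp_eq[rotated]) (use d2 D_pos in simp)
    then have Qy: "Q (\<psi> (0, y)) = quad_conj D y *\<^sub>R Q e2" ..
    have "\<psi> (x, y) = P (\<psi> (x, y)) + Q (\<psi> (x, y))" by (simp add: E)
    also have "\<dots> = (x *\<^sub>R a1 + y *\<^sub>R (fst z *s a1)) + (quad_conj D x *\<^sub>R c1 + quad_conj D y *\<^sub>R (snd z *s c1))"
      unfolding dec EL Px Py Qy z a1_def c1_def ..
    also have "\<dots> = G *v period_map D z (x, y)"
      unfolding Gv by (simp add: vec_eq_iff forall_2 algebra_simps scaleR_conv_of_real[where 'a = complex])
    finally show ?thesis by simp
  qed
  have GL: "(\<lambda>v. G *v v) ` period_lattice D \<aa> z = L"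
  proof -
    have "(\<lambda>v. G *v v) ` period_lattice D \<aa> z = \<psi> ` ideal_module D \<aa>"
      unfolding period_lattice_def image_image using G\<psi> by (intro image_cong) auto
    then show ?thesis using S(1) by (simp add: bij_betw_def)
  qed
  have GH: "(\<lambda>v w. H (G *v v) (G *v w)) = std_form z"
  proof (rule polarization_unique[OF _ polarization_std_form[OF a zu] span_period_lattice[OF a zu]])
    have inj: "G *v v \<noteq> 0" if "v \<noteq> 0" for v
    proof
      assume "G *v v = 0"
      moreover have "inj ((*v) G)" using Ginv by (metis invertible_left_inverse matrix_left_invertible_injective)
      ultimately show False using that by (metis injD matrix_vector_mult_0_right)
    qed
    have sc: "G *v (c *s v) = c *s (G *v v)" for c v
      by (simp add: vec_eq_iff matrix_vector_mult_def sum_2 algebra_simps)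
    show "polarization (period_lattice D \<aa> z) (\<lambda>v w. H (G *v v) (G *v w))"
      unfolding polarization_def
    proof (intro conjI allI impI ballI)
      show "H (G *v w) (G *v v) = cnj (H (G *v v) (G *v w))" for v w by (rule Hp(3))
      show "Im (H (G *v v) (G *v w)) \<in> \<int>" if "v \<in> period_lattice D \<aa> z" "w \<in> period_lattice D \<aa> z" for v w
        using that GL by (intro Hp(5)) auto
    qed (simp_all add: matrix_vector_right_distrib Hp(1,2) sc Hp(4) inj)
    show "Im (H (G *v v) (G *v w)) = Im (std_form z v w)"
      if vw: "v \<in> period_lattice D \<aa> z" "w \<in> period_lattice D \<aa> z" for v w
    proof -
      obtain p q where pq: "v = period_map D z p" "w = period_map D z q" "p \<in> ideal_module D \<aa>" "q \<in> ideal_module D \<aa>"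
        using vw by (auto simp: period_lattice_def)
      have "Im (H (G *v v) (G *v w)) = Im (H (\<psi> p) (\<psi> q))"
        using G\<psi>[of "fst p" "snd p"] G\<psi>[of "fst q" "snd q"] pq by simp
      then show ?thesis
        using S(4)[OF pq(3,4)] Im_std_form_period[OF zu] ideal_module_field[OF a] pq by simp
    qed
  qed
  have Grho: "G ** period_rm D k = \<rho> k ** G" if k: "k \<in> quad_order D" for k
  proof -
    have "\<rho> k *v (G *v v) = G *v (period_rm D k *v v)" for v
    proof -
      have sc: "\<rho> k *v (c *s v) = c *s (\<rho> k *v v)" for c v
        by (simp add: vec_eq_iff matrix_vector_mult_def sum_2 algebra_simps)
      have "\<rho> k *v (G *v v) = v $ 1 *s (k *\<^sub>R a1) + v $ 2 *s (quad_conj D k *\<^sub>R c1)"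
        unfolding Gv matrix_vector_right_distrib sc using E(6,7)[OF k] by (simp add: a1_def c1_def)
      also have "\<dots> = G *v (period_rm D k *v v)"
        unfolding Gv by (simp add: vec_eq_iff forall_2 scaleR_conv_of_real[where 'a = complex])
      finally show ?thesis .
    qed
    then show ?thesis by (simp add: matrix_eq matrix_vector_mul_assoc)
  qed
  have "(period_surface D \<aa> z, (L, H, \<rho>)) \<in> rm_iso D d1 d2"
    by (rule rm_isoI[OF period_surface_rm[OF a zu] T period_surface_eq[OF a zu] refl Ginv GL])
      (use GH Grho in \<open>auto simp: fun_eq_iff\<close>)
  with zu show "z \<in> upper2 \<and> (period_surface D \<aa> z, (L, H, \<rho>)) \<in> rm_iso D d1 d2" by blast
qed

lemma period_symplectic_iso:
  assumes a: "\<aa> \<in> type_ideals D d1 d2" and z: "z \<in> upper2"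
  shows "symplectic_module_iso D \<aa> (period_surface D \<aa> z) (period_map D z)"
  unfolding period_surface_eq[OF a z] symplectic_module_iso_iff
proof (intro conjI ballI)
  show "bij_betw (period_map D z) (ideal_module D \<aa>) (period_lattice D \<aa> z)"
    using inj_on_period_map[OF z] by (auto simp: bij_betw_def period_lattice_def intro: inj_on_subset)
  fix p q assume "p \<in> ideal_module D \<aa>" "q \<in> ideal_module D \<aa>"
  then show "period_map D z (p + q) = period_map D z p + period_map D z q"
    "Im (std_form z (period_map D z p) (period_map D z q)) = trace_pairing D p q"
    using ideal_module_field[OF a] period_map_add Im_std_form_period[OF z] by simp_all
next
  fix k p assume k: "k \<in> quad_order D" and p: "p \<in> ideal_module D \<aa>"
  obtain x y where xy: "p = (x, y)" by (cases p)
  then have "x \<in> quad_field D" "y \<in> quad_field D" using ideal_module_field[OF a p] by simp_all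
  then show "case p of (x, y) \<Rightarrow> period_map D z (k * x, k * y) = period_rm D k *v period_map D z (x, y)"
    using period_map_mult[OF order_in_field[OF k]] by (simp add: xy)
qed

lemma ideal_locus_eq:
  assumes a: "\<aa> \<in> type_ideals D d1 d2"
  shows "ideal_locus D d1 d2 \<aa> = (\<lambda>z. rm_class D d1 d2 (period_surface D \<aa> z)) ` upper2"
proof (intro equalityI subsetI)
  fix c assume c: "c \<in> ideal_locus D d1 d2 \<aa>"
  then have "c \<in> moduli_set D d1 d2" by (simp add: ideal_locus_def)
  then obtain T where T: "T \<in> rm_surfaces D d1 d2" "c = rm_class D d1 d2 T" by (rule moduli_setE)
  obtain L H \<rho> where LH: "T = (L, H, \<rho>)" by (cases T) auto
  obtain \<psi> where \<psi>: "symplectic_module_iso D \<aa> (L, H, \<rho>) \<psi>"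
    using c rm_class_in_locus_iff[OF T(1)] unfolding T(2) LH by blast
  obtain z where "z \<in> upper2" "(period_surface D \<aa> z, (L, H, \<rho>)) \<in> rm_iso D d1 d2"
    using uniformize(3,4)[OF a T(1)[unfolded LH] \<psi>] by blast
  moreover from this have "rm_class D d1 d2 (period_surface D \<aa> z) = c"
    unfolding T(2) LH using rm_class_eq_iff period_surface_rm[OF a] T(1) LH by blast
  ultimately show "c \<in> (\<lambda>z. rm_class D d1 d2 (period_surface D \<aa> z)) ` upper2" by blast
next
  fix c assume "c \<in> (\<lambda>z. rm_class D d1 d2 (period_surface D \<aa> z)) ` upper2"
  then obtain z where z: "z \<in> upper2" "c = rm_class D d1 d2 (period_surface D \<aa> z)" by blast
  show "c \<in> ideal_locus D d1 d2 \<aa>"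
    unfolding z(2) rm_class_in_locus_iff[OF period_surface_rm[OF a z(1)]]
    using period_symplectic_iso[OF a z(1)] by blast
qed

text \<open>The ideal is recovered as the set of values of the \<open>K\<close>-bilinear alternating form.\<close>

lemma twisted_ideal_subset:
  assumes a: "\<aa> \<in> type_ideals D d1 d2" and b: "\<bb> \<in> type_ideals D d1 d2"
    and \<psi>: "symplectic_module_iso D \<aa> (L, H, \<rho>) \<psi>" and \<phi>: "symplectic_module_iso D \<bb> (L, H, \<rho>) \<phi>"
  shows "twisted_ideal D \<aa> \<subseteq> twisted_ideal D \<bb>"
proof
  fix y assume y: "y \<in> twisted_ideal D \<aa>"
  note A = type_ideals_mem[OF a] and B = type_ideals_mem[OF b]
  note S = symplectic_module_isoD[OF \<psi>] and F = symplectic_module_isoD[OF \<phi>]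
  have m: "(1, 0) \<in> ideal_module D \<aa>" "(0, y) \<in> ideal_module D \<aa>" using A(8,10) y order_1 order_0 by auto
  have sur: "\<exists>p\<in>ideal_module D \<bb>. \<phi> p = v" if "v \<in> L" for v
    using F(1) that unfolding bij_betw_def by (metis imageE)
  obtain x1 y1 where p: "(x1, y1) \<in> ideal_module D \<bb>" "\<phi> (x1, y1) = \<psi> (1, 0)"
    using sur[OF S(2)[OF m(1)]] by force
  obtain x2 y2 where q: "(x2, y2) \<in> ideal_module D \<bb>" "\<phi> (x2, y2) = \<psi> (0, y)"
    using sur[OF S(2)[OF m(2)]] by force
  have mem: "x1 \<in> quad_order D" "x2 \<in> quad_order D" "y1 \<in> twisted_ideal D \<bb>" "y2 \<in> twisted_ideal D \<bb>"
    using p q B(8) by auto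
  have fld: "x1 \<in> quad_field D" "x2 \<in> quad_field D" "y1 \<in> quad_field D" "y2 \<in> quad_field D" "y \<in> quad_field D"
    using mem B(9) A(9)[OF y] order_in_field by auto
  have tr0: "quad_trace D (k * (x2 * y1 - x1 * y2 + y)) = 0" if k: "k \<in> quad_order D" for k
  proof -
    have km: "(k * 1, k * 0) \<in> ideal_module D \<aa>" "(k * x1, k * y1) \<in> ideal_module D \<bb>"
      using k m p A(8,10) B(8,12) order_mult by auto
    have "\<phi> (k * x1, k * y1) = \<psi> (k * 1, k * 0)"
      using S(5)[OF k m(1)] F(5)[OF k p(1)] p(2) by simp
    then have "trace_pairing D (k * x1, k * y1) (x2, y2) = trace_pairing D (k * 1, k * 0) (0, y)"
      using S(4)[OF km(1) m(2)] F(4)[OF km(2) q(1)] q(2) by simp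
    then have "quad_trace D (k * (x2 * y1 - x1 * y2)) = quad_trace D (- (k * y))"
      by (simp add: trace_pairing_def algebra_simps)
    moreover have "k \<in> quad_field D" using k by (rule order_in_field)
    ultimately show ?thesis
      using fld by (simp add: distrib_left trace_add field_mult field_diff trace_minus)
  qed
  have "x2 * y1 - x1 * y2 + y \<in> quad_field D" using fld by (intro field_add field_diff field_mult)
  then have "x2 * y1 - x1 * y2 + y = 0" using tr0 by (rule trace_nondeg)
  then have "y = x1 * y2 + (- x2) * y1" by simp
  also have "\<dots> \<in> twisted_ideal D \<bb>" using mem by (intro B(11,12) order_minus)
  finally show "y \<in> twisted_ideal D \<bb>" .
qed

lemma ideal_locus_disjoint:
  assumes a: "\<aa> \<in> type_ideals D d1 d2" and b: "\<bb> \<in> type_ideals D d1 d2"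
    and c: "c \<in> ideal_locus D d1 d2 \<aa>" "c \<in> ideal_locus D d1 d2 \<bb>"
  shows "\<aa> = \<bb>"
proof -
  have "c \<in> moduli_set D d1 d2" using c by (simp add: ideal_locus_def)
  then obtain T where T: "T \<in> rm_surfaces D d1 d2" "c = rm_class D d1 d2 T" by (rule moduli_setE)
  obtain L H \<rho> where LH: "T = (L, H, \<rho>)" by (cases T) auto
  obtain \<psi> \<phi> where "symplectic_module_iso D \<aa> (L, H, \<rho>) \<psi>" "symplectic_module_iso D \<bb> (L, H, \<rho>) \<phi>"
    using c rm_class_in_locus_iff[OF T(1)] unfolding T(2) LH by blast
  then have e: "twisted_ideal D \<aa> = twisted_ideal D \<bb>"
    using twisted_ideal_subset a b by blast
  have "x \<in> \<aa> \<longleftrightarrow> x \<in> \<bb>" for x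
    using mem_twisted_ideal_iff[of "x / sqrt (real D)" \<aa>] mem_twisted_ideal_iff[of "x / sqrt (real D)" \<bb>] e sqrt_pos by simp
  then show ?thesis by blast
qed

section \<open>The Hilbert modular group acting on periods\<close>

lemma hilbert_rel_iff:
  "(z, w) \<in> hilbert_rel D \<aa> \<longleftrightarrow> z \<in> upper2 \<and> (\<exists>M\<in>SL2_module D \<aa>. w = hilbert_action D M z)"
proof -
  have "(\<exists>P\<in>PSL2_module D \<aa>. \<exists>M\<in>P. w = hilbert_action D M z) \<longleftrightarrow> (\<exists>M\<in>SL2_module D \<aa>. w = hilbert_action D M z)"
    unfolding PSL2_module_def quotient_def by auto
  then show ?thesis by (simp add: hilbert_rel_def)
qed

lemma Im_moebius:
  fixes M :: "real ^ 2 ^ 2"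
  assumes "0 < Im z" "M $ 2 $ 1 \<noteq> 0 \<or> M $ 2 $ 2 \<noteq> 0"
  shows "Im (moebius M z) = det M * Im z / (cmod (of_real (M $ 2 $ 1) * z + of_real (M $ 2 $ 2)))\<^sup>2"
    "of_real (M $ 2 $ 1) * z + of_real (M $ 2 $ 2) \<noteq> 0"
proof -
  show nz: "of_real (M $ 2 $ 1) * z + of_real (M $ 2 $ 2) \<noteq> 0"
    using assms by (auto simp: complex_eq_iff)
  show "Im (moebius M z) = det M * Im z / (cmod (of_real (M $ 2 $ 1) * z + of_real (M $ 2 $ 2)))\<^sup>2"
    unfolding moebius_def Im_divide cmod_power2 by (simp add: det_2 algebra_simps)
qed

lemma SL2_row_nonzero: "det (M :: real ^ 2 ^ 2) = 1 \<Longrightarrow> M $ 2 $ 1 \<noteq> 0 \<or> M $ 2 $ 2 \<noteq> 0"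
  by (auto simp: det_2)

lemma det_mat_conj:
  fixes M :: "real ^ 2 ^ 2"
  assumes "\<And>i j. M $ i $ j \<in> quad_field D" "det M = 1"
  shows "det (mat_conj D M) = 1"
proof -
  have "det (mat_conj D M) = quad_conj D (det M)"
    using assms(1) by (simp add: det_2 mat_conj_def field_mult)
  then show ?thesis using assms(2) by simp
qed

lemma hilbert_action_upper2:
  assumes M: "M \<in> SL2_module D \<aa>" and z: "z \<in> upper2"
  shows "hilbert_action D M z \<in> upper2"
proof -
  have d: "det M = 1" "det (mat_conj D M) = 1" using M det_mat_conj[of M] by (auto simp: SL2_module_def)
  have "Im (moebius N t) > 0" if "det N = 1" "0 < Im t" for N :: "real ^ 2 ^ 2" and t
    using Im_moebius[OF that(2) SL2_row_nonzero[OF that(1)]] that by simp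
  then show ?thesis using d z by (simp add: hilbert_action_def upper2_iff split_def)
qed

text \<open>The diagonal matrix of automorphy factors carries the lattice at M z to the lattice at
  z. The formula Im(M z) = Im z/|j|^2 makes it an isometry.\<close>

lemma hilbert_action_iso:
  assumes a: "\<aa> \<in> type_ideals D d1 d2" and M: "M \<in> SL2_module D \<aa>" and z: "z \<in> upper2"
  shows "(period_surface D \<aa> (hilbert_action D M z), period_surface D \<aa> z) \<in> rm_iso D d1 d2"
proof -
  note A = type_ideals_mem[OF a]
  define w where "w = hilbert_action D M z"
  have w: "w \<in> upper2" unfolding w_def by (rule hilbert_action_upper2[OF M z])
  \<comment> \<open>Named by the effect on the module, (x, y) -> (alpha x + beta y, gamma x + delta
    y), which reverses the usual order of the matrix entries.\<close>
  define \<delta> \<beta> \<gamma> \<alpha> where "\<delta> = M $ 1 $ 1" and "\<beta> = M $ 1 $ 2" and "\<gamma> = M $ 2 $ 1" and "\<alpha> = M $ 2 $ 2"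
  note defs = \<delta>_def \<beta>_def \<gamma>_def \<alpha>_def
  have Mm: "\<delta> \<in> quad_order D" "\<beta> \<in> ideal_inverse D (twisted_ideal D \<aa>)" "\<gamma> \<in> twisted_ideal D \<aa>" "\<alpha> \<in> quad_order D"
    and dM: "det M = 1" and fM: "\<And>i j. M $ i $ j \<in> quad_field D"
    using M by (auto simp: SL2_module_def defs)
  have dt: "\<delta> * \<alpha> - \<beta> * \<gamma> = 1" using dM by (simp add: det_2 defs)
  have fld: "\<delta> \<in> quad_field D" "\<beta> \<in> quad_field D" "\<gamma> \<in> quad_field D" "\<alpha> \<in> quad_field D"
    unfolding defs by (rule fM)+
  let ?c = "quad_conj D"
  have dM': "det (mat_conj D M) = 1" by (rule det_mat_conj[OF fM dM])
  have mc: "mat_conj D M $ i $ j = ?c (M $ i $ j)" for i j by (simp add: mat_conj_def)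
  define j1 j2 where "j1 = of_real \<gamma> * fst z + of_real \<alpha>" and "j2 = of_real (?c \<gamma>) * snd z + of_real (?c \<alpha>)"
  have zi: "0 < Im (fst z)" "0 < Im (snd z)" using z by (simp_all add: upper2_iff)
  have j0: "j1 \<noteq> 0" "j2 \<noteq> 0"
    using Im_moebius(2)[OF zi(1) SL2_row_nonzero[OF dM]] Im_moebius(2)[OF zi(2) SL2_row_nonzero[OF dM']]
    by (simp_all add: j1_def j2_def defs mc)
  have w12: "fst w = (of_real \<delta> * fst z + of_real \<beta>) / j1" "snd w = (of_real (?c \<delta>) * snd z + of_real (?c \<beta>)) / j2"
    by (simp_all add: w_def hilbert_action_def split_def moebius_def j1_def j2_def defs mc)
  have Imw: "Im (fst w) = Im (fst z) / (cmod j1)\<^sup>2" "Im (snd w) = Im (snd z) / (cmod j2)\<^sup>2"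
    using Im_moebius(1)[OF zi(1) SL2_row_nonzero[OF dM]] Im_moebius(1)[OF zi(2) SL2_row_nonzero[OF dM']] dM dM'
    by (simp_all add: w_def hilbert_action_def split_def j1_def j2_def defs mc)
  define F :: "complex ^ 2 ^ 2" where "F = vector [vector [j1, 0], vector [0, j2]]"
  have Fv: "(F *v v) $ 1 = j1 * v $ 1" "(F *v v) $ 2 = j2 * v $ 2" for v
    by (simp_all add: F_def matrix_vector_mult_def sum_2)
  have Fp: "F *v period_map D w (x, y) = period_map D z (\<alpha> * x + \<beta> * y, \<gamma> * x + \<delta> * y)"
    if xy: "x \<in> quad_field D" "y \<in> quad_field D" for x y
  proof -
    have "j1 * (of_real x + of_real y * fst w) = of_real (\<alpha> * x + \<beta> * y) + of_real (\<gamma> * x + \<delta> * y) * fst z"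
    proof -
      have "j1 * fst w = of_real \<delta> * fst z + of_real \<beta>" using j0 by (simp add: w12)
      moreover have "j1 * (of_real x + of_real y * fst w) = j1 * of_real x + of_real y * (j1 * fst w)"
        by (simp add: algebra_simps)
      ultimately have "j1 * (of_real x + of_real y * fst w) = j1 * of_real x + of_real y * (of_real \<delta> * fst z + of_real \<beta>)"
        by (simp only:)
      then show ?thesis by (simp add: j1_def algebra_simps)
    qed
    moreover have "j2 * (of_real (?c x) + of_real (?c y) * snd w) =
        of_real (?c \<alpha> * ?c x + ?c \<beta> * ?c y) + of_real (?c \<gamma> * ?c x + ?c \<delta> * ?c y) * snd z"
    proof -
      have "j2 * snd w = of_real (?c \<delta>) * snd z + of_real (?c \<beta>)" using j0 by (simp add: w12)
      moreover have "j2 * (of_real (?c x) + of_real (?c y) * snd w) = j2 * of_real (?c x) + of_real (?c y) * (j2 * snd w)"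
        by (simp add: algebra_simps)
      ultimately have "j2 * (of_real (?c x) + of_real (?c y) * snd w) =
          j2 * of_real (?c x) + of_real (?c y) * (of_real (?c \<delta>) * snd z + of_real (?c \<beta>))"
        by (simp only:)
      then show ?thesis by (simp add: j2_def algebra_simps)
    qed
    ultimately show ?thesis using xy fld by (simp add: vec_eq_iff forall_2 Fv field_mult)
  qed
  have FL: "(\<lambda>v. F *v v) ` period_lattice D \<aa> w = period_lattice D \<aa> z"
  proof (intro equalityI subsetI)
    fix v assume "v \<in> (\<lambda>v. F *v v) ` period_lattice D \<aa> w"
    then obtain x y where xy: "x \<in> quad_order D" "y \<in> twisted_ideal D \<aa>" "v = F *v period_map D w (x, y)"
      using A(8) by (auto simp: period_lattice_def)
    have "\<beta> * y \<in> quad_order D" using Mm(2) xy(2) by (simp add: ideal_inverse_def)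
    then have "(\<alpha> * x + \<beta> * y, \<gamma> * x + \<delta> * y) \<in> ideal_module D \<aa>"
      using A(8,11,12) xy Mm order_mult order_add by (simp add: mult.commute[of \<gamma>])
    moreover have "v = period_map D z (\<alpha> * x + \<beta> * y, \<gamma> * x + \<delta> * y)"
      using Fp xy A(9) order_in_field by simp
    ultimately show "v \<in> period_lattice D \<aa> z" unfolding period_lattice_def by blast
  next
    fix v assume "v \<in> period_lattice D \<aa> z"
    then obtain x y where xy: "x \<in> quad_order D" "y \<in> twisted_ideal D \<aa>" "v = period_map D z (x, y)"
      using A(8) by (auto simp: period_lattice_def)
    have K: "x \<in> quad_field D" "y \<in> quad_field D" using xy A(9) order_in_field by auto
    have bby: "\<beta> * y \<in> quad_order D" using Mm(2) xy(2) by (simp add: ideal_inverse_def)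
    \<comment> \<open>The inverse of the unimodular substitution, showing that the lattice map is
      onto.\<close>
    have "(\<delta> * x - \<beta> * y, \<alpha> * y + (- x) * \<gamma>) \<in> ideal_module D \<aa>"
      unfolding A(8)
      by (rule conjI, rule order_diff[OF order_mult[OF Mm(1) xy(1)] bby],
          rule A(11)[OF A(12)[OF Mm(4) xy(2)] A(12)[OF order_minus[OF xy(1)] Mm(3)]])
    moreover have "v = F *v period_map D w (\<delta> * x - \<beta> * y, \<alpha> * y + (- x) * \<gamma>)"
    proof -
      have "\<alpha> * (\<delta> * x - \<beta> * y) + \<beta> * (\<alpha> * y + (- x) * \<gamma>) = (\<delta> * \<alpha> - \<beta> * \<gamma>) * x"
        "\<gamma> * (\<delta> * x - \<beta> * y) + \<delta> * (\<alpha> * y + (- x) * \<gamma>) = (\<delta> * \<alpha> - \<beta> * \<gamma>) * y"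
        by (simp_all add: algebra_simps)
      then have "(\<alpha> * (\<delta> * x - \<beta> * y) + \<beta> * (\<alpha> * y + (- x) * \<gamma>), \<gamma> * (\<delta> * x - \<beta> * y) + \<delta> * (\<alpha> * y + (- x) * \<gamma>)) = (x, y)"
        unfolding dt by simp
      then show ?thesis
        using Fp[of "\<delta> * x - \<beta> * y" "\<alpha> * y + (- x) * \<gamma>"] fld K xy(3)
        by (simp only: field_add field_diff field_mult field_minus)
    qed
    ultimately show "v \<in> (\<lambda>v. F *v v) ` period_lattice D \<aa> w" unfolding period_lattice_def by blast
  qed
  have FH: "std_form z (F *v v) (F *v v') = std_form w v v'" for v v'
  proof -
    have e: "j * p * cnj (j * q) / of_real t = p * cnj q / of_real (t / (cmod j)\<^sup>2)" if "j \<noteq> 0" "t > 0" for j p q t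
    proof -
      have r: "complex_of_real (t / (cmod j)\<^sup>2) = of_real t / (j * cnj j)" by (simp only: of_real_divide complex_norm_square)
      show ?thesis unfolding r using that by (simp add: field_simps)
    qed
    show ?thesis by (simp only: std_form_def Fv Imw e[OF j0(1) zi(1)] e[OF j0(2) zi(2)])
  qed
  have "det F = j1 * j2" by (simp add: F_def det_2)
  then have inv: "invertible F" using j0 by (simp add: invertible_det_nz)
  have comm: "F ** period_rm D k = period_rm D k ** F" for k
    by (simp add: F_def period_rm_def vec_eq_iff forall_2 matrix_matrix_mult_def sum_2)
  show ?thesis
    unfolding w_def[symmetric]
    by (rule rm_isoI[OF period_surface_rm[OF a w] period_surface_rm[OF a z] period_surface_eq[OF a w] period_surface_eq[OF a z] inv FL FH])
      (rule comm)
qed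

end

context quad_conductor
begin

lemma moduli_set_covered:
  assumes cop: "coprime (d2 div d1) f" and T: "T \<in> rm_surfaces D d1 d2"
  shows "\<exists>\<aa>\<in>type_ideals D d1 d2. \<exists>\<psi>. symplectic_module_iso D \<aa> T \<psi>"
proof -
  obtain L H \<rho> where LH: "T = (L, H, \<rho>)" by (cases T) auto
  note R = rm_surfacesD[OF T[unfolded LH]]
  interpret M: proper_order_module D \<Delta> f L "\<lambda>k v. \<rho> k *v v" "\<lambda>v w. Im (H v w)" d1 d2
    using rm_surface_module T LH by blast
  obtain I \<psi> where I: "ideal I RO" "bij_betw \<psi> (ideal_module D I) L" "additive_on (ideal_module D I) \<psi>"
    and E: "\<And>p q. p \<in> ideal_module D I \<Longrightarrow> q \<in> ideal_module D I \<Longrightarrow> Im (H (\<psi> p) (\<psi> q)) = trace_pairing D p q"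
    and act: "\<And>k x y. k \<in> quad_order D \<Longrightarrow> (x, y) \<in> ideal_module D I \<Longrightarrow> \<psi> (k * x, k * y) = \<rho> k *v \<psi> (x, y)"
    using M.module_structure[OF cop] by blast
  have "symplectic_module_iso D I T \<psi>"
    unfolding LH symplectic_module_iso_iff using I E act by (auto simp: additive_on_def)
  \<comment> \<open>The type of I is read off by transporting a symplectic basis of L back to the
    module.\<close>
  moreover have "form_type (ideal_module D I) (trace_pairing D) d1 d2"
  proof -
    define h where "h = inv_into (ideal_module D I) \<psi>"
    have h: "bij_betw h L (ideal_module D I)" unfolding h_def by (rule bij_betw_inv_into[OF I(2)])
    have h\<psi>: "\<psi> (h v) = v" "h v \<in> ideal_module D I" if "v \<in> L" for v
      using that I(2) h by (auto simp: h_def bij_betw_inv_into_right bij_betwE)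
    have inj: "inj_on \<psi> (ideal_module D I)" using I(2) by (simp add: bij_betw_def)
    have cl: "p + q \<in> ideal_module D I" if "p \<in> ideal_module D I" "q \<in> ideal_module D I" for p q
      using that I(1) unfolding ideal_order_iff
      by (cases p, cases q) (auto simp: ideal_module_def mem_twisted_ideal_iff order_add distrib_left)
    have "additive_on L h"
      unfolding additive_on_def
    proof (intro ballI)
      fix v w assume vw: "v \<in> L" "w \<in> L"
      have "\<psi> (h (v + w)) = \<psi> (h v + h w)"
        using I(3) h\<psi> vw M.L_add by (simp add: additive_on_def)
      then show "h (v + w) = h v + h w"
        by (rule inj_onD[OF inj _ h\<psi>(2)[OF M.L_add[OF vw]] cl[OF h\<psi>(2)[OF vw(1)] h\<psi>(2)[OF vw(2)]]])
    qed
    moreover have "inj_on h L" "h ` L = ideal_module D I" using h by (auto simp: bij_betw_def)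
    ultimately show ?thesis
      using form_type_image[OF R(3), of h "trace_pairing D"] E h\<psi> by metis
  qed
  ultimately show ?thesis using I(1) by (auto simp: type_ideals_def)
qed

text \<open>Commuting with omega makes F diagonal. The images of (1, 0) and (0, d2) are the columns
  of the matrix, the second after division by d2; compatibility with the polarization gives
  determinant 1.\<close>

lemma iso_hilbert_action:
  assumes a: "\<aa> \<in> type_ideals D d1 d2" and cop: "coprime (d2 div d1) f"
    and z: "z \<in> upper2" and w: "w \<in> upper2"
    and i: "(period_surface D \<aa> z, period_surface D \<aa> w) \<in> rm_iso D d1 d2"
  shows "\<exists>M\<in>SL2_module D \<aa>. z = hilbert_action D M w"
proof -
  note A = type_ideals_mem[OF a]
  obtain F where F: "invertible F" "(\<lambda>v. F *v v) ` period_lattice D \<aa> z = period_lattice D \<aa> w"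
    "\<And>v v'. std_form w (F *v v) (F *v v') = std_form z v v'"
    "\<And>k. k \<in> quad_order D \<Longrightarrow> F ** period_rm D k = period_rm D k ** F"
    using rm_isoE[OF i period_surface_eq[OF a z] period_surface_eq[OF a w]] by blast
  have Fo: "F ** period_rm D (omega D) = period_rm D (omega D) ** F" using F(4) order_omega by blast
  have ne: "complex_of_real (omega D) \<noteq> of_real (omega' D)" using omega_neq by simp
  have "F $ 1 $ 2 = 0" "F $ 2 $ 1 = 0"
    using Fo ne by (auto simp: period_rm_def vec_eq_iff forall_2 matrix_matrix_mult_def sum_2 mult.commute)
  then have Fv: "(F *v v) $ 1 = F $ 1 $ 1 * v $ 1" "(F *v v) $ 2 = F $ 2 $ 2 * v $ 2" for v
    by (simp_all add: matrix_vector_mult_def sum_2)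
  define f1 f2 where "f1 = F $ 1 $ 1" and "f2 = F $ 2 $ 2"
  let ?c = "quad_conj D"
  have zi: "0 < Im (fst z)" "0 < Im (snd z)" and wi: "0 < Im (fst w)" "0 < Im (snd w)"
    using z w by (simp_all add: upper2_iff)
  have img: "\<exists>x' y'. (x', y') \<in> ideal_module D \<aa> \<and> F *v period_map D z p = period_map D w (x', y')"
    if "p \<in> ideal_module D \<aa>" for p
  proof -
    have "F *v period_map D z p \<in> period_lattice D \<aa> w" using F(2) that by (auto simp: period_lattice_def)
    then show ?thesis by (auto simp: period_lattice_def)
  qed
  have m: "(1, 0) \<in> ideal_module D \<aa>" "(0, real d2) \<in> ideal_module D \<aa>" using A(7,8,10) order_1 order_0 by auto
  obtain \<alpha> \<gamma> where ag: "(\<alpha>, \<gamma>) \<in> ideal_module D \<aa>" "F *v period_map D z (1, 0) = period_map D w (\<alpha>, \<gamma>)"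
    using img[OF m(1)] by blast
  obtain b0 e0 where be: "(b0, e0) \<in> ideal_module D \<aa>" "F *v period_map D z (0, real d2) = period_map D w (b0, e0)"
    using img[OF m(2)] by blast
  have d2: "real d2 > 0" using A(5) by simp
  define \<beta> \<delta> where "\<beta> = b0 / real d2" and "\<delta> = e0 / real d2"
  have f0: "b0 \<in> quad_field D" "e0 \<in> quad_field D" using ideal_module_field[OF a be(1)] by auto
  have fld: "\<alpha> \<in> quad_field D" "\<gamma> \<in> quad_field D" "\<beta> \<in> quad_field D" "\<delta> \<in> quad_field D"
    using ideal_module_field[OF a ag(1)] field_divide[OF f0(1) field_rat, of "real d2"] field_divide[OF f0(2) field_rat, of "real d2"]
    by (simp_all add: \<beta>_def \<delta>_def)
  have cb: "?c \<beta> = ?c b0 / real d2" "?c \<delta> = ?c e0 / real d2"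
    using f0 d2 by (simp_all add: \<beta>_def \<delta>_def field_rat)
  have f1: "f1 = of_real \<alpha> + of_real \<gamma> * fst w" "f2 = of_real (?c \<alpha>) + of_real (?c \<gamma>) * snd w"
    using arg_cong[OF ag(2), of "\<lambda>v :: complex ^ 2. v $ 1"] arg_cong[OF ag(2), of "\<lambda>v :: complex ^ 2. v $ 2"]
    by (simp_all add: Fv f1_def f2_def)
  have d2c: "complex_of_real (real d2) \<noteq> 0" using d2 by simp
  have fz: "f1 * fst z = of_real \<beta> + of_real \<delta> * fst w" "f2 * snd z = of_real (?c \<beta>) + of_real (?c \<delta>) * snd w"
  proof -
    have "f1 * (of_real (real d2) * fst z) = of_real b0 + of_real e0 * fst w"
      "f2 * (of_real (real d2) * snd z) = of_real (?c b0) + of_real (?c e0) * snd w"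
      using arg_cong[OF be(2), of "\<lambda>v :: complex ^ 2. v $ 1"] arg_cong[OF be(2), of "\<lambda>v :: complex ^ 2. v $ 2"]
      by (simp_all add: Fv f1_def f2_def)
    then show "f1 * fst z = of_real \<beta> + of_real \<delta> * fst w" "f2 * snd z = of_real (?c \<beta>) + of_real (?c \<delta>) * snd w"
      unfolding cb unfolding \<beta>_def \<delta>_def using d2c by (simp_all add: field_simps)
  qed
  have mult: "y * \<beta> \<in> quad_order D \<and> y * \<delta> \<in> twisted_ideal D \<aa>" if y: "y \<in> twisted_ideal D \<aa>" for y
  proof -
    have "(0, y) \<in> ideal_module D \<aa>" using y A(8) order_0 by simp
    then obtain x' y' where xy: "(x', y') \<in> ideal_module D \<aa>" "F *v period_map D z (0, y) = period_map D w (x', y')"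
      using img by blast
    have "f1 * (of_real y * fst z) = of_real x' + of_real y' * fst w"
      using arg_cong[OF xy(2), of "\<lambda>v :: complex ^ 2. v $ 1"] by (simp add: Fv f1_def)
    moreover have "f1 * (of_real y * fst z) = of_real y * (f1 * fst z)" by simp
    ultimately have "of_real (y * \<beta>) + of_real (y * \<delta>) * fst w = of_real x' + of_real y' * fst w"
      unfolding fz by (simp add: algebra_simps)
    from arg_cong[OF this, of Im] arg_cong[OF this, of Re] have "y * \<beta> = x'" "y * \<delta> = y'"
      using wi by simp_all
    then show ?thesis using xy(1) A(8) by simp
  qed
  \<comment> \<open>delta multiplies the ideal into itself, so it is integral but a priori only in
    the maximal order. Both f delta and (d2/d1) delta lie in O_D, and f is prime to d2/d1.\<close>
  have "\<delta> \<in> quad_order D"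
  proof -
    have am: "\<delta> * x \<in> \<aa>" if "x \<in> \<aa>" for x
    proof -
      have "x / sqrt (real D) \<in> twisted_ideal D \<aa>" using that sqrt_pos by (simp add: mem_twisted_ideal_iff)
      then have "x / sqrt (real D) * \<delta> \<in> twisted_ideal D \<aa>" using mult by blast
      then show ?thesis using sqrt_pos by (simp add: mem_twisted_ideal_iff mult.commute)
    qed
    obtain r where r: "int (d2 div d1) dvd omega_poly D r" "\<aa> = (\<lambda>x. real d1 * x) ` root_ideal D (d2 div d1) r"
      "d2 = d1 * (d2 div d1)" "0 < d1" "0 < d2 div d1" using a by (rule type_idealsE)
    define n where "n = int (d2 div d1)"
    have "of_int n + of_int 0 * omega D \<in> root_ideal D n r" unfolding mem_root_ideal_iff by simp
    then have na: "real d1 * of_int n \<in> \<aa>" unfolding r(2) n_def by force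
    have "real d1 * of_int n \<noteq> 0" using r(4,5) by (simp add: n_def)
    then have nz: "\<aa> \<noteq> {0}" using na by blast
    obtain b :: "2 \<Rightarrow> real" where b: "zbasis b \<aa>" using ideal_zbasis[OF A(1) nz] by blast
    have "\<delta> \<in> quad_order \<Delta>"
      using multiplier_integral[OF b fld(4) am] fld(4)
      by (intro F.integral_in_order) (simp_all add: field_D conj_D quad_trace_def)
    then obtain u v where uv: "\<delta> = of_int u + of_int v * omega \<Delta>" by (rule quad_orderE)
    obtain c where c: "omega D = of_int c + of_int (int f) * omega \<Delta>" using omega_shift by metis
    have fd: "of_int (int f) * \<delta> \<in> quad_order D"
    proof -
      have "of_int (int f) * \<delta> = of_int (int f * u) + of_int v * (of_int (int f) * omega \<Delta>)"
        by (simp add: uv algebra_simps)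
      also have "of_int (int f) * omega \<Delta> = omega D - of_int c" using c by simp
      also have "of_int (int f * u) + of_int v * (omega D - of_int c) = of_int (int f * u - v * c) + of_int v * omega D"
        by (simp add: algebra_simps)
      finally show ?thesis by (simp only: quad_orderI)
    qed
    have "\<delta> * (real d1 * of_int n) \<in> \<aa>" using am na by blast
    then have "\<delta> * of_int n \<in> root_ideal D n r" unfolding r(2) n_def using r(4) by auto
    then have nd: "\<delta> * of_int n \<in> quad_order D" using root_ideal_subset by blast
    have "coprime n (int f)" using cop by (simp add: n_def)
    then obtain g h where gh: "g * n + h * int f = 1" by (metis bezout_int coprime_iff_gcd_eq_1)
    have "of_int g * (\<delta> * of_int n) + of_int h * (of_int (int f) * \<delta>) \<in> quad_order D"
      by (intro order_add order_mult[OF order_int] nd fd)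
    also have "of_int g * (\<delta> * of_int n) + of_int h * (of_int (int f) * \<delta>) = of_int (g * n + h * int f) * \<delta>"
      by (simp add: algebra_simps)
    finally show ?thesis using gh by simp
  qed
  \<comment> \<open>The imaginary part of f1 z1 times the conjugate of f1 is the determinant times
    Im w1. The isometry evaluated on (1, 0) gives |f1|^2 Im z1 = Im w1.\<close>
  moreover have "\<alpha> * \<delta> - \<beta> * \<gamma> = 1"
  proof -
    have e: "(of_real \<beta> + of_real \<delta> * t) * cnj (of_real \<alpha> + of_real \<gamma> * t) = f1 * fst z * cnj f1" if "t = fst w" for t
      using fz(1) f1(1) that by simp
    have "Im ((of_real \<beta> + of_real \<delta> * fst w) * cnj (of_real \<alpha> + of_real \<gamma> * fst w)) = (\<alpha> * \<delta> - \<beta> * \<gamma>) * Im (fst w)"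
      by (simp add: algebra_simps)
    moreover have "f1 * fst z * cnj f1 = of_real ((cmod f1)\<^sup>2) * fst z"
      by (simp only: complex_norm_square mult_ac)
    moreover have "Im (of_real ((cmod f1)\<^sup>2) * fst z) = (cmod f1)\<^sup>2 * Im (fst z)"
      by (simp del: of_real_power)
    ultimately have i1: "(\<alpha> * \<delta> - \<beta> * \<gamma>) * Im (fst w) = (cmod f1)\<^sup>2 * Im (fst z)"
      using e[OF refl] by (simp only:)
    have "std_form w (F *v vector [1, 0]) (F *v vector [1, 0]) = std_form z (vector [1, 0]) (vector [1, 0])"
      by (rule F(3))
    then have "f1 * cnj f1 / of_real (Im (fst w)) = 1 / of_real (Im (fst z))"
      by (simp add: std_form_def Fv f1_def)
    then have "of_real ((cmod f1)\<^sup>2 / Im (fst w)) = complex_of_real (1 / Im (fst z))"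
      by (simp only: of_real_divide complex_norm_square of_real_1)
    then have "(cmod f1)\<^sup>2 / Im (fst w) = 1 / Im (fst z)" by (simp only: of_real_eq_iff)
    then have "(cmod f1)\<^sup>2 * Im (fst z) = Im (fst w)" using zi wi by (simp add: field_simps)
    then show ?thesis using i1 wi by simp
  qed
  moreover have "\<alpha> \<in> quad_order D" "\<gamma> \<in> twisted_ideal D \<aa>" using ag(1) A(8) by auto
  moreover have "\<beta> \<in> ideal_inverse D (twisted_ideal D \<aa>)"
    using fld mult by (simp add: ideal_inverse_def mult.commute)
  ultimately have M: "vector [vector [\<delta>, \<beta>], vector [\<gamma>, \<alpha>]] \<in> SL2_module D \<aa>" (is "?M \<in> _")
    using fld by (simp add: SL2_module_def det_2 forall_2 mult.commute)
  have "f1 \<noteq> 0" "f2 \<noteq> 0"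
  proof -
    have "det F = f1 * f2"
      using \<open>F $ 1 $ 2 = 0\<close> by (simp add: det_2 f1_def f2_def)
    then show "f1 \<noteq> 0" "f2 \<noteq> 0" using F(1) by (auto simp: invertible_det_nz)
  qed
  then have "fst z = moebius ?M (fst w)" "snd z = moebius (mat_conj D ?M) (snd w)"
    using fz f1 by (simp_all add: moebius_def mat_conj_def field_simps)
  then have "z = hilbert_action D ?M w" by (simp add: hilbert_action_def split_def prod_eq_iff)
  with M show ?thesis by blast
qed

lemma hilbert_rel_iff_class:
  assumes a: "\<aa> \<in> type_ideals D d1 d2" and cop: "coprime (d2 div d1) f"
  shows "(z, w) \<in> hilbert_rel D \<aa> \<longleftrightarrow> z \<in> upper2 \<and> w \<in> upper2 \<and>
    rm_class D d1 d2 (period_surface D \<aa> z) = rm_class D d1 d2 (period_surface D \<aa> w)"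
proof
  assume "(z, w) \<in> hilbert_rel D \<aa>"
  then obtain M where M: "z \<in> upper2" "M \<in> SL2_module D \<aa>" "w = hilbert_action D M z"
    unfolding hilbert_rel_iff by blast
  then show "z \<in> upper2 \<and> w \<in> upper2 \<and>
      rm_class D d1 d2 (period_surface D \<aa> z) = rm_class D d1 d2 (period_surface D \<aa> w)"
    using hilbert_action_upper2 hilbert_action_iso[OF a] rm_class_eq_iff period_surface_rm[OF a] by metis
next
  assume zw: "z \<in> upper2 \<and> w \<in> upper2 \<and>
      rm_class D d1 d2 (period_surface D \<aa> z) = rm_class D d1 d2 (period_surface D \<aa> w)"
  then have "(period_surface D \<aa> w, period_surface D \<aa> z) \<in> rm_iso D d1 d2"
    using rm_class_eq_iff period_surface_rm[OF a] by metis
  then show "(z, w) \<in> hilbert_rel D \<aa>"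
    using iso_hilbert_action[OF a cop] zw unfolding hilbert_rel_iff by blast
qed

end

section \<open>Functions of two complex variables\<close>

text \<open>For x near a the functions F(x, .) and F(a, .) are uniformly close on a disc, so their
  derivatives are close by Cauchy's estimate. Continuity of one partial derivative is what joint
  differentiability rests on.\<close>

lemma isCont_deriv_snd:
  fixes F :: "complex \<times> complex \<Rightarrow> complex"
  assumes r: "0 < r" and cont: "continuous_on (cball a r \<times> cball b r) F"
    and hol: "\<And>x. x \<in> cball a r \<Longrightarrow> (\<lambda>v. F (x, v)) holomorphic_on ball b r"
  shows "isCont (\<lambda>(x, y). deriv (\<lambda>v. F (x, v)) y) (a, b)"
  unfolding continuous_at_eps_delta
proof (intro allI impI)
  fix e :: real assume e: "0 < e"
  have "uniformly_continuous_on (cball a r \<times> cball b r) F"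
    by (intro compact_uniformly_continuous cont compact_Times compact_cball)
  moreover have "0 < e * r / 8" using e r by simp
  ultimately obtain d1 where d1: "d1 > 0" "\<And>p q. p \<in> cball a r \<times> cball b r \<Longrightarrow> q \<in> cball a r \<times> cball b r \<Longrightarrow>
      dist q p < d1 \<Longrightarrow> dist (F q) (F p) < e * r / 8"
    unfolding uniformly_continuous_on_def by metis
  have a: "a \<in> cball a r" using r by simp
  have "deriv (\<lambda>v. F (a, v)) holomorphic_on ball b r" by (intro holomorphic_deriv hol a open_ball)
  then have "isCont (deriv (\<lambda>v. F (a, v))) b"
    using r holomorphic_on_imp_continuous_on by (fastforce simp: continuous_on_eq_continuous_at)
  then obtain d2 where d2: "d2 > 0" "\<And>y. dist y b < d2 \<Longrightarrow> dist (deriv (\<lambda>v. F (a, v)) y) (deriv (\<lambda>v. F (a, v)) b) < e / 2"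
    unfolding continuous_at_eps_delta using e half_gt_zero by metis
  show "\<exists>d>0. \<forall>x'. dist x' (a, b) < d \<longrightarrow>
      dist (case x' of (x, y) \<Rightarrow> deriv (\<lambda>v. F (x, v)) y) (case (a, b) of (x, y) \<Rightarrow> deriv (\<lambda>v. F (x, v)) y) < e"
  proof (intro exI[of _ "min (min d1 d2) (r / 2)"] conjI allI impI)
    show "0 < min (min d1 d2) (r / 2)" using d1 d2 r by simp
    fix p assume p: "dist p (a, b) < min (min d1 d2) (r / 2)"
    obtain x y where xy: "p = (x, y)" by (cases p)
    have dx: "dist x a < min (min d1 d2) (r / 2)" "dist y b < min (min d1 d2) (r / 2)"
      using p dist_fst_le[of p "(a, b)"] dist_snd_le[of p "(a, b)"] unfolding xy by simp_all
    have x: "x \<in> cball a r" using dx r by (simp add: dist_commute)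
    have sub: "cball y (r / 2) \<subseteq> ball b r"
    proof
      fix v assume "v \<in> cball y (r / 2)"
      then show "v \<in> ball b r" using dx(2) dist_triangle[of b v y] by (simp add: dist_commute)
    qed
    have ysub: "y \<in> ball b r" using dx(2) r by (simp add: dist_commute)
    have hx: "(\<lambda>v. F (x, v)) holomorphic_on ball b r" and ha: "(\<lambda>v. F (a, v)) holomorphic_on ball b r"
      using hol x a by auto
    have hd: "(\<lambda>v. F (x, v) - F (a, v)) holomorphic_on ball b r" by (intro holomorphic_on_diff hx ha)
    \<comment> \<open>The bound e r/8 on circles of radius r/2 yields e/4 for the derivative;
      continuity of the derivative at b contributes another e/2.\<close>
    have "norm ((deriv ^^ 1) (\<lambda>v. F (x, v) - F (a, v)) y) \<le> fact 1 * (e * r / 8) / (r / 2) ^ 1"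
    proof (rule Cauchy_inequality)
      show "(\<lambda>v. F (x, v) - F (a, v)) holomorphic_on ball y (r / 2)"
        using hd sub by (meson ball_subset_cball holomorphic_on_subset order_trans)
      show "continuous_on (cball y (r / 2)) (\<lambda>v. F (x, v) - F (a, v))"
        using hd sub holomorphic_on_imp_continuous_on continuous_on_subset by blast
      fix v assume "norm (y - v) = r / 2"
      then have v: "v \<in> cball b r" using sub by (auto simp: dist_norm subset_iff less_imp_le)
      have "dist (x, v) (a, v) < d1" using dx(1) by (simp add: dist_Pair_Pair)
      then have "dist (F (x, v)) (F (a, v)) < e * r / 8" using d1(2)[of "(a, v)" "(x, v)"] x a v by simp
      then show "norm (F (x, v) - F (a, v)) \<le> e * r / 8" by (simp add: dist_norm)
    qed (use r in auto)
    moreover have "deriv (\<lambda>v. F (x, v) - F (a, v)) y = deriv (\<lambda>v. F (x, v)) y - deriv (\<lambda>v. F (a, v)) y"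
      by (intro deriv_diff holomorphic_on_imp_differentiable_at[OF _ open_ball ysub] hx ha)
    ultimately have "dist (deriv (\<lambda>v. F (x, v)) y) (deriv (\<lambda>v. F (a, v)) y) \<le> e / 4"
      using r by (simp add: dist_norm)
    moreover have "dist (deriv (\<lambda>v. F (a, v)) y) (deriv (\<lambda>v. F (a, v)) b) < e / 2" using d2(2) dx(2) by simp
    ultimately have "dist (deriv (\<lambda>v. F (x, v)) y) (deriv (\<lambda>v. F (a, v)) b) < e"
      using dist_triangle[of "deriv (\<lambda>v. F (x, v)) y" "deriv (\<lambda>v. F (a, v)) b" "deriv (\<lambda>v. F (a, v)) y"] e by simp
    then show "dist (case p of (x, y) \<Rightarrow> deriv (\<lambda>v. F (x, v)) y) (case (a, b) of (x, y) \<Rightarrow> deriv (\<lambda>v. F (x, v)) y) < e"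
      unfolding xy by simp
  qed
qed

lemma open_cball_Times:
  fixes U :: "(complex \<times> complex) set"
  assumes "open U" "(a, b) \<in> U"
  obtains r where "0 < r" "cball a r \<times> cball b r \<subseteq> U"
proof -
  obtain A B where AB: "open A" "open B" "(a, b) \<in> A \<times> B" "A \<times> B \<subseteq> U" using open_prod_elim[OF assms] .
  obtain r1 r2 where r: "0 < r1" "cball a r1 \<subseteq> A" "0 < r2" "cball b r2 \<subseteq> B"
    using AB by (metis mem_Sigma_iff open_contains_cball)
  have "cball a (min r1 r2) \<subseteq> A" "cball b (min r1 r2) \<subseteq> B" using r by auto
  then show thesis using that[of "min r1 r2"] r AB(4) by fastforce
qed

lemma holomorphic2_mono: "holomorphic2 U f \<Longrightarrow> V \<subseteq> U \<Longrightarrow> holomorphic2 V f"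
  unfolding holomorphic2_def by (fast intro: continuous_on_subset holomorphic_on_subset)

lemma open_slices:
  fixes U :: "('a::topological_space \<times> 'b::topological_space) set"
  assumes "open U"
  shows "open {w. (w, b) \<in> U}" "open {w. (a, w) \<in> U}"
proof -
  have "open ((\<lambda>w. (w, b)) -` U)" by (intro open_vimage assms continuous_intros)
  then show "open {w. (w, b) \<in> U}" by (simp add: vimage_def)
  have "open ((\<lambda>w. (a, w)) -` U)" by (intro open_vimage assms continuous_intros)
  then show "open {w. (a, w) \<in> U}" by (simp add: vimage_def)
qed

text \<open>Pointwise form of \<open>holomorphic2\<close>, equivalent to it on open sets by
  \<open>holomorphic2_iff\<close>; it makes localisation and gluing immediate.\<close>

definition hol_at2 :: "(complex \<times> complex \<Rightarrow> complex) \<Rightarrow> complex \<times> complex \<Rightarrow> bool" where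
  "hol_at2 f p \<longleftrightarrow> isCont f p \<and> (\<lambda>w. f (w, snd p)) field_differentiable at (fst p) \<and>
    (\<lambda>w. f (fst p, w)) field_differentiable at (snd p)"

lemma holomorphic2_iff: "open U \<Longrightarrow> holomorphic2 U f \<longleftrightarrow> (\<forall>p\<in>U. hol_at2 f p)"
proof -
  assume o: "open U"
  have h: "(\<lambda>w. f (w, b)) holomorphic_on {w. (w, b) \<in> U} \<longleftrightarrow>
      (\<forall>w. (w, b) \<in> U \<longrightarrow> (\<lambda>w. f (w, b)) field_differentiable at w)"
    "(\<lambda>w. f (a, w)) holomorphic_on {w. (a, w) \<in> U} \<longleftrightarrow>
      (\<forall>w. (a, w) \<in> U \<longrightarrow> (\<lambda>w. f (a, w)) field_differentiable at w)" for a b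
    by (simp_all add: holomorphic_on_open[OF open_slices(1)[OF o]] holomorphic_on_open[OF open_slices(2)[OF o]]
        field_differentiable_def)
  show ?thesis
    unfolding holomorphic2_def hol_at2_def continuous_on_eq_continuous_at[OF o] h
    by (auto simp: Ball_def split_paired_All)
qed

lemma field_differentiable_transform_open:
  assumes "f field_differentiable at a" "open S" "a \<in> S" "\<And>x. x \<in> S \<Longrightarrow> f x = g x"
  shows "g field_differentiable at a"
  using assms unfolding field_differentiable_def by (meson has_field_derivative_transform_within_open)

lemma hol_at2_cong:
  assumes "hol_at2 f p" "open V" "p \<in> V" "\<And>q. q \<in> V \<Longrightarrow> f q = g q"
  shows "hol_at2 g p"
proof -
  have "eventually (\<lambda>q. f q = g q) (nhds p)" using assms by (auto simp: eventually_nhds)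
  then have "isCont g p" using assms(1) isCont_cong by (auto simp: hol_at2_def)
  moreover have "(\<lambda>w. g (w, snd p)) field_differentiable at (fst p)"
    by (rule field_differentiable_transform_open[of "\<lambda>w. f (w, snd p)" _ "{w. (w, snd p) \<in> V}"])
      (use assms open_slices in \<open>auto simp: hol_at2_def\<close>)
  moreover have "(\<lambda>w. g (fst p, w)) field_differentiable at (snd p)"
    by (rule field_differentiable_transform_open[of "\<lambda>w. f (fst p, w)" _ "{w. (fst p, w) \<in> V}"])
      (use assms open_slices in \<open>auto simp: hol_at2_def\<close>)
  ultimately show ?thesis by (simp add: hol_at2_def)
qed

text \<open>\<open>holomorphic2\<close> only provides continuity and separate holomorphy. The joint
  derivative, needed for the chain rule, comes from the continuity of the second partial
  derivative.\<close>

lemma holomorphic2_has_derivative: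
  assumes F: "holomorphic2 U F" and U: "open U" "(a, b) \<in> U"
  shows "\<exists>c d. (F has_derivative (\<lambda>(s, t). c * s + d * t)) (at (a, b))"
proof -
  obtain r where r: "0 < r" "cball a r \<times> cball b r \<subseteq> U" using open_cball_Times[OF U] .
  define D where "D = (\<lambda>x y. deriv (\<lambda>v. F (x, v)) y)"
  have h: "(\<lambda>v. F (x, v)) holomorphic_on ball b r" if "x \<in> cball a r" for x
  proof (rule holomorphic_on_subset)
    show "(\<lambda>v. F (x, v)) holomorphic_on {w. (x, w) \<in> U}" using F unfolding holomorphic2_def by blast
    show "ball b r \<subseteq> {w. (x, w) \<in> U}" using that r by auto
  qed
  have cont: "isCont (\<lambda>(x, y). D x y) (a, b)"
    unfolding D_def using r F
    by (intro isCont_deriv_snd[OF r(1)] h) (auto simp: holomorphic2_def intro: continuous_on_subset)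
  have "hol_at2 F (a, b)" using F U holomorphic2_iff by blast
  then obtain c where c: "((\<lambda>w. F (w, b)) has_field_derivative c) (at a)"
    unfolding hol_at2_def field_differentiable_def by auto
  have "((\<lambda>(x, y). F (x, y)) has_derivative (\<lambda>(tx, ty). c * tx + blinfun_apply (blinfun_mult_right (D a b)) ty))
      (at (a, b) within ball a r \<times> ball b r)"
  proof (rule has_derivative_partialsI)
    show "((\<lambda>x. F (x, b)) has_derivative (*) c) (at a within ball a r)"
      using c unfolding has_field_derivative_def by (rule has_derivative_at_withinI)
    fix x y assume x: "x \<in> ball a r" and y: "y \<in> ball b r"
    have "((\<lambda>v. F (x, v)) has_field_derivative D x y) (at y)"
      unfolding D_def using holomorphic_derivI[OF h open_ball y] x by simp
    then have "((\<lambda>v. F (x, v)) has_field_derivative D x y) (at y within ball b r)"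
      by (rule has_field_derivative_at_within)
    then show "((\<lambda>v. F (x, v)) has_derivative blinfun_apply (blinfun_mult_right (D x y))) (at y within ball b r)"
      by (simp add: has_field_derivative_def)
  next
    have "isCont (\<lambda>p. blinfun_mult_right (case p of (x, y) \<Rightarrow> D x y)) (a, b)"
      using cont by (rule bounded_linear.continuous[OF bounded_linear_blinfun_mult_right])
    then show "continuous (at (a, b) within ball a r \<times> ball b r) (\<lambda>(x, y). blinfun_mult_right (D x y))"
      by (simp add: continuous_at_imp_continuous_at_within case_prod_beta')
  qed (use r in auto)
  then have "(F has_derivative (\<lambda>(tx, ty). c * tx + D a b * ty)) (at (a, b))"
    using r(1) by (simp add: at_within_open[of _ "ball a r \<times> ball b r"] open_Times)
  then show ?thesis by blast
qed

lemma holomorphic2_compose: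
  assumes F: "holomorphic2 U F" and U: "open U" "(g w, h w) \<in> U"
    and g: "g field_differentiable at w" and h: "h field_differentiable at w"
  shows "(\<lambda>w. F (g w, h w)) field_differentiable at w"
proof -
  obtain c d where cd: "(F has_derivative (\<lambda>(s, t). c * s + d * t)) (at (g w, h w))"
    using holomorphic2_has_derivative[OF F U] by blast
  obtain g' h' where gh: "(g has_field_derivative g') (at w)" "(h has_field_derivative h') (at w)"
    using g h by (auto simp: field_differentiable_def)
  then have "((\<lambda>w. (g w, h w)) has_derivative (\<lambda>t. (g' * t, h' * t))) (at w)"
    unfolding has_field_derivative_def by (rule has_derivative_Pair)
  from has_derivative_compose[OF this cd]
  have "((\<lambda>w. F (g w, h w)) has_derivative (\<lambda>t. c * (g' * t) + d * (h' * t))) (at w)" by simp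
  moreover have "(\<lambda>t. c * (g' * t) + d * (h' * t)) = (*) (c * g' + d * h')"
    by (simp add: fun_eq_iff algebra_simps)
  ultimately have "((\<lambda>w. F (g w, h w)) has_derivative (*) (c * g' + d * h')) (at w)" by simp
  then show ?thesis unfolding field_differentiable_def has_field_derivative_def by blast
qed

text \<open>The identity theorem one variable at a time: first along horizontal discs through a
  small polydisc in W, then along vertical ones.\<close>

lemma holomorphic2_vanishing:
  assumes f: "holomorphic2 (ball a r \<times> ball b r) f"
    and W: "open W" "W \<noteq> {}" "W \<subseteq> ball a r \<times> ball b r" "\<And>p. p \<in> W \<Longrightarrow> f p = 0"
    and p: "p \<in> ball a r \<times> ball b r"
  shows "f p = 0"
proof -
  obtain u v where uv: "(u, v) \<in> W" using W(2) by auto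
  obtain s where s: "0 < s" "cball u s \<times> cball v s \<subseteq> W" using open_cball_Times[OF W(1) uv] .
  have sub: "ball u s \<times> ball v s \<subseteq> W" using s(2) ball_subset_cball by blast
  have uvs: "u \<in> ball u s" "v \<in> ball v s" using s(1) by auto
  have sub1: "ball u s \<subseteq> ball a r" and sub2: "ball v s \<subseteq> ball b r" using sub W(3) uvs by blast+
  have hol1: "(\<lambda>w. f (w, y)) holomorphic_on ball a r" if "y \<in> ball b r" for y
    by (rule holomorphic_on_subset[of _ "{w. (w, y) \<in> ball a r \<times> ball b r}"])
      (use f that in \<open>auto simp: holomorphic2_def\<close>)
  have hol2: "(\<lambda>w. f (x, w)) holomorphic_on ball b r" if "x \<in> ball a r" for x
    by (rule holomorphic_on_subset[of _ "{w. (x, w) \<in> ball a r \<times> ball b r}"])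
      (use f that in \<open>auto simp: holomorphic2_def\<close>)
  have 1: "f (x, y) = 0" if x: "x \<in> ball a r" and y: "y \<in> ball v s" for x y
  proof (rule analytic_continuation_open[of "ball u s" "ball a r" "\<lambda>w. f (w, y)" "\<lambda>_. 0"])
    show "(\<lambda>w. f (w, y)) holomorphic_on ball a r" using hol1 y sub2 by blast
    show "ball u s \<noteq> {}" using uvs by blast
    show "f (z, y) = 0" if "z \<in> ball u s" for z using W(4) sub that y by blast
  qed (use sub1 x in auto)
  have "f (x, y) = 0" if x: "x \<in> ball a r" and y: "y \<in> ball b r" for x y
  proof (rule analytic_continuation_open[of "ball v s" "ball b r" "\<lambda>w. f (x, w)" "\<lambda>_. 0"])
    show "(\<lambda>w. f (x, w)) holomorphic_on ball b r" using hol2 x by blast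
    show "ball v s \<noteq> {}" using uvs by blast
    show "f (x, z) = 0" if "z \<in> ball v s" for z using 1 that x by blast
  qed (use sub2 y in auto)
  then show ?thesis using p by auto
qed

section \<open>Analytic subsets of a domain in two variables\<close>

definition locally_zero_set2 :: "(complex \<times> complex) set \<Rightarrow> (complex \<times> complex) set \<Rightarrow> bool" where
  "locally_zero_set2 X A \<longleftrightarrow> (\<forall>x\<in>X. \<exists>V F. open V \<and> x \<in> V \<and> V \<subseteq> X \<and> (\<forall>f\<in>F. holomorphic2 V f) \<and>
    A \<inter> V = {y \<in> V. \<forall>f\<in>F. f y = 0})"

lemma locally_zero_set2E:
  assumes "locally_zero_set2 X A" "x \<in> X"
  obtains V F where "open V" "x \<in> V" "V \<subseteq> X" "\<forall>f\<in>F. holomorphic2 V f" "A \<inter> V = {y \<in> V. \<forall>f\<in>F. f y = 0}"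
  using bspec[OF assms(1)[unfolded locally_zero_set2_def] assms(2)] by (elim exE conjE) (rule that)

lemma locally_zero_set2_open_diff:
  assumes "locally_zero_set2 X A"
  shows "open (X - A)"
proof (subst open_subopen, intro ballI)
  fix x assume x: "x \<in> X - A"
  then obtain V F where V: "open V" "x \<in> V" "V \<subseteq> X" "\<forall>f\<in>F. holomorphic2 V f" "A \<inter> V = {y \<in> V. \<forall>f\<in>F. f y = 0}"
    using locally_zero_set2E[OF assms] by blast
  then obtain f where f: "f \<in> F" "f x \<noteq> 0" using x by blast
  have "continuous_on V f" using V f by (simp add: holomorphic2_def)
  then have "open (V \<inter> f -` (- {0}))" using V(1) by (intro continuous_open_preimage) auto
  moreover have "V \<inter> f -` (- {0}) \<subseteq> X - A" using V f by blast
  ultimately show "\<exists>T. open T \<and> x \<in> T \<and> T \<subseteq> X - A" using f V(2) by blast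
qed

text \<open>The interior of A is also closed in X: if a small polydisc with local equations for A
  meets it, these equations vanish identically there.\<close>

lemma locally_zero_set2_dichotomy:
  assumes A: "locally_zero_set2 X A" "A \<subseteq> X" and X: "open X" "connected X" and int: "interior A \<noteq> {}"
  shows "A = X"
proof -
  have iX: "interior A \<subseteq> X" using A(2) interior_subset by blast
  have "open (X - interior A)"
  proof (subst open_subopen, intro ballI)
    fix x assume x: "x \<in> X - interior A"
    then obtain V F where V: "open V" "x \<in> V" "V \<subseteq> X" "\<forall>f\<in>F. holomorphic2 V f" "A \<inter> V = {y \<in> V. \<forall>f\<in>F. f y = 0}"
      using locally_zero_set2E[OF A(1)] by blast
    obtain a b where ab: "x = (a, b)" by (cases x)
    obtain r where r: "0 < r" "cball a r \<times> cball b r \<subseteq> V" using open_cball_Times V(1,2) ab by blast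
    let ?B = "ball a r \<times> ball b r"
    have B: "open ?B" "x \<in> ?B" "?B \<subseteq> V" using r ball_subset_cball by (auto simp: ab open_Times subset_iff)
    have "?B \<inter> interior A = {}"
    proof (rule ccontr)
      assume ne: "?B \<inter> interior A \<noteq> {}"
      have "f p = 0" if f: "f \<in> F" and p: "p \<in> ?B" for f p
      proof (rule holomorphic2_vanishing[OF _ _ ne _ _ p])
        show "holomorphic2 ?B f" using V(4) f B(3) holomorphic2_mono by blast
        show "open (?B \<inter> interior A)" using B by blast
        show "f q = 0" if "q \<in> ?B \<inter> interior A" for q using that V(5) f B(3) interior_subset by blast
      qed auto
      then have "?B \<subseteq> A" using V(5) B(3) by blast
      then have "x \<in> interior A" using B by (meson interiorI)
      then show False using x by blast
    qed
    then show "\<exists>T. open T \<and> x \<in> T \<and> T \<subseteq> X - interior A" using B V(3) by blast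
  qed
  then have "closedin (top_of_set X) (interior A)"
    using iX X(1) by (simp add: closedin_def openin_open_eq)
  moreover have "openin (top_of_set X) (interior A)" using iX X(1) by (simp add: openin_open_eq)
  ultimately have "interior A = X" using X(2) int unfolding connected_clopen by blast
  then show ?thesis using A(2) interior_subset by blast
qed

text \<open>If A is not everything, its complement is a nonempty open set contained in B, so B has
  interior points.\<close>

lemma locally_zero_set2_irreducible:
  assumes A: "locally_zero_set2 X A" "A \<subseteq> X" and B: "locally_zero_set2 X B" "B \<subseteq> X"
    and X: "open X" "connected X" and u: "X = A \<union> B"
  shows "X = A \<or> X = B"
proof (rule ccontr)
  assume n: "\<not> ?thesis"
  then have "X - A \<subseteq> interior B" "X - A \<noteq> {}"
    using locally_zero_set2_open_diff[OF A(1)] u by (auto intro: interiorI)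
  then have "interior B \<noteq> {}" by blast
  then show False using locally_zero_set2_dichotomy[OF B X] n by blast
qed

lemma open_upper2: "open upper2" and connected_upper2: "connected upper2"
proof -
  have u: "upper2 = {z. 0 < Im z} \<times> {z. 0 < Im z}" by (auto simp: upper2_def)
  show "open upper2" unfolding u by (intro open_Times open_halfspace_Im_gt)
  show "connected upper2" unfolding u by (intro connected_Times convex_connected convex_halfspace_Im_gt)
qed


section \<open>Holomorphic functions of several variables\<close>

lemma fun_upd_Cn: "t \<in> Cn n \<Longrightarrow> i < n \<Longrightarrow> t(i := w) \<in> Cn n"
  by (auto simp: Cn_def)

lemma continuous_fun_upd: "continuous_on UNIV (\<lambda>w :: complex. t(i := w))"
proof (rule continuous_on_coordinatewise_then_product)
  show "continuous_on UNIV (\<lambda>w. (t(i := w)) j)" for j by (cases "j = i") simp_all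
qed

lemma open_Cn_slice:
  assumes "openin (top_of_set (Cn n)) B" "t \<in> Cn n" "i < n"
  shows "open {w. t(i := w) \<in> B}"
proof -
  obtain T where T: "open T" "B = Cn n \<inter> T" using assms(1) openin_open by blast
  have "open ((\<lambda>w. t(i := w)) -` T)" using T(1) continuous_fun_upd by (rule open_vimage)
  then show ?thesis unfolding T(2) using fun_upd_Cn[OF assms(2,3)] by (simp add: vimage_def)
qed

text \<open>The analogue of \<open>hol_at2\<close>. Continuity is taken within \<open>Cn n\<close>,
  which is not open in the ambient product space.\<close>

definition hol_atCn :: "nat \<Rightarrow> ((nat \<Rightarrow> complex) \<Rightarrow> complex) \<Rightarrow> (nat \<Rightarrow> complex) \<Rightarrow> bool" where
  "hol_atCn n f t \<longleftrightarrow> continuous (at t within Cn n) f \<and>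
    (\<forall>i<n. (\<lambda>w. f (t(i := w))) field_differentiable at (t i))"

lemma at_within_openin_Cn:
  assumes "openin (top_of_set (Cn n)) B" "t \<in> B"
  shows "at t within B = at t within Cn n"
proof -
  obtain T where T: "open T" "B = Cn n \<inter> T" using assms(1) openin_open by blast
  show ?thesis using T assms(2) by (intro at_within_nhd[of t T]) auto
qed

lemma holomorphic_Cn_iff:
  assumes B: "openin (top_of_set (Cn n)) B"
  shows "holomorphic_Cn n B f \<longleftrightarrow> (\<forall>t\<in>B. hol_atCn n f t)"
proof -
  have BC: "B \<subseteq> Cn n" using openin_imp_subset[OF B] .
  have 1: "continuous_on B f \<longleftrightarrow> (\<forall>t\<in>B. continuous (at t within Cn n) f)"
    unfolding continuous_on_eq_continuous_within using at_within_openin_Cn[OF B] by simp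
  have 2: "(\<lambda>w. f (t(i := w))) holomorphic_on {w. t(i := w) \<in> B} \<longleftrightarrow>
      (\<forall>w. t(i := w) \<in> B \<longrightarrow> (\<lambda>w. f (t(i := w))) field_differentiable at w)" if "t \<in> B" "i < n" for t i
    using holomorphic_on_open[OF open_Cn_slice[OF B _ that(2)], of t] that BC
    by (auto simp: field_differentiable_def)
  \<comment> \<open>Each point \<open>t(i := w)\<close> of a slice inside B is itself a point of B,
    so differentiability at the base coordinate covers the whole slice.\<close>
  have 3: "(\<forall>t\<in>B. \<forall>w. t(i := w) \<in> B \<longrightarrow> (\<lambda>w. f (t(i := w))) field_differentiable at w) \<longleftrightarrow>
      (\<forall>t\<in>B. (\<lambda>w. f (t(i := w))) field_differentiable at (t i))" (is "?l \<longleftrightarrow> ?r") for i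
  proof
    assume ?l
    then show ?r by (metis fun_upd_triv)
  next
    assume r: ?r
    show ?l
    proof (intro ballI allI impI)
      fix t w assume "t(i := w) \<in> B"
      with r have "(\<lambda>v. f ((t(i := w))(i := v))) field_differentiable at ((t(i := w)) i)" by blast
      then show "(\<lambda>w. f (t(i := w))) field_differentiable at w" by simp
    qed
  qed
  show ?thesis unfolding holomorphic_Cn_def hol_atCn_def 1 using 2 3 by blast
qed

lemma hol_atCn_cong:
  assumes "hol_atCn n f t" "openin (top_of_set (Cn n)) V" "t \<in> V" "\<And>s. s \<in> V \<Longrightarrow> f s = g s"
  shows "hol_atCn n g t"
proof -
  have t: "t \<in> Cn n" using openin_imp_subset[OF assms(2)] assms(3) by blast
  have "continuous (at t within V) f" using assms(1) at_within_openin_Cn[OF assms(2,3)] by (simp add: hol_atCn_def)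
  moreover have "eventually (\<lambda>s. f s = g s) (at t within V)"
    using assms(4) by (simp add: eventually_at_filter)
  ultimately have "continuous (at t within V) g"
    using assms(3,4) by (simp add: continuous_within tendsto_cong)
  moreover have "(\<lambda>w. g (t(i := w))) field_differentiable at (t i)" if "i < n" for i
    by (rule field_differentiable_transform_open[of "\<lambda>w. f (t(i := w))" _ "{w. t(i := w) \<in> V}"])
      (use assms that open_Cn_slice[OF assms(2) t] in \<open>auto simp: hol_atCn_def\<close>)
  ultimately show ?thesis unfolding hol_atCn_def using at_within_openin_Cn[OF assms(2,3)] by simp
qed

lemma hol_atCn_const: "hol_atCn n (\<lambda>_. c) t"
  by (simp add: hol_atCn_def)

lemma hol_atCn_add: "hol_atCn n f t \<Longrightarrow> hol_atCn n g t \<Longrightarrow> hol_atCn n (\<lambda>t. f t + g t) t"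
  by (auto simp: hol_atCn_def intro: continuous_add field_differentiable_add)

lemma hol_atCn_mult: "hol_atCn n f t \<Longrightarrow> hol_atCn n g t \<Longrightarrow> hol_atCn n (\<lambda>t. f t * g t) t"
  by (auto simp: hol_atCn_def intro: continuous_mult field_differentiable_mult)

lemma hol_atCn_sum: "(\<And>i. i \<in> I \<Longrightarrow> hol_atCn n (f i) t) \<Longrightarrow> hol_atCn n (\<lambda>t. \<Sum>i\<in>I. f i t) t"
  by (induction I rule: infinite_finite_induct) (auto intro: hol_atCn_add hol_atCn_const)

lemma hol_atCn_divide:
  assumes "hol_atCn n f t" "hol_atCn n g t" "g t \<noteq> 0"
  shows "hol_atCn n (\<lambda>t. f t / g t) t"
  using assms unfolding hol_atCn_def
  by (auto intro!: continuous_at_within_divide field_differentiable_divide)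

lemma hol_atCn_coord: "hol_atCn n (\<lambda>t. t i) t"
proof -
  have "continuous_on UNIV (\<lambda>t :: nat \<Rightarrow> complex. t i)" by (rule continuous_on_product_coordinates)
  then have "continuous (at t within Cn n) (\<lambda>t. t i)"
    by (meson UNIV_I continuous_at_imp_continuous_at_within continuous_on_eq_continuous_at open_UNIV)
  moreover have "(\<lambda>w. (t(j := w)) i) field_differentiable at (t j)" for j
    by (cases "i = j") (auto simp: field_differentiable_ident field_differentiable_const)
  ultimately show ?thesis by (simp add: hol_atCn_def)
qed

lemma hol_atCn_compose2:
  assumes F: "holomorphic2 U F" and U: "open U" "(f t, g t) \<in> U" and f: "hol_atCn n f t" and g: "hol_atCn n g t"
  shows "hol_atCn n (\<lambda>t. F (f t, g t)) t"
  unfolding hol_atCn_def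
proof (intro conjI allI impI)
  have "isCont F (f t, g t)" using F U holomorphic2_iff hol_at2_def by blast
  moreover have "continuous (at t within Cn n) (\<lambda>t. (f t, g t))"
    using f g by (intro continuous_Pair) (auto simp: hol_atCn_def)
  ultimately show "continuous (at t within Cn n) (\<lambda>t. F (f t, g t))"
    by (intro continuous_within_compose3[where g = F and f = "\<lambda>t. (f t, g t)"])
  fix i assume "i < n"
  then show "(\<lambda>w. F (f (t(i := w)), g (t(i := w)))) field_differentiable at (t i)"
    using f g U(2) by (intro holomorphic2_compose[OF F U(1)]) (auto simp: hol_atCn_def)
qed

text \<open>Near a point where some coordinate of W1 is nonzero, the proportionality factor is the
  quotient of that coordinate.\<close>

lemma hol_atCn_ratio:
  fixes W1 W2 :: "(nat \<Rightarrow> complex) \<Rightarrow> complex ^ 2"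
  assumes B: "openin (top_of_set (Cn n)) B" and W: "\<And>j. holomorphic_Cn n B (\<lambda>t. W1 t $ j)" "\<And>j. holomorphic_Cn n B (\<lambda>t. W2 t $ j)"
    and ne: "\<And>t. t \<in> B \<Longrightarrow> W1 t \<noteq> 0" and e: "\<And>t. t \<in> B \<Longrightarrow> W2 t = \<zeta> t *s W1 t" and t: "t \<in> B"
  shows "hol_atCn n \<zeta> t"
proof -
  obtain j where j: "W1 t $ j \<noteq> 0" using ne[OF t] by (auto simp: vec_eq_iff)
  have "openin (top_of_set B) (B \<inter> (\<lambda>t. W1 t $ j) -` (- {0}))"
    using W(1)[of j] by (intro continuous_openin_preimage_gen) (auto simp: holomorphic_Cn_def)
  then have V: "openin (top_of_set (Cn n)) (B \<inter> (\<lambda>t. W1 t $ j) -` (- {0}))" using B openin_trans by blast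
  have "hol_atCn n (\<lambda>t. W2 t $ j / W1 t $ j) t"
    using W t j holomorphic_Cn_iff[OF B] by (intro hol_atCn_divide) auto
  then show ?thesis using V by (rule hol_atCn_cong) (use t j e in auto)
qed

lemma continuous_on_Cn_pair:
  assumes "openin (top_of_set (Cn n)) B" "holomorphic_Cn n B f" "holomorphic_Cn n B g" "open U"
  shows "openin (top_of_set (Cn n)) {t \<in> B. (f t, g t) \<in> U}"
proof -
  have "continuous_on B (\<lambda>t. (f t, g t))" using assms by (intro continuous_on_Pair) (auto simp: holomorphic_Cn_def)
  then have "openin (top_of_set B) (B \<inter> (\<lambda>t. (f t, g t)) -` U)" using assms(4) by (rule continuous_openin_preimage_gen)
  moreover have "B \<inter> (\<lambda>t. (f t, g t)) -` U = {t \<in> B. (f t, g t) \<in> U}" by blast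
  ultimately show ?thesis using assms(1) openin_trans by metis
qed

text \<open>The identification of pairs with \<open>Cn 2\<close>, needed because families live over
  subsets of \<open>nat \<Rightarrow> complex\<close> while the half planes are pairs.\<close>

definition pt2 :: "complex \<times> complex \<Rightarrow> nat \<Rightarrow> complex" where
  "pt2 z i = (if i = 0 then fst z else if i = 1 then snd z else 0)"

lemma pt2_simps [simp]: "pt2 z 0 = fst z" "pt2 z (Suc 0) = snd z" "pt2 z \<in> Cn 2"
  "(pt2 z)(0 := w) = pt2 (w, snd z)" "(pt2 z)(Suc 0 := w) = pt2 (fst z, w)"
  by (auto simp: pt2_def Cn_def fun_eq_iff)

lemma continuous_pt2: "continuous_on UNIV pt2"
proof (rule continuous_on_coordinatewise_then_product)
  show "continuous_on UNIV (\<lambda>z. pt2 z i)" for i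
    by (cases "i = 0"; cases "i = 1") (simp_all add: pt2_def continuous_on_fst continuous_on_snd)
qed

lemma open_pt2_vimage:
  assumes "openin (top_of_set (Cn 2)) B"
  shows "open {z. pt2 z \<in> B}"
proof -
  obtain T where T: "open T" "B = Cn 2 \<inter> T" using assms openin_open by blast
  have "open (pt2 -` T)" using T(1) continuous_pt2 by (rule open_vimage)
  then show ?thesis by (simp add: T(2) vimage_def)
qed

lemma hol_at2_pt2:
  assumes "hol_atCn 2 f (pt2 z)"
  shows "hol_at2 (\<lambda>z. f (pt2 z)) z"
proof -
  have "continuous (at (pt2 z) within Cn 2) f" using assms by (simp add: hol_atCn_def)
  moreover have "isCont pt2 z" using continuous_on_eq_continuous_at[OF open_UNIV] continuous_pt2 by blast
  moreover have "range pt2 \<subseteq> Cn 2" by auto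
  ultimately have "isCont (\<lambda>z. f (pt2 z)) z"
    by (metis continuous_within_compose2 continuous_within_subset)
  moreover have "\<forall>i<2. (\<lambda>w. f ((pt2 z)(i := w))) field_differentiable at (pt2 z i)"
    using assms by (simp add: hol_atCn_def)
  from this[rule_format, of 0] this[rule_format, of "Suc 0"]
  have "(\<lambda>w. f (pt2 (w, snd z))) field_differentiable at (fst z)"
    "(\<lambda>w. f (pt2 (fst z, w))) field_differentiable at (snd z)" by simp_all
  ultimately show ?thesis by (simp add: hol_at2_def)
qed

section \<open>Families of surfaces\<close>

lemma holomorphic_Cn_mono: "holomorphic_Cn n B f \<Longrightarrow> A \<subseteq> B \<Longrightarrow> holomorphic_Cn n A f"
  unfolding holomorphic_Cn_def
proof (elim conjE, intro conjI ballI allI impI)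
  assume A: "A \<subseteq> B" and f: "continuous_on B f" "\<forall>t\<in>B. \<forall>i<n. (\<lambda>w. f (t(i := w))) holomorphic_on {w. t(i := w) \<in> B}"
  show "continuous_on A f" using f(1) A by (rule continuous_on_subset)
  fix t i assume "t \<in> A" "i < n"
  then have "(\<lambda>w. f (t(i := w))) holomorphic_on {w. t(i := w) \<in> B}" using f(2) A by blast
  then show "(\<lambda>w. f (t(i := w))) holomorphic_on {w. t(i := w) \<in> A}"
    by (rule holomorphic_on_subset) (use A in blast)
qed

lemma rm_family_class_in_moduli:
  "rm_family D d1 d2 n B L H \<rho> \<Longrightarrow> t \<in> B \<Longrightarrow> rm_class D d1 d2 (L t, H t, \<rho> t) \<in> moduli_set D d1 d2"
  by (auto simp: rm_family_def intro: rm_class_in_moduli)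

definition frame_comb :: "(4 \<Rightarrow> 'b \<Rightarrow> complex ^ 2) \<Rightarrow> 'b \<Rightarrow> (4 \<Rightarrow> int) \<Rightarrow> complex ^ 2" where
  "frame_comb b t k = (\<Sum>i\<in>UNIV. of_int (k i) *\<^sub>R b i t)"

lemma frame_comb_add: "frame_comb b t (\<lambda>i. k i + l i) = frame_comb b t k + frame_comb b t l"
  by (simp add: frame_comb_def scaleR_add_left sum.distrib)

lemma frame_comb_matrix:
  "(\<Sum>j\<in>UNIV. of_int (l j) *\<^sub>R frame_comb b t (M j)) = frame_comb b t (\<lambda>i. \<Sum>j\<in>UNIV. l j * M j i)"
proof -
  have "(\<Sum>j\<in>UNIV. of_int (l j) *\<^sub>R frame_comb b t (M j)) =
      (\<Sum>j\<in>UNIV. \<Sum>i\<in>UNIV. of_int (l j * M j i) *\<^sub>R b i t)"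
    by (simp add: frame_comb_def scaleR_sum_right)
  also have "\<dots> = (\<Sum>i\<in>UNIV. \<Sum>j\<in>UNIV. of_int (l j * M j i) *\<^sub>R b i t)" by (rule sum.swap)
  also have "\<dots> = frame_comb b t (\<lambda>i. \<Sum>j\<in>UNIV. l j * M j i)"
    by (simp add: frame_comb_def scaleR_sum_left)
  finally show ?thesis .
qed

lemma matrix_vector_mult_sum: "(A :: complex ^ 2 ^ 2) *v (\<Sum>i\<in>I. f i) = (\<Sum>i\<in>I. A *v f i)"
  by (induction I rule: infinite_finite_induct) (simp_all add: matrix_vector_right_distrib)

lemma matrix_frame_comb:
  "(A :: complex ^ 2 ^ 2) *v frame_comb b t l = (\<Sum>j\<in>UNIV. of_int (l j) *\<^sub>R (A *v b j t))"
  by (simp add: frame_comb_def matrix_vector_mult_sum matrix_vector_scaleR)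

lemma polarization_frame_comb:
  assumes "polarization L H"
  shows "Im (H (frame_comb b t k) (frame_comb b t l)) =
    (\<Sum>i\<in>UNIV. \<Sum>j\<in>UNIV. of_int (k i) * of_int (l j) * Im (H (b i t) (b j t)))"
proof -
  note P = polarizationD[OF assms]
  have H0: "H 0 w = 0" "H w 0 = 0" for w using P(1)[of 0 0 w] P(6)[of w 0 0] by simp_all
  have l: "H (sum f S) w = (\<Sum>i\<in>S. H (f i) w)" "H w (sum f S) = (\<Sum>i\<in>S. H w (f i))"
    for f w and S :: "4 set"
    by (induction S rule: infinite_finite_induct) (simp_all add: H0 P(1,6))
  have "H (frame_comb b t k) (frame_comb b t l) =
    (\<Sum>i\<in>UNIV. \<Sum>j\<in>UNIV. of_real (of_int (k i) * of_int (l j)) * H (b i t) (b j t))"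
    unfolding frame_comb_def l(1) unfolding l(2) by (simp add: P(8,9) sum_distrib_left mult_ac)
  then show ?thesis by (simp add: Im_sum del: of_real_mult of_real_of_int_eq)
qed

lemma hol_atCn_frame_comb:
  fixes b :: "4 \<Rightarrow> (nat \<Rightarrow> complex) \<Rightarrow> complex ^ 2"
  assumes "\<And>i. hol_atCn n (\<lambda>t. b i t $ j) t"
  shows "hol_atCn n (\<lambda>t. frame_comb b t k $ j) t"
proof -
  have "hol_atCn n (\<lambda>t. \<Sum>i\<in>UNIV. of_int (k i) * b i t $ j) t"
    by (intro hol_atCn_sum hol_atCn_mult hol_atCn_const assms)
  then show ?thesis by (simp add: frame_comb_def scaleR_conv_of_real[where 'a = complex])
qed

context quad_disc
begin

text \<open>The period map applied to a fixed basis of the module is affine in z, while the pairing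
  and the action on that basis do not involve z. Testing the moduli structure on this family
  recovers the structure of the two half planes.\<close>

lemma universal_family:
  assumes a: "\<aa> \<in> type_ideals D d1 d2"
  shows "rm_family D d1 d2 2 {t \<in> Cn 2. (t 0, t 1) \<in> upper2} (\<lambda>t. period_lattice D \<aa> (t 0, t 1))
    (\<lambda>t. std_form (t 0, t 1)) (\<lambda>_. period_rm D)"
proof -
  let ?B = "{t \<in> Cn 2. (t 0, t 1) \<in> upper2}"
  note A = type_ideals_mem[OF a]
  note fld = ideal_module_field[OF a]
  have C: "openin (top_of_set (Cn 2)) (Cn 2)" by (rule openin_subtopology_self)
  have B: "openin (top_of_set (Cn 2)) ?B"
    by (rule continuous_on_Cn_pair[OF C _ _ open_upper2]; unfold holomorphic_Cn_iff[OF C]) (blast intro: hol_atCn_coord)+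
  obtain u v :: "2 \<Rightarrow> real \<times> real" where uv: "zbasis (case_sum u v) (ideal_module D \<aa>)"
    using A(2) unfolding form_type_def by blast
  have "card (UNIV :: 4 set) = card (UNIV :: (2 + 2) set)" by (simp add: card_UNIV_sum)
  then obtain g :: "4 \<Rightarrow> 2 + 2" where g: "bij g"
    using finite_same_card_bij[of "UNIV :: 4 set" "UNIV :: (2 + 2) set"] by auto
  define c where "c = case_sum u v \<circ> g"
  have c: "zbasis c (ideal_module D \<aa>)" unfolding c_def by (rule zbasis_reindex[OF g uv])
  have cmem: "c i \<in> ideal_module D \<aa>" for i using c by (rule zbasis_basis_mem)
  have add: "additive_on (ideal_module D \<aa>) (period_map D z)" for z
    using fld by (auto simp: additive_on_def intro!: period_map_add)
  define b where "b = (\<lambda>i (t :: nat \<Rightarrow> complex). period_map D (t 0, t 1) (c i))"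
  have "holomorphic_Cn 2 ?B (\<lambda>t. b i t $ j)" for i and j :: 2
  proof -
    have "hol_atCn 2 (\<lambda>t. b i t $ 1) t" "hol_atCn 2 (\<lambda>t. b i t $ 2) t" for t
      unfolding b_def period_map_nth fst_conv snd_conv
      by (rule hol_atCn_add[OF hol_atCn_const hol_atCn_mult[OF hol_atCn_const hol_atCn_coord]])+
    then show ?thesis unfolding holomorphic_Cn_iff[OF B] using exhaust_2[of j] by auto
  qed
  moreover have "zbasis (\<lambda>i. b i t) (period_lattice D \<aa> (t 0, t 1))" if t: "t \<in> ?B" for t
  proof -
    have "inj_on (period_map D (t 0, t 1)) (ideal_module D \<aa>)"
      by (rule inj_on_subset[OF inj_on_period_map]) (use t in auto)
    from zbasis_image[OF c add this] show ?thesis by (simp add: b_def comp_def period_lattice_def)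
  qed
  moreover have "\<exists>e. \<forall>t\<in>?B. Im (std_form (t 0, t 1) (b i t) (b j t)) = e" for i j
    using Im_std_form_period fld[OF cmem] by (auto simp: b_def)
  moreover have "\<exists>m :: 4 \<Rightarrow> int. \<forall>t\<in>?B. period_rm D k *v b j t = (\<Sum>i\<in>UNIV. of_int (m i) *\<^sub>R b i t)"
    if k: "k \<in> quad_order D" for k j
  proof -
    obtain x y where xy: "c j = (x, y)" by (cases "c j")
    have "(k * x, k * y) \<in> ideal_module D \<aa>" using cmem[of j] k A(8,12) order_mult unfolding xy by auto
    then obtain m where m: "(k * x, k * y) = (\<Sum>i\<in>UNIV. of_int (m i) *\<^sub>R c i)" using zbasis_span[OF c] by metis
    have "period_rm D k *v b j t = (\<Sum>i\<in>UNIV. of_int (m i) *\<^sub>R b i t)" for t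
      using period_map_mult[of k x y "(t 0, t 1)"] zbasis_additive[OF c add, of "(t 0, t 1)" m]
        fld[OF cmem[of j]] order_in_field[OF k] m by (simp add: b_def xy)
    then show ?thesis by blast
  qed
  moreover have "(period_lattice D \<aa> (t 0, t 1), std_form (t 0, t 1), period_rm D) \<in> rm_surfaces D d1 d2"
    if "t \<in> ?B" for t
    using period_surface_rm[OF a] period_surface_eq[OF a] that by force
  ultimately show ?thesis unfolding rm_family_def using B by blast
qed

text \<open>Transport keeps the coordinates with respect to the frame: both the form and the action of the
  order have locally constant coordinates.\<close>

lemma family_transport:
  assumes fam: "rm_family D d1 d2 n B L H \<rho>" and t0: "t0 \<in> B" and a: "\<aa> \<in> type_ideals D d1 d2"
    and \<psi>0: "symplectic_module_iso D \<aa> (L t0, H t0, \<rho> t0) \<psi>0"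
  shows "\<exists>\<psi>. (\<forall>t\<in>B. symplectic_module_iso D \<aa> (L t, H t, \<rho> t) (\<psi> t)) \<and>
    (\<forall>p\<in>ideal_module D \<aa>. \<forall>j. holomorphic_Cn n B (\<lambda>t. \<psi> t p $ j))"
proof -
  obtain b :: "4 \<Rightarrow> (nat \<Rightarrow> complex) \<Rightarrow> complex ^ 2" where
    b1: "\<forall>i j. holomorphic_Cn n B (\<lambda>t. b i t $ j)" and b2: "\<forall>t\<in>B. zbasis (\<lambda>i. b i t) (L t)"
    and b3: "\<forall>i j. \<exists>e. \<forall>t\<in>B. Im (H t (b i t) (b j t)) = e"
    and b4: "\<forall>k\<in>quad_order D. \<forall>j. \<exists>m :: 4 \<Rightarrow> int. \<forall>t\<in>B. \<rho> t k *v b j t = (\<Sum>i\<in>UNIV. of_int (m i) *\<^sub>R b i t)"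
    using fam unfolding rm_family_def by blast
  have B: "openin (top_of_set (Cn n)) B" and surf: "\<forall>t\<in>B. (L t, H t, \<rho> t) \<in> rm_surfaces D d1 d2"
    using fam by (simp_all add: rm_family_def)
  note S = symplectic_module_isoD[OF \<psi>0]
  have C: "bij_betw (frame_comb b t) UNIV (L t)" if "t \<in> B" for t
    using b2 that by (auto simp: zbasis_def frame_comb_def[abs_def])
  obtain M where M: "\<forall>k\<in>quad_order D. \<forall>j. \<forall>t\<in>B. \<rho> t k *v b j t = frame_comb b t (M k j)"
    using b4 unfolding frame_comb_def by metis
  define m where "m = inv_into UNIV (frame_comb b t0) \<circ> \<psi>0"
  have m_bij: "bij_betw m (ideal_module D \<aa>) UNIV"
    unfolding m_def by (rule bij_betw_trans[OF S(1) bij_betw_inv_into[OF C[OF t0]]])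
  have mp: "frame_comb b t0 (m p) = \<psi>0 p" if "p \<in> ideal_module D \<aa>" for p
    using S(2)[OF that] C[OF t0] by (simp add: m_def bij_betw_inv_into_right)
  have m_eq: "m p = k" if "p \<in> ideal_module D \<aa>" "\<psi>0 p = frame_comb b t0 k" for p k
    using mp[OF that(1)] that(2) C[OF t0] by (metis UNIV_I bij_betw_inv_into_left)
  have m_add: "m (p + q) = (\<lambda>i. m p i + m q i)" if "p \<in> ideal_module D \<aa>" "q \<in> ideal_module D \<aa>" for p q
  proof (rule m_eq)
    show "p + q \<in> ideal_module D \<aa>" using that type_ideals_mem(8,11)[OF a] order_add by (cases p, cases q) auto
    show "\<psi>0 (p + q) = frame_comb b t0 (\<lambda>i. m p i + m q i)"
      using S(3)[OF that] mp that by (simp add: frame_comb_add)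
  qed
  have m_mult: "m (k * x, k * y) = (\<lambda>i. \<Sum>j\<in>UNIV. m (x, y) j * M k j i)"
    if k: "k \<in> quad_order D" and xy: "(x, y) \<in> ideal_module D \<aa>" for k x y
  proof (rule m_eq)
    show "(k * x, k * y) \<in> ideal_module D \<aa>" using k xy type_ideals_mem(8,12)[OF a] order_mult by auto
    have "\<psi>0 (k * x, k * y) = \<rho> t0 k *v frame_comb b t0 (m (x, y))" using S(5)[OF k xy] mp[OF xy] by simp
    then show "\<psi>0 (k * x, k * y) = frame_comb b t0 (\<lambda>i. \<Sum>j\<in>UNIV. m (x, y) j * M k j i)"
      using M k t0 by (simp add: matrix_frame_comb frame_comb_matrix)
  qed
  define \<psi> where "\<psi> = (\<lambda>t. frame_comb b t \<circ> m)"
  have "symplectic_module_iso D \<aa> (L t, H t, \<rho> t) (\<psi> t)" if t: "t \<in> B" for t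
    unfolding symplectic_module_iso_iff
  proof (intro conjI ballI)
    show "bij_betw (\<psi> t) (ideal_module D \<aa>) (L t)" unfolding \<psi>_def by (rule bij_betw_trans[OF m_bij C[OF t]])
    fix p q assume pq: "p \<in> ideal_module D \<aa>" "q \<in> ideal_module D \<aa>"
    show "\<psi> t (p + q) = \<psi> t p + \<psi> t q" by (simp add: \<psi>_def m_add[OF pq] frame_comb_add)
    have e: "Im (H t (b i t) (b j t)) = Im (H t0 (b i t0) (b j t0))" for i j using b3 t t0 by metis
    have pol: "polarization (L s) (H s)" if "s \<in> B" for s using surf that rm_surfacesD(2) by blast
    have "Im (H t (\<psi> t p) (\<psi> t q)) = Im (H t0 (\<psi>0 p) (\<psi>0 q))"
      by (simp only: \<psi>_def comp_apply mp[OF pq(1), symmetric] mp[OF pq(2), symmetric]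
        polarization_frame_comb[OF pol[OF t]] polarization_frame_comb[OF pol[OF t0]] e)
    then show "Im (H t (\<psi> t p) (\<psi> t q)) = trace_pairing D p q" using S(4)[OF pq] by simp
  next
    fix k p assume k: "k \<in> quad_order D" and p: "p \<in> ideal_module D \<aa>"
    obtain x y where xy: "p = (x, y)" by (cases p)
    have "\<psi> t (k * x, k * y) = \<rho> t k *v \<psi> t (x, y)"
      using m_mult[OF k p[unfolded xy]] M k t by (simp add: \<psi>_def matrix_frame_comb frame_comb_matrix)
    then show "case p of (x, y) \<Rightarrow> \<psi> t (k * x, k * y) = \<rho> t k *v \<psi> t (x, y)" by (simp add: xy)
  qed
  moreover have "holomorphic_Cn n B (\<lambda>t. \<psi> t p $ j)" for p j
    using b1 unfolding holomorphic_Cn_iff[OF B] \<psi>_def comp_def by (blast intro: hol_atCn_frame_comb)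
  ultimately show ?thesis by blast
qed

text \<open>Over all of B the projections of the two generators to each eigenline are proportional
  holomorphic vectors, the first never zero, so the period is holomorphic as their quotient.\<close>

lemma family_uniformize:
  assumes fam: "rm_family D d1 d2 n B L H \<rho>" and t0: "t0 \<in> B" and a: "\<aa> \<in> type_ideals D d1 d2"
    and locus: "rm_class D d1 d2 (L t0, H t0, \<rho> t0) \<in> ideal_locus D d1 d2 \<aa>"
  shows "\<exists>\<zeta>. (\<forall>t\<in>B. \<zeta> t \<in> upper2 \<and>
      rm_class D d1 d2 (L t, H t, \<rho> t) = rm_class D d1 d2 (period_surface D \<aa> (\<zeta> t))) \<and>
    holomorphic_Cn n B (\<lambda>t. fst (\<zeta> t)) \<and> holomorphic_Cn n B (\<lambda>t. snd (\<zeta> t))"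
proof -
  have B: "openin (top_of_set (Cn n)) B" and surf: "\<And>t. t \<in> B \<Longrightarrow> (L t, H t, \<rho> t) \<in> rm_surfaces D d1 d2"
    using fam by (simp_all add: rm_family_def)
  note A = type_ideals_mem[OF a]
  obtain \<psi>0 where "symplectic_module_iso D \<aa> (L t0, H t0, \<rho> t0) \<psi>0"
    using locus rm_class_in_locus_iff[OF surf[OF t0]] by blast
  from family_transport[OF fam t0 a this] obtain \<psi> :: "(nat \<Rightarrow> complex) \<Rightarrow> real \<times> real \<Rightarrow> complex ^ 2" where
    iso: "\<And>t. t \<in> B \<Longrightarrow> symplectic_module_iso D \<aa> (L t, H t, \<rho> t) (\<psi> t)" and
    hol: "\<And>p j. p \<in> ideal_module D \<aa> \<Longrightarrow> holomorphic_Cn n B (\<lambda>t. \<psi> t p $ j)" by blast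
  define P where "P = (\<lambda>t. eigP D (\<rho> t (omega D)))"
  define Q where "Q = (\<lambda>t. eigQ D (\<rho> t (omega D)))"
  have PQ: "holomorphic_Cn n B (\<lambda>t. P t (r *\<^sub>R \<psi> t (x, y)) $ j)" "holomorphic_Cn n B (\<lambda>t. Q t (r *\<^sub>R \<psi> t (x, y)) $ j)"
    if xy: "(x, y) \<in> ideal_module D \<aa>" for r x y j
  proof -
    have m: "(omega D * x, omega D * y) \<in> ideal_module D \<aa>" using xy A(8,12) order_mult order_omega by auto
    have h: "hol_atCn n (\<lambda>t. of_real u * (of_real c * \<psi> t (omega D * x, omega D * y) $ j + of_real d * \<psi> t (x, y) $ j)) t"
      if "t \<in> B" for t c d u
      using hol[OF m, of j] hol[OF xy, of j] that unfolding holomorphic_Cn_iff[OF B]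
      by (intro hol_atCn_mult hol_atCn_add hol_atCn_const) auto
    \<comment> \<open>\<open>\<rho> t\<close> carries no holomorphy assumption of its own. Linearity
      over the order replaces it by the values of \<open>\<psi> t\<close>, which are
      holomorphic.\<close>
    have act: "\<rho> t (omega D) *v \<psi> t (x, y) = \<psi> t (omega D * x, omega D * y)" if "t \<in> B" for t
      using symplectic_module_isoD(5)[OF iso[OF that] order_omega xy] by simp
    have e: "P t (r *\<^sub>R \<psi> t (x, y)) $ j = of_real (r / sqrt (real D)) *
        (of_real 1 * \<psi> t (omega D * x, omega D * y) $ j + of_real (- omega' D) * \<psi> t (x, y) $ j)"
      "Q t (r *\<^sub>R \<psi> t (x, y)) $ j = of_real (r / sqrt (real D)) *
        (of_real (- 1) * \<psi> t (omega D * x, omega D * y) $ j + of_real (omega D) * \<psi> t (x, y) $ j)" if "t \<in> B" for t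
      unfolding P_def Q_def eig_linear eigP_def eigQ_def matrix_vector_scaleR act[OF that]
      by (simp_all add: scaleR_conv_of_real[where 'a = complex] algebra_simps)
    show "holomorphic_Cn n B (\<lambda>t. P t (r *\<^sub>R \<psi> t (x, y)) $ j)" "holomorphic_Cn n B (\<lambda>t. Q t (r *\<^sub>R \<psi> t (x, y)) $ j)"
      unfolding holomorphic_Cn_iff[OF B]
      by (rule ballI, rule hol_atCn_cong[OF h B], assumption, assumption, rule e(1)[symmetric], assumption)
        (rule ballI, rule hol_atCn_cong[OF h B], assumption, assumption, rule e(2)[symmetric], assumption)
  qed
  have m1: "(1, 0) \<in> ideal_module D \<aa>" and m2: "(0, real d2) \<in> ideal_module D \<aa>"
    using A(7,8,10) order_1 order_0 by auto
  have PQ1: "holomorphic_Cn n B (\<lambda>t. P t (\<psi> t (1, 0)) $ j)" "holomorphic_Cn n B (\<lambda>t. Q t (\<psi> t (1, 0)) $ j)" for j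
    using PQ[OF m1, of 1] by simp_all
  have PQ2: "holomorphic_Cn n B (\<lambda>t. P t (unif_basis d2 (\<psi> t)) $ j)"
    "holomorphic_Cn n B (\<lambda>t. Q t (unif_basis d2 (\<psi> t)) $ j)" for j
    using PQ[OF m2, of "1 / real d2"] unfolding unif_basis_def by simp_all
  have U: "P t (\<psi> t (1, 0)) \<noteq> 0" "Q t (\<psi> t (1, 0)) \<noteq> 0"
    "\<exists>z. P t (unif_basis d2 (\<psi> t)) = fst z *s P t (\<psi> t (1, 0)) \<and> Q t (unif_basis d2 (\<psi> t)) = snd z *s Q t (\<psi> t (1, 0))"
    "P t (unif_basis d2 (\<psi> t)) = fst z *s P t (\<psi> t (1, 0)) \<Longrightarrow> Q t (unif_basis d2 (\<psi> t)) = snd z *s Q t (\<psi> t (1, 0)) \<Longrightarrow>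
      z \<in> upper2 \<and> (period_surface D \<aa> z, (L t, H t, \<rho> t)) \<in> rm_iso D d1 d2" if "t \<in> B" for t z
    unfolding P_def Q_def by (fact uniformize[OF a surf[OF that] iso[OF that]])+
  from U(3) obtain \<zeta> where \<zeta>: "\<And>t. t \<in> B \<Longrightarrow> P t (unif_basis d2 (\<psi> t)) = fst (\<zeta> t) *s P t (\<psi> t (1, 0))"
    "\<And>t. t \<in> B \<Longrightarrow> Q t (unif_basis d2 (\<psi> t)) = snd (\<zeta> t) *s Q t (\<psi> t (1, 0))" by metis
  have z: "\<zeta> t \<in> upper2" "rm_class D d1 d2 (L t, H t, \<rho> t) = rm_class D d1 d2 (period_surface D \<aa> (\<zeta> t))" if "t \<in> B" for t
    using U(4)[OF that \<zeta>[OF that]] surf[OF that] period_surface_rm[OF a] rm_class_eq_iff by blast+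
  moreover have "holomorphic_Cn n B (\<lambda>t. fst (\<zeta> t))"
    unfolding holomorphic_Cn_iff[OF B] using hol_atCn_ratio[OF B PQ1(1) PQ2(1) U(1) \<zeta>(1)] by blast
  moreover have "holomorphic_Cn n B (\<lambda>t. snd (\<zeta> t))"
    unfolding holomorphic_Cn_iff[OF B] using hol_atCn_ratio[OF B PQ1(2) PQ2(2) U(2) \<zeta>(2)] by blast
  ultimately show ?thesis by blast
qed

end

section \<open>The components of the moduli space\<close>

lemma openin_moduli_space [simp]: "openin (cs_top (moduli_space D d1 d2)) = moduli_open D d1 d2"
  by (simp add: moduli_space_def topology_inverse'[OF istopology_moduli_open])

lemma cs_hol_moduli_space: "f \<in> cs_hol (moduli_space D d1 d2) U \<longleftrightarrow> (\<forall>n B L H \<rho>. rm_family D d1 d2 n B L H \<rho> \<longrightarrow>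
    holomorphic_Cn n {t \<in> B. rm_class D d1 d2 (L t, H t, \<rho> t) \<in> U} (\<lambda>t. f (rm_class D d1 d2 (L t, H t, \<rho> t))))"
  by (simp add: moduli_space_def)

lemma moduli_open_subset: "moduli_open D d1 d2 U \<Longrightarrow> U \<subseteq> moduli_set D d1 d2"
  by (simp add: moduli_open_def)

lemma moduli_openD:
  "moduli_open D d1 d2 U \<Longrightarrow> rm_family D d1 d2 n B L H \<rho> \<Longrightarrow>
    openin (top_of_set (Cn n)) {t \<in> B. rm_class D d1 d2 (L t, H t, \<rho> t) \<in> U}"
  by (simp add: moduli_open_def)

lemma moduli_open_Int: "moduli_open D d1 d2 U \<Longrightarrow> moduli_open D d1 d2 V \<Longrightarrow> moduli_open D d1 d2 (U \<inter> V)"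
  using openin_Int[of "cs_top (moduli_space D d1 d2)"] by simp

lemma cs_hol_moduli_space_mono:
  assumes "f \<in> cs_hol (moduli_space D d1 d2) U" "V \<subseteq> U"
  shows "f \<in> cs_hol (moduli_space D d1 d2) V"
  unfolding cs_hol_moduli_space
proof (intro allI impI)
  fix n B L H \<rho> assume "rm_family D d1 d2 n B L H \<rho>"
  then have "holomorphic_Cn n {t \<in> B. rm_class D d1 d2 (L t, H t, \<rho> t) \<in> U} (\<lambda>t. f (rm_class D d1 d2 (L t, H t, \<rho> t)))"
    using assms(1) unfolding cs_hol_moduli_space by blast
  then show "holomorphic_Cn n {t \<in> B. rm_class D d1 d2 (L t, H t, \<rho> t) \<in> V} (\<lambda>t. f (rm_class D d1 d2 (L t, H t, \<rho> t)))"
    by (rule holomorphic_Cn_mono) (use assms(2) in blast)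
qed

lemma const_cs_hol_moduli_space: "(\<lambda>_. c) \<in> cs_hol (moduli_space D d1 d2) U"
  by (simp add: cs_hol_moduli_space holomorphic_Cn_def)

lemma analytic_subset_moduli:
  "analytic_subset (moduli_space D d1 d2) Z \<longleftrightarrow> Z \<subseteq> moduli_set D d1 d2 \<and>
    (\<forall>x\<in>moduli_set D d1 d2. \<exists>U F. moduli_open D d1 d2 U \<and> x \<in> U \<and>
      finite F \<and> F \<subseteq> cs_hol (moduli_space D d1 d2) U \<and> Z \<inter> U = {y \<in> U. \<forall>f\<in>F. f y = 0})"
  by (simp add: analytic_subset_def topspace_moduli_space)

text \<open>Local equations are kept inside W; on the open complement the empty set is cut out by a
  nowhere vanishing function.\<close>

lemma analytic_subset_Int_clopen:
  assumes Z: "analytic_subset (moduli_space D d1 d2) Z"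
    and W: "moduli_open D d1 d2 W" "moduli_open D d1 d2 (moduli_set D d1 d2 - W)"
  shows "analytic_subset (moduli_space D d1 d2) (Z \<inter> W)"
  unfolding analytic_subset_moduli
proof (intro conjI ballI)
  show "Z \<inter> W \<subseteq> moduli_set D d1 d2" using Z unfolding analytic_subset_moduli by blast
  fix x assume x: "x \<in> moduli_set D d1 d2"
  show "\<exists>U F. moduli_open D d1 d2 U \<and> x \<in> U \<and> finite F \<and> F \<subseteq> cs_hol (moduli_space D d1 d2) U \<and>
      Z \<inter> W \<inter> U = {y \<in> U. \<forall>f\<in>F. f y = 0}"
  proof (cases "x \<in> W")
    case True
    obtain U F where U: "moduli_open D d1 d2 U" "x \<in> U" "finite F" "F \<subseteq> cs_hol (moduli_space D d1 d2) U"
      "Z \<inter> U = {y \<in> U. \<forall>f\<in>F. f y = 0}"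
      using bspec[OF conjunct2[OF Z[unfolded analytic_subset_moduli]] x] by (elim exE conjE) (rule that)
    have "F \<subseteq> cs_hol (moduli_space D d1 d2) (U \<inter> W)" using U(4) cs_hol_moduli_space_mono by blast
    moreover have "Z \<inter> W \<inter> (U \<inter> W) = {y \<in> U \<inter> W. \<forall>f\<in>F. f y = 0}" using U(5) by blast
    ultimately show ?thesis using U(2,3) True moduli_open_Int[OF U(1) W(1)]
      by (intro exI[of _ "U \<inter> W"], intro exI[of _ F]) (simp only: Int_iff)
  next
    case False
    \<comment> \<open>The constant function 1 serves as the equation of the empty set.\<close>
    have "Z \<inter> W \<inter> (moduli_set D d1 d2 - W) = {y \<in> moduli_set D d1 d2 - W. \<forall>f\<in>{\<lambda>_. 1 :: complex}. f y = 0}" by auto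
    moreover have "{\<lambda>_. 1} \<subseteq> cs_hol (moduli_space D d1 d2) (moduli_set D d1 d2 - W)" by (simp add: const_cs_hol_moduli_space)
    ultimately show ?thesis using W(2) x False
      by (intro exI[of _ "moduli_set D d1 d2 - W"], intro exI[of _ "{\<lambda>_. 1}"]) (simp only: Diff_iff finite.intros)
  qed
qed

lemma analytic_subset_clopen:
  assumes "moduli_open D d1 d2 W" "moduli_open D d1 d2 (moduli_set D d1 d2 - W)"
  shows "analytic_subset (moduli_space D d1 d2) W"
proof -
  have o: "moduli_open D d1 d2 (moduli_set D d1 d2)"
    using openin_topspace[of "cs_top (moduli_space D d1 d2)"] by (simp add: topspace_moduli_space)
  have "analytic_subset (moduli_space D d1 d2) (moduli_set D d1 d2)"
    unfolding analytic_subset_moduli using o by (intro conjI ballI exI[of _ "moduli_set D d1 d2"] exI[of _ "{}"]) auto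
  from analytic_subset_Int_clopen[OF this assms] show ?thesis
    using moduli_open_subset[OF assms(1)] by (simp add: Int_absorb1)
qed

section \<open>A single locus and its Hilbert modular surface\<close>

locale ideal_component = quad_conductor D \<Delta> f for D \<Delta> f +
  fixes d1 d2 :: nat and \<aa> :: "real set"
  assumes ideal: "\<aa> \<in> type_ideals D d1 d2" and cop: "coprime (d2 div d1) f"
begin

abbreviation "locus \<equiv> ideal_locus D d1 d2 \<aa>"

definition cls :: "complex \<times> complex \<Rightarrow> rm_triple set" where
  "cls z = rm_class D d1 d2 (period_surface D \<aa> z)"

lemma locus_eq: "locus = cls ` upper2"
  unfolding cls_def using ideal_locus_eq[OF ideal] .

lemma locus_subset: "locus \<subseteq> moduli_set D d1 d2"
  by (auto simp: ideal_locus_def)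

lemma hilbert_rel_Image: "z \<in> upper2 \<Longrightarrow> hilbert_rel D \<aa> `` {z} = {w \<in> upper2. cls w = cls z}"
  unfolding Image_singleton hilbert_rel_iff_class[OF ideal cop] cls_def by auto

lemma hilbert_rel_Image_eq_iff:
  "z \<in> upper2 \<Longrightarrow> w \<in> upper2 \<Longrightarrow> hilbert_rel D \<aa> `` {z} = hilbert_rel D \<aa> `` {w} \<longleftrightarrow> cls z = cls w"
  by (auto simp: hilbert_rel_Image)

text \<open>The frame data are constant on all of B, connected or not, so one member of the locus
  puts the whole family into it.\<close>

lemma family_uniformize':
  assumes fam: "rm_family D d1 d2 n B L H \<rho>"
  shows "(\<forall>t\<in>B. rm_class D d1 d2 (L t, H t, \<rho> t) \<notin> locus) \<or>
    (\<exists>\<zeta>. (\<forall>t\<in>B. \<zeta> t \<in> upper2 \<and> rm_class D d1 d2 (L t, H t, \<rho> t) = cls (\<zeta> t)) \<and>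
      holomorphic_Cn n B (\<lambda>t. fst (\<zeta> t)) \<and> holomorphic_Cn n B (\<lambda>t. snd (\<zeta> t)))"
  using family_uniformize[OF fam _ ideal] unfolding cls_def by blast

lemma universal_class:
  "{t \<in> {t \<in> Cn 2. (t 0, t 1) \<in> upper2}. rm_class D d1 d2 (period_lattice D \<aa> (t 0, t 1), std_form (t 0, t 1), period_rm D) \<in> U} =
    {t \<in> Cn 2. (t 0, t 1) \<in> upper2 \<and> cls (t 0, t 1) \<in> U}"
  using period_surface_eq[OF ideal] by (auto simp: cls_def)

lemma open_cls_vimage:
  assumes "moduli_open D d1 d2 U"
  shows "openin (top_of_set (Cn 2)) {t \<in> Cn 2. (t 0, t 1) \<in> upper2 \<and> cls (t 0, t 1) \<in> U}"
    "open {z \<in> upper2. cls z \<in> U}"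
proof -
  show o: "openin (top_of_set (Cn 2)) {t \<in> Cn 2. (t 0, t 1) \<in> upper2 \<and> cls (t 0, t 1) \<in> U}"
    using moduli_openD[OF assms universal_family[OF ideal]] by (simp only: universal_class)
  from open_pt2_vimage[OF o] show "open {z \<in> upper2. cls z \<in> U}" by simp
qed

text \<open>The defining condition of the structure sheaf is tested on the universal family.\<close>

lemma holomorphic2_cls:
  assumes U: "moduli_open D d1 d2 U" and g: "g \<in> cs_hol (moduli_space D d1 d2) U"
  shows "holomorphic2 {z \<in> upper2. cls z \<in> U} (\<lambda>z. g (cls z))"
  unfolding holomorphic2_iff[OF open_cls_vimage(2)[OF U]]
proof
  let ?g = "\<lambda>t. g (rm_class D d1 d2 (period_lattice D \<aa> (t 0, t 1), std_form (t 0, t 1), period_rm D))"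
  fix z assume z: "z \<in> {z \<in> upper2. cls z \<in> U}"
  have "holomorphic_Cn 2 {t \<in> {t \<in> Cn 2. (t 0, t 1) \<in> upper2}.
      rm_class D d1 d2 (period_lattice D \<aa> (t 0, t 1), std_form (t 0, t 1), period_rm D) \<in> U} ?g"
    using g[unfolded cs_hol_moduli_space, rule_format, OF universal_family[OF ideal]] .
  then have "hol_atCn 2 ?g (pt2 z)"
    unfolding universal_class holomorphic_Cn_iff[OF open_cls_vimage(1)[OF U]] using z by auto
  from hol_at2_pt2[OF this] open_cls_vimage(2)[OF U] z
  show "hol_at2 (\<lambda>z. g (cls z)) z"
    by (rule hol_at2_cong) (use period_surface_eq[OF ideal] in \<open>auto simp: cls_def\<close>)
qed

text \<open>One direction tests the universal family. Conversely, a family meeting the locus has a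
  continuous period, and openness is pulled back along it.\<close>

lemma moduli_open_locus_iff:
  assumes U: "U \<subseteq> locus"
  shows "moduli_open D d1 d2 U \<longleftrightarrow> open {z \<in> upper2. cls z \<in> U}"
proof
  assume o: "open {z \<in> upper2. cls z \<in> U}"
  show "moduli_open D d1 d2 U"
    unfolding moduli_open_def
  proof (intro conjI allI impI)
    show "U \<subseteq> moduli_set D d1 d2" using U locus_subset by blast
    fix n B L H \<rho> assume fam: "rm_family D d1 d2 n B L H \<rho>"
    then have B: "openin (top_of_set (Cn n)) B" by (simp add: rm_family_def)
    from family_uniformize'[OF fam]
    show "openin (top_of_set (Cn n)) {t \<in> B. rm_class D d1 d2 (L t, H t, \<rho> t) \<in> U}"
    proof (elim disjE exE conjE)
      assume "\<forall>t\<in>B. rm_class D d1 d2 (L t, H t, \<rho> t) \<notin> locus"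
      then have "{t \<in> B. rm_class D d1 d2 (L t, H t, \<rho> t) \<in> U} = {}" using U by blast
      then show ?thesis by (simp only: openin_empty)
    next
      fix \<zeta> assume z: "\<forall>t\<in>B. \<zeta> t \<in> upper2 \<and> rm_class D d1 d2 (L t, H t, \<rho> t) = cls (\<zeta> t)"
        and h: "holomorphic_Cn n B (\<lambda>t. fst (\<zeta> t))" "holomorphic_Cn n B (\<lambda>t. snd (\<zeta> t))"
      have "{t \<in> B. rm_class D d1 d2 (L t, H t, \<rho> t) \<in> U} = {t \<in> B. (fst (\<zeta> t), snd (\<zeta> t)) \<in> {z \<in> upper2. cls z \<in> U}}"
        using z by auto
      then show ?thesis using continuous_on_Cn_pair[OF B h o] by simp
    qed
  qed
qed (rule open_cls_vimage(2))

lemma moduli_open_locus: "moduli_open D d1 d2 locus"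
proof -
  have "{z \<in> upper2. cls z \<in> locus} = upper2" by (auto simp: locus_eq)
  then show ?thesis using moduli_open_locus_iff[OF subset_refl] open_upper2 by simp
qed

text \<open>A family lies inside or outside the locus as a whole, so the set in question is B or
  empty.\<close>

lemma moduli_open_locus_compl: "moduli_open D d1 d2 (moduli_set D d1 d2 - locus)"
  unfolding moduli_open_def
proof (intro conjI allI impI)
  fix n B L H \<rho> assume fam: "rm_family D d1 d2 n B L H \<rho>"
  then have B: "openin (top_of_set (Cn n)) B" by (simp add: rm_family_def)
  have "(\<forall>t\<in>B. rm_class D d1 d2 (L t, H t, \<rho> t) \<notin> locus) \<or> (\<forall>t\<in>B. rm_class D d1 d2 (L t, H t, \<rho> t) \<in> locus)"
    using family_uniformize'[OF fam] by (auto simp: locus_eq)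
  then have "{t \<in> B. rm_class D d1 d2 (L t, H t, \<rho> t) \<in> moduli_set D d1 d2 - locus} = B \<or>
      {t \<in> B. rm_class D d1 d2 (L t, H t, \<rho> t) \<in> moduli_set D d1 d2 - locus} = {}"
    using rm_family_class_in_moduli[OF fam] by blast
  then show "openin (top_of_set (Cn n)) {t \<in> B. rm_class D d1 d2 (L t, H t, \<rho> t) \<in> moduli_set D d1 d2 - locus}"
    by (elim disjE) (simp_all only: B openin_empty)
qed simp

text \<open>Forward, local extensions are pulled back along the universal family. Backward,
  composition with the holomorphic period of an arbitrary family gives a function on U in the
  ambient space.\<close>

lemma cs_hol_locus_iff:
  assumes U: "moduli_open D d1 d2 U" "U \<subseteq> locus"
  shows "u \<in> cs_hol (cs_sub (moduli_space D d1 d2) locus) U \<longleftrightarrow> holomorphic2 {z \<in> upper2. cls z \<in> U} (\<lambda>z. u (cls z))"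
proof
  assume u: "u \<in> cs_hol (cs_sub (moduli_space D d1 d2) locus) U"
  show "holomorphic2 {z \<in> upper2. cls z \<in> U} (\<lambda>z. u (cls z))"
    unfolding holomorphic2_iff[OF open_cls_vimage(2)[OF U(1)]]
  proof
    fix z assume z: "z \<in> {z \<in> upper2. cls z \<in> U}"
    then obtain V g where V: "moduli_open D d1 d2 V" "cls z \<in> V" "g \<in> cs_hol (moduli_space D d1 d2) V" "\<forall>y\<in>U \<inter> V. u y = g y"
      using u unfolding cs_sub_def by auto
    have "hol_at2 (\<lambda>z. g (cls z)) z"
      using holomorphic2_cls[OF V(1,3)] z V(2) unfolding holomorphic2_iff[OF open_cls_vimage(2)[OF V(1)]] by blast
    then show "hol_at2 (\<lambda>z. u (cls z)) z"
      using open_cls_vimage(2)[OF moduli_open_Int[OF U(1) V(1)]] by (rule hol_at2_cong) (use z V in auto)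
  qed
next
  assume F: "holomorphic2 {z \<in> upper2. cls z \<in> U} (\<lambda>z. u (cls z))"
  have "u \<in> cs_hol (moduli_space D d1 d2) U"
    unfolding cs_hol_moduli_space
  proof (intro allI impI)
    fix n B L H \<rho> assume fam: "rm_family D d1 d2 n B L H \<rho>"
    then have B: "openin (top_of_set (Cn n)) B" by (simp add: rm_family_def)
    let ?B = "{t \<in> B. rm_class D d1 d2 (L t, H t, \<rho> t) \<in> U}"
    have B': "openin (top_of_set (Cn n)) ?B" using U(1) fam by (simp add: moduli_open_def)
    from family_uniformize'[OF fam] show "holomorphic_Cn n ?B (\<lambda>t. u (rm_class D d1 d2 (L t, H t, \<rho> t)))"
    proof (elim disjE exE conjE)
      assume "\<forall>t\<in>B. rm_class D d1 d2 (L t, H t, \<rho> t) \<notin> locus"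
      then have "?B = {}" using U(2) by blast
      then show ?thesis by (simp only:) (simp add: holomorphic_Cn_def)
    next
      fix \<zeta> assume z: "\<forall>t\<in>B. \<zeta> t \<in> upper2 \<and> rm_class D d1 d2 (L t, H t, \<rho> t) = cls (\<zeta> t)"
        and h: "holomorphic_Cn n B (\<lambda>t. fst (\<zeta> t))" "holomorphic_Cn n B (\<lambda>t. snd (\<zeta> t))"
      show ?thesis
        unfolding holomorphic_Cn_iff[OF B']
      proof
        fix t assume t: "t \<in> ?B"
        have "hol_atCn n (\<lambda>t. u (cls (fst (\<zeta> t), snd (\<zeta> t)))) t"
          by (rule hol_atCn_compose2[OF F open_cls_vimage(2)[OF U(1)]])
            (use t z h in \<open>auto simp: holomorphic_Cn_iff[OF B]\<close>)
        then show "hol_atCn n (\<lambda>t. u (rm_class D d1 d2 (L t, H t, \<rho> t))) t"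
          using B' t by (rule hol_atCn_cong) (use z in auto)
      qed
    qed
  qed
  then show "u \<in> cs_hol (cs_sub (moduli_space D d1 d2) locus) U"
    unfolding cs_sub_def using U(1) by auto
qed

text \<open>The choice of representative is harmless because \<open>cls\<close> is constant on
  orbits.\<close>

definition orbit_class :: "(complex \<times> complex) set \<Rightarrow> rm_triple set" where
  "orbit_class c = cls (SOME z. z \<in> c)"

lemma orbit_class: "z \<in> upper2 \<Longrightarrow> orbit_class (hilbert_rel D \<aa> `` {z}) = cls z"
proof -
  assume z: "z \<in> upper2"
  then have "z \<in> hilbert_rel D \<aa> `` {z}" by (simp add: hilbert_rel_Image)
  then have "(SOME w. w \<in> hilbert_rel D \<aa> `` {z}) \<in> hilbert_rel D \<aa> `` {z}" by (rule someI)
  then show ?thesis by (simp add: orbit_class_def hilbert_rel_Image[OF z])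
qed

lemma orbitE:
  assumes "c \<in> upper2 // hilbert_rel D \<aa>"
  obtains z where "z \<in> upper2" "c = hilbert_rel D \<aa> `` {z}"
  using assms by (rule quotientE)

lemma orbit_in_quotient: "z \<in> upper2 \<Longrightarrow> hilbert_rel D \<aa> `` {z} \<in> upper2 // hilbert_rel D \<aa>"
  by (rule quotientI)

lemma openin_hilbert: "openin (cs_top (hilbert_modular_surface D \<aa>)) = hilbert_open D \<aa>"
  by (simp add: hilbert_modular_surface_def topology_inverse'[OF istopology_hilbert_open])

lemma topspace_hilbert: "topspace (cs_top (hilbert_modular_surface D \<aa>)) = upper2 // hilbert_rel D \<aa>"
proof -
  have "{z \<in> upper2. hilbert_rel D \<aa> `` {z} \<in> upper2 // hilbert_rel D \<aa>} = upper2" using orbit_in_quotient by blast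
  then have "hilbert_open D \<aa> (upper2 // hilbert_rel D \<aa>)" using open_upper2 by (simp add: hilbert_open_def)
  then show ?thesis unfolding topspace_def openin_hilbert by (auto simp: hilbert_open_def)
qed

lemma openin_locus:
  "openin (cs_top (cs_sub (moduli_space D d1 d2) locus)) U \<longleftrightarrow> moduli_open D d1 d2 U \<and> U \<subseteq> locus"
proof -
  have "openin (cs_top (moduli_space D d1 d2)) locus" using moduli_open_locus by simp
  from openin_open_subtopology[OF this] show ?thesis by (simp add: cs_sub_def)
qed

lemma topspace_locus: "topspace (cs_top (cs_sub (moduli_space D d1 d2) locus)) = locus"
  using locus_subset by (auto simp: cs_sub_def topspace_moduli_space)

lemma orbit_class_vimage:
  assumes "U \<subseteq> locus"
  shows "{z \<in> upper2. hilbert_rel D \<aa> `` {z} \<in> {c \<in> upper2 // hilbert_rel D \<aa>. orbit_class c \<in> U}} = {z \<in> upper2. cls z \<in> U}"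
  using orbit_class orbit_in_quotient by auto

text \<open>The orbits are exactly the fibres of \<open>cls\<close>, so the map is bijective. Open
  sets and holomorphic functions on both sides are described by the same pullbacks to the half
  planes.\<close>

lemma cs_iso_orbit_class:
  "cs_iso (hilbert_modular_surface D \<aa>) (cs_sub (moduli_space D d1 d2) locus) orbit_class"
  unfolding cs_iso_def
proof (intro conjI allI impI)
  let ?X = "cs_top (hilbert_modular_surface D \<aa>)" and ?Y = "cs_top (cs_sub (moduli_space D d1 d2) locus)"
  have inj: "inj_on orbit_class (upper2 // hilbert_rel D \<aa>)"
    by (rule inj_onI) (metis orbitE orbit_class hilbert_rel_Image_eq_iff)
  have img: "orbit_class ` (upper2 // hilbert_rel D \<aa>) = locus"
  proof (intro equalityI subsetI)
    show "x \<in> locus" if "x \<in> orbit_class ` (upper2 // hilbert_rel D \<aa>)" for x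
      using that orbit_class by (auto simp: locus_eq elim!: orbitE)
    show "x \<in> orbit_class ` (upper2 // hilbert_rel D \<aa>)" if x: "x \<in> locus" for x
    proof -
      obtain z where "z \<in> upper2" "x = cls z" using x by (auto simp: locus_eq)
      then show ?thesis using orbit_class[of z] orbit_in_quotient[of z] by force
    qed
  qed
  show "homeomorphic_map ?X ?Y orbit_class"
  proof (rule bijective_open_imp_homeomorphic_map)
    show "continuous_map ?X ?Y orbit_class"
      unfolding continuous_map_def topspace_hilbert topspace_locus openin_hilbert openin_locus hilbert_open_def
    proof (intro conjI allI impI)
      show "orbit_class \<in> upper2 // hilbert_rel D \<aa> \<rightarrow> locus" using img by blast
      fix U assume U: "moduli_open D d1 d2 U \<and> U \<subseteq> locus"
      show "open {z \<in> upper2. hilbert_rel D \<aa> `` {z} \<in> {c \<in> upper2 // hilbert_rel D \<aa>. orbit_class c \<in> U}}"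
        using U open_cls_vimage(2) by (simp only: orbit_class_vimage)
    qed blast
    show "open_map ?X ?Y orbit_class"
      unfolding open_map_def openin_hilbert openin_locus
    proof (intro allI impI)
      fix V assume V: "hilbert_open D \<aa> V"
      then have VQ: "V \<subseteq> upper2 // hilbert_rel D \<aa>" by (simp add: hilbert_open_def)
      then have sub: "orbit_class ` V \<subseteq> locus" using img by blast
      have "cls z \<in> orbit_class ` V \<longleftrightarrow> hilbert_rel D \<aa> `` {z} \<in> V" if z: "z \<in> upper2" for z
        using inj_on_image_mem_iff[OF inj orbit_in_quotient[OF z] VQ] orbit_class[OF z] by simp
      then have "{z \<in> upper2. cls z \<in> orbit_class ` V} = {z \<in> upper2. hilbert_rel D \<aa> `` {z} \<in> V}" by blast
      then show "moduli_open D d1 d2 (orbit_class ` V) \<and> orbit_class ` V \<subseteq> locus"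
        using V sub moduli_open_locus_iff[OF sub] by (simp add: hilbert_open_def)
    qed
  qed (simp_all only: topspace_hilbert topspace_locus inj img)
  fix U f assume "openin ?Y U"
  then have U: "moduli_open D d1 d2 U" "U \<subseteq> locus" by (simp_all add: openin_locus)
  let ?S = "{z \<in> upper2. cls z \<in> U}"
  have o: "open ?S" using open_cls_vimage(2)[OF U(1)] .
  have "f \<circ> orbit_class \<in> cs_hol (hilbert_modular_surface D \<aa>) {x \<in> topspace ?X. orbit_class x \<in> U} \<longleftrightarrow>
      holomorphic2 ?S (\<lambda>z. f (orbit_class (hilbert_rel D \<aa> `` {z})))"
    unfolding topspace_hilbert using orbit_class_vimage[OF U(2)] by (simp add: hilbert_modular_surface_def)
  also have "\<dots> \<longleftrightarrow> holomorphic2 ?S (\<lambda>z. f (cls z))"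
  proof -
    have "f (orbit_class (hilbert_rel D \<aa> `` {z})) = f (cls z)" if "z \<in> ?S" for z using that orbit_class by simp
    then show ?thesis
      unfolding holomorphic2_iff[OF o] using hol_at2_cong[OF _ o] by (metis (no_types, lifting))
  qed
  also have "\<dots> \<longleftrightarrow> f \<in> cs_hol (cs_sub (moduli_space D d1 d2) locus) U" by (rule cs_hol_locus_iff[OF U, symmetric])
  finally show "f \<in> cs_hol (cs_sub (moduli_space D d1 d2) locus) U \<longleftrightarrow>
    f \<circ> orbit_class \<in> cs_hol (hilbert_modular_surface D \<aa>) {x \<in> topspace ?X. orbit_class x \<in> U}" by blast
qed

lemma locally_zero_set2_cls:
  assumes "analytic_subset (moduli_space D d1 d2) Z"
  shows "locally_zero_set2 upper2 {z \<in> upper2. cls z \<in> Z}"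
  unfolding locally_zero_set2_def
proof
  fix z assume z: "z \<in> upper2"
  then have c: "cls z \<in> moduli_set D d1 d2" using locus_subset by (auto simp: locus_eq)
  obtain U F where U: "moduli_open D d1 d2 U" "cls z \<in> U" "F \<subseteq> cs_hol (moduli_space D d1 d2) U"
    "Z \<inter> U = {y \<in> U. \<forall>f\<in>F. f y = 0}"
    using bspec[OF conjunct2[OF assms[unfolded analytic_subset_moduli]] c] by (elim exE conjE) (rule that)
  let ?V = "{z \<in> upper2. cls z \<in> U}" and ?F = "(\<lambda>f z. f (cls z)) ` F"
  have "\<forall>g\<in>?F. holomorphic2 ?V g" using holomorphic2_cls[OF U(1)] U(3) by blast
  moreover have "cls w \<in> Z \<longleftrightarrow> (\<forall>f\<in>F. f (cls w) = 0)" if "w \<in> ?V" for w using U(4) that by blast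
  then have "{z \<in> upper2. cls z \<in> Z} \<inter> ?V = {y \<in> ?V. \<forall>f\<in>?F. f y = 0}" by auto
  moreover have "open ?V" using open_cls_vimage(2)[OF U(1)] .
  ultimately show "\<exists>V F. open V \<and> z \<in> V \<and> V \<subseteq> upper2 \<and> (\<forall>f\<in>F. holomorphic2 V f) \<and>
      {z \<in> upper2. cls z \<in> Z} \<inter> V = {y \<in> V. \<forall>f\<in>F. f y = 0}"
    using z U(2) by (intro exI[of _ ?V], intro exI[of _ ?F]) auto
qed

lemma locus_nonempty: "locus \<noteq> {}"
proof -
  have "(\<i>, \<i>) \<in> upper2" by (simp add: upper2_def)
  then show ?thesis by (auto simp: locus_eq)
qed

text \<open>A decomposition pulls back to one of the product of half planes, which is connected, so
  one part contains all periods.\<close>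

lemma irreducible_locus: "irreducible_subset (moduli_space D d1 d2) locus"
  unfolding irreducible_subset_def
proof (intro conjI allI impI)
  show "analytic_subset (moduli_space D d1 d2) locus"
    by (rule analytic_subset_clopen[OF moduli_open_locus moduli_open_locus_compl])
  show "locus \<noteq> {}" by (rule locus_nonempty)
  fix Z1 Z2
  assume "analytic_subset (moduli_space D d1 d2) Z1 \<and> analytic_subset (moduli_space D d1 d2) Z2 \<and> locus = Z1 \<union> Z2"
  then have Z: "analytic_subset (moduli_space D d1 d2) Z1" "analytic_subset (moduli_space D d1 d2) Z2" "locus = Z1 \<union> Z2" by auto
  have "upper2 = {z \<in> upper2. cls z \<in> Z1} \<or> upper2 = {z \<in> upper2. cls z \<in> Z2}"
  proof (rule locally_zero_set2_irreducible[OF _ _ _ _ open_upper2 connected_upper2])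
    show "upper2 = {z \<in> upper2. cls z \<in> Z1} \<union> {z \<in> upper2. cls z \<in> Z2}" using Z(3) unfolding locus_eq by blast
  qed (use Z locally_zero_set2_cls in auto)
  then have "cls ` upper2 \<subseteq> Z1 \<or> cls ` upper2 \<subseteq> Z2" by blast
  then show "locus = Z1 \<or> locus = Z2" using Z(3) unfolding locus_eq by blast
qed

text \<open>The locus is open and closed, so it splits Z into two analytic pieces, of which only the
  one containing x can be everything.\<close>

lemma irreducible_subset_locus:
  assumes Z: "irreducible_subset (moduli_space D d1 d2) Z" and x: "x \<in> Z" "x \<in> locus"
  shows "Z \<subseteq> locus"
proof -
  have an: "analytic_subset (moduli_space D d1 d2) Z" using Z by (simp add: irreducible_subset_def)
  have c: "moduli_set D d1 d2 - (moduli_set D d1 d2 - locus) = locus" using locus_subset by blast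
  have "analytic_subset (moduli_space D d1 d2) (Z \<inter> locus)"
    by (rule analytic_subset_Int_clopen[OF an moduli_open_locus moduli_open_locus_compl])
  moreover have "analytic_subset (moduli_space D d1 d2) (Z \<inter> (moduli_set D d1 d2 - locus))"
    using analytic_subset_Int_clopen[OF an moduli_open_locus_compl] moduli_open_locus unfolding c by blast
  moreover have "Z = (Z \<inter> locus) \<union> (Z \<inter> (moduli_set D d1 d2 - locus))"
    using an unfolding analytic_subset_moduli by blast
  ultimately have "Z = Z \<inter> locus \<or> Z = Z \<inter> (moduli_set D d1 d2 - locus)"
    using Z unfolding irreducible_subset_def by blast
  then show ?thesis using x by blast
qed

end

section \<open>All loci together\<close>

context quad_conductor
begin

lemma ideal_componentI:
  assumes "\<aa> \<in> type_ideals D d1 d2" "coprime (d2 div d1) f" shows "ideal_component D \<Delta> f d1 d2 \<aa>"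
  using assms by unfold_locales

lemma moduli_set_eq_Union:
  assumes cop: "coprime (d2 div d1) f"
  shows "moduli_set D d1 d2 = (\<Union>\<aa>\<in>type_ideals D d1 d2. ideal_locus D d1 d2 \<aa>)"
proof (intro equalityI subsetI)
  fix c assume "c \<in> moduli_set D d1 d2"
  then obtain T where T: "T \<in> rm_surfaces D d1 d2" "c = rm_class D d1 d2 T" by (rule moduli_setE)
  then show "c \<in> (\<Union>\<aa>\<in>type_ideals D d1 d2. ideal_locus D d1 d2 \<aa>)"
    using moduli_set_covered[OF cop T(1)] rm_class_in_locus_iff[OF T(1)] by blast
qed (auto simp: ideal_locus_def)

lemma inj_on_ideal_locus:
  assumes cop: "coprime (d2 div d1) f"
  shows "inj_on (ideal_locus D d1 d2) (type_ideals D d1 d2)"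
proof (rule inj_onI)
  fix \<aa> \<bb> assume a: "\<aa> \<in> type_ideals D d1 d2" and b: "\<bb> \<in> type_ideals D d1 d2"
    and e: "ideal_locus D d1 d2 \<aa> = ideal_locus D d1 d2 \<bb>"
  obtain x where "x \<in> ideal_locus D d1 d2 \<aa>"
    using ideal_component.locus_nonempty[OF ideal_componentI[OF a cop]] by blast
  then show "\<aa> = \<bb>" using ideal_locus_disjoint[OF a b] e by blast
qed

text \<open>The loci are irreducible and cover the space, and an irreducible set meeting one of them
  stays inside it; hence they are the maximal irreducible subsets.\<close>

lemma irreducible_components_moduli_space:
  assumes cop: "coprime (d2 div d1) f"
  shows "irreducible_components (moduli_space D d1 d2) = ideal_locus D d1 d2 ` type_ideals D d1 d2"
proof -
  let ?M = "moduli_space D d1 d2"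
  have irr: "irreducible_subset ?M (ideal_locus D d1 d2 \<aa>)" if "\<aa> \<in> type_ideals D d1 d2" for \<aa>
    by (rule ideal_component.irreducible_locus[OF ideal_componentI[OF that cop]])
  have sub: "\<exists>\<aa>\<in>type_ideals D d1 d2. Z \<subseteq> ideal_locus D d1 d2 \<aa>" if Z: "irreducible_subset ?M Z" for Z
  proof -
    have "Z \<noteq> {}" "Z \<subseteq> moduli_set D d1 d2"
      using Z unfolding irreducible_subset_def analytic_subset_moduli by blast+
    then obtain x where x: "x \<in> Z" "x \<in> moduli_set D d1 d2" by blast
    then obtain \<aa> where a: "\<aa> \<in> type_ideals D d1 d2" "x \<in> ideal_locus D d1 d2 \<aa>"
      using moduli_set_eq_Union[OF cop] by blast
    then show ?thesis
      using ideal_component.irreducible_subset_locus[OF ideal_componentI[OF a(1) cop] Z x(1)] by blast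
  qed
  show ?thesis
  proof (intro equalityI subsetI)
    fix Z assume "Z \<in> irreducible_components ?M"
    then have Z: "irreducible_subset ?M Z" "\<And>Z'. irreducible_subset ?M Z' \<Longrightarrow> Z \<subseteq> Z' \<Longrightarrow> Z' = Z"
      by (auto simp: irreducible_components_def)
    then show "Z \<in> ideal_locus D d1 d2 ` type_ideals D d1 d2" using sub[OF Z(1)] irr by blast
  next
    fix Z assume "Z \<in> ideal_locus D d1 d2 ` type_ideals D d1 d2"
    then obtain \<aa> where a: "\<aa> \<in> type_ideals D d1 d2" "Z = ideal_locus D d1 d2 \<aa>" by blast
    have "Z' = Z" if Z': "irreducible_subset ?M Z'" "Z \<subseteq> Z'" for Z'
    proof -
      obtain x where x: "x \<in> Z"
        using ideal_component.locus_nonempty[OF ideal_componentI[OF a(1) cop]] a(2) by blast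
      then have "Z' \<subseteq> Z"
        using ideal_component.irreducible_subset_locus[OF ideal_componentI[OF a(1) cop] Z'(1)] Z'(2) a(2) by blast
      then show ?thesis using Z'(2) by blast
    qed
    then show "Z \<in> irreducible_components ?M" using irr[OF a(1)] a(2) by (simp add: irreducible_components_def)
  qed
qed

lemma type_ideals_nonempty_iff:
  assumes d: "0 < d1" "d1 dvd d2" "0 < d2"
  shows "type_ideals D d1 d2 \<noteq> {} \<longleftrightarrow> omega_roots D (d2 div d1) \<noteq> {}"
proof
  assume "type_ideals D d1 d2 \<noteq> {}"
  then obtain \<aa> where "\<aa> \<in> type_ideals D d1 d2" by blast
  then obtain r where "int (d2 div d1) dvd omega_poly D r" "0 < d2 div d1" by (rule type_idealsE)
  then show "omega_roots D (d2 div d1) \<noteq> {}" using mod_in_omega_roots_iff by blast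
next
  assume "omega_roots D (d2 div d1) \<noteq> {}"
  then show "type_ideals D d1 d2 \<noteq> {}" using card_type_ideals[OF d] by force
qed

end

theorem theorem6p6:
  fixes D d1 d2 :: nat
  assumes "0 < D" and "discriminant D" and "\<nexists>k. D = k ^ 2"
    and "0 < d1" and "0 < d2" and "d1 dvd d2"
    and "coprime (d2 div d1) (conductor D)"
  shows "(moduli_set D d1 d2 \<noteq> {} \<longleftrightarrow> prime_factor_condition D d1 d2) \<and>
    (prime_factor_condition D d1 d2 \<longrightarrow>
      moduli_set D d1 d2 = (\<Union>\<aa>\<in>type_ideals D d1 d2. ideal_locus D d1 d2 \<aa>) \<and>
      irreducible_components (moduli_space D d1 d2) = ideal_locus D d1 d2 ` type_ideals D d1 d2 \<and>
      inj_on (ideal_locus D d1 d2) (type_ideals D d1 d2) \<and>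
      card (irreducible_components (moduli_space D d1 d2)) =
        2 ^ card {p \<in> prime_factors (d2 div d1). splitting D p} \<and>
      (\<forall>\<aa>\<in>type_ideals D d1 d2. \<exists>\<Phi>.
        (\<forall>z\<in>upper2. \<Phi> (hilbert_rel D \<aa> `` {z}) = rm_class D d1 d2 (period_surface D \<aa> z)) \<and>
        cs_iso (hilbert_modular_surface D \<aa>)
          (cs_sub (moduli_space D d1 d2) (ideal_locus D d1 d2 \<aa>)) \<Phi>))"
proof -
  interpret quad_disc D using assms by unfold_locales
  obtain \<Delta> f where "quad_conductor D \<Delta> f" by (rule obtain_conductor)
  then interpret quad_conductor D \<Delta> f .
  have cop: "coprime (d2 div d1) f" using assms(7) conductor_D by simp
  note roots = omega_roots_prime_factor_condition[OF assms(4,6,5) cop]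
  have ne: "moduli_set D d1 d2 \<noteq> {} \<longleftrightarrow> prime_factor_condition D d1 d2"
    using moduli_set_eq_Union[OF cop] type_ideals_nonempty_iff[OF assms(4,6,5)] roots(1)
      ideal_component.locus_nonempty[OF ideal_componentI[OF _ cop]] by blast
  have "card (irreducible_components (moduli_space D d1 d2)) = card (type_ideals D d1 d2)"
    unfolding irreducible_components_moduli_space[OF cop] by (rule card_image[OF inj_on_ideal_locus[OF cop]])
  moreover have "\<exists>\<Phi>. (\<forall>z\<in>upper2. \<Phi> (hilbert_rel D \<aa> `` {z}) = rm_class D d1 d2 (period_surface D \<aa> z)) \<and>
      cs_iso (hilbert_modular_surface D \<aa>) (cs_sub (moduli_space D d1 d2) (ideal_locus D d1 d2 \<aa>)) \<Phi>"
    if a: "\<aa> \<in> type_ideals D d1 d2" for \<aa>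
  proof -
    interpret C: ideal_component D \<Delta> f d1 d2 \<aa> by (rule ideal_componentI[OF a cop])
    show ?thesis using C.cs_iso_orbit_class C.orbit_class unfolding C.cls_def by blast
  qed
  ultimately show ?thesis
    using ne moduli_set_eq_Union[OF cop] irreducible_components_moduli_space[OF cop] inj_on_ideal_locus[OF cop]
      card_type_ideals[OF assms(4,6,5)] roots(2) by simp
qed

end
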